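(* Let $\lambda,\mu,\nu$ be real with $\lambda\neq0$ and $3\lambda-\mu+4\nu=0$, and consider $$S[w,\Psi]=\int_M \Big(\lambda\,\Psi^\dagger\wedge F\wedge\Psi+\mu\, da\wedge(\Psi^\dagger\wedge\Psi)+\nu\,(\Psi^\dagger\wedge\Psi)\wedge(\Psi^\dagger\wedge\Psi)\Big)$$ as a functional of a $\mathrm{U}(2)$ connection $w=A+\mathbb{I}a$ and a $\mathrm{U}(2)$ frame $\Psi$. The Euler–Lagrange equation obtained by varying with respect to the $\mathrm{SU}(2)$ connection $A$ is algebraic in $A$, and its solution is $A=\mathbf{w}$, where $\mathbf{w}$ is the anti-self-dual part of the Levi-Civita connection of the metric $g$ defined by $\Psi$. After $A=\mathbf{w}$ is substituted back, one obtains a functional of the $\mathrm{U}(2)$ structure encoded by $\Psi$ and the remaining $\mathrm{U}(1)$ part $a$ of $w$. It can be rewritten as a functional of $a$ and of the pair $(g,\omega)$ consisting of the metric $g=\alpha\odot\bar\alpha+\beta\odot\bar\beta$ and the almost-symplectic 2-form $\omega=\frac{\mathrm{i}}{2}(\alpha\wedge\bar\alpha+\beta\wedge\bar\beta)$, namely $$S[g,\omega,a]=-\lambda\int_M\Big[\,(s+2\tilde\mu-6)\,dV-2\tilde\mu\,\omega\wedge \mathrm{i}\,da\Big],\qquad \tilde\mu=\mu/\lambda,$$ where $dV$ is the volume form and $s$ the scalar curvature of $g$. Viewed as a functional of $(g,\omega)$, these are subject to the compatibility condition $$\omega_{\mu\alpha}g^{\alpha\beta}\omega_{\beta\nu}=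-g_{\mu\nu}.$$
   Context: $M$ is a smooth 4-manifold. $\Psi=\begin{pmatrix}\alpha\\ \beta\end{pmatrix}$ is a $\mathbb{C}^2$-valued 1-form (in a local gauge) with $\alpha,\beta,\bar\alpha,\bar\beta$ pointwise linearly independent, $\Psi^\dagger=(\bar\alpha,\bar\beta)$. $A$ is an $\mathfrak{su}(2)$-valued connection 1-form (tracefree anti-Hermitian $2\times2$ matrix of 1-forms), $F=dA+A\wedge A$, and $a$ is an $\mathrm{i}\mathbb{R}$-valued 1-form. $\odot$ is the symmetrised tensor product; writing $\alpha=e^1+\mathrm{i}e^2$, $\beta=e^3+\mathrm{i}e^4$ with real 1-forms $e^I$, the metric $g$ is the one for which $e^1,\dots,e^4$ is an orthonormal coframe, and $\omega=\frac{1}{2\mathrm{i}}\Psi^\dagger\wedge\Psi=e^1\wedge e^2+e^3\wedge e^4$. The orientation is the one with $dV=e^1\wedge e^2\wedge e^3\wedge e^4$, for which $\omega$ is self-dual, and the components of the tracefree part $\Psi\wedge\Psi^\dagger+\frac12\mathbb{I}\,\Psi^\dagger\wedge\Psi$ span the anti-self-dual 2-forms. The anti-self-dual part $\mathbf{w}$ of the Levi-Civita connection is its component in the factor $\mathfrak{su}(2)_-$ of $\mathfrak{so}(4)=\mathfrak{su}(2)_+\oplus\mathfrak{su}(2)_-$, where $\mathfrak{su}(2)_-$ is the factor acting non-trivially on anti-self-dual 2-forms and trivially on self-dual ones. It acts on the adapted coframe $\Psi$ as the standard $\mathfrak{su}(2)$ of tracefree anti-Hermitian $2\times2$ matrices,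 so $\mathbf{w}$ is regarded as an $\mathfrak{su}(2)$-valued 1-form in the frame $\Psi$. Normalisation of $s$: if $w^{IJ}$ is the Levi-Civita connection, $de^I=-w^I{}_J\wedge e^J$, with curvature $R^{IJ}=dw^{IJ}+w^I{}_K\wedge w^{KJ}$, then $s$ is given by $$s\,dV=\tfrac14\,\epsilon_{IJKL}\,R^{IJ}\wedge e^K\wedge e^L .$$ *)

theory Defs
  imports "HOL-Analysis.Analysis"
begin

definition pd :: "4 \<Rightarrow> (real^4 \<Rightarrow> 'v::real_normed_vector) \<Rightarrow> real^4 \<Rightarrow> 'v" where
  "pd i f x = frechet_derivative f (at x) (axis i 1)"

text \<open>Only used for open \<open>S\<close>: every iterated partial derivative is (totally) differentiable
  on \<open>S\<close>, which amounts to being of class \<open>C\<^sup>\<infinity>\<close>.\<close>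

definition smooth_on :: "(real^4) set \<Rightarrow> (real^4 \<Rightarrow> 'v::real_normed_vector) \<Rightarrow> bool" where
  "smooth_on S f \<longleftrightarrow> (\<forall>is. foldr pd is f differentiable_on S)"

text \<open>A form with values in \<open>'v\<close> is given by its components \<open>\<omega> x [\<mu>1, ..., \<mu>k]\<close>. Elements of this
  type may be inhomogeneous: a homogeneous form of degree \<open>k\<close> vanishes on lists whose length
  is not \<open>k\<close>. One-forms also occur as plain fields of covectors \<open>\<theta> x $ \<mu>\<close>, which
  \<open>form1\<close> turns into forms.\<close>

type_synonym 'v form = "real^4 \<Rightarrow> 4 list \<Rightarrow> 'v"

definition form1 :: "(real^4 \<Rightarrow> 'v::zero^4) \<Rightarrow> 'v form" where
  "form1 \<theta> = (\<lambda>x xs. case xs of [i] \<Rightarrow> \<theta> x $ i | _ \<Rightarrow> 0)"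

text \<open>The wedge product with respect to a bilinear product \<open>B\<close> of the values, as a sum over
  shuffles: \<open>S\<close> is the set of argument slots handed to the first factor, and the
  sign is that of the corresponding permutation, so that
  \<open>(\<alpha> \<and> \<beta>)\<^sub>i\<^sub>j = \<alpha>\<^sub>i \<beta>\<^sub>j - \<alpha>\<^sub>j \<beta>\<^sub>i\<close> for one-forms.\<close>

definition shuffle_sign :: "nat \<Rightarrow> nat set \<Rightarrow> real" where
  "shuffle_sign n S = (- 1) ^ card {(i, j). i \<in> S \<and> j \<in> {..<n} - S \<and> j < i}"

definition wedge :: "('a \<Rightarrow> 'b \<Rightarrow> 'c::real_vector) \<Rightarrow> 'a form \<Rightarrow> 'b form \<Rightarrow> 'c form" where
  "wedge B \<alpha> \<beta> = (\<lambda>x xs. \<Sum>S\<in>Pow {..<length xs}.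
     shuffle_sign (length xs) S *\<^sub>R B (\<alpha> x (nths xs S)) (\<beta> x (nths xs (- S))))"

definition ext_d :: "'v::real_normed_vector form \<Rightarrow> 'v form" where
  "ext_d \<omega> = (\<lambda>x xs. \<Sum>i<length xs.
     (- 1) ^ i *\<^sub>R pd (xs ! i) (\<lambda>y. \<omega> y (take i xs @ drop (Suc i) xs)) x)"

definition pullback1 :: "(real^4 \<Rightarrow> real^4) \<Rightarrow> (real^4 \<Rightarrow> 'v::real_vector^4) \<Rightarrow> real^4 \<Rightarrow> 'v^4" where
  "pullback1 \<tau> \<theta> x = (\<chi> i. \<Sum>j\<in>UNIV. (pd i \<tau> x $ j) *\<^sub>R (\<theta> (\<tau> x) $ j))"

definition curvature ::
    "(real^4 \<Rightarrow> (('a::{semiring_1, real_normed_vector})^'n^'n)^4) \<Rightarrow> ('a^'n^'n) form" where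
  "curvature A = (\<lambda>x xs. ext_d (form1 A) x xs + wedge (**) (form1 A) (form1 A) x xs)"

definition eps :: "4 \<Rightarrow> 4 \<Rightarrow> 4 \<Rightarrow> 4 \<Rightarrow> real" where
  "eps i j k l = det (\<chi> r. axis (if r = 1 then i else if r = 2 then j else if r = 3 then k else l) 1)"


definition hconj :: "complex^2^2 \<Rightarrow> complex^2^2" where
  "hconj X = (\<chi> i j. cnj (X $ j $ i))"

definition unitary2 :: "complex^2^2 \<Rightarrow> bool" where
  "unitary2 X \<longleftrightarrow> X ** hconj X = mat 1"

definition su2 :: "complex^2^2 \<Rightarrow> bool" where
  "su2 X \<longleftrightarrow> hconj X = - X \<and> trace X = 0"

definition so4 :: "real^4^4 \<Rightarrow> bool" where
  "so4 X \<longleftrightarrow> transpose X = - X"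

text \<open>Two-forms in an orthonormal frame are antisymmetric matrices, and \<open>X\<close> in
  \<open>so(4)\<close> acts on them by \<open>B \<mapsto> X B + B X\<^sup>T = X B - B X\<close>.\<close>

definition hodge :: "real^4^4 \<Rightarrow> real^4^4" where
  "hodge B = (\<chi> i j. (1/2) * (\<Sum>k\<in>UNIV. \<Sum>l\<in>UNIV. eps i j k l * B $ k $ l))"

definition su2_minus :: "(real^4^4) set" where
  "su2_minus = {X. so4 X \<and> (\<forall>B. so4 B \<and> hodge B = B \<longrightarrow> X ** B - B ** X = 0)}"

definition su2_plus :: "(real^4^4) set" where
  "su2_plus = {X. so4 X \<and> (\<forall>B. so4 B \<and> hodge B = - B \<longrightarrow> X ** B - B ** X = 0)}"

definition asd_component :: "real^4^4 \<Rightarrow> real^4^4" where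
  "asd_component X = (THE Y. Y \<in> su2_minus \<and> X - Y \<in> su2_plus)"

text \<open>The identification of \<open>(e\<^sup>1, e\<^sup>2, e\<^sup>3, e\<^sup>4)\<close> with
  \<open>(\<alpha>, \<beta>) = (e\<^sup>1 + i e\<^sup>2, e\<^sup>3 + i e\<^sup>4)\<close>, in both directions.\<close>

definition cplx :: "real^4 \<Rightarrow> complex^2" where
  "cplx v = (\<chi> k. if k = 1 then Complex (v $ 1) (v $ 2) else Complex (v $ 3) (v $ 4))"

definition uncplx :: "complex^2 \<Rightarrow> real^4" where
  "uncplx z = (\<chi> I. if I = 1 then Re (z $ 1) else if I = 2 then Im (z $ 1)
                    else if I = 3 then Re (z $ 2) else Im (z $ 2))"


text \<open>A coframe is a one-form with values in \<open>\<real>\<^sup>4\<close>: \<open>e x $ \<mu> $ I\<close> is the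
  component \<open>\<mu>\<close> of \<open>e\<^sup>I\<close>.\<close>

definition coframe_form :: "(real^4 \<Rightarrow> real^4^4) \<Rightarrow> 4 \<Rightarrow> real form" where
  "coframe_form e I = form1 (\<lambda>x. \<chi> i. e x $ i $ I)"

definition coframe_vol :: "(real^4 \<Rightarrow> real^4^4) \<Rightarrow> real form" where
  "coframe_vol e = wedge (*) (coframe_form e 1) (wedge (*) (coframe_form e 2)
     (wedge (*) (coframe_form e 3) (coframe_form e 4)))"

text \<open>The Levi-Civita connection in an orthonormal coframe: the \<open>so(4)\<close>-valued one-form
  \<open>w\<close> with \<open>de\<^sup>I = - w\<^sup>I\<^sub>J \<and> e\<^sup>J\<close>. Since this equation does not
  involve derivatives of \<open>w\<close>, it determines \<open>w\<close> point by point.\<close>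

definition lc_conn :: "(real^4 \<Rightarrow> real^4^4) \<Rightarrow> real^4 \<Rightarrow> (real^4^4)^4" where
  "lc_conn e x = (THE W. (\<forall>i. so4 (W $ i)) \<and>
     (\<forall>xs. ext_d (form1 e) x xs = - wedge (*v) (form1 (\<lambda>_. W)) (form1 e) x xs))"

definition coframe_scal :: "(real^4 \<Rightarrow> real^4^4) \<Rightarrow> real^4 \<Rightarrow> real" where
  "coframe_scal e x =
     (1/4) * (\<Sum>I\<in>UNIV. \<Sum>J\<in>UNIV. \<Sum>K\<in>UNIV. \<Sum>L\<in>UNIV. eps I J K L *
        wedge (*) (\<lambda>y ys. curvature (lc_conn e) y ys $ I $ J)
          (wedge (*) (coframe_form e K) (coframe_form e L)) x [1, 2, 3, 4])
     / coframe_vol e x [1, 2, 3, 4]"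

definition orthonormal_coframe ::
    "(real^4) set \<Rightarrow> (real^4 \<Rightarrow> real^4^4) \<Rightarrow> (real^4 \<Rightarrow> real^4^4) \<Rightarrow> bool" where
  "orthonormal_coframe S g e \<longleftrightarrow> smooth_on S e \<and>
     (\<forall>x\<in>S. \<forall>i j. g x $ i $ j = (\<Sum>I\<in>UNIV. e x $ i $ I * e x $ j $ I))"

text \<open>The scalar curvature of a metric \<open>g\<close>, computed in any local orthonormal coframe.
  With the normalisation \<open>s dV = 1/4 \<epsilon>\<^sub>I\<^sub>J\<^sub>K\<^sub>L R\<^sup>I\<^sup>J \<and> e\<^sup>K \<and> e\<^sup>L\<close> it is one half of the
  trace of the Ricci tensor (6 for the unit sphere).\<close>

definition scal :: "(real^4 \<Rightarrow> real^4^4) \<Rightarrow> real^4 \<Rightarrow> real" where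
  "scal g x = (THE s. \<exists>S e. open S \<and> x \<in> S \<and> orthonormal_coframe S g e \<and> s = coframe_scal e x)"

text \<open>The volume form of \<open>g\<close> for the orientation in which \<open>\<omega> \<and> \<omega>\<close> is positive.\<close>

definition metric_vol :: "(real^4 \<Rightarrow> real^4^4) \<Rightarrow> real form \<Rightarrow> real form" where
  "metric_vol g \<omega> = (\<lambda>x xs. if length xs = 4
     then sgn (wedge (*) \<omega> \<omega> x [1, 2, 3, 4]) * sqrt (det (g x)) * eps (xs!0) (xs!1) (xs!2) (xs!3)
     else 0)"


text \<open>\<open>\<Psi> x $ \<mu>\<close> is the vector with entries \<open>\<alpha>\<^sub>\<mu>\<close> and \<open>\<beta>\<^sub>\<mu>\<close>.\<close>

type_synonym frame = "real^4 \<Rightarrow> (complex^2)^4"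

definition fcomp :: "frame \<Rightarrow> 2 \<Rightarrow> real^4 \<Rightarrow> complex^4" where
  "fcomp \<Psi> k x = (\<chi> i. \<Psi> x $ i $ k)"

definition fcomp_cnj :: "frame \<Rightarrow> 2 \<Rightarrow> real^4 \<Rightarrow> complex^4" where
  "fcomp_cnj \<Psi> k x = (\<chi> i. cnj (\<Psi> x $ i $ k))"

definition nondegenerate_at :: "frame \<Rightarrow> real^4 \<Rightarrow> bool" where
  "nondegenerate_at \<Psi> x \<longleftrightarrow> (\<forall>c1 c2 c3 c4 :: complex.
     c1 *s fcomp \<Psi> 1 x + c2 *s fcomp \<Psi> 2 x + c3 *s fcomp_cnj \<Psi> 1 x + c4 *s fcomp_cnj \<Psi> 2 x = 0
     \<longrightarrow> c1 = 0 \<and> c2 = 0 \<and> c3 = 0 \<and> c4 = 0)"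

definition coframe :: "frame \<Rightarrow> real^4 \<Rightarrow> real^4^4" where
  "coframe \<Psi> x = (\<chi> i. uncplx (\<Psi> x $ i))"

definition symprod :: "complex^4 \<Rightarrow> complex^4 \<Rightarrow> complex^4^4" where
  "symprod a b = (\<chi> i j. (1/2) * (a $ i * b $ j + b $ i * a $ j))"

text \<open>The metric and \<open>\<omega>\<close> have real components; \<open>Re\<close> below only changes the type.\<close>

definition metric_of :: "frame \<Rightarrow> real^4 \<Rightarrow> real^4^4" where
  "metric_of \<Psi> x = (\<chi> i j. Re ((symprod (fcomp \<Psi> 1 x) (fcomp_cnj \<Psi> 1 x)
                               + symprod (fcomp \<Psi> 2 x) (fcomp_cnj \<Psi> 2 x)) $ i $ j))"

definition omega_of :: "frame \<Rightarrow> real form" where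
  "omega_of \<Psi> = (\<lambda>x xs. Re ((\<i>/2) *
     (wedge (*) (form1 (fcomp \<Psi> 1)) (form1 (fcomp_cnj \<Psi> 1)) x xs
    + wedge (*) (form1 (fcomp \<Psi> 2)) (form1 (fcomp_cnj \<Psi> 2)) x xs)))"

definition form2_matrix :: "real form \<Rightarrow> real^4 \<Rightarrow> real^4^4" where
  "form2_matrix \<omega> x = (\<chi> i j. \<omega> x [i, j])"

text \<open>The anti-self-dual part of the Levi-Civita connection, as the matrix of
  \<open>su(2)\<close> through which it acts on the adapted coframe \<open>\<Psi>\<close>.\<close>

definition asd_conn :: "frame \<Rightarrow> real^4 \<Rightarrow> (complex^2^2)^4" where
  "asd_conn \<Psi> x = (\<chi> i. THE m. su2 m \<and>
     (\<forall>v. m *v cplx v = cplx (asd_component (lc_conn (coframe \<Psi>) x $ i) *v v)))"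


text \<open>A smooth structure on the whole type \<open>'m\<close>, given by a countable atlas (empty charts are
  allowed). Objects on the manifold are families of local representatives on the chart
  images \<open>\<phi> n ` U n\<close>; what they are outside of these is irrelevant.\<close>

definition trans_map :: "(nat \<Rightarrow> 'm set) \<Rightarrow> (nat \<Rightarrow> 'm \<Rightarrow> real^4) \<Rightarrow> nat \<Rightarrow> nat \<Rightarrow> real^4 \<Rightarrow> real^4" where
  "trans_map U \<phi> m n x = \<phi> n (inv_into (U m) (\<phi> m) x)"

definition smooth_atlas ::
    "(nat \<Rightarrow> 'm::{t2_space, second_countable_topology} set) \<Rightarrow> (nat \<Rightarrow> 'm \<Rightarrow> real^4) \<Rightarrow> bool" where
  "smooth_atlas U \<phi> \<longleftrightarrow> (\<Union>n. U n) = UNIV \<and>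
     (\<forall>n. open (U n) \<and> open (\<phi> n ` U n) \<and>
          homeomorphism (U n) (\<phi> n ` U n) (\<phi> n) (inv_into (U n) (\<phi> n))) \<and>
     (\<forall>m n. smooth_on (\<phi> m ` (U m \<inter> U n)) (trans_map U \<phi> m n))"

text \<open>A \<open>U(2)\<close> bundle trivialised over the charts. The transition function \<open>h m n\<close> maps gauge
  \<open>n\<close> to gauge \<open>m\<close>, and is expressed in the coordinates of the chart \<open>m\<close>.\<close>

definition u2_bundle ::
    "(nat \<Rightarrow> 'm set) \<Rightarrow> (nat \<Rightarrow> 'm \<Rightarrow> real^4) \<Rightarrow> (nat \<Rightarrow> nat \<Rightarrow> real^4 \<Rightarrow> complex^2^2) \<Rightarrow> bool" where
  "u2_bundle U \<phi> h \<longleftrightarrow>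
     (\<forall>m n. smooth_on (\<phi> m ` (U m \<inter> U n)) (h m n) \<and> (\<forall>x\<in>\<phi> m ` (U m \<inter> U n). unitary2 (h m n x))) \<and>
     (\<forall>k m n. \<forall>x\<in>\<phi> k ` (U k \<inter> U m \<inter> U n). h k n x = h k m x ** h m n (trans_map U \<phi> k m x))"

definition u2_frame ::
    "(nat \<Rightarrow> 'm set) \<Rightarrow> (nat \<Rightarrow> 'm \<Rightarrow> real^4) \<Rightarrow> (nat \<Rightarrow> nat \<Rightarrow> real^4 \<Rightarrow> complex^2^2) \<Rightarrow>
     (nat \<Rightarrow> frame) \<Rightarrow> bool" where
  "u2_frame U \<phi> h \<Psi> \<longleftrightarrow>
     (\<forall>n. smooth_on (\<phi> n ` U n) (\<Psi> n) \<and> (\<forall>x\<in>\<phi> n ` U n. nondegenerate_at (\<Psi> n) x)) \<and>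
     (\<forall>m n. \<forall>x\<in>\<phi> m ` (U m \<inter> U n). \<forall>i.
        \<Psi> m x $ i = h m n x *v (pullback1 (trans_map U \<phi> m n) (\<Psi> n) x $ i))"

definition u2_conn_form ::
    "(real^4 \<Rightarrow> (complex^2^2)^4) \<Rightarrow> (real^4 \<Rightarrow> complex^4) \<Rightarrow> real^4 \<Rightarrow> (complex^2^2)^4" where
  "u2_conn_form A a x = (\<chi> i. A x $ i + mat (a x $ i))"

text \<open>\<open>A + \<I> a\<close> is a \<open>U(2)\<close> connection: local one-forms with values in \<open>su(2)\<close> and in the
  imaginary numbers, such that \<open>w\<^sub>m = h w\<^sub>n h\<^sup>\<dagger> - dh h\<^sup>\<dagger>\<close> on overlaps.\<close>

definition u2_connection ::
    "(nat \<Rightarrow> 'm set) \<Rightarrow> (nat \<Rightarrow> 'm \<Rightarrow> real^4) \<Rightarrow> (nat \<Rightarrow> nat \<Rightarrow> real^4 \<Rightarrow> complex^2^2) \<Rightarrow>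
     (nat \<Rightarrow> real^4 \<Rightarrow> (complex^2^2)^4) \<Rightarrow> (nat \<Rightarrow> real^4 \<Rightarrow> complex^4) \<Rightarrow> bool" where
  "u2_connection U \<phi> h A a \<longleftrightarrow>
     (\<forall>n. smooth_on (\<phi> n ` U n) (A n) \<and> smooth_on (\<phi> n ` U n) (a n) \<and>
          (\<forall>x\<in>\<phi> n ` U n. \<forall>i. su2 (A n x $ i) \<and> Re (a n x $ i) = 0)) \<and>
     (\<forall>m n. \<forall>x\<in>\<phi> m ` (U m \<inter> U n). \<forall>i.
        u2_conn_form (A m) (a m) x $ i =
          h m n x ** (pullback1 (trans_map U \<phi> m n) (u2_conn_form (A n) (a n)) x $ i) ** hconj (h m n x)
          - pd i (h m n) x ** hconj (h m n x))"

text \<open>A variation of the \<open>SU(2)\<close> part of a connection, supported in \<open>K\<close>.\<close>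

definition su2_variation ::
    "(nat \<Rightarrow> 'm set) \<Rightarrow> (nat \<Rightarrow> 'm \<Rightarrow> real^4) \<Rightarrow> (nat \<Rightarrow> nat \<Rightarrow> real^4 \<Rightarrow> complex^2^2) \<Rightarrow> 'm set \<Rightarrow>
     (nat \<Rightarrow> real^4 \<Rightarrow> (complex^2^2)^4) \<Rightarrow> bool" where
  "su2_variation U \<phi> h K B \<longleftrightarrow>
     (\<forall>n. smooth_on (\<phi> n ` U n) (B n) \<and> (\<forall>x\<in>\<phi> n ` U n. \<forall>i. su2 (B n x $ i)) \<and>
          (\<forall>p\<in>U n - K. B n (\<phi> n p) = 0)) \<and>
     (\<forall>m n. \<forall>x\<in>\<phi> m ` (U m \<inter> U n). \<forall>i.
        B m x $ i = h m n x ** (pullback1 (trans_map U \<phi> m n) (B n) x $ i) ** hconj (h m n x))"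

text \<open>The integral of a four-form \<open>L\<close> over a subset \<open>K\<close> of the manifold, for the orientation given
  by a nowhere vanishing four-form \<open>V\<close>: the manifold is cut into the disjoint Borel pieces
  \<open>U n - (\<Union>m<n. U m)\<close>, each of which is integrated in its chart. By the change of variables
  formula the result does not depend on the atlas. Summation over the pieces and integration
  form one Lebesgue integral over \<open>\<nat> \<times> \<real>\<^sup>4\<close>, which provides a notion of integrability.\<close>

definition local_integrand ::
    "(nat \<Rightarrow> 'm set) \<Rightarrow> (nat \<Rightarrow> 'm \<Rightarrow> real^4) \<Rightarrow> (nat \<Rightarrow> real form) \<Rightarrow> 'm set \<Rightarrow>
     (nat \<Rightarrow> complex form) \<Rightarrow> nat \<times> (real^4) \<Rightarrow> complex" where
  "local_integrand U \<phi> V K L = (\<lambda>(n, x). if x \<in> \<phi> n ` (K \<inter> (U n - (\<Union>m<n. U m)))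
     then sgn (V n x [1, 2, 3, 4]) *\<^sub>R L n x [1, 2, 3, 4] else 0)"

definition form_integrable ::
    "(nat \<Rightarrow> 'm set) \<Rightarrow> (nat \<Rightarrow> 'm \<Rightarrow> real^4) \<Rightarrow> (nat \<Rightarrow> real form) \<Rightarrow> 'm set \<Rightarrow>
     (nat \<Rightarrow> complex form) \<Rightarrow> bool" where
  "form_integrable U \<phi> V K L \<longleftrightarrow>
     integrable (count_space UNIV \<Otimes>\<^sub>M lborel) (local_integrand U \<phi> V K L)"

definition form_integral ::
    "(nat \<Rightarrow> 'm set) \<Rightarrow> (nat \<Rightarrow> 'm \<Rightarrow> real^4) \<Rightarrow> (nat \<Rightarrow> real form) \<Rightarrow> 'm set \<Rightarrow>
     (nat \<Rightarrow> complex form) \<Rightarrow> complex" where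
  "form_integral U \<phi> V K L =
     integral\<^sup>L (count_space UNIV \<Otimes>\<^sub>M lborel) (local_integrand U \<phi> V K L)"


definition herm :: "complex^2 \<Rightarrow> complex^2 \<Rightarrow> complex" where
  "herm u v = (\<Sum>k\<in>UNIV. cnj (u $ k) * v $ k)"

definition psi_psi :: "frame \<Rightarrow> complex form" where
  "psi_psi \<Psi> = wedge herm (form1 \<Psi>) (form1 \<Psi>)"

definition psi_F_psi :: "(real^4 \<Rightarrow> (complex^2^2)^4) \<Rightarrow> frame \<Rightarrow> complex form" where
  "psi_F_psi A \<Psi> = wedge herm (form1 \<Psi>) (wedge (*v) (curvature A) (form1 \<Psi>))"

definition lagrangian ::
    "real \<Rightarrow> real \<Rightarrow> real \<Rightarrow> frame \<Rightarrow> (real^4 \<Rightarrow> (complex^2^2)^4) \<Rightarrow> (real^4 \<Rightarrow> complex^4) \<Rightarrow> complex form" where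
  "lagrangian lam mu nu \<Psi> A a = (\<lambda>x xs.
     of_real lam * psi_F_psi A \<Psi> x xs
   + of_real mu * wedge (*) (ext_d (form1 a)) (psi_psi \<Psi>) x xs
   + of_real nu * wedge (*) (psi_psi \<Psi>) (psi_psi \<Psi>) x xs)"

text \<open>The part of the first functional over the region \<open>K\<close>; \<open>K = UNIV\<close> gives the integral over
  the whole manifold.\<close>

definition frame_action ::
    "(nat \<Rightarrow> 'm set) \<Rightarrow> (nat \<Rightarrow> 'm \<Rightarrow> real^4) \<Rightarrow> real \<Rightarrow> real \<Rightarrow> real \<Rightarrow> 'm set \<Rightarrow>
     (nat \<Rightarrow> frame) \<Rightarrow> (nat \<Rightarrow> real^4 \<Rightarrow> (complex^2^2)^4) \<Rightarrow> (nat \<Rightarrow> real^4 \<Rightarrow> complex^4) \<Rightarrow> complex" where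
  "frame_action U \<phi> lam mu nu K \<Psi> A a =
     form_integral U \<phi> (\<lambda>n. coframe_vol (coframe (\<Psi> n))) K (\<lambda>n. lagrangian lam mu nu (\<Psi> n) (A n) (a n))"

text \<open>The Euler--Lagrange equation for \<open>A\<close>: the action is stationary under all compactly
  supported variations. As such a variation does not change the Lagrangian outside a
  compact set \<open>K\<close>, it is enough to integrate over \<open>K\<close>, where everything is finite.\<close>

definition stationary_in_A ::
    "(nat \<Rightarrow> 'm::topological_space set) \<Rightarrow> (nat \<Rightarrow> 'm \<Rightarrow> real^4) \<Rightarrow> (nat \<Rightarrow> nat \<Rightarrow> real^4 \<Rightarrow> complex^2^2) \<Rightarrow>
     real \<Rightarrow> real \<Rightarrow> real \<Rightarrow>
     (nat \<Rightarrow> frame) \<Rightarrow> (nat \<Rightarrow> real^4 \<Rightarrow> (complex^2^2)^4) \<Rightarrow> (nat \<Rightarrow> real^4 \<Rightarrow> complex^4) \<Rightarrow> bool" where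
  "stationary_in_A U \<phi> h lam mu nu \<Psi> A a \<longleftrightarrow>
     (\<forall>K B. compact K \<and> su2_variation U \<phi> h K B \<longrightarrow>
        ((\<lambda>t::real. frame_action U \<phi> lam mu nu K \<Psi> (\<lambda>n x. A n x + t *\<^sub>R B n x) a)
           has_vector_derivative 0) (at 0))"

definition metric_lagrangian ::
    "real \<Rightarrow> (real^4 \<Rightarrow> real^4^4) \<Rightarrow> real form \<Rightarrow> (real^4 \<Rightarrow> complex^4) \<Rightarrow> complex form" where
  "metric_lagrangian mt g \<omega> a = (\<lambda>x xs.
     of_real ((scal g x + 2 * mt - 6) * metric_vol g \<omega> x xs)
   - of_real (2 * mt) * wedge (\<lambda>r c. of_real r * c) \<omega> (\<lambda>y ys. \<i> * ext_d (form1 a) y ys) x xs)"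

definition metric_action ::
    "(nat \<Rightarrow> 'm set) \<Rightarrow> (nat \<Rightarrow> 'm \<Rightarrow> real^4) \<Rightarrow> real \<Rightarrow> real \<Rightarrow> 'm set \<Rightarrow>
     (nat \<Rightarrow> real^4 \<Rightarrow> real^4^4) \<Rightarrow> (nat \<Rightarrow> real form) \<Rightarrow> (nat \<Rightarrow> real^4 \<Rightarrow> complex^4) \<Rightarrow> complex" where
  "metric_action U \<phi> lam mu K g \<omega> a = - of_real lam *
     form_integral U \<phi> (\<lambda>n. metric_vol (g n) (\<omega> n)) K (\<lambda>n. metric_lagrangian (mu / lam) (g n) (\<omega> n) (a n))"

end

theory Submission
  imports Defs
begin

text \<open>Write \<open>A = w + C\<close> with \<open>w\<close> the anti-self-dual part of the Levi-Civita connection. With respect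
  to \<open>w\<close>, the frame \<open>\<Psi>\<close> is covariantly closed up to the self-dual part of the Levi-Civita
  connection, whose matrices commute with \<open>su(2)\<^sub>-\<close>. Hence the part of \<open>\<Psi>\<^sup>\<dagger> F \<Psi>\<close> that is linear in
  \<open>C\<close> is exact, and the derivative of the action in a direction \<open>B\<close> is the integral of
  \<open>\<lambda> \<Psi>\<^sup>\<dagger> (C \<and> B + B \<and> C) \<Psi>\<close>. This algebraic pairing of \<open>su(2)\<close>-valued 1-forms is nondegenerate, so
  variations concentrated near a point force \<open>C = 0\<close> there. At \<open>A = w\<close> the first Bianchi identity
  turns \<open>\<Psi>\<^sup>\<dagger> F \<Psi>\<close> into \<open>- s dV\<close>, and the other terms are read off from \<open>\<Psi>\<^sup>\<dagger> \<Psi> = 2 i \<omega>\<close> and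
  \<open>4 \<nu> = \<mu> - 3 \<lambda>\<close>.\<close>

subsection \<open>Partial derivatives and smooth functions\<close>

text \<open>A four-form enters only through its component \<open>[1, 2, 3, 4]\<close>, written as a
  full contraction with the alternating symbol. A change of chart and gauge multiplies it by the
  determinant of the Jacobian, and the orientation sign of the frame turns it into a density.
  Exactness of the linear part is used as a divergence identity in a single chart, where derivatives
  of compactly supported functions integrate to zero. The obstacle is that the integral is defined
  by cutting the manifold into Borel pieces with uncontrolled boundaries, so Stokes cannot be
  applied piece by piece. Variations are therefore split by bump functions into ones living in a
  coordinate ball, and for those all pieces are brought back to one chart. The Levi-Civita
  connection is a unique description: its regularity comes from the Koszul formula, its gauge
  behaviour from uniqueness. The trace part of \<open>dh h\<^sup>\<dagger>\<close> is self-dual and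
  hence lost in the anti-self-dual connection; the given \<open>U(1)\<close> part restores it, which
  makes the sum of both a \<open>U(2)\<close> connection.\<close>

lemma pd_eq:
  assumes "(f has_derivative D) (at x)"
  shows "pd i f x = D (axis i 1)"
  using frechet_derivative_at[OF assms] by (simp add: pd_def)

lemma differentiable_imp_has_derivative:
  "f differentiable (at x) \<Longrightarrow> (f has_derivative frechet_derivative f (at x)) (at x)"
  by (simp add: frechet_derivative_works)

lemma frechet_eq_sum_pd:
  fixes f :: "real^4 \<Rightarrow> 'v::real_normed_vector"
  assumes "f differentiable (at x)"
  shows "frechet_derivative f (at x) v = (\<Sum>i\<in>UNIV. v $ i *\<^sub>R pd i f x)"
proof -
  interpret linear "frechet_derivative f (at x)"
    using assms by (rule linear_frechet_derivative)
  have "v = (\<Sum>i\<in>UNIV. v $ i *\<^sub>R axis i 1)"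
    by (simp add: vec_eq_iff axis_def if_distrib cong: if_cong)
  then have "frechet_derivative f (at x) v = frechet_derivative f (at x) (\<Sum>i\<in>UNIV. v $ i *\<^sub>R axis i 1)"
    by simp
  also have "\<dots> = (\<Sum>i\<in>UNIV. v $ i *\<^sub>R pd i f x)"
    by (simp add: sum scale pd_def)
  finally show ?thesis .
qed

text \<open>\<open>frechet_derivative\<close> chooses among all derivatives, and the two functions
  have the same derivatives at \<open>x\<close>; so the choices agree even where neither function is
  differentiable.\<close>

lemma pd_cong:
  assumes "open S" "x \<in> S" "\<And>y. y \<in> S \<Longrightarrow> f y = g y"
  shows "pd i f x = pd i g x"
proof -
  have "(f has_derivative D) (at x) \<longleftrightarrow> (g has_derivative D) (at x)" for D
    using has_derivative_transform_within_open[OF _ assms(1,2), of f D UNIV g]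
      has_derivative_transform_within_open[OF _ assms(1,2), of g D UNIV f] assms(3) by auto
  then show ?thesis by (simp add: pd_def frechet_derivative_def)
qed

lemma differentiable_cong_open:
  assumes "open S" "x \<in> S" "\<And>y. y \<in> S \<Longrightarrow> f y = g y" "f differentiable (at x)"
  shows "g differentiable (at x)"
  using assms has_derivative_transform_within_open[OF _ assms(1,2), of f _ UNIV g]
  unfolding differentiable_def by blast

lemma pd_const [simp]: "pd i (\<lambda>x. c) x = 0"
  by (rule pd_eq[where D="\<lambda>_. 0", THEN trans]) auto

lemma pd_bounded_linear:
  assumes "bounded_linear L" "f differentiable (at x)"
  shows "pd i (\<lambda>x. L (f x)) x = L (pd i f x)"
  using bounded_linear.has_derivative[OF assms(1) differentiable_imp_has_derivative[OF assms(2)]]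
  by (subst pd_eq) (auto simp: pd_def)

lemma pd_add:
  assumes "f differentiable (at x)" "g differentiable (at x)"
  shows "pd i (\<lambda>x. f x + g x) x = pd i f x + pd i g x"
  by (subst pd_eq[OF has_derivative_add[OF assms[THEN differentiable_imp_has_derivative]]]) (simp add: pd_def)

lemma pd_diff:
  assumes "f differentiable (at x)" "g differentiable (at x)"
  shows "pd i (\<lambda>x. f x - g x) x = pd i f x - pd i g x"
  by (subst pd_eq[OF has_derivative_diff[OF assms[THEN differentiable_imp_has_derivative]]]) (simp add: pd_def)

lemma pd_minus:
  assumes "f differentiable (at x)"
  shows "pd i (\<lambda>x. - f x) x = - pd i f x"
  by (subst pd_eq[OF has_derivative_minus[OF assms[THEN differentiable_imp_has_derivative]]]) (simp add: pd_def)

lemma pd_sum: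
  assumes "\<And>k. k \<in> I \<Longrightarrow> f k differentiable (at x)"
  shows "pd i (\<lambda>x. \<Sum>k\<in>I. f k x) x = (\<Sum>k\<in>I. pd i (f k) x)"
  by (subst pd_eq[OF has_derivative_sum[OF assms[THEN differentiable_imp_has_derivative]]]) (simp_all add: pd_def)

lemma pd_bilinear:
  assumes "bounded_bilinear B" "f differentiable (at x)" "g differentiable (at x)"
  shows "pd i (\<lambda>x. B (f x) (g x)) x = B (pd i f x) (g x) + B (f x) (pd i g x)"
  by (subst pd_eq[OF bounded_bilinear.FDERIV[OF assms(1) assms(2,3)[THEN differentiable_imp_has_derivative]]])
     (simp add: pd_def)

lemma differentiable_bounded_linear:
  assumes "bounded_linear L" "f differentiable F"
  shows "(\<lambda>x. L (f x)) differentiable F"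
  using assms bounded_linear.has_derivative unfolding differentiable_def by blast

lemma differentiable_bilinear:
  assumes "bounded_bilinear B" "f differentiable (at x)" "g differentiable (at x)"
  shows "(\<lambda>x. B (f x) (g x)) differentiable (at x)"
  using bounded_bilinear.FDERIV[OF assms(1)] assms(2,3) unfolding differentiable_def by blast

lemma pd_compose:
  fixes \<tau> :: "real^4 \<Rightarrow> real^4"
  assumes "\<tau> differentiable (at x)" "f differentiable (at (\<tau> x))"
  shows "pd i (\<lambda>x. f (\<tau> x)) x = (\<Sum>j\<in>UNIV. pd i \<tau> x $ j *\<^sub>R pd j f (\<tau> x))"
proof -
  have "pd i (\<lambda>x. f (\<tau> x)) x = frechet_derivative f (at (\<tau> x)) (pd i \<tau> x)"
    using frechet_derivative_compose[OF assms] by (simp add: pd_def o_def)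
  then show ?thesis by (simp add: frechet_eq_sum_pd[OF assms(2)])
qed

lemma differentiable_compose_at:
  "\<tau> differentiable (at x) \<Longrightarrow> f differentiable (at (\<tau> x)) \<Longrightarrow> (\<lambda>x. f (\<tau> x)) differentiable (at x)"
  using differentiable_chain_at[of \<tau> x f] by (simp add: o_def)

section \<open>Differentiability classes of finite order and their closure properties\<close>

primrec ckn :: "nat \<Rightarrow> (real^4) set \<Rightarrow> (real^4 \<Rightarrow> 'v::real_normed_vector) \<Rightarrow> bool" where
  "ckn 0 S f \<longleftrightarrow> (\<forall>x\<in>S. f differentiable (at x))"
| "ckn (Suc n) S f \<longleftrightarrow> (\<forall>x\<in>S. f differentiable (at x)) \<and> (\<forall>i. ckn n S (pd i f))"

text \<open>\<open>foldr\<close> applies the last index of the list first, so the derivative peeled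
  off by \<open>ckn\<close> sits at the end of the list. \<open>ckn n\<close> asks that all iterated
  partial derivatives up to order \<open>n\<close> are still differentiable; it turns closure
  properties of smoothness into inductions over \<open>n\<close>.\<close>

lemma ckn_iff_foldr:
  "open S \<Longrightarrow> ckn n S f \<longleftrightarrow> (\<forall>is. length is \<le> n \<longrightarrow> foldr pd is f differentiable_on S)"
proof (induction n arbitrary: f)
  case 0
  then show ?case by (simp add: differentiable_on_eq_differentiable_at)
next
  case (Suc n)
  have "(\<forall>is. length is \<le> Suc n \<longrightarrow> foldr pd is f differentiable_on S) \<longleftrightarrow>
     foldr pd [] f differentiable_on S \<and> (\<forall>i is. length is \<le> n \<longrightarrow> foldr pd (is @ [i]) f differentiable_on S)"
    (is "?L \<longleftrightarrow> ?R")
  proof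
    assume ?L
    then show ?R by (auto dest: spec[of _ "[]"] simp del: foldr_append)
  next
    assume R: ?R
    show ?L
    proof (intro allI impI)
      fix "is" :: "4 list" assume l: "length is \<le> Suc n"
      show "foldr pd is f differentiable_on S"
      proof (cases "is" rule: rev_cases)
        case Nil then show ?thesis using R by simp
      next
        case (snoc ys y) then show ?thesis using R l by simp
      qed
    qed
  qed
  then show ?case using Suc by (simp add: differentiable_on_eq_differentiable_at)
qed

lemma smooth_on_iff_ckn: "open S \<Longrightarrow> smooth_on S f \<longleftrightarrow> (\<forall>n. ckn n S f)"
  by (auto simp: ckn_iff_foldr smooth_on_def)

lemma ckn_differentiable: "ckn n S f \<Longrightarrow> x \<in> S \<Longrightarrow> f differentiable (at x)"
  by (cases n) auto

lemma ckn_SucD: "ckn (Suc n) S f \<Longrightarrow> ckn n S f"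
  by (induction n arbitrary: f) auto

lemma ckn_cong:
  assumes "open S"
  shows "(\<And>y. y \<in> S \<Longrightarrow> f y = g y) \<Longrightarrow> ckn n S f \<Longrightarrow> ckn n S g"
proof (induction n arbitrary: f g)
  case 0
  then show ?case using differentiable_cong_open[OF assms, of _ f g] by auto
next
  case (Suc n)
  have "ckn n S (pd i g)" for i
    by (rule Suc.IH[of "pd i f"]) (use Suc.prems pd_cong[OF assms, of _ f g i] in auto)
  then show ?case using Suc.prems differentiable_cong_open[OF assms, of _ f g] by auto
qed

lemma ckn_local:
  assumes "\<And>x. x \<in> S \<Longrightarrow> \<exists>T. x \<in> T \<and> ckn n T f"
  shows "ckn n S f"
  using assms
proof (induction n arbitrary: f)
  case 0
  then show ?case by fastforce
next
  case (Suc n)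
  have "ckn n S (pd i f)" for i
    by (rule Suc.IH) (use Suc.prems in fastforce)
  then show ?case using Suc.prems by fastforce
qed

lemma ckn_const: "ckn n S (\<lambda>x. c)"
proof (induction n arbitrary: c)
  case (Suc n)
  have "pd i (\<lambda>x. c) = (\<lambda>x. 0)" for i by auto
  then show ?case using Suc by simp
qed auto

lemma ckn_bounded_linear:
  assumes "bounded_linear L" "open S"
  shows "ckn n S f \<Longrightarrow> ckn n S (\<lambda>x. L (f x))"
proof (induction n arbitrary: f)
  case 0
  then show ?case using differentiable_bounded_linear[OF assms(1)] by auto
next
  case (Suc n)
  have "ckn n S (pd i (\<lambda>x. L (f x)))" for i
    by (rule ckn_cong[OF assms(2) _ Suc.IH[of "pd i f"]])
      (use Suc.prems pd_bounded_linear[OF assms(1)] in auto)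
  then show ?case using Suc.prems differentiable_bounded_linear[OF assms(1)] by auto
qed

lemma ckn_add:
  assumes "open S"
  shows "ckn n S f \<Longrightarrow> ckn n S g \<Longrightarrow> ckn n S (\<lambda>x. f x + g x)"
proof (induction n arbitrary: f g)
  case 0
  then show ?case by (auto intro: differentiable_add)
next
  case (Suc n)
  have "ckn n S (pd i (\<lambda>x. f x + g x))" for i
    by (rule ckn_cong[OF assms _ Suc.IH[of "pd i f" "pd i g"]])
      (use Suc.prems in \<open>auto simp: pd_add\<close>)
  then show ?case using Suc.prems by (auto intro: differentiable_add)
qed

lemma ckn_sum:
  assumes "open S" "\<And>k. k \<in> I \<Longrightarrow> ckn n S (f k)"
  shows "ckn n S (\<lambda>x. \<Sum>k\<in>I. f k x)"
proof (cases "finite I")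
  case True
  then show ?thesis using assms(2)
    by (induction I rule: finite_induct) (auto intro: ckn_const ckn_add[OF assms(1)])
qed (auto intro: ckn_const)

text \<open>Leibniz rule: each summand of the derivative pairs one differentiated factor with one
  factor of order \<open>Suc n\<close>, which \<open>ckn_SucD\<close> lowers to fit the induction
  hypothesis.\<close>

lemma ckn_bilinear:
  assumes "bounded_bilinear B" "open S"
  shows "ckn n S f \<Longrightarrow> ckn n S g \<Longrightarrow> ckn n S (\<lambda>x. B (f x) (g x))"
proof (induction n arbitrary: f g)
  case 0
  then show ?case using differentiable_bilinear[OF assms(1)] by (simp, blast)
next
  case (Suc n)
  have d: "(\<lambda>x. B (f x) (g x)) differentiable (at x)" if "x \<in> S" for x
    using Suc.prems that by (intro differentiable_bilinear[OF assms(1)]) auto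
  have "ckn n S (pd i (\<lambda>x. B (f x) (g x)))" for i
    by (rule ckn_cong[OF assms(2) _ ckn_add[OF assms(2) Suc.IH[of "pd i f" g] Suc.IH[of f "pd i g"]]])
      (use Suc.prems pd_bilinear[OF assms(1)] ckn_SucD[OF Suc.prems(1)] ckn_SucD[OF Suc.prems(2)] in auto)
  then show ?case using d by auto
qed

lemma ckn_compose:
  fixes \<tau> :: "real^4 \<Rightarrow> real^4"
  assumes "open S" "\<And>x. x \<in> S \<Longrightarrow> \<tau> x \<in> T"
  shows "ckn n S \<tau> \<Longrightarrow> ckn n T f \<Longrightarrow> ckn n S (\<lambda>x. f (\<tau> x))"
proof (induction n arbitrary: f)
  case 0
  then show ?case using assms by (auto intro: differentiable_compose_at)
next
  case (Suc n)
  have *: "ckn n S (\<lambda>x. \<Sum>j\<in>UNIV. pd i \<tau> x $ j *\<^sub>R pd j f (\<tau> x))" for i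
    using Suc.prems ckn_SucD[of n S]
    by (intro ckn_sum assms(1) ckn_bilinear[OF bounded_bilinear_scaleR assms(1)]
         ckn_bounded_linear[OF bounded_linear_vec_nth assms(1)] Suc.IH) auto
  have "ckn n S (pd i (\<lambda>x. f (\<tau> x)))" for i
    by (rule ckn_cong[OF assms(1) _ *]) (use Suc.prems assms in \<open>auto simp: pd_compose\<close>)
  then show ?case using Suc.prems assms by (auto intro: differentiable_compose_at)
qed

text \<open>The derivative of \<open>1/f\<close> contains \<open>1/f\<close> again, but to one order
  less, so the induction runs on \<open>1/f\<close> itself while \<open>f\<close> stays
  fixed.\<close>

lemma ckn_inverse:
  fixes f :: "real^4 \<Rightarrow> real"
  assumes "open S" "\<And>x. x \<in> S \<Longrightarrow> f x \<noteq> 0" 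
  shows "ckn n S f \<Longrightarrow> ckn n S (\<lambda>x. inverse (f x))"
proof (induction n)
  case 0
  then show ?case using assms by (auto intro!: differentiable_inverse)
next
  case (Suc n)
  have *: "ckn n S (\<lambda>x. - (inverse (f x) * pd i f x * inverse (f x)))" for i
    using Suc.prems ckn_SucD[OF Suc.prems]
    by (intro ckn_bounded_linear[OF bounded_linear_minus[OF bounded_linear_ident] assms(1)]
         ckn_bilinear[OF bounded_bilinear_mult assms(1)] Suc.IH) auto
  have d: "((\<lambda>x. inverse (f x)) has_derivative (\<lambda>v. - (inverse (f x) * frechet_derivative f (at x) v * inverse (f x)))) (at x)"
    if "x \<in> S" for x
    by (rule Deriv.has_derivative_inverse[where f=f])
      (use Suc.prems that assms(2) in \<open>auto intro: differentiable_imp_has_derivative\<close>)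
  have "ckn n S (pd i (\<lambda>x. inverse (f x)))" for i
    by (rule ckn_cong[OF assms(1) _ *]) (use pd_eq[OF d] in \<open>auto simp: pd_def\<close>)
  then show ?case using d differentiableI by (simp, blast)
qed

lemma smooth_on_subset: "smooth_on S f \<Longrightarrow> T \<subseteq> S \<Longrightarrow> smooth_on T f"
  by (auto simp: smooth_on_def intro: differentiable_on_subset)

lemma smooth_on_differentiable: "open S \<Longrightarrow> smooth_on S f \<Longrightarrow> x \<in> S \<Longrightarrow> f differentiable (at x)"
  by (auto simp: smooth_on_iff_ckn intro: ckn_differentiable[of 0])

lemma smooth_on_pd: "open S \<Longrightarrow> smooth_on S f \<Longrightarrow> smooth_on S (pd i f)"
  by (meson ckn.simps(2) smooth_on_iff_ckn)

lemma smooth_on_continuous: "open S \<Longrightarrow> smooth_on S f \<Longrightarrow> continuous_on S f"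
  by (metis continuous_at_imp_continuous_on differentiable_imp_continuous_within smooth_on_differentiable)

lemma smooth_on_cong:
  "open S \<Longrightarrow> smooth_on S f \<Longrightarrow> (\<And>y. y \<in> S \<Longrightarrow> f y = g y) \<Longrightarrow> smooth_on S g"
  by (meson ckn_cong smooth_on_iff_ckn)

lemma smooth_on_local:
  assumes "open S" "\<And>x. x \<in> S \<Longrightarrow> \<exists>T. open T \<and> x \<in> T \<and> smooth_on T f"
  shows "smooth_on S f"
  using assms by (meson ckn_local smooth_on_iff_ckn)

lemma smooth_on_const [simp]: "smooth_on S (\<lambda>x. c)"
  by (rule smooth_on_subset[of UNIV]) (auto simp: smooth_on_iff_ckn ckn_const)

lemma smooth_on_linear: "bounded_linear L \<Longrightarrow> open S \<Longrightarrow> smooth_on S f \<Longrightarrow> smooth_on S (\<lambda>x. L (f x))"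
  by (auto simp: smooth_on_iff_ckn ckn_bounded_linear)

lemma smooth_on_add: "open S \<Longrightarrow> smooth_on S f \<Longrightarrow> smooth_on S g \<Longrightarrow> smooth_on S (\<lambda>x. f x + g x)"
  by (auto simp: smooth_on_iff_ckn ckn_add)

lemma smooth_on_minus: "open S \<Longrightarrow> smooth_on S f \<Longrightarrow> smooth_on S (\<lambda>x. - f x)"
  by (rule smooth_on_linear[OF bounded_linear_minus[OF bounded_linear_ident]])

lemma smooth_on_diff: "open S \<Longrightarrow> smooth_on S f \<Longrightarrow> smooth_on S g \<Longrightarrow> smooth_on S (\<lambda>x. f x - g x)"
  using smooth_on_add[OF _ _ smooth_on_minus, of S f g] by simp

lemma smooth_on_sum: "open S \<Longrightarrow> (\<And>k. k \<in> I \<Longrightarrow> smooth_on S (f k)) \<Longrightarrow> smooth_on S (\<lambda>x. \<Sum>k\<in>I. f k x)"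
  by (auto simp: smooth_on_iff_ckn ckn_sum)

lemma smooth_on_bilinear:
  "bounded_bilinear B \<Longrightarrow> open S \<Longrightarrow> smooth_on S f \<Longrightarrow> smooth_on S g \<Longrightarrow> smooth_on S (\<lambda>x. B (f x) (g x))"
  by (auto simp: smooth_on_iff_ckn ckn_bilinear)

lemmas smooth_on_mult = smooth_on_bilinear[OF bounded_bilinear_mult]
lemmas smooth_on_scaleR = smooth_on_bilinear[OF bounded_bilinear_scaleR]

lemma smooth_on_compose:
  "open S \<Longrightarrow> smooth_on S \<tau> \<Longrightarrow> open T \<Longrightarrow> smooth_on T f \<Longrightarrow> (\<And>x. x \<in> S \<Longrightarrow> \<tau> x \<in> T) \<Longrightarrow>
    smooth_on S (\<lambda>x. f (\<tau> x))"
  unfolding smooth_on_iff_ckn by (blast intro: ckn_compose)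

lemma smooth_on_inverse:
  fixes f :: "real^4 \<Rightarrow> real"
  shows "open S \<Longrightarrow> smooth_on S f \<Longrightarrow> (\<And>x. x \<in> S \<Longrightarrow> f x \<noteq> 0) \<Longrightarrow> smooth_on S (\<lambda>x. inverse (f x))"
  by (auto simp: smooth_on_iff_ckn ckn_inverse)

lemma bounded_linear_axis: "bounded_linear (axis i :: 'a::euclidean_space \<Rightarrow> 'a^'n)"
  by (intro linear_conv_bounded_linear[THEN iffD1] linearI) (auto simp: vec_eq_iff axis_def)

lemma vec_eq_sum_axis: "(x :: 'a::ab_group_add^'n) = (\<Sum>i\<in>UNIV. axis i (x $ i))"
  by (auto simp: vec_eq_iff axis_def)

lemma smooth_on_vec_iff:
  fixes f :: "real^4 \<Rightarrow> 'a::euclidean_space^'n"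
  assumes "open S"
  shows "smooth_on S f \<longleftrightarrow> (\<forall>i. smooth_on S (\<lambda>x. f x $ i))"
proof
  assume "\<forall>i. smooth_on S (\<lambda>x. f x $ i)"
  then have "smooth_on S (\<lambda>x. \<Sum>i\<in>UNIV. axis i (f x $ i))"
    using assms by (intro smooth_on_sum smooth_on_linear[OF bounded_linear_axis]) auto
  then show "smooth_on S f" by (simp flip: vec_eq_sum_axis)
qed (blast intro: smooth_on_linear[OF bounded_linear_vec_nth assms])

lemma pd_vec_nth: "f differentiable (at x) \<Longrightarrow> pd i (\<lambda>x. f x $ j) x = pd i f x $ j"
  by (rule pd_bounded_linear[OF bounded_linear_vec_nth])

lemma smooth_on_id: "smooth_on S (\<lambda>x. x)"
proof -
  have p: "pd i (\<lambda>x. x) = (\<lambda>x. axis i 1)" for i :: 4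
    by (auto simp: pd_def frechet_derivative_ident)
  have "ckn n UNIV (\<lambda>x. x)" for n
    by (cases n) (auto simp: p ckn_const)
  then have "smooth_on UNIV (\<lambda>x. x)" by (simp add: smooth_on_iff_ckn)
  then show ?thesis by (rule smooth_on_subset) simp
qed

section \<open>Symmetry of second partial derivatives\<close>

lemma pd_line:
  fixes g :: "real^4 \<Rightarrow> real"
  assumes "g differentiable (at (y + u *\<^sub>R axis k 1))"
  shows "((\<lambda>u. g (y + u *\<^sub>R axis k 1)) has_real_derivative pd k g (y + u *\<^sub>R axis k 1)) (at u)"
proof -
  have "((\<lambda>u. y + u *\<^sub>R axis k 1 :: real^4) has_derivative (\<lambda>h. h *\<^sub>R axis k 1)) (at u)"
    by (auto intro!: derivative_eq_intros)
  from has_derivative_compose[OF this differentiable_imp_has_derivative[OF assms]]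
  have "((\<lambda>u. g (y + u *\<^sub>R axis k 1)) has_derivative
     (\<lambda>h. frechet_derivative g (at (y + u *\<^sub>R axis k 1)) (h *\<^sub>R axis k 1))) (at u)" .
  then show ?thesis
    unfolding has_field_derivative_def pd_def
    using linear_frechet_derivative[OF assms] by (simp add: linear_scale mult_commute_abs)
qed

text \<open>Both mixed second derivatives are limits of the same second difference quotients.\<close>

lemma second_difference:
  fixes f :: "real^4 \<Rightarrow> real"
  assumes "0 < r" and f: "\<And>y. y \<in> ball x (3 * r) \<Longrightarrow> f differentiable (at y)"
    and f': "\<And>y. y \<in> ball x (3 * r) \<Longrightarrow> pd i f differentiable (at y)"
  shows "\<exists>u v. 0 < u \<and> u < r \<and> 0 < v \<and> v < r \<and>
    f (x + r *\<^sub>R axis i 1 + r *\<^sub>R axis j 1) - f (x + r *\<^sub>R axis i 1) - f (x + r *\<^sub>R axis j 1) + f x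
     = r * r * pd j (pd i f) (x + u *\<^sub>R axis i 1 + v *\<^sub>R axis j 1)"
proof -
  \<comment> \<open>Both displacements are at most \<open>r\<close>, so all points used stay within
    \<open>2 * r\<close> of \<open>x\<close>, strictly inside the ball of radius
    \<open>3 * r\<close>.\<close>
  have inb: "x + u *\<^sub>R axis i 1 + v *\<^sub>R axis j 1 \<in> ball x (3 * r)" if "0 \<le> u" "u \<le> r" "0 \<le> v" "v \<le> r" for u v
  proof -
    have "norm (u *\<^sub>R axis i 1 + v *\<^sub>R axis j 1 :: real^4) \<le> u + v"
      using that norm_triangle_ineq[of "u *\<^sub>R axis i 1 :: real^4" "v *\<^sub>R axis j 1"] by simp
    moreover have "dist x (x + u *\<^sub>R axis i 1 + v *\<^sub>R axis j 1) = norm (u *\<^sub>R axis i 1 + v *\<^sub>R axis j 1 :: real^4)"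
      by (metis add.assoc add_diff_cancel_left' dist_commute dist_norm)
    ultimately show ?thesis using that \<open>0 < r\<close> by simp
  qed
  \<comment> \<open>Difference in direction \<open>j\<close> as a function of the position along
    direction \<open>i\<close>: one mean value theorem in \<open>u\<close>, a second one in
    \<open>v\<close> for its derivative.\<close>
  define g where "g = (\<lambda>u. f (x + r *\<^sub>R axis j 1 + u *\<^sub>R axis i 1) - f (x + u *\<^sub>R axis i 1))"
  have "DERIV g u :> pd i f (x + r *\<^sub>R axis j 1 + u *\<^sub>R axis i 1) - pd i f (x + u *\<^sub>R axis i 1)"
    if "0 \<le> u" "u \<le> r" for u
    unfolding g_def
    using inb[of u r] inb[of u 0] that \<open>0 < r\<close> f
    by (intro DERIV_diff pd_line) (auto simp: add_ac)
  from MVT2[OF \<open>0 < r\<close> this]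
  obtain u where u: "0 < u" "u < r" "g r - g 0 = r * (pd i f (x + r *\<^sub>R axis j 1 + u *\<^sub>R axis i 1) - pd i f (x + u *\<^sub>R axis i 1))"
    by auto
  have "DERIV (\<lambda>v. pd i f (x + u *\<^sub>R axis i 1 + v *\<^sub>R axis j 1)) v :> pd j (pd i f) (x + u *\<^sub>R axis i 1 + v *\<^sub>R axis j 1)"
    if "0 \<le> v" "v \<le> r" for v
    using inb[of u v] that \<open>0 < r\<close> f' u by (intro pd_line) auto
  from MVT2[OF \<open>0 < r\<close> this]
  obtain v where v: "0 < v" "v < r" "pd i f (x + u *\<^sub>R axis i 1 + r *\<^sub>R axis j 1) - pd i f (x + u *\<^sub>R axis i 1)
      = r * pd j (pd i f) (x + u *\<^sub>R axis i 1 + v *\<^sub>R axis j 1)" by auto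
  have "x + r *\<^sub>R axis j 1 + u *\<^sub>R axis i 1 = x + u *\<^sub>R axis i 1 + r *\<^sub>R axis j 1"
    "x + r *\<^sub>R axis j 1 + r *\<^sub>R axis i 1 = x + r *\<^sub>R axis i 1 + r *\<^sub>R axis j 1"
    by (simp_all add: add_ac)
  then have "f (x + r *\<^sub>R axis i 1 + r *\<^sub>R axis j 1) - f (x + r *\<^sub>R axis i 1) - f (x + r *\<^sub>R axis j 1) + f x
     = r * r * pd j (pd i f) (x + u *\<^sub>R axis i 1 + v *\<^sub>R axis j 1)"
    using u(3) v(3) by (simp add: g_def algebra_simps)
  then show ?thesis using u v by blast
qed

lemma pd_commute_real:
  fixes f :: "real^4 \<Rightarrow> real"
  assumes S: "open S" "x \<in> S" and f: "smooth_on S f"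
  shows "pd i (pd j f) x = pd j (pd i f) x"
proof (rule ccontr)
  assume ne: "pd i (pd j f) x \<noteq> pd j (pd i f) x"
  \<comment> \<open>Half the assumed gap: the two difference quotients have one common value, which
    would lie within less than half the gap of both limits.\<close>
  define e where "e = \<bar>pd i (pd j f) x - pd j (pd i f) x\<bar> / 2"
  have e: "e > 0" using ne by (simp add: e_def)
  have c: "isCont (pd k (pd l f)) x" for k l
    using S smooth_on_continuous[OF S(1) smooth_on_pd[OF S(1) smooth_on_pd[OF S(1) f]]]
    by (simp add: continuous_on_eq_continuous_at)
  from c obtain d1 where d1: "d1 > 0" "\<And>y. dist y x < d1 \<Longrightarrow> dist (pd i (pd j f) y) (pd i (pd j f) x) < e"
    unfolding continuous_at_eps_delta using e by metis
  from c obtain d2 where d2: "d2 > 0" "\<And>y. dist y x < d2 \<Longrightarrow> dist (pd j (pd i f) y) (pd j (pd i f) x) < e"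
    unfolding continuous_at_eps_delta using e by metis
  obtain d3 where d3: "d3 > 0" "ball x d3 \<subseteq> S" using S openE by blast
  define r where "r = min d1 (min d2 d3) / 3"
  have r: "0 < r" "3 * r \<le> d1" "3 * r \<le> d2" "ball x (3 * r) \<subseteq> S"
    using d1(1) d2(1) d3 by (auto simp: r_def)
  have df: "f differentiable (at y)" "pd k f differentiable (at y)" if "y \<in> ball x (3 * r)" for y k
    using that r(4) smooth_on_differentiable[OF S(1)] f smooth_on_pd[OF S(1) f] by blast+
  have near: "dist (x + u *\<^sub>R axis k 1 + v *\<^sub>R axis l 1) x < 3 * r" if "0 < u" "u < r" "0 < v" "v < r" for u v k l
  proof -
    have "norm (u *\<^sub>R axis k 1 + v *\<^sub>R axis l 1 :: real^4) \<le> u + v"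
      using that norm_triangle_ineq[of "u *\<^sub>R axis k 1 :: real^4" "v *\<^sub>R axis l 1"] by simp
    moreover have "dist (x + u *\<^sub>R axis k 1 + v *\<^sub>R axis l 1) x = norm (u *\<^sub>R axis k 1 + v *\<^sub>R axis l 1 :: real^4)"
      by (metis add.assoc add_diff_cancel_left' dist_norm)
    ultimately show ?thesis using that by simp
  qed
  obtain u v where uv: "0 < u" "u < r" "0 < v" "v < r"
    "f (x + r *\<^sub>R axis i 1 + r *\<^sub>R axis j 1) - f (x + r *\<^sub>R axis i 1) - f (x + r *\<^sub>R axis j 1) + f x
     = r * r * pd j (pd i f) (x + u *\<^sub>R axis i 1 + v *\<^sub>R axis j 1)"
    using second_difference[OF r(1) df] by blast
  obtain u' v' where uv': "0 < u'" "u' < r" "0 < v'" "v' < r"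
    "f (x + r *\<^sub>R axis j 1 + r *\<^sub>R axis i 1) - f (x + r *\<^sub>R axis j 1) - f (x + r *\<^sub>R axis i 1) + f x
     = r * r * pd i (pd j f) (x + u' *\<^sub>R axis j 1 + v' *\<^sub>R axis i 1)"
    using second_difference[OF r(1) df] by blast
  have "r * r * pd j (pd i f) (x + u *\<^sub>R axis i 1 + v *\<^sub>R axis j 1) = r * r * pd i (pd j f) (x + u' *\<^sub>R axis j 1 + v' *\<^sub>R axis i 1)"
    unfolding uv(5)[symmetric] uv'(5)[symmetric] by (simp add: add_ac)
  then have "pd j (pd i f) (x + u *\<^sub>R axis i 1 + v *\<^sub>R axis j 1) = pd i (pd j f) (x + u' *\<^sub>R axis j 1 + v' *\<^sub>R axis i 1)"
    using r(1) by simp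
  moreover have "dist (pd j (pd i f) (x + u *\<^sub>R axis i 1 + v *\<^sub>R axis j 1)) (pd j (pd i f) x) < e"
    using near[OF uv(1-4), of i j] r by (intro d2) linarith
  moreover have "dist (pd i (pd j f) (x + u' *\<^sub>R axis j 1 + v' *\<^sub>R axis i 1)) (pd i (pd j f) x) < e"
    using near[OF uv'(1-4), of j i] r by (intro d1) linarith
  ultimately show False unfolding e_def dist_real_def by argo
qed

lemma pd_commute:
  fixes f :: "real^4 \<Rightarrow> 'v::euclidean_space"
  assumes S: "open S" "x \<in> S" and f: "smooth_on S f"
  shows "pd i (pd j f) x = pd j (pd i f) x"
proof (rule euclidean_eqI)
  fix b :: 'v
  have *: "pd k (pd l f) x \<bullet> b = pd k (pd l (\<lambda>y. f y \<bullet> b)) x" for k l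
  proof -
    have "pd k (pd l f) x \<bullet> b = pd k (\<lambda>y. pd l f y \<bullet> b) x"
      using smooth_on_differentiable[OF S(1) smooth_on_pd[OF S(1) f] S(2)]
      by (rule pd_bounded_linear[OF bounded_linear_inner_left, symmetric])
    also have "\<dots> = pd k (pd l (\<lambda>y. f y \<bullet> b)) x"
      using smooth_on_differentiable[OF S(1) f]
      by (intro pd_cong[OF S] pd_bounded_linear[OF bounded_linear_inner_left, symmetric])
    finally show ?thesis .
  qed
  show "pd i (pd j f) x \<bullet> b = pd j (pd i f) x \<bullet> b"
    unfolding * by (rule pd_commute_real[OF S smooth_on_linear[OF bounded_linear_inner_left S(1) f]])
qed

subsection \<open>Wedge products and exterior derivatives in components\<close>

lemma sum_Pow_Suc:
  fixes f :: "nat set \<Rightarrow> 'a::comm_monoid_add"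
  shows "(\<Sum>S\<in>Pow {..<Suc n}. f S) = (\<Sum>S\<in>Pow {..<n}. f S) + (\<Sum>S\<in>Pow {..<n}. f (insert n S))"
proof -
  have "inj_on (insert n) (Pow {..<n})"
    by (rule inj_onI) (metis PowD insert_ident less_irrefl lessThan_iff subset_iff)
  moreover have "Pow {..<n} \<inter> insert n ` Pow {..<n} = {}"
    by auto
  ultimately show ?thesis
    by (simp add: lessThan_Suc Pow_insert sum.union_disjoint sum.reindex)
qed

lemma shuffle_sign_0: "shuffle_sign 0 S = 1"
  by (simp add: shuffle_sign_def)

lemma shuffle_sign_Suc: "S \<subseteq> {..<n} \<Longrightarrow> shuffle_sign (Suc n) S = shuffle_sign n S"
  unfolding shuffle_sign_def by (rule arg_cong[where f="\<lambda>A. (- 1) ^ card A"]) auto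

text \<open>The new largest slot \<open>n\<close> is inverted exactly against the
  \<open>n - card S\<close> slots left to the second factor.\<close>

lemma shuffle_sign_insert:
  assumes "S \<subseteq> {..<n}"
  shows "shuffle_sign (Suc n) (insert n S) = shuffle_sign n S * (- 1) ^ (n - card S)"
proof -
  have "{(i, j). i \<in> insert n S \<and> j \<in> {..<Suc n} - insert n S \<and> j < i} =
      {(i, j). i \<in> S \<and> j \<in> {..<n} - S \<and> j < i} \<union> Pair n ` ({..<n} - S)"
    using assms by auto
  moreover have "finite {(i, j). i \<in> S \<and> j \<in> {..<n} - S \<and> j < i}"
    by (rule finite_subset[of _ "{..<n} \<times> {..<n}"]) (use assms in blast, simp)
  moreover have "{(i, j). i \<in> S \<and> j \<in> {..<n} - S \<and> j < i} \<inter> Pair n ` ({..<n} - S) = {}"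
    using assms by auto
  moreover have "card (Pair n ` ({..<n} - S)) = n - card S"
    using assms by (simp add: card_image inj_on_def card_Diff_subset finite_subset)
  ultimately show ?thesis
    unfolding shuffle_sign_def by (simp add: card_Un_disjoint power_add)
qed

definition homog :: "nat \<Rightarrow> 'a::zero form \<Rightarrow> bool" where
  "homog k \<omega> \<longleftrightarrow> (\<forall>x xs. length xs \<noteq> k \<longrightarrow> \<omega> x xs = 0)"

lemma homogD: "homog k \<omega> \<Longrightarrow> length xs \<noteq> k \<Longrightarrow> \<omega> x xs = 0"
  by (simp add: homog_def)

lemma homog_form1: "homog 1 (form1 a)"
  by (auto simp: homog_def form1_def split: list.splits)

lemma form1_single [simp]: "form1 a x [i] = a x $ i"
  by (simp add: form1_def)

text \<open>The two sublists share out the slots, so their lengths add up to that of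
  \<open>xs\<close>; on a list of the wrong length one factor of every shuffle vanishes.\<close>

lemma homog_wedge:
  assumes "homog p \<alpha>" "homog q \<beta>" "\<And>y. B 0 y = 0" "\<And>x. B x 0 = 0"
  shows "homog (p + q) (wedge B \<alpha> \<beta>)"
  unfolding homog_def
proof (intro allI impI)
  fix x xs assume l: "length (xs :: 4 list) \<noteq> p + q"
  have "B (\<alpha> x (nths xs S)) (\<beta> x (nths xs (- S))) = 0" for S
  proof -
    have "length (nths xs S) + length (nths xs (- S)) = card ({i. i < length xs \<and> i \<in> S} \<union> {i. i < length xs \<and> i \<in> - S})"
      unfolding length_nths by (rule card_Un_disjoint[symmetric]) auto
    also have "{i. i < length xs \<and> i \<in> S} \<union> {i. i < length xs \<and> i \<in> - S} = {..<length xs}" by auto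
    finally have "length (nths xs S) \<noteq> p \<or> length (nths xs (- S)) \<noteq> q" using l by auto
    then show ?thesis using assms by (auto simp: homogD)
  qed
  then show "wedge B \<alpha> \<beta> x xs = 0" by (simp add: wedge_def)
qed

text \<open>These rewrite a wedge product on a list of known length into an explicit signed sum;
  homogeneity then removes the shuffles that split the list into the wrong degrees.\<close>

lemmas wedge_expand = wedge_def sum_Pow_Suc shuffle_sign_0 shuffle_sign_Suc shuffle_sign_insert nths_Cons nths_nil

lemma wedge11:
  assumes "\<And>y. B 0 y = 0" "\<And>x. B x 0 = 0" "homog 1 \<alpha>" "homog 1 \<beta>"
  shows "wedge B \<alpha> \<beta> x [i, j] = B (\<alpha> x [i]) (\<beta> x [j]) - B (\<alpha> x [j]) (\<beta> x [i])"
  using assms(1,2) by (simp add: wedge_expand homogD[OF assms(3)] homogD[OF assms(4)])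

lemma wedge12:
  assumes "\<And>y. B 0 y = 0" "\<And>x. B x 0 = 0" "homog 1 \<alpha>" "homog 2 \<beta>"
  shows "wedge B \<alpha> \<beta> x [i, j, k] = B (\<alpha> x [i]) (\<beta> x [j, k]) - B (\<alpha> x [j]) (\<beta> x [i, k]) + B (\<alpha> x [k]) (\<beta> x [i, j])"
  using assms(1,2) by (simp add: wedge_expand homogD[OF assms(3)] homogD[OF assms(4)])

lemma wedge21:
  assumes "\<And>y. B 0 y = 0" "\<And>x. B x 0 = 0" "homog 2 \<alpha>" "homog 1 \<beta>"
  shows "wedge B \<alpha> \<beta> x [i, j, k] = B (\<alpha> x [i, j]) (\<beta> x [k]) - B (\<alpha> x [i, k]) (\<beta> x [j]) + B (\<alpha> x [j, k]) (\<beta> x [i])"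
  using assms(1,2) by (simp add: wedge_expand homogD[OF assms(3)] homogD[OF assms(4)])

lemma wedge13:
  assumes "\<And>y. B 0 y = 0" "\<And>x. B x 0 = 0" "homog 1 \<alpha>" "homog 3 \<beta>"
  shows "wedge B \<alpha> \<beta> x [i, j, k, l] = B (\<alpha> x [i]) (\<beta> x [j, k, l]) - B (\<alpha> x [j]) (\<beta> x [i, k, l])
     + B (\<alpha> x [k]) (\<beta> x [i, j, l]) - B (\<alpha> x [l]) (\<beta> x [i, j, k])"
  using assms(1,2) by (simp add: wedge_expand homogD[OF assms(3)] homogD[OF assms(4)])

lemma wedge22:
  assumes "\<And>y. B 0 y = 0" "\<And>x. B x 0 = 0" "homog 2 \<alpha>" "homog 2 \<beta>"
  shows "wedge B \<alpha> \<beta> x [i, j, k, l] =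
      B (\<alpha> x [i, j]) (\<beta> x [k, l]) - B (\<alpha> x [i, k]) (\<beta> x [j, l]) + B (\<alpha> x [i, l]) (\<beta> x [j, k])
    + B (\<alpha> x [j, k]) (\<beta> x [i, l]) - B (\<alpha> x [j, l]) (\<beta> x [i, k]) + B (\<alpha> x [k, l]) (\<beta> x [i, j])"
  using assms(1,2) by (simp add: wedge_expand homogD[OF assms(3)] homogD[OF assms(4)])

lemma ext_d_form1_pair: "ext_d (form1 a) x [i, j] = pd i (\<lambda>y. a y $ j) x - pd j (\<lambda>y. a y $ i) x"
  by (simp add: ext_d_def)

lemma homog_ext_d: "homog k \<omega> \<Longrightarrow> homog (Suc k) (ext_d \<omega>)"
  unfolding homog_def ext_d_def
  by (auto intro!: sum.neutral)

lemma matrix_mult_zero [simp]: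
  "(0::'a::semiring_1^'n^'m) ** Y = 0" "X ** (0::'a::semiring_1^'n^'m) = 0"
  by (simp_all add: matrix_matrix_mult_def vec_eq_iff)

lemma homog_ext_d_form1: "homog 2 (ext_d (form1 a))"
  using homog_ext_d[OF homog_form1] by (simp add: numeral_2_eq_2)

lemma homog_curvature: "homog 2 (curvature A)"
  using homog_ext_d_form1[of A] homog_wedge[OF homog_form1[of A] homog_form1[of A], of "(**)"]
  by (simp add: homog_def curvature_def)

lemma curvature_pair:
  "curvature A x [i, j] = pd i (\<lambda>y. A y $ j) x - pd j (\<lambda>y. A y $ i) x + (A x $ i ** A x $ j - A x $ j ** A x $ i)"
  by (simp add: curvature_def ext_d_form1_pair wedge11[OF _ _ homog_form1 homog_form1])

subsection \<open>The alternating symbol\<close>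

lemma det_4:
  "det (A::'a::comm_ring_1^4^4) =
    A$1$1 * A$2$2 * A$3$3 * A$4$4 - A$1$1 * A$2$2 * A$3$4 * A$4$3
  - A$1$1 * A$2$3 * A$3$2 * A$4$4 + A$1$1 * A$2$3 * A$3$4 * A$4$2
  + A$1$1 * A$2$4 * A$3$2 * A$4$3 - A$1$1 * A$2$4 * A$3$3 * A$4$2
  - A$1$2 * A$2$1 * A$3$3 * A$4$4 + A$1$2 * A$2$1 * A$3$4 * A$4$3
  + A$1$2 * A$2$3 * A$3$1 * A$4$4 - A$1$2 * A$2$3 * A$3$4 * A$4$1
  - A$1$2 * A$2$4 * A$3$1 * A$4$3 + A$1$2 * A$2$4 * A$3$3 * A$4$1
  + A$1$3 * A$2$1 * A$3$2 * A$4$4 - A$1$3 * A$2$1 * A$3$4 * A$4$2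
  - A$1$3 * A$2$2 * A$3$1 * A$4$4 + A$1$3 * A$2$2 * A$3$4 * A$4$1
  + A$1$3 * A$2$4 * A$3$1 * A$4$2 - A$1$3 * A$2$4 * A$3$2 * A$4$1
  - A$1$4 * A$2$1 * A$3$2 * A$4$3 + A$1$4 * A$2$1 * A$3$3 * A$4$2
  + A$1$4 * A$2$2 * A$3$1 * A$4$3 - A$1$4 * A$2$2 * A$3$3 * A$4$1
  - A$1$4 * A$2$3 * A$3$1 * A$4$2 + A$1$4 * A$2$3 * A$3$2 * A$4$1"
proof -
  have f: "finite {2::4, 3, 4}" "1 \<notin> {2::4, 3, 4}" "finite {3::4, 4}" "2 \<notin> {3::4, 4}"
    "finite {4::4}" "3 \<notin> {4::4}" by auto
  show ?thesis
    unfolding det_def UNIV_4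
    unfolding sum_over_permutations_insert[OF f(1,2)]
    unfolding sum_over_permutations_insert[OF f(3,4)]
    unfolding sum_over_permutations_insert[OF f(5,6)]
    unfolding permutes_sing
    by (simp add: sign_swap_id permutation_swap_id sign_compose permutation_compose sign_id swap_id_eq transpose_def)
qed


text \<open>Signed sum over permutations: the component \<open>[1, 2, 3, 4]\<close> of the wedge of
  four one-forms \<open>a, b, c, d\<close> is the value for \<open>a i * b j * c k * d l\<close>. A
  two-form given by its antisymmetric components is counted twice, whence the factors
  \<open>1/2\<close> further on.\<close>

definition top4 :: "(4 \<Rightarrow> 4 \<Rightarrow> 4 \<Rightarrow> 4 \<Rightarrow> 'a::real_vector) \<Rightarrow> 'a" where
  "top4 T = (\<Sum>i\<in>UNIV. \<Sum>j\<in>UNIV. \<Sum>k\<in>UNIV. \<Sum>l\<in>UNIV. eps i j k l *\<^sub>R T i j k l)"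

lemma eps_eq: "eps i j k l =
   (\<Sum>p\<in>{(1,2,3,4),(1,3,4,2),(1,4,2,3),(2,1,4,3),(2,3,1,4),(2,4,3,1),
           (3,1,2,4),(3,2,4,1),(3,4,1,2),(4,1,3,2),(4,2,1,3),(4,3,2,1)}. of_bool ((i, j, k, l) = p))
 - (\<Sum>p\<in>{(1,2,4,3),(1,3,2,4),(1,4,3,2),(2,1,3,4),(2,3,4,1),(2,4,1,3),
           (3,1,4,2),(3,2,1,4),(3,4,2,1),(4,1,2,3),(4,2,3,1),(4,3,1,2)}. of_bool ((i, j, k, l) = p))"
  by (simp add: eps_def det_4 axis_def)

lemma top4_eq: "top4 T =
    T 1 2 3 4 + T 1 3 4 2 + T 1 4 2 3 + T 2 1 4 3 + T 2 3 1 4 + T 2 4 3 1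
  + T 3 1 2 4 + T 3 2 4 1 + T 3 4 1 2 + T 4 1 3 2 + T 4 2 1 3 + T 4 3 2 1
  - (T 1 2 4 3 + T 1 3 2 4 + T 1 4 3 2 + T 2 1 3 4 + T 2 3 4 1 + T 2 4 1 3
  + T 3 1 4 2 + T 3 2 1 4 + T 3 4 2 1 + T 4 1 2 3 + T 4 2 3 1 + T 4 3 1 2)"
  unfolding top4_def sum_4 by (simp add: eps_eq)

lemma top4_linear:
  "top4 (\<lambda>i j k l. T i j k l + T' i j k l) = top4 T + top4 T'"
  "top4 (\<lambda>i j k l. T i j k l - T' i j k l) = top4 T - top4 T'"
  "top4 (\<lambda>i j k l. c *\<^sub>R T i j k l) = c *\<^sub>R top4 T"
  by (simp_all add: top4_def scaleR_add_right scaleR_diff_right sum.distrib sum_subtractf scaleR_sum_right mult.commute)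

text \<open>Both sides are the determinant of \<open>Q ** transpose P\<close>, where row
  \<open>r\<close> of \<open>Q\<close> is the basis vector of the \<open>r\<close>-th chosen index,
  so that the rows of the product are the chosen columns of \<open>P\<close>.\<close>

lemma eps_contract:
  "top4 (\<lambda>i j k l. P $ i $ I * P $ j $ J * P $ k $ K * P $ l $ L) = det P * eps I J K L"
proof -
  define s :: "4 \<Rightarrow> 4" where "s r = (if r = 1 then I else if r = 2 then J else if r = 3 then K else L)" for r
  define Q :: "real^4^4" where "Q = (\<chi> r. axis (s r) 1)"
  have Q: "(Q ** transpose P) $ r $ c = P $ c $ s r" for r c
    by (simp add: Q_def matrix_matrix_mult_def transpose_def axis_def if_distrib[of "\<lambda>x. x * _"] cong: if_cong)
  have e: "eps I J K L = det Q"
    unfolding eps_def Q_def s_def by (rule arg_cong[where f=det]) (simp add: vec_eq_iff)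
  have "det P * eps I J K L = det (Q ** transpose P)"
    by (simp add: det_mul det_transpose e)
  also have "\<dots> = top4 (\<lambda>i j k l. P $ i $ I * P $ j $ J * P $ k $ K * P $ l $ L)"
    unfolding det_4 Q top4_eq by (simp add: s_def)
  finally show ?thesis ..
qed

lemma sum_UNIV_prod: "(\<Sum>i\<in>UNIV. \<Sum>j\<in>UNIV. f i j) = (\<Sum>p\<in>UNIV. f (fst p) (snd p))"
  for f :: "'a::finite \<Rightarrow> 'b::finite \<Rightarrow> 'c::comm_monoid_add"
  by (simp add: sum.cartesian_product case_prod_unfold)

text \<open>Exchange the sums over old and new indices and apply \<open>eps_contract\<close>. The
  transformation laws of the integrands under changes of chart and of coframe rest on this.\<close>

lemma top4_transform:
  assumes "\<And>i j k l. T i j k l = (\<Sum>I\<in>UNIV. \<Sum>J\<in>UNIV. \<Sum>K\<in>UNIV. \<Sum>L\<in>UNIV.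
     (P $ i $ I * P $ j $ J * P $ k $ K * P $ l $ L) *\<^sub>R T' I J K L)"
  shows "top4 T = det P *\<^sub>R top4 T'"
proof -
  \<comment> \<open>Quadruples of indices are packed into one index, so that a single exchange of
    two sums suffices.\<close>
  define E :: "4 \<times> 4 \<times> 4 \<times> 4 \<Rightarrow> real" where
    "E p = eps (fst p) (fst (snd p)) (fst (snd (snd p))) (snd (snd (snd p)))" for p
  define c :: "4 \<times> 4 \<times> 4 \<times> 4 \<Rightarrow> 4 \<times> 4 \<times> 4 \<times> 4 \<Rightarrow> real" where
    "c p q = P $ fst p $ fst q * P $ fst (snd p) $ fst (snd q) * P $ fst (snd (snd p)) $ fst (snd (snd q))
       * P $ snd (snd (snd p)) $ snd (snd (snd q))" for p q
  have top: "top4 F = (\<Sum>p\<in>UNIV. E p *\<^sub>R F (fst p) (fst (snd p)) (fst (snd (snd p))) (snd (snd (snd p))))"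
    for F :: "4 \<Rightarrow> 4 \<Rightarrow> 4 \<Rightarrow> 4 \<Rightarrow> 'c::real_vector"
    unfolding top4_def sum_UNIV_prod E_def ..
  have T: "T (fst p) (fst (snd p)) (fst (snd (snd p))) (snd (snd (snd p))) =
      (\<Sum>q\<in>UNIV. c p q *\<^sub>R T' (fst q) (fst (snd q)) (fst (snd (snd q))) (snd (snd (snd q))))" for p
    unfolding assms sum_UNIV_prod c_def ..
  have c: "(\<Sum>p\<in>UNIV. E p * c p q) = det P * E q" for q
    using eps_contract[of P "fst q" "fst (snd q)" "fst (snd (snd q))" "snd (snd (snd q))"]
    unfolding top by (simp add: c_def E_def)
  have "top4 T = (\<Sum>q\<in>UNIV. (\<Sum>p\<in>UNIV. E p * c p q) *\<^sub>R T' (fst q) (fst (snd q)) (fst (snd (snd q))) (snd (snd (snd q))))"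
    unfolding top T scaleR_sum_right scaleR_sum_left scaleR_scaleR by (rule sum.swap)
  then show ?thesis
    by (simp add: c top scaleR_sum_right)
qed

subsection \<open>Matrices acting on the adapted coframe\<close>

definition cidx :: "4 \<Rightarrow> 2" where "cidx I = (if I = 1 \<or> I = 2 then 1 else 2)"

lemma cidx_simps [simp]: "cidx 1 = 1" "cidx 2 = 1" "cidx 3 = 2" "cidx 4 = 2"
  by (simp_all add: cidx_def)

text \<open>The real \<open>4 \<times> 4\<close> matrix through which a complex matrix acts on \<open>(e\<^sup>1, e\<^sup>2, e\<^sup>3, e\<^sup>4)\<close>.\<close>

definition realify :: "complex^2^2 \<Rightarrow> real^4^4" where
  "realify m = (\<chi> I J. let z = m $ cidx I $ cidx J in
     if I = 1 \<or> I = 3 then if J = 1 \<or> J = 3 then Re z else - Im z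
     else if J = 1 \<or> J = 3 then Im z else Re z)"

lemma realify_nth:
  "realify m $ 1 $ 1 = Re (m$1$1)" "realify m $ 1 $ 2 = - Im (m$1$1)"
  "realify m $ 1 $ 3 = Re (m$1$2)" "realify m $ 1 $ 4 = - Im (m$1$2)"
  "realify m $ 2 $ 1 = Im (m$1$1)" "realify m $ 2 $ 2 = Re (m$1$1)"
  "realify m $ 2 $ 3 = Im (m$1$2)" "realify m $ 2 $ 4 = Re (m$1$2)"
  "realify m $ 3 $ 1 = Re (m$2$1)" "realify m $ 3 $ 2 = - Im (m$2$1)"
  "realify m $ 3 $ 3 = Re (m$2$2)" "realify m $ 3 $ 4 = - Im (m$2$2)"
  "realify m $ 4 $ 1 = Im (m$2$1)" "realify m $ 4 $ 2 = Re (m$2$1)"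
  "realify m $ 4 $ 3 = Im (m$2$2)" "realify m $ 4 $ 4 = Re (m$2$2)"
  by (simp_all add: realify_def Let_def)

lemma uncplx_nth [simp]: "uncplx z $ 1 = Re (z $ 1)" "uncplx z $ 2 = Im (z $ 1)"
  "uncplx z $ 3 = Re (z $ 2)" "uncplx z $ 4 = Im (z $ 2)"
  by (simp_all add: uncplx_def)

lemma cplx_nth [simp]: "cplx v $ 1 = Complex (v $ 1) (v $ 2)" "cplx v $ 2 = Complex (v $ 3) (v $ 4)"
  by (simp_all add: cplx_def)

lemma cplx_uncplx [simp]: "cplx (uncplx z) = z" and uncplx_cplx [simp]: "uncplx (cplx v) = v"
  by (simp_all add: vec_eq_iff forall_2 forall_4 complex_eq_iff)

lemmas mat_expand = vec_eq_iff forall_2 forall_4 matrix_matrix_mult_def matrix_vector_mult_def sum_2 sum_4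
  realify_nth complex_eq_iff

lemma realify_mult_vec: "realify m *v uncplx z = uncplx (m *v z)"
  by (simp add: mat_expand algebra_simps)

lemma realify_mult: "realify (m ** n) = realify m ** realify n"
  by (simp add: mat_expand algebra_simps)

lemma realify_hconj: "realify (hconj m) = transpose (realify m)"
  by (simp add: mat_expand hconj_def transpose_def)

lemma realify_mat_1 [simp]: "realify (mat 1) = mat 1"
  by (simp add: mat_expand mat_def)

lemma realify_add: "realify (m + n) = realify m + realify n"
  and realify_diff: "realify (m - n) = realify m - realify n"
  and realify_minus: "realify (- m) = - realify m"
  and realify_scaleR: "realify (r *\<^sub>R m) = r *\<^sub>R realify m"
  and realify_0 [simp]: "realify 0 = 0"
  by (simp_all add: mat_expand)

lemma bounded_linear_realify: "bounded_linear realify"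
  by (intro linear_conv_bounded_linear[THEN iffD1] linearI) (simp_all add: realify_add realify_scaleR)

lemma bounded_linear_uncplx: "bounded_linear uncplx"
  by (intro linear_conv_bounded_linear[THEN iffD1] linearI) (simp_all add: vec_eq_iff forall_4)

lemma det_realify: "det (realify m) = (cmod (det m))\<^sup>2"
  unfolding det_4 det_2 realify_nth cmod_power2 by (simp add: algebra_simps power2_eq_square)

lemma hconj_simps:
  "hconj (hconj m) = m" "hconj (m ** n) = hconj n ** hconj m" "hconj (m + n) = hconj m + hconj n"
  "hconj (m - n) = hconj m - hconj n" "hconj (- m) = - hconj m" "hconj (r *\<^sub>R m) = r *\<^sub>R hconj m"
  "hconj (mat c) = mat (cnj c)" "hconj 0 = 0"
  by (simp_all add: hconj_def mat_expand mat_def algebra_simps)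

lemma bounded_linear_hconj: "bounded_linear hconj"
  by (intro linear_conv_bounded_linear[THEN iffD1] linearI) (simp_all add: hconj_simps)

lemma bounded_bilinear_matrix_mult:
  "bounded_bilinear ((**) :: 'a::{real_normed_field,euclidean_space}^'n^'m \<Rightarrow> 'a^'p^'n \<Rightarrow> 'a^'p^'m)"
  unfolding bilinear_conv_bounded_bilinear[symmetric] bilinear_def
  by (auto intro!: linearI simp: matrix_matrix_mult_def vec_eq_iff sum.distrib algebra_simps scaleR_sum_right)

lemma bounded_bilinear_matrix_vector:
  "bounded_bilinear ((*v) :: 'a::{real_normed_field,euclidean_space}^'n^'m \<Rightarrow> 'a^'n \<Rightarrow> 'a^'m)"
  unfolding bilinear_conv_bounded_bilinear[symmetric] bilinear_def
  by (auto intro!: linearI simp: matrix_vector_mult_def vec_eq_iff sum.distrib algebra_simps scaleR_sum_right)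

lemma matrix_left_unitary: "unitary2 h \<Longrightarrow> hconj h ** h = mat 1"
  by (simp add: unitary2_def matrix_left_right_inverse)

text \<open>A unitary matrix has determinant of modulus 1, and a complex matrix acts on the
  underlying real space with the squared modulus as determinant. Hence gauge transformations affect
  neither orientation nor volume of the coframe.\<close>

lemma det_realify_unitary:
  assumes "unitary2 h" shows "det (realify h) = 1"
proof -
  have "det h * cnj (det h) = 1"
    using arg_cong[OF assms[unfolded unitary2_def], of det]
    by (simp add: det_mul) (simp add: hconj_def det_2 algebra_simps)
  then have "of_real ((cmod (det h))\<^sup>2) = (1::complex)"
    by (simp only: complex_mult_cnj cmod_power2)
  then show ?thesis unfolding det_realify of_real_eq_1_iff .
qed

subsection \<open>The anti-self-dual part of \<open>so(4)\<close>\<close>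

text \<open>Projection of \<open>so(4)\<close> to its anti-self-dual factor, read as a matrix of
  \<open>su(2)\<close>: on antisymmetric matrices it kills the self-dual ones, and it inverts
  \<open>realify\<close> on \<open>su(2)\<close>.\<close>

definition asd_matrix :: "real^4^4 \<Rightarrow> complex^2^2" where
  "asd_matrix X = (\<chi> a b. if a = 1 then if b = 1 then Complex 0 ((X$3$4 - X$1$2) / 2)
       else Complex ((X$1$3 + X$2$4) / 2) ((X$2$3 - X$1$4) / 2)
     else if b = 1 then Complex (- (X$1$3 + X$2$4) / 2) ((X$2$3 - X$1$4) / 2)
       else Complex 0 ((X$1$2 - X$3$4) / 2))"

lemma asd_matrix_nth:
  "asd_matrix X $ 1 $ 1 = Complex 0 ((X$3$4 - X$1$2) / 2)"
  "asd_matrix X $ 1 $ 2 = Complex ((X$1$3 + X$2$4) / 2) ((X$2$3 - X$1$4) / 2)"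
  "asd_matrix X $ 2 $ 1 = Complex (- (X$1$3 + X$2$4) / 2) ((X$2$3 - X$1$4) / 2)"
  "asd_matrix X $ 2 $ 2 = Complex 0 ((X$1$2 - X$3$4) / 2)"
  by (simp_all add: asd_matrix_def)

lemma su2_nth: "su2 m \<longleftrightarrow> Re (m$1$1) = 0 \<and> Re (m$2$2) = 0 \<and> Im (m$2$2) = - Im (m$1$1) \<and>
   Re (m$2$1) = - Re (m$1$2) \<and> Im (m$2$1) = Im (m$1$2)"
  by (auto simp: su2_def hconj_def mat_expand trace_def)

lemma su2_asd_matrix: "su2 (asd_matrix X)"
  by (simp add: su2_nth asd_matrix_nth field_simps)

lemma asd_matrix_linear: "asd_matrix (X + Y) = asd_matrix X + asd_matrix Y"
  "asd_matrix (X - Y) = asd_matrix X - asd_matrix Y"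
  "asd_matrix (r *\<^sub>R X) = r *\<^sub>R asd_matrix X"
  by (simp_all add: mat_expand asd_matrix_nth field_simps)

lemma bounded_linear_asd_matrix: "bounded_linear asd_matrix"
  by (intro linear_conv_bounded_linear[THEN iffD1] linearI) (simp_all add: asd_matrix_linear)

lemma so4_nth: "so4 X \<longleftrightarrow> X$1$1 = 0 \<and> X$2$2 = 0 \<and> X$3$3 = 0 \<and> X$4$4 = 0 \<and>
   X$2$1 = - X$1$2 \<and> X$3$1 = - X$1$3 \<and> X$4$1 = - X$1$4 \<and>
   X$3$2 = - X$2$3 \<and> X$4$2 = - X$2$4 \<and> X$4$3 = - X$3$4"
  by (auto simp: so4_def transpose_def vec_eq_iff forall_4)

text \<open>The trace part of an anti-Hermitian matrix is an imaginary multiple of the identity. Its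
  real form is a multiple of the complex structure, which is self-dual and so dies under
  \<open>asd_matrix\<close>.\<close>

lemma asd_matrix_realify:
  assumes "hconj m = - m" shows "asd_matrix (realify m) = m - mat (trace m / 2)"
proof -
  have "hconj m $ a $ b = (- m) $ a $ b" for a b by (simp add: assms)
  from this[of 1 1] this[of 1 2] this[of 2 2]
  have "Re (m$1$1) = 0" "Re (m$2$2) = 0" "Re (m$2$1) = - Re (m$1$2)" "Im (m$2$1) = Im (m$1$2)"
    by (auto simp: hconj_def complex_eq_iff)
  then show ?thesis
    by (simp add: mat_expand asd_matrix_nth mat_def trace_def field_simps)
qed

text \<open>Projection to a factor of a direct sum of Lie algebras is a homomorphism. This makes the
  curvature of the projected connection the projection of the curvature.\<close>

lemma asd_matrix_commutator:
  assumes "so4 X" "so4 Y"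
  shows "asd_matrix (X ** Y - Y ** X) = asd_matrix X ** asd_matrix Y - asd_matrix Y ** asd_matrix X"
  using assms by (simp add: so4_nth mat_expand asd_matrix_nth field_simps)

text \<open>\<open>asd_matrix\<close> is the adjoint of \<open>realify\<close> up to a factor.\<close>

lemma trace_asd_matrix:
  assumes "so4 X" "su2 m"
  shows "trace (asd_matrix X ** m) = of_real (trace (X ** realify m) / 2)"
  using assms by (simp add: so4_nth su2_nth trace_def mat_expand asd_matrix_nth field_simps)

text \<open>The trace form is negative definite on \<open>su(2)\<close>, so testing with
  \<open>p\<close> itself is enough.\<close>

lemma su2_trace_nondegenerate:
  assumes "su2 p" "\<And>m. su2 m \<Longrightarrow> trace (p ** m) = 0"
  shows "p = 0"
proof -
  have "Re (trace (p ** p)) = - 2 * ((Im (p$1$1))\<^sup>2 + (Re (p$1$2))\<^sup>2 + (Im (p$1$2))\<^sup>2)"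
    using assms(1) by (simp add: su2_nth trace_def mat_expand power2_eq_square)
  moreover have "trace (p ** p) = 0" using assms by blast
  ultimately have "(Im (p$1$1))\<^sup>2 + (Re (p$1$2))\<^sup>2 + (Im (p$1$2))\<^sup>2 = 0" by simp
  then have "Im (p$1$1) = 0 \<and> Re (p$1$2) = 0 \<and> Im (p$1$2) = 0"
    by (smt (verit) zero_eq_power2 zero_le_power2)
  then show ?thesis using assms(1) by (simp add: su2_nth mat_expand)
qed

lemma so4_conj: "so4 X \<Longrightarrow> so4 (Q ** X ** transpose Q)"
  by (simp add: so4_def matrix_transpose_mul matrix_mul_assoc) 
    (simp add: matrix_matrix_mult_def vec_eq_iff sum_negf)

lemma su2_conj: "su2 m \<Longrightarrow> unitary2 h \<Longrightarrow> su2 (h ** m ** hconj h)"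
proof -
  assume m: "su2 m" and h: "unitary2 h"
  have "trace (h ** m ** hconj h) = trace (hconj h ** (h ** m))" by (rule trace_mul_sym)
  also have "\<dots> = trace m" using matrix_left_unitary[OF h] by (simp add: matrix_mul_assoc)
  finally show ?thesis using m
    by (simp add: su2_def hconj_simps matrix_mul_assoc)
      (simp add: matrix_matrix_mult_def vec_eq_iff sum_negf)
qed

text \<open>Both sides lie in \<open>su(2)\<close>, so it suffices to compare traces against every
  \<open>m\<close> in \<open>su(2)\<close>; \<open>trace_asd_matrix\<close> lets the conjugation by
  \<open>h\<close> be moved onto \<open>m\<close>.\<close>

lemma asd_matrix_conj:
  assumes X: "so4 X" and h: "unitary2 h"
  shows "asd_matrix (realify h ** X ** transpose (realify h)) = h ** asd_matrix X ** hconj h"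
proof -
  let ?Q = "realify h"
  let ?p = "asd_matrix (?Q ** X ** transpose ?Q)" and ?q = "h ** asd_matrix X ** hconj h"
  have p: "su2 ?p" and q: "su2 ?q" using su2_conj[OF su2_asd_matrix h] su2_asd_matrix by auto
  have "?p - ?q = 0"
  proof (rule su2_trace_nondegenerate)
    show "su2 (?p - ?q)" using p q by (simp add: su2_nth)
  next
    fix m assume m: "su2 m"
    have hh: "unitary2 (hconj h)"
      using matrix_left_unitary[OF h] by (simp add: unitary2_def hconj_simps)
    have "trace (?p ** m) = of_real (trace (?Q ** X ** transpose ?Q ** realify m) / 2)"
      by (rule trace_asd_matrix[OF so4_conj[OF X] m])
    also have "trace (?Q ** X ** transpose ?Q ** realify m) = trace (X ** (transpose ?Q ** realify m ** ?Q))"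
      using trace_mul_sym[of ?Q "X ** transpose ?Q ** realify m"] by (simp add: matrix_mul_assoc)
    also have "transpose ?Q ** realify m ** ?Q = realify (hconj h ** m ** h)"
      by (simp add: realify_mult realify_hconj)
    also have "of_real (trace (X ** realify (hconj h ** m ** h)) / 2) = trace (asd_matrix X ** (hconj h ** m ** h))"
      using trace_asd_matrix[OF X, of "hconj h ** m ** h"] su2_conj[OF m hh] by (simp add: hconj_simps)
    also have "\<dots> = trace (?q ** m)"
      using trace_mul_sym[of h "asd_matrix X ** hconj h ** m"] by (simp add: matrix_mul_assoc)
    finally show "trace ((?p - ?q) ** m) = 0"
      by (simp add: trace_def matrix_matrix_mult_def sum_2 algebra_simps)
  qed
  then show ?thesis by simp
qed

lemma so4_eqI:
  assumes "so4 X" "so4 Y" "X$1$2 = Y$1$2" "X$1$3 = Y$1$3" "X$1$4 = Y$1$4" "X$2$3 = Y$2$3" "X$2$4 = Y$2$4" "X$3$4 = Y$3$4"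
  shows "X = Y"
  using assms by (simp add: so4_nth vec_eq_iff forall_4)

lemma eps_pair:
  "eps i i k l = 0"
  "eps 1 2 k l = of_bool (k = 3 \<and> l = 4) - of_bool (k = 4 \<and> l = 3)"
  "eps 1 3 k l = of_bool (k = 4 \<and> l = 2) - of_bool (k = 2 \<and> l = 4)"
  "eps 1 4 k l = of_bool (k = 2 \<and> l = 3) - of_bool (k = 3 \<and> l = 2)"
  "eps 2 3 k l = of_bool (k = 1 \<and> l = 4) - of_bool (k = 4 \<and> l = 1)"
  "eps 2 4 k l = of_bool (k = 3 \<and> l = 1) - of_bool (k = 1 \<and> l = 3)"
  "eps 3 4 k l = of_bool (k = 1 \<and> l = 2) - of_bool (k = 2 \<and> l = 1)"
  "eps 2 1 k l = of_bool (k = 4 \<and> l = 3) - of_bool (k = 3 \<and> l = 4)"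
  "eps 3 1 k l = of_bool (k = 2 \<and> l = 4) - of_bool (k = 4 \<and> l = 2)"
  "eps 4 1 k l = of_bool (k = 3 \<and> l = 2) - of_bool (k = 2 \<and> l = 3)"
  "eps 3 2 k l = of_bool (k = 4 \<and> l = 1) - of_bool (k = 1 \<and> l = 4)"
  "eps 4 2 k l = of_bool (k = 1 \<and> l = 3) - of_bool (k = 3 \<and> l = 1)"
  "eps 4 3 k l = of_bool (k = 2 \<and> l = 1) - of_bool (k = 1 \<and> l = 2)"
  by (auto simp: eps_eq)

lemma hodge_nth:
  assumes "so4 B"
  shows "hodge B $ 1 $ 2 = B$3$4" "hodge B $ 3 $ 4 = B$1$2" "hodge B $ 1 $ 3 = - B$2$4"
    "hodge B $ 2 $ 4 = - B$1$3" "hodge B $ 1 $ 4 = B$2$3" "hodge B $ 2 $ 3 = B$1$4" "so4 (hodge B)"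
  using assms unfolding so4_nth by (simp_all add: hodge_def sum_4 eps_pair)

lemma asd_iff: "so4 X \<Longrightarrow> hodge X = - X \<longleftrightarrow> X$3$4 = - X$1$2 \<and> X$2$4 = X$1$3 \<and> X$2$3 = - X$1$4"
  and sd_iff: "so4 X \<Longrightarrow> hodge X = X \<longleftrightarrow> X$3$4 = X$1$2 \<and> X$2$4 = - X$1$3 \<and> X$2$3 = X$1$4"
proof -
  assume X: "so4 X"
  have m: "so4 (- X)" using X by (simp add: so4_nth)
  show "hodge X = - X \<longleftrightarrow> X$3$4 = - X$1$2 \<and> X$2$4 = X$1$3 \<and> X$2$3 = - X$1$4"
  proof
    assume "hodge X = - X"
    then have "hodge X $ i $ j = - X $ i $ j" for i j by simp
    from this[of 1 2] this[of 1 3] this[of 1 4] show "X$3$4 = - X$1$2 \<and> X$2$4 = X$1$3 \<and> X$2$3 = - X$1$4"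
      by (simp add: hodge_nth[OF X])
  qed (rule so4_eqI[OF hodge_nth(7)[OF X] m], simp_all add: hodge_nth[OF X])
  show "hodge X = X \<longleftrightarrow> X$3$4 = X$1$2 \<and> X$2$4 = - X$1$3 \<and> X$2$3 = X$1$4"
  proof
    assume "hodge X = X"
    then have "hodge X $ i $ j = X $ i $ j" for i j by simp
    from this[of 1 2] this[of 1 3] this[of 1 4] show "X$3$4 = X$1$2 \<and> X$2$4 = - X$1$3 \<and> X$2$3 = X$1$4"
      by (simp add: hodge_nth[OF X])
  qed (rule so4_eqI[OF hodge_nth(7)[OF X] X], simp_all add: hodge_nth[OF X])
qed

lemma sd_asd_commute:
  assumes "so4 X" "hodge X = - X" "so4 B" "hodge B = B"
  shows "X ** B = B ** X"
  using assms(1,3) assms(2)[unfolded asd_iff[OF assms(1)]] assms(4)[unfolded sd_iff[OF assms(3)]]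
  by (simp add: so4_nth mat_expand)

lemma su2_minus_eq: "su2_minus = {X. so4 X \<and> hodge X = - X}"
proof (intro set_eqI iffI)
  fix X assume "X \<in> su2_minus"
  then have X: "so4 X" and c: "\<And>B. so4 B \<Longrightarrow> hodge B = B \<Longrightarrow> X ** B - B ** X = 0"
    by (auto simp: su2_minus_def)
  \<comment> \<open>Test matrices spanning two of the three self-dual directions; the third is a
    multiple of their commutator, so commuting with these two is enough.\<close>
  define B where "B p q = (\<chi> i j. if (i, j) = (1,2) \<or> (i, j) = (3,4) then p else if (i, j) = (2,1) \<or> (i, j) = (4,3) then - p
     else if (i, j) = (1,3) \<or> (i, j) = (4,2) then q else if (i, j) = (3,1) \<or> (i, j) = (2,4) then - q else 0 :: real^4^4)"
    for p q :: real
  have so: "so4 (B p q)" for p q by (simp add: so4_nth B_def)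
  have "hodge (B p q) = B p q" for p q
    unfolding sd_iff[OF so] by (simp add: B_def)
  then have "(X ** B p q) $ i $ j = (B p q ** X) $ i $ j" for p q i j using c[OF so, of p q] by simp
  from this[of 1 0 1 3] this[of 1 0 1 4] this[of 0 1 1 4]
  show "X \<in> {X. so4 X \<and> hodge X = - X}"
    using X asd_iff[OF X] by (simp add: B_def matrix_matrix_mult_def sum_4)
next
  fix X assume "X \<in> {X. so4 X \<and> hodge X = - X}"
  then show "X \<in> su2_minus" using sd_asd_commute by (simp add: su2_minus_def)
qed

lemma asd_realify: 
  assumes "su2 m" shows "so4 (realify m)" "hodge (realify m) = - realify m"
proof -
  show so: "so4 (realify m)" using assms by (simp add: so4_nth su2_nth realify_nth)
  show "hodge (realify m) = - realify m" unfolding asd_iff[OF so] using assms by (simp add: su2_nth realify_nth)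
qed

lemma su2_plus_eq: "su2_plus = {X. so4 X \<and> hodge X = X}"
proof (intro set_eqI iffI)
  fix X assume "X \<in> su2_plus"
  then have X: "so4 X" and c: "\<And>B. so4 B \<Longrightarrow> hodge B = - B \<Longrightarrow> X ** B - B ** X = 0"
    by (auto simp: su2_plus_def)
  then have *: "(X ** realify m) $ i $ j = (realify m ** X) $ i $ j" if "su2 m" for m i j
    using c[OF asd_realify[OF that]] by simp
  \<comment> \<open>Two generators of \<open>su(2)\<close>, one diagonal and one real off-diagonal;
    the third is a multiple of their commutator.\<close>
  let ?m = "(\<chi> a b. if a = b then if a = 1 then \<i> else - \<i> else 0) :: complex^2^2"
  let ?n = "(\<chi> a b. if a = b then 0 else if a = 1 then 1 else - 1) :: complex^2^2"
  have m: "su2 ?m" "su2 ?n" by (simp_all add: su2_nth)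
  from *[OF m(1), of 1 3] *[OF m(1), of 1 4] *[OF m(2), of 1 4]
  show "X \<in> {X. so4 X \<and> hodge X = X}"
    using X sd_iff[OF X] by (simp add: matrix_matrix_mult_def sum_4 realify_nth)
next
  fix X assume "X \<in> {X. so4 X \<and> hodge X = X}"
  then show "X \<in> su2_plus" using sd_asd_commute[symmetric, of _ X] by (auto simp: su2_plus_def)
qed

text \<open>The difference of \<open>X\<close> and the candidate satisfies the self-duality
  relations entry by entry, and a splitting is unique because both sets of relations together
  determine all six entries.\<close>

lemma asd_component_eq:
  assumes X: "so4 X"
  shows "asd_component X = realify (asd_matrix X)"
  unfolding asd_component_def
proof (rule the_equality)
  note re = asd_realify[OF su2_asd_matrix[of X]]
  have so: "so4 (X - realify (asd_matrix X))"
    using X re(1) by (simp add: so4_nth)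
  have "hodge (X - realify (asd_matrix X)) = X - realify (asd_matrix X)"
    unfolding sd_iff[OF so] by (simp add: realify_nth asd_matrix_nth field_simps)
  then show "realify (asd_matrix X) \<in> su2_minus \<and> X - realify (asd_matrix X) \<in> su2_plus"
    using re so by (simp add: su2_minus_eq su2_plus_eq)
next
  fix Y assume Y: "Y \<in> su2_minus \<and> X - Y \<in> su2_plus"
  then have so: "so4 Y" "so4 (X - Y)" and h: "hodge Y = - Y" "hodge (X - Y) = X - Y"
    by (auto simp: su2_minus_eq su2_plus_eq)
  show "Y = realify (asd_matrix X)"
    using h[unfolded asd_iff[OF so(1)] sd_iff[OF so(2)]]
    by (intro so4_eqI[OF so(1) asd_realify(1)[OF su2_asd_matrix]])
      (simp_all add: realify_nth asd_matrix_nth field_simps)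
qed

text \<open>\<open>cplx\<close> is onto, so the action on all real vectors determines the complex
  matrix.\<close>

lemma matrix_cplx_the:
  assumes "su2 m"
  shows "(THE m'. su2 m' \<and> (\<forall>v. m' *v cplx v = cplx (realify m *v v))) = m"
proof (rule the_equality)
  have "m *v cplx v = cplx (realify m *v v)" for v
    using realify_mult_vec[of m "cplx v"] by simp
  then show "su2 m \<and> (\<forall>v. m *v cplx v = cplx (realify m *v v))" using assms by simp
next
  fix m' assume "su2 m' \<and> (\<forall>v. m' *v cplx v = cplx (realify m *v v))"
  moreover have "m *v cplx v = cplx (realify m *v v)" for v
    using realify_mult_vec[of m "cplx v"] by simp
  ultimately have "m' *v cplx (uncplx z) = m *v cplx (uncplx z)" for z by metis
  then show "m' = m" by (simp add: matrix_eq)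
qed

subsection \<open>Gauge transformations and pullbacks of connections\<close>

lemmas matrix_mult_simps =
  bounded_bilinear.add_left[OF bounded_bilinear_matrix_mult] bounded_bilinear.add_right[OF bounded_bilinear_matrix_mult]
  bounded_bilinear.diff_left[OF bounded_bilinear_matrix_mult] bounded_bilinear.diff_right[OF bounded_bilinear_matrix_mult]
  bounded_bilinear.minus_left[OF bounded_bilinear_matrix_mult] bounded_bilinear.minus_right[OF bounded_bilinear_matrix_mult]
  bounded_bilinear.scaleR_left[OF bounded_bilinear_matrix_mult] bounded_bilinear.scaleR_right[OF bounded_bilinear_matrix_mult]

lemmas matrix_vector_simps =
  bounded_bilinear.add_left[OF bounded_bilinear_matrix_vector] bounded_bilinear.add_right[OF bounded_bilinear_matrix_vector]
  bounded_bilinear.diff_left[OF bounded_bilinear_matrix_vector] bounded_bilinear.diff_right[OF bounded_bilinear_matrix_vector]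
  bounded_bilinear.minus_left[OF bounded_bilinear_matrix_vector] bounded_bilinear.minus_right[OF bounded_bilinear_matrix_vector]
  bounded_bilinear.scaleR_left[OF bounded_bilinear_matrix_vector] bounded_bilinear.scaleR_right[OF bounded_bilinear_matrix_vector]

lemmas matrix_sum_simps =
  bounded_bilinear.sum_left[OF bounded_bilinear_matrix_mult] bounded_bilinear.sum_right[OF bounded_bilinear_matrix_mult]

lemmas smooth_on_matrix_mult = smooth_on_bilinear[OF bounded_bilinear_matrix_mult]
lemmas smooth_on_matrix_vector = smooth_on_bilinear[OF bounded_bilinear_matrix_vector]
lemmas pd_matrix_mult = pd_bilinear[OF bounded_bilinear_matrix_mult]
lemmas pd_matrix_vector = pd_bilinear[OF bounded_bilinear_matrix_vector]
lemmas smooth_on_nth = smooth_on_linear[OF bounded_linear_vec_nth]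

lemma pullback1_nth: "pullback1 \<tau> \<theta> x $ i = (\<Sum>j\<in>UNIV. (pd i \<tau> x $ j) *\<^sub>R (\<theta> (\<tau> x) $ j))"
  by (simp add: pullback1_def)

lemma smooth_on_pullback1:
  fixes \<theta> :: "real^4 \<Rightarrow> 'v::euclidean_space^4"
  assumes "open S" "open T" "smooth_on S \<tau>" "\<And>y. y \<in> S \<Longrightarrow> \<tau> y \<in> T" "smooth_on T \<theta>"
  shows "smooth_on S (pullback1 \<tau> \<theta>)"
  unfolding smooth_on_vec_iff[OF assms(1)] pullback1_nth
  using assms
  by (intro allI smooth_on_sum smooth_on_scaleR smooth_on_nth smooth_on_pd smooth_on_nth[OF _ smooth_on_compose[of S \<tau> T \<theta>]]) auto

lemma pd_pullback1:
  fixes \<theta> :: "real^4 \<Rightarrow> 'v::euclidean_space^4"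
  assumes "open S" "x \<in> S" "open T" "smooth_on S \<tau>" "\<And>y. y \<in> S \<Longrightarrow> \<tau> y \<in> T" "smooth_on T \<theta>"
  shows "pd i (\<lambda>y. pullback1 \<tau> \<theta> y $ j) x =
    (\<Sum>k\<in>UNIV. pd i (pd j \<tau>) x $ k *\<^sub>R \<theta> (\<tau> x) $ k)
     + (\<Sum>k\<in>UNIV. \<Sum>l\<in>UNIV. (pd i \<tau> x $ k * pd j \<tau> x $ l) *\<^sub>R pd k (\<lambda>z. \<theta> z $ l) (\<tau> x))"
proof -
  have dt: "\<tau> differentiable (at x)" "pd j \<tau> differentiable (at x)"
    and d\<theta>: "\<theta> differentiable (at (\<tau> x))"
    using assms smooth_on_differentiable smooth_on_pd by blast+
  have d1: "(\<lambda>y. pd j \<tau> y $ l) differentiable (at x)" for l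
    by (rule differentiable_bounded_linear[OF bounded_linear_vec_nth dt(2)])
  have d2: "(\<lambda>y. \<theta> y $ l) differentiable (at (\<tau> x))" for l
    by (rule differentiable_bounded_linear[OF bounded_linear_vec_nth d\<theta>])
  have d3: "(\<lambda>y. \<theta> (\<tau> y) $ l) differentiable (at x)" for l
    by (rule differentiable_compose_at[OF dt(1) d2])
  have "pd i (\<lambda>y. pullback1 \<tau> \<theta> y $ j) x = (\<Sum>l\<in>UNIV. pd i (\<lambda>y. pd j \<tau> y $ l *\<^sub>R \<theta> (\<tau> y) $ l) x)"
    unfolding pullback1_nth
    by (rule pd_sum) (rule differentiable_bilinear[OF bounded_bilinear_scaleR d1 d3])
  also have "\<dots> = (\<Sum>l\<in>UNIV. pd i (pd j \<tau>) x $ l *\<^sub>R \<theta> (\<tau> x) $ l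
       + pd j \<tau> x $ l *\<^sub>R (\<Sum>k\<in>UNIV. pd i \<tau> x $ k *\<^sub>R pd k (\<lambda>z. \<theta> z $ l) (\<tau> x)))"
    by (simp add: pd_bilinear[OF bounded_bilinear_scaleR d1 d3] pd_compose[OF dt(1) d2] pd_vec_nth[OF dt(2)])
  also have "\<dots> = (\<Sum>k\<in>UNIV. pd i (pd j \<tau>) x $ k *\<^sub>R \<theta> (\<tau> x) $ k)
     + (\<Sum>l\<in>UNIV. \<Sum>k\<in>UNIV. (pd i \<tau> x $ k * pd j \<tau> x $ l) *\<^sub>R pd k (\<lambda>z. \<theta> z $ l) (\<tau> x))"
    by (simp add: sum.distrib scaleR_sum_right mult.commute)
  also have "(\<Sum>l\<in>UNIV. \<Sum>k\<in>UNIV. (pd i \<tau> x $ k * pd j \<tau> x $ l) *\<^sub>R pd k (\<lambda>z. \<theta> z $ l) (\<tau> x))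
     = (\<Sum>k\<in>UNIV. \<Sum>l\<in>UNIV. (pd i \<tau> x $ k * pd j \<tau> x $ l) *\<^sub>R pd k (\<lambda>z. \<theta> z $ l) (\<tau> x))"
    by (rule sum.swap)
  finally show ?thesis .
qed

text \<open>The terms with second derivatives of \<tau> are symmetric in \<open>i\<close> and
  \<open>j\<close>, hence cancel in the antisymmetric difference.\<close>

lemma ext_d_pullback1:
  fixes \<theta> :: "real^4 \<Rightarrow> 'v::euclidean_space^4"
  assumes "open S" "x \<in> S" "open T" "smooth_on S \<tau>" "\<And>y. y \<in> S \<Longrightarrow> \<tau> y \<in> T" "smooth_on T \<theta>"
  shows "ext_d (form1 (pullback1 \<tau> \<theta>)) x [i, j] =
    (\<Sum>k\<in>UNIV. \<Sum>l\<in>UNIV. (pd i \<tau> x $ k * pd j \<tau> x $ l) *\<^sub>R ext_d (form1 \<theta>) (\<tau> x) [k, l])"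
proof -
  have "(\<Sum>k\<in>UNIV. \<Sum>l\<in>UNIV. (pd j \<tau> x $ k * pd i \<tau> x $ l) *\<^sub>R pd k (\<lambda>z. \<theta> z $ l) (\<tau> x))
     = (\<Sum>k\<in>UNIV. \<Sum>l\<in>UNIV. (pd i \<tau> x $ k * pd j \<tau> x $ l) *\<^sub>R pd l (\<lambda>z. \<theta> z $ k) (\<tau> x))"
    by (subst sum.swap) (simp add: mult.commute)
  then show ?thesis
    by (simp add: ext_d_form1_pair pd_pullback1[OF assms] pd_commute[OF assms(1,2,4), of i j]
        scaleR_diff_right sum_subtractf)
qed

lemma curvature_pullback1:
  fixes A :: "real^4 \<Rightarrow> ('a::{real_normed_field,euclidean_space}^'n^'n)^4"
  assumes "open S" "x \<in> S" "open T" "smooth_on S \<tau>" "\<And>y. y \<in> S \<Longrightarrow> \<tau> y \<in> T" "smooth_on T A"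
  shows "curvature (pullback1 \<tau> A) x [i, j] =
    (\<Sum>k\<in>UNIV. \<Sum>l\<in>UNIV. (pd i \<tau> x $ k * pd j \<tau> x $ l) *\<^sub>R curvature A (\<tau> x) [k, l])"
proof -
  have 1: "pullback1 \<tau> A x $ i ** pullback1 \<tau> A x $ j =
     (\<Sum>k\<in>UNIV. \<Sum>l\<in>UNIV. (pd i \<tau> x $ k * pd j \<tau> x $ l) *\<^sub>R (A (\<tau> x) $ k ** A (\<tau> x) $ l))"
    by (simp add: pullback1_nth matrix_sum_simps matrix_mult_simps scaleR_sum_right)
      (subst sum.swap, simp add: mult.commute)
  have "(\<Sum>k\<in>UNIV. \<Sum>l\<in>UNIV. (pd j \<tau> x $ k * pd i \<tau> x $ l) *\<^sub>R (A (\<tau> x) $ k ** A (\<tau> x) $ l))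
    = (\<Sum>k\<in>UNIV. \<Sum>l\<in>UNIV. (pd i \<tau> x $ k * pd j \<tau> x $ l) *\<^sub>R (A (\<tau> x) $ l ** A (\<tau> x) $ k))"
    by (subst sum.swap) (simp add: mult.commute)
  then have 2: "pullback1 \<tau> A x $ j ** pullback1 \<tau> A x $ i =
     (\<Sum>k\<in>UNIV. \<Sum>l\<in>UNIV. (pd i \<tau> x $ k * pd j \<tau> x $ l) *\<^sub>R (A (\<tau> x) $ l ** A (\<tau> x) $ k))"
    by (simp add: pullback1_nth matrix_sum_simps matrix_mult_simps scaleR_sum_right)
  show ?thesis
    unfolding curvature_def ext_d_pullback1[OF assms]
    by (simp add: ext_d_pullback1[OF assms] wedge11[OF _ _ homog_form1 homog_form1] 1 2 scaleR_add_right scaleR_diff_right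
        sum.distrib sum_subtractf)
qed

text \<open>Differentiate \<open>hi ** h = mat 1\<close> and multiply by \<open>hi\<close> from the
  right.\<close>

lemma pd_matrix_inverse:
  fixes h :: "real^4 \<Rightarrow> 'a::{real_normed_field,euclidean_space}^'n^'n"
  assumes S: "open S" "x \<in> S" and h: "smooth_on S h" "smooth_on S hi"
    and inv: "\<And>y. y \<in> S \<Longrightarrow> hi y ** h y = mat 1"
  shows "pd i hi x = - (hi x ** pd i h x ** hi x)"
proof -
  have d: "h differentiable (at x)" "hi differentiable (at x)"
    using S h smooth_on_differentiable by blast+
  have "pd i (\<lambda>y. hi y ** h y) x = 0"
    using pd_cong[OF S, of "\<lambda>y. hi y ** h y" "\<lambda>y. mat 1" i] inv by simp
  then have "pd i hi x ** h x + hi x ** pd i h x = 0"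
    by (simp add: pd_matrix_mult d)
  then have "(pd i hi x ** h x + hi x ** pd i h x) ** hi x = 0" by simp
  moreover have "h x ** hi x = mat 1"
    using inv[OF S(2)] by (simp add: matrix_left_right_inverse)
  ultimately show ?thesis
    by (simp add: matrix_mult_simps flip: matrix_mul_assoc) (simp add: eq_neg_iff_add_eq_0)
qed

text \<open>The derivatives of \<open>h\<close> cancel because the terms containing them are symmetric in \<open>i\<close>
  and \<open>j\<close>.\<close>

lemma curvature_gauge:
  fixes h :: "real^4 \<Rightarrow> 'a::{real_normed_field,euclidean_space}^'n^'n"
  assumes S: "open S" "x \<in> S" and h: "smooth_on S h" "smooth_on S hi" and G: "smooth_on S G"
    and inv: "\<And>y. y \<in> S \<Longrightarrow> hi y ** h y = mat 1"
    and A: "\<And>y i. y \<in> S \<Longrightarrow> A y $ i = h y ** G y $ i ** hi y - pd i h y ** hi y"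
  shows "curvature A x [i, j] = h x ** curvature G x [i, j] ** hi x"
proof -
  have d: "h differentiable (at x)" "hi differentiable (at x)" "\<And>j. pd j h differentiable (at x)"
    "\<And>j. (\<lambda>y. G y $ j) differentiable (at x)"
    using S h G smooth_on_differentiable smooth_on_pd smooth_on_nth[OF S(1) G] by blast+
  have cancel: "h x ** (hi x ** X) = X" "hi x ** (h x ** X) = X" for X
    using inv[OF S(2)] matrix_left_right_inverse[of "hi x" "h x"] by (simp_all add: matrix_mul_assoc)
  have pdA: "pd i (\<lambda>y. A y $ j) x =
      pd i h x ** (G x $ j ** hi x) + h x ** (pd i (\<lambda>y. G y $ j) x ** hi x)
      - h x ** (G x $ j ** (hi x ** (pd i h x ** hi x)))
      - pd i (pd j h) x ** hi x + pd j h x ** (hi x ** (pd i h x ** hi x))" for i j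
  proof -
    have "pd i (\<lambda>y. A y $ j) x = pd i (\<lambda>y. h y ** (G y $ j ** hi y) - pd j h y ** hi y) x"
      by (rule pd_cong[OF S]) (simp add: A matrix_mul_assoc)
    then show ?thesis
      by (simp add: pd_diff pd_matrix_mult d differentiable_bilinear[OF bounded_bilinear_matrix_mult]
          pd_matrix_inverse[OF S h inv] matrix_mult_simps flip: matrix_mul_assoc)
  qed
  show ?thesis
    unfolding curvature_pair pdA A[OF S(2)] pd_commute[OF S h(1), of i j]
    by (simp add: matrix_mult_simps cancel flip: matrix_mul_assoc)
qed

subsection \<open>The Levi-Civita connection\<close>

text \<open>Both sides of the structure equation are two-forms, so only lists of length 2 can
  distinguish them.\<close>

lemma lc_conn_condition_iff:
  fixes e :: "real^4 \<Rightarrow> real^4^4"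
  shows "(\<forall>xs. ext_d (form1 e) x xs = - wedge (*v) (form1 (\<lambda>_. W)) (form1 e) x xs) \<longleftrightarrow>
   (\<forall>i j. ext_d (form1 e) x [i, j] = - (W $ i *v e x $ j - W $ j *v e x $ i))" (is "?L \<longleftrightarrow> ?R")
proof -
  have w: "wedge (*v) (form1 (\<lambda>_. W)) (form1 e) x [i, j] = W $ i *v e x $ j - W $ j *v e x $ i" for i j
    by (simp add: wedge11[OF _ _ homog_form1 homog_form1])
  show ?thesis
  proof
    assume ?L then show ?R by (simp add: w)
  next
    assume R: ?R
    show ?L
    proof
      fix xs :: "4 list"
      show "ext_d (form1 e) x xs = - wedge (*v) (form1 (\<lambda>_. W)) (form1 e) x xs"
      proof (cases "length xs = 2")
        case True
        then obtain i j where "xs = [i, j]" by (auto simp: numeral_2_eq_2 length_Suc_conv)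
        then show ?thesis using R w by simp
      next
        case False
        have "homog (1 + 1) (wedge (*v) (form1 (\<lambda>_. W)) (form1 e))"
          by (rule homog_wedge[OF homog_form1 homog_form1]) simp_all
        then show ?thesis using False homog_ext_d_form1[of e] by (simp add: homog_def)
      qed
    qed
  qed
qed

lemma matrix_inv_row:
  fixes E :: "real^'n^'n"
  assumes "det E \<noteq> 0"
  shows "(\<Sum>K\<in>UNIV. E $ i $ K * matrix_inv E $ K $ j) = of_bool (i = j)"
    and "(\<Sum>K\<in>UNIV. matrix_inv E $ i $ K * E $ K $ j) = of_bool (i = j)"
proof -
  have "E ** matrix_inv E = mat 1" "matrix_inv E ** E = mat 1"
    using assms someI_ex[of "\<lambda>F. E ** F = mat 1 \<and> F ** E = mat 1"]
    unfolding invertible_det_nz[symmetric] invertible_def matrix_inv_def by auto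
  then have "(E ** matrix_inv E) $ i $ j = mat 1 $ i $ j" "(matrix_inv E ** E) $ i $ j = mat 1 $ i $ j" by simp_all
  then show "(\<Sum>K\<in>UNIV. E $ i $ K * matrix_inv E $ K $ j) = of_bool (i = j)"
    "(\<Sum>K\<in>UNIV. matrix_inv E $ i $ K * E $ K $ j) = of_bool (i = j)"
    unfolding matrix_matrix_mult_def mat_def by (simp_all add: of_bool_def)
qed

lemma so4D:
  assumes "so4 X" shows "X $ i $ j = - X $ j $ i"
proof -
  have "transpose X $ j $ i = (- X) $ j $ i" using assms by (simp only: so4_def)
  then show ?thesis by (simp add: transpose_def)
qed

lemma so4I:
  assumes "\<And>i j. X $ i $ j = - X $ j $ i" shows "so4 X"
proof -
  have "transpose X $ i $ j = (- X) $ i $ j" for i j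
    by (simp add: transpose_def assms[of j i])
  then show ?thesis by (simp add: so4_def vec_eq_iff)
qed

text \<open>In frame components \<open>v K I L\<close> the difference of two solutions is
  antisymmetric in the last two slots and symmetric in the first and third. Applying the two
  symmetries alternately, three times each, returns to the start with a minus sign.\<close>

lemma torsion_free_zero:
  fixes E :: "real^4^4"
  assumes E: "det E \<noteq> 0" and so: "\<And>i. so4 (V $ i)" and sym: "\<And>i j. V $ i *v E $ j = V $ j *v E $ i"
  shows "V = 0"
proof -
  let ?F = "matrix_inv E"
  define v where "v K I L = (\<Sum>i\<in>UNIV. ?F $ K $ i * V $ i $ I $ L)" for K I L
  have anti: "v K I L = - v K L I" for K I L
  proof -
    have "V $ i $ I $ L = - V $ i $ L $ I" for i
      by (rule so4D[OF so])
    then show ?thesis by (simp add: v_def sum_negf[symmetric])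
  qed
  have V: "V $ i $ I $ L = (\<Sum>K\<in>UNIV. E $ i $ K * v K I L)" for i I L
  proof -
    have "(\<Sum>K\<in>UNIV. E $ i $ K * v K I L) = (\<Sum>j\<in>UNIV. (\<Sum>K\<in>UNIV. E $ i $ K * ?F $ K $ j) * V $ j $ I $ L)"
      unfolding v_def sum_distrib_left sum_distrib_right mult.assoc by (rule sum.swap)
    then show ?thesis by (simp add: matrix_inv_row[OF E])
  qed
  have s: "(\<Sum>L\<in>UNIV. V $ i $ I $ L * E $ j $ L) = (\<Sum>L\<in>UNIV. V $ j $ I $ L * E $ i $ L)" for i j I
    using sym[of i j] by (simp add: matrix_vector_mult_def vec_eq_iff)
  \<comment> \<open>Contracting the \<open>L\<close> slot with the frame and back with its inverse
    changes nothing, but brings in the expression whose symmetry \<open>s\<close> is known.\<close>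
  have v_alt: "v K I L = (\<Sum>i\<in>UNIV. \<Sum>j\<in>UNIV. ?F $ K $ i * ?F $ L $ j * (\<Sum>M\<in>UNIV. V $ i $ I $ M * E $ j $ M))" for K I L
  proof -
    have "(\<Sum>j\<in>UNIV. ?F $ L $ j * (\<Sum>M\<in>UNIV. X $ M * E $ j $ M)) = X $ L" for X :: "real^4"
    proof -
      have "(\<Sum>j\<in>UNIV. ?F $ L $ j * (\<Sum>M\<in>UNIV. X $ M * E $ j $ M)) = (\<Sum>M\<in>UNIV. (\<Sum>j\<in>UNIV. ?F $ L $ j * E $ j $ M) * X $ M)"
        unfolding sum_distrib_left sum_distrib_right by (subst sum.swap) (simp add: mult_ac)
      then show ?thesis by (simp add: matrix_inv_row[OF E])
    qed
    then show ?thesis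
      by (simp add: v_def mult.assoc flip: sum_distrib_left)
  qed
  have sym': "v K I L = v L I K" for K I L
  proof -
    have "v L I K = (\<Sum>i\<in>UNIV. \<Sum>j\<in>UNIV. ?F $ K $ i * ?F $ L $ j * (\<Sum>M\<in>UNIV. V $ j $ I $ M * E $ i $ M))"
      unfolding v_alt by (subst sum.swap) (simp add: mult_ac)
    then show ?thesis
      unfolding v_alt[of K I L] by (simp only: s)
  qed
  have "v K I L = 0" for K I L
    using anti[of K I L] sym'[of K L I] anti[of I L K] sym'[of I K L] anti[of L K I] sym'[of L I K] by linarith
  then show ?thesis using V by (simp add: vec_eq_iff)
qed

text \<open>The connection coefficients \<open>w\<^sub>K\<^sub>I\<^sub>L\<close> in the frame, by the Koszul formula; \<open>T\<^sub>I\<^sub>K\<^sub>L\<close> are the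
  components of \<open>de\<^sup>I\<close>.\<close>

definition frame_ext_d :: "(real^4 \<Rightarrow> real^4^4) \<Rightarrow> real^4 \<Rightarrow> 4 \<Rightarrow> 4 \<Rightarrow> 4 \<Rightarrow> real" where
  "frame_ext_d e x I K L = (\<Sum>i\<in>UNIV. \<Sum>j\<in>UNIV. matrix_inv (e x) $ K $ i * matrix_inv (e x) $ L $ j
      * ext_d (form1 e) x [i, j] $ I)"

definition koszul :: "(real^4 \<Rightarrow> real^4^4) \<Rightarrow> real^4 \<Rightarrow> (real^4^4)^4" where
  "koszul e x = (\<chi> i I L. \<Sum>K\<in>UNIV. e x $ i $ K *
     ((frame_ext_d e x L K I - frame_ext_d e x I K L - frame_ext_d e x K I L) / 2))"

lemma frame_ext_d_anti: "frame_ext_d e x I K L = - frame_ext_d e x I L K"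
proof -
  let ?F = "matrix_inv (e x)"
  have *: "?F $ K $ i * ?F $ L $ j * ext_d (form1 e) x [i, j] $ I = - (?F $ L $ j * ?F $ K $ i * ext_d (form1 e) x [j, i] $ I)" for i j
    by (simp add: ext_d_form1_pair algebra_simps)
  show ?thesis
    unfolding frame_ext_d_def * sum_negf by (subst sum.swap) (rule refl)
qed

lemma ext_d_frame:
  assumes E: "det (e x) \<noteq> 0"
  shows "ext_d (form1 e) x [i, j] $ I = (\<Sum>K\<in>UNIV. \<Sum>L\<in>UNIV. e x $ i $ K * e x $ j $ L * frame_ext_d e x I K L)"
proof -
  let ?F = "matrix_inv (e x)"
  have "(\<Sum>K\<in>UNIV. \<Sum>L\<in>UNIV. e x $ i $ K * e x $ j $ L * frame_ext_d e x I K L)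
     = (\<Sum>q\<in>UNIV. (e x $ i $ fst q * e x $ j $ snd q) * (\<Sum>p\<in>UNIV. (?F $ fst q $ fst p * ?F $ snd q $ snd p) * ext_d (form1 e) x [fst p, snd p] $ I))"
    unfolding frame_ext_d_def sum_UNIV_prod ..
  also have "\<dots> = (\<Sum>q\<in>UNIV. \<Sum>p\<in>UNIV. (e x $ i $ fst q * e x $ j $ snd q) * (?F $ fst q $ fst p * ?F $ snd q $ snd p) * ext_d (form1 e) x [fst p, snd p] $ I)"
    by (simp add: sum_distrib_left mult.assoc)
  also have "\<dots> = (\<Sum>p\<in>UNIV. (\<Sum>q\<in>UNIV. (e x $ i $ fst q * ?F $ fst q $ fst p) * (e x $ j $ snd q * ?F $ snd q $ snd p)) * ext_d (form1 e) x [fst p, snd p] $ I)"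
    by (subst sum.swap) (simp add: sum_distrib_right sum_distrib_left mult_ac)
  also have "\<dots> = (\<Sum>k\<in>UNIV. \<Sum>l\<in>UNIV. (\<Sum>K\<in>UNIV. \<Sum>L\<in>UNIV. (e x $ i $ K * ?F $ K $ k) * (e x $ j $ L * ?F $ L $ l)) * ext_d (form1 e) x [k, l] $ I)"
    unfolding sum_UNIV_prod ..
  also have "\<dots> = (\<Sum>k\<in>UNIV. \<Sum>l\<in>UNIV. of_bool (i = k) * of_bool (j = l) * ext_d (form1 e) x [k, l] $ I)"
    by (simp add: sum_product[symmetric] matrix_inv_row[OF E])
  also have "\<dots> = ext_d (form1 e) x [i, j] $ I"
  proof -
    have d: "(\<Sum>k\<in>UNIV. of_bool (i = k) * f k) = f i" for f :: "4 \<Rightarrow> real" and i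
      by (simp add: of_bool_def if_distrib[of "\<lambda>x. x * _"] cong: if_cong)
    show ?thesis by (simp only: mult.assoc sum_distrib_left[symmetric] d)
  qed
  finally show ?thesis ..
qed

text \<open>Existence of the Levi-Civita connection. Antisymmetry and the torsion equation both
  reduce to the antisymmetry of \<open>frame_ext_d\<close> in its last two slots.\<close>

lemma koszul_spec:
  assumes E: "det (e x) \<noteq> 0"
  shows "so4 (koszul e x $ i)"
    and "ext_d (form1 e) x [i, j] = - (koszul e x $ i *v e x $ j - koszul e x $ j *v e x $ i)"
proof -
  define w where "w K I L = (frame_ext_d e x L K I - frame_ext_d e x I K L - frame_ext_d e x K I L) / 2" for K I L
  have k: "koszul e x $ i $ I $ L = (\<Sum>K\<in>UNIV. e x $ i $ K * w K I L)" for i I L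
    by (simp add: koszul_def w_def)
  have anti: "w K I L = - w K L I" for K I L
    using frame_ext_d_anti[of e x K I L] by (simp add: w_def field_simps)
  show "so4 (koszul e x $ i)"
    by (rule so4I) (subst k, subst k, subst anti, simp add: sum_negf)
  have w: "w K I L - w L I K = - frame_ext_d e x I K L" for I K L
    using frame_ext_d_anti[of e x I K L] frame_ext_d_anti[of e x L K I] frame_ext_d_anti[of e x K L I]
    by (simp add: w_def field_simps)
  have ke: "(koszul e x $ i *v e x $ j) $ I = (\<Sum>K\<in>UNIV. \<Sum>L\<in>UNIV. e x $ i $ K * e x $ j $ L * w K I L)" for i j I
    unfolding matrix_vector_mult_def by (simp add: k sum_distrib_right sum_distrib_left mult_ac) (subst sum.swap, simp add: mult_ac)
  have "(koszul e x $ j *v e x $ i) $ I = (\<Sum>K\<in>UNIV. \<Sum>L\<in>UNIV. e x $ i $ K * e x $ j $ L * w L I K)" for I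
    unfolding ke by (subst sum.swap) (simp add: mult_ac)
  then have "(koszul e x $ i *v e x $ j - koszul e x $ j *v e x $ i) $ I
     = (\<Sum>K\<in>UNIV. \<Sum>L\<in>UNIV. e x $ i $ K * e x $ j $ L * (w K I L - w L I K))" for I
    by (simp add: ke sum_subtractf right_diff_distrib)
  then have "ext_d (form1 e) x [i, j] $ I = - (koszul e x $ i *v e x $ j - koszul e x $ j *v e x $ i) $ I" for I
    unfolding w ext_d_frame[where e=e and x=x, OF E] by (simp add: sum_negf)
  then show "ext_d (form1 e) x [i, j] = - (koszul e x $ i *v e x $ j - koszul e x $ j *v e x $ i)"
    by (simp add: vec_eq_iff)
qed

text \<open>Uniqueness in the description comes from \<open>torsion_free_zero\<close>, applied to
  the difference of two solutions.\<close>

lemma lc_conn_eqI: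
  assumes E: "det (e x) \<noteq> 0" and so: "\<And>i. so4 (W $ i)"
    and W: "\<And>i j. ext_d (form1 e) x [i, j] = - (W $ i *v e x $ j - W $ j *v e x $ i)"
  shows "lc_conn e x = W"
  unfolding lc_conn_def lc_conn_condition_iff
proof (rule the_equality)
  show "(\<forall>i. so4 (W $ i)) \<and> (\<forall>i j. ext_d (form1 e) x [i, j] = - (W $ i *v e x $ j - W $ j *v e x $ i))"
    using so W by blast
next
  fix W' assume W': "(\<forall>i. so4 (W' $ i)) \<and> (\<forall>i j. ext_d (form1 e) x [i, j] = - (W' $ i *v e x $ j - W' $ j *v e x $ i))"
  have "W' - W = 0"
  proof (rule torsion_free_zero[OF E])
    show "so4 ((W' - W) $ i)" for i
      using W' so[of i] by (simp add: so4_nth)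
    fix i j
    have "W' $ i *v e x $ j - W' $ j *v e x $ i = W $ i *v e x $ j - W $ j *v e x $ i"
      using W'[THEN conjunct2, rule_format, of i j] W[of i j] by (metis neg_equal_iff_equal)
    then show "(W' - W) $ i *v e x $ j = (W' - W) $ j *v e x $ i"
      by (simp add: matrix_vector_simps algebra_simps)
  qed
  then show "W' = W" by simp
qed

lemma lc_conn_koszul: "det (e x) \<noteq> 0 \<Longrightarrow> lc_conn e x = koszul e x"
  using koszul_spec by (intro lc_conn_eqI) auto

lemma lc_conn_spec:
  assumes "det (e x) \<noteq> 0"
  shows "so4 (lc_conn e x $ i)"
    and "ext_d (form1 e) x [i, j] = - (lc_conn e x $ i *v e x $ j - lc_conn e x $ j *v e x $ i)"
  using koszul_spec[where e=e and x=x, OF assms] by (simp_all add: lc_conn_koszul[where e=e and x=x, OF assms])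

section \<open>Smooth dependence of the Levi-Civita connection on the point\<close>

lemma smooth_on_prod:
  fixes f :: "'i \<Rightarrow> real^4 \<Rightarrow> real"
  assumes "open S" "\<And>k. k \<in> I \<Longrightarrow> smooth_on S (f k)"
  shows "smooth_on S (\<lambda>x. \<Prod>k\<in>I. f k x)"
proof (cases "finite I")
  case True
  then show ?thesis using assms(2)
    by (induction I rule: finite_induct) (auto intro: smooth_on_mult[OF assms(1)])
qed simp

lemma smooth_on_det:
  fixes E :: "real^4 \<Rightarrow> real^'n^'n"
  assumes "open S" "\<And>i j. smooth_on S (\<lambda>x. E x $ i $ j)"
  shows "smooth_on S (\<lambda>x. det (E x))"
  unfolding det_def
  by (intro smooth_on_sum smooth_on_mult smooth_on_prod assms smooth_on_const)

text \<open>Cramer's rule writes the entries as quotients of determinants, which are polynomials in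
  the entries of \<open>E\<close>.\<close>

lemma smooth_on_matrix_inv:
  fixes E :: "real^4 \<Rightarrow> real^'n^'n"
  assumes S: "open S" and E: "\<And>i j. smooth_on S (\<lambda>x. E x $ i $ j)" and d: "\<And>x. x \<in> S \<Longrightarrow> det (E x) \<noteq> 0"
  shows "smooth_on S (\<lambda>x. matrix_inv (E x) $ i $ j)"
proof -
  have "matrix_inv (E x) $ i $ j = det (\<chi> k l. if l = i then of_bool (k = j) else E x $ k $ l) * inverse (det (E x))"
    if "x \<in> S" for x
  proof -
    have "E x *v column j (matrix_inv (E x)) = (\<chi> k. of_bool (k = j))"
      using matrix_inv_row[OF d[OF that]] by (simp add: matrix_vector_mult_def column_def vec_eq_iff)
    then have "column j (matrix_inv (E x)) $ i = det (\<chi> k l. if l = i then of_bool (k = j) else E x $ k $ l) / det (E x)"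
      unfolding cramer[OF d[OF that]] by (simp cong: if_cong)
    then show ?thesis by (simp add: column_def divide_inverse)
  qed
  moreover have "smooth_on S (\<lambda>x. (\<chi> k l. if l = i then of_bool (k = j) else E x $ k $ l) $ k $ l)" for k l
    using E[of k l] by (cases "l = i") auto
  then have "smooth_on S (\<lambda>x. det (\<chi> k l. if l = i then of_bool (k = j) else E x $ k $ l) * inverse (det (E x)))"
    using d by (intro smooth_on_mult smooth_on_inverse smooth_on_det S E) 
  ultimately show ?thesis by (metis (no_types, lifting) smooth_on_cong[OF S])
qed

lemma smooth_on_ext_d_form1:
  fixes e :: "real^4 \<Rightarrow> 'v::euclidean_space^4"
  assumes "open S" "smooth_on S e"
  shows "smooth_on S (\<lambda>x. ext_d (form1 e) x [i, j])"
  unfolding ext_d_form1_pair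
  by (intro smooth_on_diff smooth_on_pd smooth_on_nth assms)

text \<open>\<open>lc_conn\<close> is a pointwise unique description without visible regularity;
  smoothness is read off the explicit formula \<open>koszul\<close>.\<close>

lemma smooth_on_lc_conn:
  assumes S: "open S" and e: "smooth_on S e" and d: "\<And>x. x \<in> S \<Longrightarrow> det (e x) \<noteq> 0"
  shows "smooth_on S (lc_conn e)"
proof (rule smooth_on_cong[OF S])
  show "koszul e x = lc_conn e x" if "x \<in> S" for x
    using lc_conn_koszul[where e=e and x=x, OF d[OF that]] ..
  have e2: "smooth_on S (\<lambda>x. e x $ i $ j)" for i j by (intro smooth_on_nth S e)
  have f: "smooth_on S (\<lambda>x. frame_ext_d e x I K L)" for I K L
    unfolding frame_ext_d_def
    by (intro smooth_on_sum smooth_on_mult smooth_on_matrix_inv S e2 d smooth_on_nth[OF S smooth_on_ext_d_form1[OF S e]])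
  have "smooth_on S (\<lambda>x. \<Sum>K\<in>UNIV. e x $ i $ K * ((frame_ext_d e x L K I - frame_ext_d e x I K L - frame_ext_d e x K I L) * (1 / 2)))" for i I L
    by (intro smooth_on_sum smooth_on_mult smooth_on_diff f S e2 smooth_on_const)
  then show "smooth_on S (koszul e)"
    unfolding smooth_on_vec_iff[OF S] koszul_def by simp
qed

text \<open>Instead of transforming the Koszul formula, the expected right-hand side
  \<open>V\<close> is shown to meet the two conditions that characterise \<open>lc_conn\<close>: it
  is antisymmetric and solves the structure equation of \<open>e'\<close>.\<close>

lemma lc_conn_gauge:
  assumes S: "open S" "x \<in> S" and T: "open T" and \<tau>: "smooth_on S \<tau>" "\<And>y. y \<in> S \<Longrightarrow> \<tau> y \<in> T"
    and e: "smooth_on T e" "det (e (\<tau> x)) \<noteq> 0" and Q: "smooth_on S Q"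
    and orth: "\<And>y. y \<in> S \<Longrightarrow> transpose (Q y) ** Q y = mat 1"
    and e': "\<And>y i. y \<in> S \<Longrightarrow> e' y $ i = Q y *v pullback1 \<tau> e y $ i" "det (e' x) \<noteq> 0"
  shows "lc_conn e' x $ i = Q x ** pullback1 \<tau> (lc_conn e) x $ i ** transpose (Q x) - pd i Q x ** transpose (Q x)"
proof -
  define G where "G = pullback1 \<tau> e"
  define W where "W = pullback1 \<tau> (lc_conn e) x"
  define V where "V = (\<chi> i. Q x ** W $ i ** transpose (Q x) - pd i Q x ** transpose (Q x))"
  have G: "smooth_on S G" unfolding G_def by (rule smooth_on_pullback1[OF S(1) T \<tau> e(1)])
  have orth': "Q x ** transpose (Q x) = mat 1"
    using orth[OF S(2)] by (simp add: matrix_left_right_inverse)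
  have dQ: "Q differentiable (at x)" and dG: "(\<lambda>y. G y $ i) differentiable (at x)" for i
    using S Q smooth_on_differentiable smooth_on_nth[OF S(1) G] by blast+
  have soW: "so4 (W $ i)" for i
  proof (rule so4I)
    fix a b
    have "lc_conn e (\<tau> x) $ k $ a $ b = - lc_conn e (\<tau> x) $ k $ b $ a" for k
      by (rule so4D[OF lc_conn_spec(1)[where e=e and x="\<tau> x", OF e(2)]])
    then have "(\<Sum>k\<in>UNIV. pd i \<tau> x $ k * lc_conn e (\<tau> x) $ k $ a $ b) = (\<Sum>k\<in>UNIV. - (pd i \<tau> x $ k * lc_conn e (\<tau> x) $ k $ b $ a))"
      by simp
    then show "W $ i $ a $ b = - W $ i $ b $ a"
      by (simp add: W_def pullback1_nth sum_negf)
  qed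
  have blt: "bounded_linear (transpose :: real^4^4 \<Rightarrow> real^4^4)"
    by (intro linear_conv_bounded_linear[THEN iffD1] linearI) (simp_all add: transpose_def vec_eq_iff)
  \<comment> \<open>The inhomogeneous term is antisymmetric because \<open>Q\<close> is orthogonal:
    differentiate \<open>transpose (Q y) ** Q y = mat 1\<close>.\<close>
  have soV: "so4 (V $ i)" for i
  proof -
    have "pd i (\<lambda>y. transpose (Q y)) x = - (transpose (Q x) ** pd i Q x ** transpose (Q x))"
      by (rule pd_matrix_inverse[OF S Q smooth_on_linear[OF blt S(1) Q] orth])
    then have "transpose (pd i Q x) = - (transpose (Q x) ** pd i Q x ** transpose (Q x))"
      using pd_bounded_linear[OF blt dQ, of i] by simp
    then have "transpose (pd i Q x ** transpose (Q x)) = - (Q x ** transpose (Q x) ** (pd i Q x ** transpose (Q x)))"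
      by (simp add: matrix_transpose_mul matrix_mult_simps matrix_mul_assoc)
    then have "so4 (pd i Q x ** transpose (Q x))"
      by (simp add: orth' so4_def)
    then show ?thesis using so4_conj[OF soW, of "Q x" i] by (simp add: V_def so4_nth)
  qed
  have dGW: "ext_d (form1 G) x [i, j] = - (W $ i *v G x $ j - W $ j *v G x $ i)" for i j
  proof -
    have "ext_d (form1 G) x [i, j] = - (\<Sum>k\<in>UNIV. \<Sum>l\<in>UNIV. (pd i \<tau> x $ k * pd j \<tau> x $ l) *\<^sub>R (lc_conn e (\<tau> x) $ k *v e (\<tau> x) $ l))
      + (\<Sum>k\<in>UNIV. \<Sum>l\<in>UNIV. (pd i \<tau> x $ k * pd j \<tau> x $ l) *\<^sub>R (lc_conn e (\<tau> x) $ l *v e (\<tau> x) $ k))"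
      by (simp add: G_def ext_d_pullback1[OF S T \<tau> e(1)] lc_conn_spec(2)[where e=e and x="\<tau> x", OF e(2)]
          sum_negf scaleR_diff_right sum_subtractf)
    also have "(\<Sum>k\<in>UNIV. \<Sum>l\<in>UNIV. (pd i \<tau> x $ k * pd j \<tau> x $ l) *\<^sub>R (lc_conn e (\<tau> x) $ l *v e (\<tau> x) $ k))
      = (\<Sum>k\<in>UNIV. \<Sum>l\<in>UNIV. (pd j \<tau> x $ k * pd i \<tau> x $ l) *\<^sub>R (lc_conn e (\<tau> x) $ k *v e (\<tau> x) $ l))"
      by (subst sum.swap) (simp add: mult.commute)
    moreover have "W $ i *v G x $ j = (\<Sum>k\<in>UNIV. \<Sum>l\<in>UNIV. (pd i \<tau> x $ k * pd j \<tau> x $ l) *\<^sub>R (lc_conn e (\<tau> x) $ k *v e (\<tau> x) $ l))" for i j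
      unfolding G_def W_def pullback1_nth
      by (simp add: bounded_bilinear.sum_left[OF bounded_bilinear_matrix_vector]
          bounded_bilinear.sum_right[OF bounded_bilinear_matrix_vector] matrix_vector_simps scaleR_sum_right)
        (subst sum.swap, simp add: mult.commute)
    ultimately show ?thesis by simp
  qed
  have de': "pd i (\<lambda>y. e' y $ j) x = pd i Q x *v G x $ j + Q x *v pd i (\<lambda>y. G y $ j) x" for i j
  proof -
    have "pd i (\<lambda>y. e' y $ j) x = pd i (\<lambda>y. Q y *v G y $ j) x"
      by (rule pd_cong[OF S]) (simp add: e' G_def)
    then show ?thesis by (simp add: pd_matrix_vector dQ dG)
  qed
  have cancel: "transpose (Q x) *v (Q x *v v) = v" for v
    using orth[OF S(2)] by (simp only: matrix_vector_mul_assoc matrix_vector_mul_lid)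
  have "lc_conn e' x = V"
  proof (rule lc_conn_eqI[where e=e' and x=x, OF e'(2) soV])
    fix i j
    have Ve: "V $ i *v e' x $ j = Q x *v (W $ i *v G x $ j) - pd i Q x *v G x $ j" for i j
      using e'(1)[OF S(2), of j]
      by (simp add: V_def G_def[symmetric] matrix_vector_simps cancel del: transpose_matrix_vector flip: matrix_vector_mul_assoc)
    have "ext_d (form1 e') x [i, j] = pd i Q x *v G x $ j - pd j Q x *v G x $ i + Q x *v ext_d (form1 G) x [i, j]"
      by (simp add: ext_d_form1_pair de' matrix_vector_simps)
    then show "ext_d (form1 e') x [i, j] = - (V $ i *v e' x $ j - V $ j *v e' x $ i)"
      by (simp add: dGW Ve matrix_vector_simps)
  qed
  then show ?thesis by (simp add: V_def W_def)
qed

text \<open>Exterior derivative of the structure equation: the second derivatives of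
  \<open>e\<close> cancel, and replacing differences of first derivatives by the torsion equation
  leaves exactly the curvature terms.\<close>

lemma lc_bianchi:
  assumes S: "open S" "x \<in> S" and e: "smooth_on S e" "\<And>y. y \<in> S \<Longrightarrow> det (e y) \<noteq> 0"
  shows "curvature (lc_conn e) x [i, j] *v e x $ k + curvature (lc_conn e) x [j, k] *v e x $ i
     + curvature (lc_conn e) x [k, i] *v e x $ j = 0"
proof -
  define W where "W = lc_conn e"
  have W: "smooth_on S W" unfolding W_def by (rule smooth_on_lc_conn[OF S(1) e])
  have dW: "(\<lambda>y. W y $ i) differentiable (at x)" and de: "(\<lambda>y. e y $ i) differentiable (at x)" for i
    using S smooth_on_differentiable smooth_on_nth[OF S(1) W] smooth_on_nth[OF S(1) e(1)] by blast+
  have dpe: "pd j (\<lambda>y. e y $ i) differentiable (at x)" for i j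
    using S smooth_on_differentiable smooth_on_pd smooth_on_nth[OF S(1) e(1)] by blast
  have tors: "pd i (\<lambda>y. e y $ j) y - pd j (\<lambda>y. e y $ i) y = W y $ j *v e y $ i - W y $ i *v e y $ j" if "y \<in> S" for i j y
    using lc_conn_spec(2)[of e y i j] e(2)[OF that] by (simp add: ext_d_form1_pair W_def)
  have D: "pd k (pd i (\<lambda>y. e y $ j)) x - pd k (pd j (\<lambda>y. e y $ i)) x =
      pd k (\<lambda>y. W y $ j) x *v e x $ i + W x $ j *v pd k (\<lambda>y. e y $ i) x
    - (pd k (\<lambda>y. W y $ i) x *v e x $ j + W x $ i *v pd k (\<lambda>y. e y $ j) x)" for i j k
  proof -
    have "pd k (\<lambda>y. pd i (\<lambda>y. e y $ j) y - pd j (\<lambda>y. e y $ i) y) x = pd k (\<lambda>y. W y $ j *v e y $ i - W y $ i *v e y $ j) x"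
      by (rule pd_cong[OF S tors])
    then show ?thesis
      by (simp add: pd_diff dpe pd_matrix_vector dW de differentiable_bilinear[OF bounded_bilinear_matrix_vector])
  qed
  have c: "pd k (pd i (\<lambda>y. e y $ j)) x = pd i (pd k (\<lambda>y. e y $ j)) x" for i j k
    by (rule pd_commute[OF S smooth_on_nth[OF S(1) e(1)]])
  have t: "pd i (\<lambda>y. e y $ j) x = pd j (\<lambda>y. e y $ i) x + W x $ j *v e x $ i - W x $ i *v e x $ j" for i j
    using tors[OF S(2), of i j] by (simp add: algebra_simps)
  \<comment> \<open>Six second derivatives that cancel in pairs, grouped so that \<open>D\<close>
    turns each bracket into connection terms.\<close>
  have "0 = (pd k (pd i (\<lambda>y. e y $ j)) x - pd k (pd j (\<lambda>y. e y $ i)) x)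
     + (pd i (pd j (\<lambda>y. e y $ k)) x - pd i (pd k (\<lambda>y. e y $ j)) x)
     + (pd j (pd k (\<lambda>y. e y $ i)) x - pd j (pd i (\<lambda>y. e y $ k)) x)"
    using c[of k i j] c[of k j i] c[of i j k] by simp
  also have "\<dots> = - (curvature W x [i, j] *v e x $ k + curvature W x [j, k] *v e x $ i + curvature W x [k, i] *v e x $ j)"
    unfolding D curvature_pair t[of k i] t[of k j] t[of i j]
    by (simp add: matrix_vector_simps flip: matrix_vector_mul_assoc)
  finally show ?thesis
    unfolding W_def neg_0_equal_iff_equal by (rule sym)
qed

subsection \<open>Four-forms built from the frame\<close>

lemma homog_wedge_11: "homog 1 \<alpha> \<Longrightarrow> homog 1 \<beta> \<Longrightarrow> (\<And>y. B 0 y = 0) \<Longrightarrow> (\<And>x. B x 0 = 0) \<Longrightarrow> homog 2 (wedge B \<alpha> \<beta>)"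
  and homog_wedge_12: "homog 1 \<alpha> \<Longrightarrow> homog 2 \<beta>' \<Longrightarrow> (\<And>y. B' 0 y = 0) \<Longrightarrow> (\<And>x. B' x 0 = 0) \<Longrightarrow> homog 3 (wedge B' \<alpha> \<beta>')"
  and homog_wedge_21: "homog 2 \<beta>' \<Longrightarrow> homog 1 \<gamma> \<Longrightarrow> (\<And>y. C 0 y = 0) \<Longrightarrow> (\<And>x. C x 0 = 0) \<Longrightarrow> homog 3 (wedge C \<beta>' \<gamma>)"
proof -
  have e: "(1::nat) + 1 = 2" "(1::nat) + 2 = 3" "(2::nat) + 1 = 3" by simp_all
  show "homog 1 \<alpha> \<Longrightarrow> homog 1 \<beta> \<Longrightarrow> (\<And>y. B 0 y = 0) \<Longrightarrow> (\<And>x. B x 0 = 0) \<Longrightarrow> homog 2 (wedge B \<alpha> \<beta>)"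
    by (rule homog_wedge[of 1 \<alpha> 1 \<beta> B, unfolded e])
  show "homog 1 \<alpha> \<Longrightarrow> homog 2 \<beta>' \<Longrightarrow> (\<And>y. B' 0 y = 0) \<Longrightarrow> (\<And>x. B' x 0 = 0) \<Longrightarrow> homog 3 (wedge B' \<alpha> \<beta>')"
    by (rule homog_wedge[of 1 \<alpha> 2 \<beta>' B', unfolded e])
  show "homog 2 \<beta>' \<Longrightarrow> homog 1 \<gamma> \<Longrightarrow> (\<And>y. C 0 y = 0) \<Longrightarrow> (\<And>x. C x 0 = 0) \<Longrightarrow> homog 3 (wedge C \<beta>' \<gamma>)"
    by (rule homog_wedge[of 2 \<beta>' 1 \<gamma> C, unfolded e])
qed

lemma top4_bounded_linear: "bounded_linear L \<Longrightarrow> L (top4 T) = top4 (\<lambda>i j k l. L (T i j k l))"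
  by (simp add: top4_def bounded_linear.linear linear_sum linear_scale)

lemma herm_eq: "herm u v = cnj (u $ 1) * v $ 1 + cnj (u $ 2) * v $ 2"
  by (simp add: herm_def sum_2)

lemma bounded_bilinear_herm: "bounded_bilinear herm"
  unfolding bilinear_conv_bounded_bilinear[symmetric] bilinear_def
  by (auto intro!: linearI simp: herm_eq complex_eq_iff algebra_simps)

lemmas herm_simps = bounded_bilinear.add_left[OF bounded_bilinear_herm] bounded_bilinear.add_right[OF bounded_bilinear_herm]
  bounded_bilinear.diff_left[OF bounded_bilinear_herm] bounded_bilinear.diff_right[OF bounded_bilinear_herm]
  bounded_bilinear.minus_left[OF bounded_bilinear_herm] bounded_bilinear.minus_right[OF bounded_bilinear_herm]
  bounded_bilinear.scaleR_left[OF bounded_bilinear_herm] bounded_bilinear.scaleR_right[OF bounded_bilinear_herm]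
  bounded_bilinear.sum_left[OF bounded_bilinear_herm] bounded_bilinear.sum_right[OF bounded_bilinear_herm]
  bounded_bilinear.zero_left[OF bounded_bilinear_herm] bounded_bilinear.zero_right[OF bounded_bilinear_herm]

lemma herm_hconj: "herm u (m *v v) = herm (hconj m *v u) v"
  by (simp add: herm_eq hconj_def matrix_vector_mult_def sum_2 algebra_simps)

lemma herm_unitary: "unitary2 h \<Longrightarrow> herm (h *v u) (h *v v) = herm u v"
  by (simp add: herm_hconj matrix_vector_mul_assoc matrix_left_unitary)

text \<open>For antisymmetric \<open>F\<close> this is the component \<open>[1, 2, 3, 4]\<close> of
  \<open>\<Psi>\<^sup>\<dagger> \<and> F \<and> \<Psi>\<close>; the factor \<open>1/2\<close>
  corrects for summing over ordered pairs \<open>j, k\<close>.\<close>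

definition sandwich :: "(complex^2)^4 \<Rightarrow> (4 \<Rightarrow> 4 \<Rightarrow> complex^2^2) \<Rightarrow> complex" where
  "sandwich \<psi> F = (1/2) *\<^sub>R top4 (\<lambda>i j k l. herm (\<psi> $ i) (F j k *v \<psi> $ l))"

lemma sandwich_linear:
  "sandwich \<psi> (\<lambda>j k. F j k + G j k) = sandwich \<psi> F + sandwich \<psi> G"
  "sandwich \<psi> (\<lambda>j k. F j k - G j k) = sandwich \<psi> F - sandwich \<psi> G"
  "sandwich \<psi> (\<lambda>j k. r *\<^sub>R F j k) = r *\<^sub>R sandwich \<psi> F"
  by (simp_all add: sandwich_def top4_linear matrix_vector_simps herm_simps scaleR_add_right scaleR_diff_right)

lemma psi_F_psi_eq: "psi_F_psi A \<Psi> x [1, 2, 3, 4] = sandwich (\<Psi> x) (\<lambda>j k. curvature A x [j, k])"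
proof -
  have h: "homog 3 (wedge (*v) (curvature A) (form1 \<Psi>))"
    by (rule homog_wedge_21[OF homog_curvature homog_form1]) simp_all
  have c: "curvature A x [k, j] = - curvature A x [j, k]" for j k
    by (simp add: curvature_pair)
  have c': "curvature A x [2, 1] = - curvature A x [1, 2]" "curvature A x [3, 1] = - curvature A x [1, 3]"
    "curvature A x [4, 1] = - curvature A x [1, 4]" "curvature A x [3, 2] = - curvature A x [2, 3]"
    "curvature A x [4, 2] = - curvature A x [2, 4]" "curvature A x [4, 3] = - curvature A x [3, 4]"
    by (rule c)+
  have w: "wedge (*v) (curvature A) (form1 \<Psi>) x [i, j, k] = curvature A x [i, j] *v \<Psi> x $ k
     - curvature A x [i, k] *v \<Psi> x $ j + curvature A x [j, k] *v \<Psi> x $ i" for i j k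
    by (simp add: wedge21[OF _ _ homog_curvature homog_form1])
  have p: "psi_F_psi A \<Psi> x [1, 2, 3, 4] =
      herm (\<Psi> x $ 1) (wedge (*v) (curvature A) (form1 \<Psi>) x [2, 3, 4])
    - herm (\<Psi> x $ 2) (wedge (*v) (curvature A) (form1 \<Psi>) x [1, 3, 4])
    + herm (\<Psi> x $ 3) (wedge (*v) (curvature A) (form1 \<Psi>) x [1, 2, 4])
    - herm (\<Psi> x $ 4) (wedge (*v) (curvature A) (form1 \<Psi>) x [1, 2, 3])"
    unfolding psi_F_psi_def using h
    by (subst wedge13[OF _ _ homog_form1]) (simp_all add: herm_simps)
  show ?thesis
    unfolding sandwich_def top4_eq p c' w herm_simps matrix_vector_simps by (simp add: scaleR_conv_of_real field_simps)
qed

text \<open>\<open>P\<close> is a change of coordinates (or of coframe) and \<open>h\<close> a gauge transformation.\<close>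

lemma sandwich_transform:
  assumes h: "unitary2 h"
    and \<psi>: "\<And>i. \<psi> $ i = h *v (\<Sum>I\<in>UNIV. P $ i $ I *\<^sub>R \<psi>' $ I)"
    and F: "\<And>j k. F j k = h ** (\<Sum>J\<in>UNIV. \<Sum>K\<in>UNIV. (P $ j $ J * P $ k $ K) *\<^sub>R F' J K) ** hconj h"
  shows "sandwich \<psi> F = det P *\<^sub>R sandwich \<psi>' F'"
proof -
  have c: "hconj h *v (h *v v) = v" for v
    by (simp add: matrix_vector_mul_assoc matrix_left_unitary[OF h])
  have s: "(\<Sum>J\<in>UNIV. \<Sum>K\<in>UNIV. f J K) *v v = (\<Sum>J\<in>UNIV. \<Sum>K\<in>UNIV. f J K *v v)" for f :: "4 \<Rightarrow> 4 \<Rightarrow> complex^2^2" and v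
    by (simp only: bounded_bilinear.sum_left[OF bounded_bilinear_matrix_vector])
  have "herm (\<psi> $ i) (F j k *v \<psi> $ l) = (\<Sum>I\<in>UNIV. \<Sum>J\<in>UNIV. \<Sum>K\<in>UNIV. \<Sum>L\<in>UNIV.
     (P $ i $ I * P $ j $ J * P $ k $ K * P $ l $ L) *\<^sub>R herm (\<psi>' $ I) (F' J K *v \<psi>' $ L))" for i j k l
  proof -
    have "herm (\<psi> $ i) (F j k *v \<psi> $ l) = herm (\<Sum>I\<in>UNIV. P $ i $ I *\<^sub>R \<psi>' $ I)
        ((\<Sum>J\<in>UNIV. \<Sum>K\<in>UNIV. (P $ j $ J * P $ k $ K) *\<^sub>R F' J K) *v (\<Sum>L\<in>UNIV. P $ l $ L *\<^sub>R \<psi>' $ L))"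
      unfolding \<psi> F matrix_vector_mul_assoc[symmetric] c herm_unitary[OF h] ..
    also have "\<dots> = (\<Sum>I\<in>UNIV. \<Sum>J\<in>UNIV. \<Sum>K\<in>UNIV. \<Sum>L\<in>UNIV.
     (P $ i $ I * P $ j $ J * P $ k $ K * P $ l $ L) *\<^sub>R herm (\<psi>' $ I) (F' J K *v \<psi>' $ L))"
      unfolding bounded_bilinear.sum_left[OF bounded_bilinear_herm]
      unfolding s unfolding bounded_bilinear.sum_right[OF bounded_bilinear_matrix_vector]
      unfolding matrix_vector_simps herm_simps
      by (simp add: scaleR_sum_right mult_ac)
    finally show ?thesis .
  qed
  then have "top4 (\<lambda>i j k l. herm (\<psi> $ i) (F j k *v \<psi> $ l)) = det P *\<^sub>R top4 (\<lambda>I J K L. herm (\<psi>' $ I) (F' J K *v \<psi>' $ L))"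
    by (rule top4_transform)
  then show ?thesis
    unfolding sandwich_def by (simp only: scaleR_left_commute)
qed

lemma coframe_vol_eq: "coframe_vol e x [1, 2, 3, 4] = det (e x)"
proof -
  have c: "homog 1 (coframe_form e I)" "coframe_form e I x [i] = e x $ i $ I" for I i
    unfolding coframe_form_def by (rule homog_form1) simp
  have h2: "homog 2 (wedge (*) (coframe_form e 3) (coframe_form e 4))"
    by (rule homog_wedge_11[OF c(1) c(1)]) simp_all
  have h3: "homog 3 (wedge (*) (coframe_form e 2) (wedge (*) (coframe_form e 3) (coframe_form e 4)))"
    by (rule homog_wedge_12[OF c(1) h2]) simp_all
  show ?thesis
    unfolding coframe_vol_def det_4
    by (subst wedge13[OF _ _ c(1) h3], simp, simp) (simp add: wedge12[OF _ _ c(1) h2] wedge11[OF _ _ c(1) c(1)] c(2) algebra_simps)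
qed

lemma psi_psi_pair: "psi_psi \<Psi> x [i, j] = herm (\<Psi> x $ i) (\<Psi> x $ j) - herm (\<Psi> x $ j) (\<Psi> x $ i)"
  and homog_psi_psi: "homog 2 (psi_psi \<Psi>)"
  using homog_wedge_11[OF homog_form1[of \<Psi>] homog_form1[of \<Psi>], of herm]
  by (simp_all add: psi_psi_def wedge11[OF _ _ homog_form1 homog_form1] herm_simps)

lemma omega_pair:
  "omega_of \<Psi> x [i, j] = coframe \<Psi> x $ i $ 1 * coframe \<Psi> x $ j $ 2 - coframe \<Psi> x $ i $ 2 * coframe \<Psi> x $ j $ 1
     + coframe \<Psi> x $ i $ 3 * coframe \<Psi> x $ j $ 4 - coframe \<Psi> x $ i $ 4 * coframe \<Psi> x $ j $ 3"
  by (simp add: omega_of_def wedge11[OF _ _ homog_form1 homog_form1] fcomp_def fcomp_cnj_def coframe_def field_simps)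

lemma homog_omega: "homog 2 (omega_of \<Psi>)"
proof -
  have "homog 2 (wedge (*) (form1 (fcomp \<Psi> k)) (form1 (fcomp_cnj \<Psi> k)))" for k
    by (rule homog_wedge_11[OF homog_form1 homog_form1]) simp_all
  then show ?thesis by (simp add: homog_def omega_of_def)
qed

lemma psi_psi_omega: "psi_psi \<Psi> x [i, j] = 2 * \<i> * of_real (omega_of \<Psi> x [i, j])"
  by (simp add: psi_psi_pair omega_pair herm_eq coframe_def complex_eq_iff algebra_simps)

lemma omega_omega: "wedge (*) (omega_of \<Psi>) (omega_of \<Psi>) x [1, 2, 3, 4] = 2 * det (coframe \<Psi> x)"
  by (subst wedge22[OF _ _ homog_omega homog_omega]) (simp_all add: omega_pair det_4 algebra_simps)

lemma metric_of_eq: "metric_of \<Psi> x $ i $ j = (\<Sum>I\<in>UNIV. coframe \<Psi> x $ i $ I * coframe \<Psi> x $ j $ I)"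
  by (simp add: metric_of_def symprod_def fcomp_def fcomp_cnj_def coframe_def sum_4 algebra_simps)

lemma metric_of_matrix: "metric_of \<Psi> x = coframe \<Psi> x ** transpose (coframe \<Psi> x)"
  by (simp add: vec_eq_iff metric_of_eq matrix_matrix_mult_def transpose_def)

text \<open>The square root of \<open>det g\<close> only gives the modulus of \<open>det e\<close>;
  the sign is restored by \<open>\<omega> \<and> \<omega>\<close>, whose component is
  \<open>2 * det e\<close>.\<close>

lemma metric_vol_eq: "metric_vol (metric_of \<Psi>) (omega_of \<Psi>) x [1, 2, 3, 4] = det (coframe \<Psi> x)"
proof -
  have "sgn (2 * d) * sqrt (d * d) = d" for d :: real
    by (simp add: sgn_mult sgn_mult_abs real_sqrt_abs2)
  then show ?thesis
    unfolding metric_vol_def omega_omega metric_of_matrix det_mul det_transpose by (simp add: eps_pair)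
qed

text \<open>In the coframe, \<omega> is \<open>e J e^T\<close> and \<open>g\<close> is
  \<open>e e^T\<close> with the constant complex structure \<open>J\<close>, so the product
  collapses to \<open>e J^2 e^T\<close>.\<close>

lemma compatible:
  assumes "det (coframe \<Psi> x) \<noteq> 0"
  shows "form2_matrix (omega_of \<Psi>) x ** matrix_inv (metric_of \<Psi> x) ** form2_matrix (omega_of \<Psi>) x = - metric_of \<Psi> x"
proof -
  let ?e = "coframe \<Psi> x"
  define J :: "real^4^4" where "J = (\<chi> i j. if (i, j) = (1, 2) \<or> (i, j) = (3, 4) then 1 else if (i, j) = (2, 1) \<or> (i, j) = (4, 3) then - 1 else 0)"
  have J: "J ** J = - mat 1" by (simp add: J_def matrix_matrix_mult_def mat_def vec_eq_iff forall_4 sum_4)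
  have \<omega>: "form2_matrix (omega_of \<Psi>) x = ?e ** J ** transpose ?e"
    unfolding vec_eq_iff form2_matrix_def
    by (simp add: omega_pair matrix_matrix_mult_def transpose_def sum_4 J_def)
  have "invertible ?e" "invertible (transpose ?e)"
    using assms by (simp_all add: invertible_det_nz det_transpose)
  then obtain f f' where f: "?e ** f = mat 1" "f ** ?e = mat 1" and f': "transpose ?e ** f' = mat 1" "f' ** transpose ?e = mat 1"
    unfolding invertible_def by blast
  have "metric_of \<Psi> x ** (f' ** f) = mat 1"
    unfolding metric_of_matrix by (metis f(1) f'(1) matrix_mul_assoc matrix_mul_rid)
  moreover have "det (metric_of \<Psi> x) \<noteq> 0" using assms by (simp add: metric_of_matrix det_mul det_transpose)
  ultimately have inv: "matrix_inv (metric_of \<Psi> x) = f' ** f"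
    unfolding matrix_inv_def
    by (intro some_equality) (auto simp: matrix_left_right_inverse, metis matrix_left_right_inverse matrix_mul_assoc matrix_mul_lid matrix_mul_rid)
  have "?e ** J ** transpose ?e ** (f' ** f) ** (?e ** J ** transpose ?e) = ?e ** J ** (transpose ?e ** f') ** (f ** ?e) ** J ** transpose ?e"
    by (simp only: matrix_mul_assoc)
  also have "\<dots> = ?e ** (J ** J) ** transpose ?e"
    by (simp only: f f' matrix_mul_rid matrix_mul_assoc)
  finally show ?thesis
    unfolding \<omega> inv by (simp add: J metric_of_matrix matrix_mult_simps)
qed

lemma det_coframe:
  assumes "nondegenerate_at \<Psi> x"
  shows "det (coframe \<Psi> x) \<noteq> 0"
proof
  assume "det (coframe \<Psi> x) = 0"
  then have "\<not> invertible (coframe \<Psi> x)" by (simp add: invertible_det_nz)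
  then obtain v where v: "coframe \<Psi> x *v v = 0" "v \<noteq> 0"
    unfolding invertible_left_inverse matrix_left_invertible_ker by blast
  have v': "(\<Sum>I\<in>UNIV. coframe \<Psi> x $ i $ I * v $ I) = 0" for i
    using v(1) by (simp add: matrix_vector_mult_def vec_eq_iff)
  \<comment> \<open>With these coefficients \<open>c1 * \<alpha> + c3 * cnj \<alpha>\<close> is
    \<open>2 * (v1 * e^1 + v2 * e^2)\<close>, and likewise for \<beta>, so a real relation of the
    coframe becomes a forbidden complex one.\<close>
  define c1 c2 c3 c4 where c: "c1 = Complex (v $ 1) (- v $ 2)" "c2 = Complex (v $ 3) (- v $ 4)"
    "c3 = Complex (v $ 1) (v $ 2)" "c4 = Complex (v $ 3) (v $ 4)"
  have "c1 *s fcomp \<Psi> 1 x + c2 *s fcomp \<Psi> 2 x + c3 *s fcomp_cnj \<Psi> 1 x + c4 *s fcomp_cnj \<Psi> 2 x = 0"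
    unfolding vec_eq_iff
  proof
    fix i
    show "(c1 *s fcomp \<Psi> 1 x + c2 *s fcomp \<Psi> 2 x + c3 *s fcomp_cnj \<Psi> 1 x + c4 *s fcomp_cnj \<Psi> 2 x) $ i = 0 $ i"
      using v'[of i] by (simp add: c fcomp_def fcomp_cnj_def coframe_def sum_4 complex_eq_iff algebra_simps)
  qed
  then have "c1 = 0 \<and> c2 = 0 \<and> c3 = 0 \<and> c4 = 0"
    using assms unfolding nondegenerate_at_def by blast
  then have "v = 0" by (simp add: c vec_eq_iff forall_4 complex_eq_iff)
  then show False using v(2) by simp
qed

lemma smooth_on_coframe: "open S \<Longrightarrow> smooth_on S \<Psi> \<Longrightarrow> smooth_on S (coframe \<Psi>)"
  unfolding smooth_on_vec_iff[of S "coframe \<Psi>"] coframe_def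
  by (simp del: uncplx_nth) (intro allI smooth_on_linear[OF bounded_linear_uncplx] smooth_on_nth)

subsection \<open>The action of the anti-self-dual connection\<close>

lemma asd_conn_nth:
  assumes "det (coframe \<Psi> x) \<noteq> 0"
  shows "asd_conn \<Psi> x $ i = asd_matrix (lc_conn (coframe \<Psi>) x $ i)"
proof -
  have so: "so4 (lc_conn (coframe \<Psi>) x $ i)"
    by (rule lc_conn_spec(1)[where e="coframe \<Psi>" and x=x, OF assms])
  show ?thesis
    using matrix_cplx_the[OF su2_asd_matrix] by (simp add: asd_conn_def asd_component_eq[OF so])
qed

text \<open>\<open>asd_matrix\<close> is linear, so it commutes with partial derivatives, and it
  respects commutators of antisymmetric matrices.\<close>

lemma curvature_asd_conn:
  assumes S: "open S" "x \<in> S" and \<Psi>: "smooth_on S \<Psi>" "\<And>y. y \<in> S \<Longrightarrow> det (coframe \<Psi> y) \<noteq> 0"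
  shows "curvature (asd_conn \<Psi>) x [i, j] = asd_matrix (curvature (lc_conn (coframe \<Psi>)) x [i, j])"
proof -
  let ?W = "lc_conn (coframe \<Psi>)"
  have W: "smooth_on S ?W" by (rule smooth_on_lc_conn[OF S(1) smooth_on_coframe[OF S(1) \<Psi>(1)] \<Psi>(2)])
  have dW: "(\<lambda>y. ?W y $ i) differentiable (at x)" for i
    using S smooth_on_differentiable smooth_on_nth[OF S(1) W] by blast
  have p: "pd i (\<lambda>y. asd_conn \<Psi> y $ j) x = asd_matrix (pd i (\<lambda>y. ?W y $ j) x)" for i j
  proof -
    have "pd i (\<lambda>y. asd_conn \<Psi> y $ j) x = pd i (\<lambda>y. asd_matrix (?W y $ j)) x"
      by (rule pd_cong[OF S]) (rule asd_conn_nth[OF \<Psi>(2)])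
    then show ?thesis by (simp add: pd_bounded_linear[OF bounded_linear_asd_matrix dW])
  qed
  have so: "so4 (?W x $ i)" for i
    by (rule lc_conn_spec(1)[where e="coframe \<Psi>" and x=x, OF \<Psi>(2)[OF S(2)]])
  show ?thesis
    unfolding curvature_pair asd_matrix_linear(1) asd_matrix_commutator[OF so so]
    by (simp add: p asd_conn_nth[OF \<Psi>(2)[OF S(2)]] asd_matrix_linear(2))
qed

lemma so4_curvature_lc:
  assumes S: "open S" "x \<in> S" and e: "smooth_on S e" "\<And>y. y \<in> S \<Longrightarrow> det (e y) \<noteq> 0"
  shows "so4 (curvature (lc_conn e) x [i, j])"
proof -
  let ?W = "lc_conn e"
  have W: "smooth_on S ?W" by (rule smooth_on_lc_conn[OF S(1) e])
  have dW: "(\<lambda>y. ?W y $ i) differentiable (at x)" for i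
    using S smooth_on_differentiable smooth_on_nth[OF S(1) W] by blast
  have dW': "(\<lambda>y. ?W y $ i $ I) differentiable (at x)" for i I
    by (rule differentiable_bounded_linear[OF bounded_linear_vec_nth dW])
  have so: "so4 (?W y $ i)" if "y \<in> S" for y i
    by (rule lc_conn_spec(1)[where e=e and x=y, OF e(2)[OF that]])
  have so_pd: "so4 (pd i (\<lambda>y. ?W y $ j) x)" for i j
  proof (rule so4I)
    fix I J
    have "pd i (\<lambda>y. ?W y $ j) x $ I $ J = pd i (\<lambda>y. ?W y $ j $ I $ J) x" for I J
      by (simp add: pd_vec_nth dW dW')
    moreover have "pd i (\<lambda>y. ?W y $ j $ I $ J) x = pd i (\<lambda>y. - ?W y $ j $ J $ I) x"
      by (rule pd_cong[OF S]) (rule so4D[OF so])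
    moreover have "(\<lambda>y. ?W y $ j $ J $ I) differentiable (at x)"
      by (rule differentiable_bounded_linear[OF bounded_linear_vec_nth dW'])
    ultimately show "pd i (\<lambda>y. ?W y $ j) x $ I $ J = - pd i (\<lambda>y. ?W y $ j) x $ J $ I"
      by (simp add: pd_minus)
  qed
  have so_comm: "so4 (X ** Y - Y ** X)" if X: "so4 X" and Y: "so4 Y" for X Y
  proof -
    have "(X ** Y) $ i $ j = (Y ** X) $ j $ i" for i j
    proof -
      have "X $ i $ k * Y $ k $ j = Y $ j $ k * X $ k $ i" for k
        using so4D[OF X, of i k] so4D[OF Y, of k j] by simp
      then show ?thesis by (simp add: matrix_matrix_mult_def)
    qed
    then show ?thesis by (intro so4I) simp
  qed
  show ?thesis
    unfolding curvature_pair
    using so_pd[of i j] so_pd[of j i] so_comm[OF so[OF S(2), of i] so[OF S(2), of j]]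
    unfolding so4_nth by simp
qed

text \<open>\<open>curv_form e R I J K L\<close> is \<open>R\<^sub>I\<^sub>J \<and> e\<^sup>K \<and> e\<^sup>L\<close> up to a factor 2.\<close>

definition curv_form :: "real^4^4 \<Rightarrow> (4 \<Rightarrow> 4 \<Rightarrow> real^4^4) \<Rightarrow> 4 \<Rightarrow> 4 \<Rightarrow> 4 \<Rightarrow> 4 \<Rightarrow> real" where
  "curv_form e R I J K L = top4 (\<lambda>i j k l. e $ i $ K * R j k $ I $ J * e $ l $ L)"

lemma curv_form_anti: 
  shows "curv_form e R I J K L = - curv_form e R I J L K"
    and "(\<And>j k. so4 (R j k)) \<Longrightarrow> curv_form e R I J K L = - curv_form e R J I K L"
proof -
  show "curv_form e R I J K L = - curv_form e R I J L K"
    unfolding curv_form_def top4_eq by (simp add: algebra_simps)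
  assume so: "\<And>j k. so4 (R j k)"
  show "curv_form e R I J K L = - curv_form e R J I K L"
    unfolding curv_form_def by (subst so4D[OF so]) (simp add: top4_def sum_negf)
qed

text \<open>The contraction is a multiple of \<open>e^K\<close> wedged with
  \<open>R^I_L \<and> e^L\<close>, the three-form that the first Bianchi identity
  annihilates.\<close>

lemma curv_form_bianchi:
  assumes "\<And>i j k. R i j *v e $ k + R j k *v e $ i + R k i *v e $ j = 0"
  shows "(\<Sum>L\<in>UNIV. curv_form e R I L K L) = 0"
proof -
  define Z where "Z j k l = (\<Sum>L\<in>UNIV. R j k $ I $ L * e $ l $ L)" for j k l
  have Z: "Z j k l + Z k l j + Z l j k = 0" for j k l
    using arg_cong[OF assms[of j k l], of "\<lambda>v. v $ I"] by (simp add: Z_def matrix_vector_mult_def)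
  have "(\<Sum>L\<in>UNIV. curv_form e R I L K L) = top4 (\<lambda>i j k l. e $ i $ K * Z j k l)"
    unfolding curv_form_def Z_def top4_eq sum_4 by (simp add: algebra_simps)
  \<comment> \<open>Sorted by the coordinate slot of \<open>e^K\<close>, the contraction consists of
    cyclic sums of \<open>Z\<close>.\<close>
  also have "\<dots> = e $ 1 $ K * ((Z 2 3 4 + Z 3 4 2 + Z 4 2 3) - (Z 2 4 3 + Z 4 3 2 + Z 3 2 4))
    + e $ 2 $ K * ((Z 1 4 3 + Z 4 3 1 + Z 3 1 4) - (Z 1 3 4 + Z 3 4 1 + Z 4 1 3))
    + e $ 3 $ K * ((Z 1 2 4 + Z 2 4 1 + Z 4 1 2) - (Z 1 4 2 + Z 4 2 1 + Z 2 1 4))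
    + e $ 4 $ K * ((Z 1 3 2 + Z 3 2 1 + Z 2 1 3) - (Z 1 2 3 + Z 2 3 1 + Z 3 1 2))"
    unfolding top4_eq by (simp add: algebra_simps)
  finally show ?thesis unfolding Z by simp
qed

text \<open>The real part of the Hermitian product is the Euclidean inner product of real
  coordinates; the imaginary part of a number \<open>z\<close> is the real part of
  \<open>- \<i> * z\<close>, whence the factor \<open>mat (- \<i>)\<close>.\<close>

lemma herm_coframe:
  "herm u (m *v v) = Complex
     (\<Sum>K\<in>UNIV. \<Sum>L\<in>UNIV. realify m $ K $ L * (uncplx u $ K * uncplx v $ L))
     (\<Sum>K\<in>UNIV. \<Sum>L\<in>UNIV. realify (mat (- \<i>) ** m) $ K $ L * (uncplx u $ K * uncplx v $ L))"
  by (simp add: herm_eq complex_eq_iff sum_4 realify_nth matrix_vector_mult_def sum_2 matrix_matrix_mult_def mat_def algebra_simps)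

text \<open>The imaginary part vanishes because of the symmetries, and the first Bianchi identity turns the
  anti-self-dual part of the curvature into the full one.\<close>

lemma sandwich_asd_curvature:
  assumes so: "\<And>j k. so4 (R j k)"
    and bianchi: "\<And>i j k. R i j *v e $ k + R j k *v e $ i + R k i *v e $ j = 0"
    and \<psi>: "\<And>i. uncplx (\<psi> $ i) = e $ i"
  shows "sandwich \<psi> (\<lambda>j k. asd_matrix (R j k)) =
    of_real (- (1/8) * (\<Sum>I\<in>UNIV. \<Sum>J\<in>UNIV. \<Sum>K\<in>UNIV. \<Sum>L\<in>UNIV. eps I J K L * curv_form e R I J K L))"
proof -
  let ?c = "curv_form e R"
  have lin: "Re (top4 T) = top4 (\<lambda>i j k l. Re (T i j k l))" "Im (top4 T) = top4 (\<lambda>i j k l. Im (T i j k l))" for T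
    by (rule top4_bounded_linear[OF bounded_linear_Re] top4_bounded_linear[OF bounded_linear_Im])+
  define m where "m I J K L i j k l = e $ i $ K * R j k $ I $ J * e $ l $ L" for I J K L i j k l
  have c: "top4 (\<lambda>i j k l. m I J K L i j k l) = ?c I J K L" for I J K L
    by (simp add: m_def curv_form_def)
  have swap: "?c I J L K = - ?c I J K L" for I J K L
    by (rule curv_form_anti(1))
  have same: "?c I J K K = 0" for I J K
    using swap[of I J K K] by simp
  \<comment> \<open>In half of the terms the curvature and the coframes carry the same index pair,
    in the other half complementary pairs. The former will cancel by the Bianchi identity, the
    latter make up the contraction with \<open>eps\<close>.\<close>
  have "Re (herm (\<psi> $ i) (asd_matrix (R j k) *v \<psi> $ l)) = (1/2) *\<^sub>R (
      m 1 2 1 2 i j k l - m 3 4 1 2 i j k l - m 1 2 2 1 i j k l + m 3 4 2 1 i j k l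
    + m 3 4 3 4 i j k l - m 1 2 3 4 i j k l - m 3 4 4 3 i j k l + m 1 2 4 3 i j k l
    + m 1 3 1 3 i j k l + m 2 4 1 3 i j k l - m 1 3 3 1 i j k l - m 2 4 3 1 i j k l
    + m 1 3 2 4 i j k l + m 2 4 2 4 i j k l - m 1 3 4 2 i j k l - m 2 4 4 2 i j k l
    + m 1 4 1 4 i j k l - m 2 3 1 4 i j k l - m 1 4 4 1 i j k l + m 2 3 4 1 i j k l
    + m 2 3 2 3 i j k l - m 1 4 2 3 i j k l - m 2 3 3 2 i j k l + m 1 4 3 2 i j k l)" for i j k l
    unfolding herm_coframe \<psi> m_def
    by (simp add: sum_4 realify_nth asd_matrix_nth field_simps)
  then have re: "Re (top4 (\<lambda>i j k l. herm (\<psi> $ i) (asd_matrix (R j k) *v \<psi> $ l)))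
     = ?c 1 2 1 2 + ?c 1 3 1 3 + ?c 1 4 1 4 + ?c 2 3 2 3 + ?c 2 4 2 4 + ?c 3 4 3 4
      - ?c 3 4 1 2 + ?c 2 4 1 3 - ?c 2 3 1 4 - ?c 1 4 2 3 + ?c 1 3 2 4 - ?c 1 2 3 4"
    unfolding lin by (simp only: top4_linear c) (simp add: swap[of _ _ 1 2] swap[of _ _ 1 3] swap[of _ _ 1 4] swap[of _ _ 2 3] swap[of _ _ 2 4] swap[of _ _ 3 4])
  have "Im (herm (\<psi> $ i) (asd_matrix (R j k) *v \<psi> $ l)) = (1/2) *\<^sub>R (
      m 3 4 1 1 i j k l - m 1 2 1 1 i j k l + m 3 4 2 2 i j k l - m 1 2 2 2 i j k l
    - m 3 4 3 3 i j k l + m 1 2 3 3 i j k l - m 3 4 4 4 i j k l + m 1 2 4 4 i j k l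
    + m 2 3 1 3 i j k l - m 1 4 1 3 i j k l + m 2 3 3 1 i j k l - m 1 4 3 1 i j k l
    + m 2 3 2 4 i j k l - m 1 4 2 4 i j k l + m 2 3 4 2 i j k l - m 1 4 4 2 i j k l
    + m 1 3 1 4 i j k l + m 2 4 1 4 i j k l + m 1 3 4 1 i j k l + m 2 4 4 1 i j k l
    - m 1 3 2 3 i j k l - m 2 4 2 3 i j k l - m 1 3 3 2 i j k l - m 2 4 3 2 i j k l)" for i j k l
    unfolding herm_coframe \<psi> m_def
    by (simp add: sum_4 realify_nth asd_matrix_nth matrix_matrix_mult_def mat_def sum_2 field_simps)
  then have im: "Im (top4 (\<lambda>i j k l. herm (\<psi> $ i) (asd_matrix (R j k) *v \<psi> $ l))) = 0"
    unfolding lin by (simp only: top4_linear c) (simp add: same swap[of _ _ 1 3] swap[of _ _ 1 4] swap[of _ _ 2 3] swap[of _ _ 2 4])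
  have b: "?c I 1 I 1 + ?c I 2 I 2 + ?c I 3 I 3 + ?c I 4 I 4 = 0" for I
    using curv_form_bianchi[OF bianchi, of I I] by (simp add: sum_4)
  have d: "?c I J J I = - ?c I J I J" "?c J I I J = - ?c I J I J" "?c J I J I = ?c I J I J" for I J
    using curv_form_anti(1)[of e R] curv_form_anti(2)[of R e, OF so] by (metis minus_minus)+
  have z: "?c I I I I = 0" for I using curv_form_anti(1)[of e R I I I I] by simp
  \<comment> \<open>Each unordered pair occurs in two of the four contracted identities, so their
    sum is twice this one.\<close>
  have B: "?c 1 2 1 2 + ?c 1 3 1 3 + ?c 1 4 1 4 + ?c 2 3 2 3 + ?c 2 4 2 4 + ?c 3 4 3 4 = 0"
    using b[of 1] b[of 2] b[of 3] b[of 4] d(3)[of 1 2] d(3)[of 1 3] d(3)[of 1 4] d(3)[of 2 3] d(3)[of 2 4] d(3)[of 3 4]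
      z[of 1] z[of 2] z[of 3] z[of 4] by linarith
  \<comment> \<open>The 24 terms collapse to four times six by the two antisymmetries. With the
    factor \<open>1/2\<close> of \<open>sandwich\<close> this is the origin of
    \<open>1/8\<close>.\<close>
  have eps: "(\<Sum>I\<in>UNIV. \<Sum>J\<in>UNIV. \<Sum>K\<in>UNIV. \<Sum>L\<in>UNIV. eps I J K L * ?c I J K L)
     = 4 * (?c 3 4 1 2 - ?c 2 4 1 3 + ?c 2 3 1 4 + ?c 1 4 2 3 - ?c 1 3 2 4 + ?c 1 2 3 4)"
  proof -
    have a: "?c I J L K = - ?c I J K L" "?c J I K L = - ?c I J K L" for I J K L
      using curv_form_anti(1)[of e R I J L K] curv_form_anti(2)[of R e J I K L, OF so] by simp_all
    have "(\<Sum>I\<in>UNIV. \<Sum>J\<in>UNIV. \<Sum>K\<in>UNIV. \<Sum>L\<in>UNIV. eps I J K L * ?c I J K L) = top4 ?c"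
      by (simp add: top4_def)
    also have "\<dots> = 4 * (?c 3 4 1 2 - ?c 2 4 1 3 + ?c 2 3 1 4 + ?c 1 4 2 3 - ?c 1 3 2 4 + ?c 1 2 3 4)"
      unfolding top4_eq
      by (simp add: a(1)[of _ _ 1 2] a(1)[of _ _ 1 3] a(1)[of _ _ 1 4] a(1)[of _ _ 2 3] a(1)[of _ _ 2 4] a(1)[of _ _ 3 4]
          a(2)[of 1 2] a(2)[of 1 3] a(2)[of 1 4] a(2)[of 2 3] a(2)[of 2 4] a(2)[of 3 4])
    finally show ?thesis .
  qed
  show ?thesis
    unfolding sandwich_def complex_eq_iff eps using re im B by (simp add: field_simps)
qed

text \<open>Moving a one-form past a two-form costs no sign, so the order \<open>e^K\<close>,
  \<open>R\<close>, \<open>e^L\<close> in \<open>curv_form\<close> is harmless; the factor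
  \<open>1/2\<close> corrects for its sum over ordered pairs.\<close>

lemma scal_numerator:
  "wedge (*) (\<lambda>y ys. curvature W y ys $ I $ J) (wedge (*) (coframe_form e K) (coframe_form e L)) x [1, 2, 3, 4]
    = (1/2) * curv_form (e x) (\<lambda>j k. curvature W x [j, k]) I J K L"
proof -
  have c: "homog 1 (coframe_form e I)" "coframe_form e I x [i] = e x $ i $ I" for I i
    unfolding coframe_form_def by (rule homog_form1) simp
  have h: "homog 2 (\<lambda>y ys. curvature W y ys $ I $ J)"
    using homog_curvature[of W] by (simp add: homog_def)
  have h2: "homog 2 (wedge (*) (coframe_form e K) (coframe_form e L))"
    by (rule homog_wedge_11[OF c(1) c(1)]) simp_all
  have a: "curvature W x [j, i] = - curvature W x [i, j]" for i j
    by (simp add: curvature_pair)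
  have a': "curvature W x [2, 1] = - curvature W x [1, 2]" "curvature W x [3, 1] = - curvature W x [1, 3]"
    "curvature W x [4, 1] = - curvature W x [1, 4]" "curvature W x [3, 2] = - curvature W x [2, 3]"
    "curvature W x [4, 2] = - curvature W x [2, 4]" "curvature W x [4, 3] = - curvature W x [3, 4]"
    by (rule a)+
  have w: "wedge (*) (coframe_form e K) (coframe_form e L) x [i, j] = e x $ i $ K * e x $ j $ L - e x $ j $ K * e x $ i $ L" for i j
    by (simp add: wedge11[OF _ _ c(1) c(1)] c(2))
  show ?thesis
    by (subst wedge22[OF _ _ h h2]) (simp_all add: w curv_form_def top4_eq a' field_simps)
qed

lemma coframe_scal_eq:
  "coframe_scal e x = (1/8) * (\<Sum>I\<in>UNIV. \<Sum>J\<in>UNIV. \<Sum>K\<in>UNIV. \<Sum>L\<in>UNIV. eps I J K L *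
      curv_form (e x) (\<lambda>j k. curvature (lc_conn e) x [j, k]) I J K L) / det (e x)"
  unfolding coframe_scal_def coframe_vol_eq scal_numerator by (simp add: sum_distrib_left mult_ac)

lemma psi_F_psi_asd_conn:
  assumes S: "open S" "x \<in> S" and \<Psi>: "smooth_on S \<Psi>" "\<And>y. y \<in> S \<Longrightarrow> det (coframe \<Psi> y) \<noteq> 0"
  shows "psi_F_psi (asd_conn \<Psi>) \<Psi> x [1, 2, 3, 4] = of_real (- coframe_scal (coframe \<Psi>) x * det (coframe \<Psi> x))"
proof -
  note e = smooth_on_coframe[OF S(1) \<Psi>(1)]
  have c: "(\<lambda>j k. curvature (asd_conn \<Psi>) x [j, k]) = (\<lambda>j k. asd_matrix (curvature (lc_conn (coframe \<Psi>)) x [j, k]))"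
    by (simp add: curvature_asd_conn[OF S \<Psi>])
  have "sandwich (\<Psi> x) (\<lambda>j k. asd_matrix (curvature (lc_conn (coframe \<Psi>)) x [j, k])) =
      of_real (- (1/8) * (\<Sum>I\<in>UNIV. \<Sum>J\<in>UNIV. \<Sum>K\<in>UNIV. \<Sum>L\<in>UNIV. eps I J K L *
        curv_form (coframe \<Psi> x) (\<lambda>j k. curvature (lc_conn (coframe \<Psi>)) x [j, k]) I J K L))"
    by (rule sandwich_asd_curvature[OF so4_curvature_lc[OF S e \<Psi>(2)] lc_bianchi[OF S e \<Psi>(2)]])
      (simp_all add: coframe_def)
  then show ?thesis
    unfolding psi_F_psi_eq c coframe_scal_eq using \<Psi>(2)[OF S(2)] by simp
qed

section \<open>Independence of the scalar curvature from the orthonormal coframe\<close>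

lemma top4_swap: "top4 (\<lambda>i j k l. top4 (\<lambda>I J K L. f I J K L i j k l)) = top4 (\<lambda>I J K L. top4 (\<lambda>i j k l. f I J K L i j k l))"
  for f :: "4 \<Rightarrow> 4 \<Rightarrow> 4 \<Rightarrow> 4 \<Rightarrow> 4 \<Rightarrow> 4 \<Rightarrow> 4 \<Rightarrow> 4 \<Rightarrow> real"
proof -
  have t: "top4 F = (\<Sum>p\<in>UNIV. eps (fst p) (fst (snd p)) (fst (snd (snd p))) (snd (snd (snd p))) *
      F (fst p) (fst (snd p)) (fst (snd (snd p))) (snd (snd (snd p))))" for F :: "4 \<Rightarrow> 4 \<Rightarrow> 4 \<Rightarrow> 4 \<Rightarrow> real"
    unfolding top4_def sum_UNIV_prod by simp
  show ?thesis
    unfolding t sum_distrib_left by (subst sum.swap) (simp add: mult_ac)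
qed

text \<open>Numerator and volume both change by \<open>det Q\<close>, so the quotient is invariant
  even if \<open>Q\<close> reverses the orientation.\<close>

lemma coframe_scal_gauge:
  assumes S: "open S" "x \<in> S" and e: "smooth_on S e" "\<And>y. y \<in> S \<Longrightarrow> det (e y) \<noteq> 0" and Q: "smooth_on S Q"
    and orth: "\<And>y. y \<in> S \<Longrightarrow> transpose (Q y) ** Q y = mat 1"
    and e': "\<And>y i. y \<in> S \<Longrightarrow> e' y $ i = Q y *v e y $ i" "\<And>y. y \<in> S \<Longrightarrow> det (e' y) \<noteq> 0"
  shows "coframe_scal e' x = coframe_scal e x"
proof -
  have p: "pd i (\<lambda>y. y) y $ j = of_bool (i = j)" for i j and y :: "real^4"
    by (simp add: pd_eq[OF has_derivative_ident] axis_def)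
  \<comment> \<open>The law for the connection is used with the identity as change of
    coordinates.\<close>
  have pull: "pullback1 (\<lambda>y. y) \<theta> y = \<theta> y" for \<theta> :: "real^4 \<Rightarrow> 'v::euclidean_space^4" and y
  proof -
    have "(\<Sum>j\<in>UNIV. of_bool (i = j) *\<^sub>R \<theta> y $ j) = \<theta> y $ i" for i
      using exhaust_4[of i] by (auto simp: sum_4)
    then show ?thesis by (simp add: vec_eq_iff pullback1_nth p del: sum_4) 
  qed
  have blt: "bounded_linear (transpose :: real^4^4 \<Rightarrow> real^4^4)"
    by (intro linear_conv_bounded_linear[THEN iffD1] linearI) (simp_all add: transpose_def vec_eq_iff)
  have lc: "lc_conn e' y $ i = Q y ** lc_conn e y $ i ** transpose (Q y) - pd i Q y ** transpose (Q y)" if "y \<in> S" for y i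
    using lc_conn_gauge[OF S(1) that S(1) smooth_on_id _ e(1), of Q e' i] e(2)[OF that] e'(2)[OF that] Q orth e'(1)
    by (simp add: pull)
  define R where "R = (\<lambda>j k. curvature (lc_conn e) x [j, k])"
  have R': "curvature (lc_conn e') x [j, k] = Q x ** R j k ** transpose (Q x)" for j k
    unfolding R_def
    by (rule curvature_gauge[OF S Q smooth_on_linear[OF blt S(1) Q] smooth_on_lc_conn[OF S(1) e] orth lc])
  have R'nth: "curvature (lc_conn e') x [j, k] $ I $ J = (\<Sum>A\<in>UNIV. \<Sum>B\<in>UNIV. Q x $ I $ A * Q x $ J $ B * R j k $ A $ B)" for j k I J
    unfolding R' by (simp add: matrix_matrix_mult_def transpose_def sum_distrib_right sum_distrib_left mult_ac) (subst sum.swap, simp add: mult_ac)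
  have e'nth: "e' x $ i $ K = (\<Sum>C\<in>UNIV. Q x $ K $ C * e x $ i $ C)" for i K
    by (simp add: e'(1)[OF S(2)] matrix_vector_mult_def)
  \<comment> \<open>The contraction over the frame indices is transformed for fixed coordinate
    indices; \<open>top4_swap\<close> then exchanges the two contractions.\<close>
  have "top4 (\<lambda>I J K L. e' x $ i $ K * curvature (lc_conn e') x [j, k] $ I $ J * e' x $ l $ L)
      = det (Q x) *\<^sub>R top4 (\<lambda>I J K L. e x $ i $ K * R j k $ I $ J * e x $ l $ L)" for i j k l
  proof (rule top4_transform)
    fix I J K L
    have "e' x $ i $ K * curvature (lc_conn e') x [j, k] $ I $ J * e' x $ l $ L
      = (\<Sum>A\<in>UNIV. \<Sum>B\<in>UNIV. Q x $ I $ A * Q x $ J $ B * R j k $ A $ B) * (\<Sum>C\<in>UNIV. \<Sum>D\<in>UNIV. (Q x $ K $ C * e x $ i $ C) * (Q x $ L $ D * e x $ l $ D))"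
      unfolding e'nth R'nth sum_product[symmetric] by (simp only: mult_ac)
    also have "\<dots> = (\<Sum>A\<in>UNIV. \<Sum>B\<in>UNIV. \<Sum>C\<in>UNIV. \<Sum>D\<in>UNIV. (Q x $ I $ A * Q x $ J $ B * Q x $ K $ C * Q x $ L $ D) *\<^sub>R
       (e x $ i $ C * R j k $ A $ B * e x $ l $ D))"
      unfolding sum_distrib_right unfolding sum_distrib_left by (simp add: mult_ac)
    finally show "e' x $ i $ K * curvature (lc_conn e') x [j, k] $ I $ J * e' x $ l $ L = \<dots>" .
  qed
  then have "top4 (\<lambda>I J K L. top4 (\<lambda>i j k l. e' x $ i $ K * curvature (lc_conn e') x [j, k] $ I $ J * e' x $ l $ L))
    = det (Q x) *\<^sub>R top4 (\<lambda>I J K L. top4 (\<lambda>i j k l. e x $ i $ K * R j k $ I $ J * e x $ l $ L))"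
    using top4_linear(3)[of "det (Q x)", where 'a=real] by (subst (1 2) top4_swap[symmetric]) simp
  then have n: "(\<Sum>I\<in>UNIV. \<Sum>J\<in>UNIV. \<Sum>K\<in>UNIV. \<Sum>L\<in>UNIV. eps I J K L * curv_form (e' x) (\<lambda>j k. curvature (lc_conn e') x [j, k]) I J K L)
    = det (Q x) * (\<Sum>I\<in>UNIV. \<Sum>J\<in>UNIV. \<Sum>K\<in>UNIV. \<Sum>L\<in>UNIV. eps I J K L * curv_form (e x) R I J K L)"
  proof -
    have t: "(\<Sum>I\<in>UNIV. \<Sum>J\<in>UNIV. \<Sum>K\<in>UNIV. \<Sum>L\<in>UNIV. eps I J K L * g I J K L) = top4 g" for g
      by (simp add: top4_def)
    show "?thesis" if "top4 (\<lambda>I J K L. top4 (\<lambda>i j k l. e' x $ i $ K * curvature (lc_conn e') x [j, k] $ I $ J * e' x $ l $ L))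
      = det (Q x) *\<^sub>R top4 (\<lambda>I J K L. top4 (\<lambda>i j k l. e x $ i $ K * R j k $ I $ J * e x $ l $ L))"
      using that unfolding curv_form_def t by simp
  qed
  have "e' x = e x ** transpose (Q x)"
    by (simp add: vec_eq_iff e'nth matrix_matrix_mult_def transpose_def mult.commute)
  then have d: "det (e' x) = det (Q x) * det (e x)" by (simp add: det_mul det_transpose mult.commute)
  have "det (Q x) \<noteq> 0" using e'(2)[OF S(2)] d by auto
  then show ?thesis unfolding coframe_scal_eq n d R_def by simp
qed

lemma coframe_scal_unique:
  assumes S: "open S" "x \<in> S" and e: "orthonormal_coframe S g e" and e': "orthonormal_coframe S g e'"
    and d: "\<And>y. y \<in> S \<Longrightarrow> det (e y) \<noteq> 0"
  shows "coframe_scal e' x = coframe_scal e x"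
proof -
  have sm: "smooth_on S e" "smooth_on S e'" using e e' by (auto simp: orthonormal_coframe_def)
  have g: "e y ** transpose (e y) = e' y ** transpose (e' y)" if "y \<in> S" for y
  proof -
    have "e y ** transpose (e y) = g y" "e' y ** transpose (e' y) = g y"
      using e e' that by (auto simp: orthonormal_coframe_def matrix_matrix_mult_def transpose_def vec_eq_iff)
    then show ?thesis by simp
  qed
  have d': "det (e' y) \<noteq> 0" if "y \<in> S" for y
    using d[OF that] arg_cong[OF g[OF that], of det] by (auto simp: det_mul det_transpose)
  \<comment> \<open>The matrix relating the two coframes; it is orthogonal because both yield the
    same \<open>g\<close>.\<close>
  define Q where "Q y = transpose (matrix_inv (e y) ** e' y)" for y
  have inv: "e y ** matrix_inv (e y) = mat 1" "matrix_inv (e y) ** e y = mat 1" if "y \<in> S" for y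
    using matrix_inv_row[OF d[OF that]] by (auto simp: matrix_matrix_mult_def vec_eq_iff mat_def)
  have e'Q: "e' y = e y ** transpose (Q y)" if "y \<in> S" for y
    using inv(1)[OF that] by (simp add: Q_def transpose_transpose matrix_mul_assoc)
  have orth: "transpose (Q y) ** Q y = mat 1" if "y \<in> S" for y
  proof -
    let ?f = "matrix_inv (e y)"
    have "transpose (Q y) ** Q y = ?f ** (e' y ** transpose (e' y)) ** transpose ?f"
      by (simp add: Q_def matrix_transpose_mul matrix_mul_assoc)
    also have "\<dots> = (?f ** e y) ** transpose (?f ** e y)"
      unfolding g[OF that, symmetric] by (simp add: matrix_transpose_mul matrix_mul_assoc)
    finally show ?thesis by (simp add: inv(2)[OF that] transpose_mat)
  qed
  have smQ: "smooth_on S Q"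
    unfolding smooth_on_vec_iff[OF S(1)]
  proof (intro allI)
    fix i j
    have "smooth_on S (\<lambda>y. \<Sum>k\<in>UNIV. matrix_inv (e y) $ j $ k * e' y $ k $ i)"
      by (intro smooth_on_sum smooth_on_mult smooth_on_matrix_inv smooth_on_nth S(1) sm d)
    then show "smooth_on S (\<lambda>y. Q y $ i $ j)"
      by (simp add: Q_def transpose_def matrix_matrix_mult_def)
  qed
  have eq: "e' y $ i = Q y *v e y $ i" if "y \<in> S" for y i
    using e'Q[OF that] by (simp add: vec_eq_iff matrix_vector_mult_def matrix_matrix_mult_def transpose_def mult.commute)
  show ?thesis
    by (rule coframe_scal_gauge[OF S sm(1) d smQ orth eq d'])
qed

text \<open>The description ranges over all local orthonormal coframes, so any competitor is
  compared with \<open>coframe \<Psi>\<close> on the common neighbourhood.\<close>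

lemma scal_metric_of:
  assumes S: "open S" "x \<in> S" and \<Psi>: "smooth_on S \<Psi>" "\<And>y. y \<in> S \<Longrightarrow> det (coframe \<Psi> y) \<noteq> 0"
  shows "scal (metric_of \<Psi>) x = coframe_scal (coframe \<Psi>) x"
  unfolding scal_def
proof (rule the_equality)
  have o: "orthonormal_coframe S (metric_of \<Psi>) (coframe \<Psi>)"
    by (simp add: orthonormal_coframe_def metric_of_eq smooth_on_coframe[OF S(1) \<Psi>(1)])
  then show "\<exists>S e. open S \<and> x \<in> S \<and> orthonormal_coframe S (metric_of \<Psi>) e \<and> coframe_scal (coframe \<Psi>) x = coframe_scal e x"
    using S by blast
  fix s assume "\<exists>S e. open S \<and> x \<in> S \<and> orthonormal_coframe S (metric_of \<Psi>) e \<and> s = coframe_scal e x"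
  then obtain T e where T: "open T" "x \<in> T" "orthonormal_coframe T (metric_of \<Psi>) e" and s: "s = coframe_scal e x" by blast
  have "orthonormal_coframe (S \<inter> T) (metric_of \<Psi>) (coframe \<Psi>)" "orthonormal_coframe (S \<inter> T) (metric_of \<Psi>) e"
    using o T(3) by (auto simp: orthonormal_coframe_def intro: smooth_on_subset[of S] smooth_on_subset[of T])
  then show "s = coframe_scal (coframe \<Psi>) x"
    unfolding s using S T \<Psi>(2) by (intro coframe_scal_unique[of "S \<inter> T"]) auto
qed

text \<open>Origin of the constants: the square of
  \<open>\<Psi>\<^sup>\<dagger> \<Psi> = 2 i \<omega>\<close> is \<open>-8 dV\<close>, and
  \<open>-8 \<nu> = 6 \<lambda> - 2 \<mu>\<close> equals
  \<open>-\<lambda> (2 \<mu> / \<lambda> - 6)\<close>. The term in \<open>da\<close> becomes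
  \<open>2 \<mu> \<omega> \<and> i da\<close>.\<close>

theorem lagrangian_asd_conn:
  assumes S: "open S" "x \<in> S" and \<Psi>: "smooth_on S \<Psi>" "\<And>y. y \<in> S \<Longrightarrow> det (coframe \<Psi> y) \<noteq> 0"
    and lam: "lam \<noteq> 0" and nu: "3 * lam - mu + 4 * nu = 0"
  shows "lagrangian lam mu nu \<Psi> (asd_conn \<Psi>) a x [1, 2, 3, 4] =
    - of_real lam * metric_lagrangian (mu / lam) (metric_of \<Psi>) (omega_of \<Psi>) a x [1, 2, 3, 4]"
proof -
  let ?d = "det (coframe \<Psi> x)"
  have h: "homog 2 (\<lambda>y ys. \<i> * ext_d (form1 a) y ys)"
    using homog_ext_d_form1[of a] by (simp add: homog_def)
  define w where "w = wedge (\<lambda>r c. of_real r * c) (omega_of \<Psi>) (\<lambda>y ys. \<i> * ext_d (form1 a) y ys) x [1, 2, 3, 4]"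
  have 1: "wedge (*) (ext_d (form1 a)) (psi_psi \<Psi>) x [1, 2, 3, 4] = 2 * w"
    unfolding w_def
    by (subst wedge22[OF _ _ homog_ext_d_form1 homog_psi_psi], simp, simp, subst wedge22[OF _ _ homog_omega h])
      (simp_all add: psi_psi_omega algebra_simps)
  have 2: "wedge (*) (psi_psi \<Psi>) (psi_psi \<Psi>) x [1, 2, 3, 4] = of_real (- 8 * ?d)"
  proof -
    have "wedge (*) (psi_psi \<Psi>) (psi_psi \<Psi>) x [1, 2, 3, 4] = - 4 * of_real (wedge (*) (omega_of \<Psi>) (omega_of \<Psi>) x [1, 2, 3, 4])"
      by (subst wedge22[OF _ _ homog_psi_psi homog_psi_psi], simp, simp, subst wedge22[OF _ _ homog_omega homog_omega])
        (simp_all add: psi_psi_omega algebra_simps)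
    then show ?thesis by (simp add: omega_omega)
  qed
  have mu: "mu = 3 * lam + 4 * nu" using nu by simp
  have "lagrangian lam mu nu \<Psi> (asd_conn \<Psi>) a x [1, 2, 3, 4] =
      of_real (- lam * (coframe_scal (coframe \<Psi>) x * ?d) - 8 * nu * ?d) + of_real (2 * mu) * w"
    unfolding lagrangian_def by (simp add: 1 2 psi_F_psi_asd_conn[OF S \<Psi>])
  moreover have "metric_lagrangian (mu / lam) (metric_of \<Psi>) (omega_of \<Psi>) a x [1, 2, 3, 4]
     = of_real ((coframe_scal (coframe \<Psi>) x + 2 * (mu / lam) - 6) * ?d) - of_real (2 * (mu / lam)) * w"
    unfolding metric_lagrangian_def w_def by (simp only: scal_metric_of[OF S \<Psi>] metric_vol_eq)
  moreover have "- lam * ((coframe_scal (coframe \<Psi>) x + 2 * (mu / lam) - 6) * ?d)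
     = - lam * (coframe_scal (coframe \<Psi>) x * ?d) - 8 * nu * ?d" "- lam * (2 * (mu / lam)) = - 2 * mu"
    using lam by (simp_all add: mu field_simps)
  ultimately show ?thesis
    by (simp only: right_diff_distrib mult.assoc[symmetric] of_real_mult[symmetric] of_real_minus[symmetric]) simp
qed

subsection \<open>Transition maps\<close>

lemma open_image_chart:
  assumes "homeomorphism U V f g" "open U" "open V" "open W" "W \<subseteq> U"
  shows "open (f ` W)"
proof -
  have "openin (top_of_set V) (f ` W)"
    by (rule homeomorphism_imp_open_map[OF assms(1)]) (use assms in \<open>simp add: openin_open_eq\<close>)
  then show ?thesis using assms(3) by (simp add: openin_open_eq)
qed

locale atlas =
  fixes U :: "nat \<Rightarrow> 'm::{t2_space, second_countable_topology} set" and \<phi> :: "nat \<Rightarrow> 'm \<Rightarrow> real^4"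
  assumes atlas: "smooth_atlas U \<phi>"
begin

definition chart_inv :: "nat \<Rightarrow> real^4 \<Rightarrow> 'm" where "chart_inv n = inv_into (U n) (\<phi> n)"
abbreviation dom :: "nat \<Rightarrow> (real^4) set" where "dom n \<equiv> \<phi> n ` U n"
abbreviation overlap :: "nat \<Rightarrow> nat \<Rightarrow> (real^4) set" where "overlap m n \<equiv> \<phi> m ` (U m \<inter> U n)"
abbreviation tmap :: "nat \<Rightarrow> nat \<Rightarrow> real^4 \<Rightarrow> real^4" where "tmap \<equiv> trans_map U \<phi>"
text \<open>Transposed Jacobian matrix: rows are indexed by the direction of differentiation, so
  that components of one-forms are pulled back by multiplication from the left.\<close>

definition jac :: "nat \<Rightarrow> nat \<Rightarrow> real^4 \<Rightarrow> real^4^4" where "jac m n x = (\<chi> i j. pd i (tmap m n) x $ j)"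

lemma chart: "open (U n)" "open (dom n)" "homeomorphism (U n) (dom n) (\<phi> n) (chart_inv n)"
  and cover: "(\<Union>n. U n) = UNIV"
  and smooth_trans: "smooth_on (overlap m n) (tmap m n)"
  using atlas by (auto simp: smooth_atlas_def chart_inv_def)

lemma chart_inv_left [simp]: "p \<in> U n \<Longrightarrow> chart_inv n (\<phi> n p) = p"
  using chart(3) by (simp add: homeomorphism_def)

lemma chart_inv_in: "x \<in> dom n \<Longrightarrow> chart_inv n x \<in> U n" "x \<in> dom n \<Longrightarrow> \<phi> n (chart_inv n x) = x"
  by auto

lemma inj_chart: "inj_on (\<phi> n) (U n)"
  by (metis chart_inv_left inj_on_inverseI)

lemma open_chart_image: "open W \<Longrightarrow> W \<subseteq> U n \<Longrightarrow> open (\<phi> n ` W)"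
  by (rule open_image_chart[OF chart(3,1,2)])

lemma open_overlap: "open (overlap m n)"
  using chart by (intro open_chart_image) auto

lemma trans_chart [simp]: "p \<in> U m \<Longrightarrow> tmap m n (\<phi> m p) = \<phi> n p"
  using chart_inv_left by (simp add: trans_map_def chart_inv_def)

lemma trans_dom: "x \<in> overlap m n \<Longrightarrow> tmap m n x \<in> dom n"
  by auto

lemma trans_image: "W \<subseteq> U m \<Longrightarrow> tmap m n ` \<phi> m ` W = \<phi> n ` W"
  by (force simp: image_iff)

lemma inj_trans: "inj_on (tmap m n) (overlap m n)"
  using inj_chart[of n] by (auto simp: inj_on_def)

lemma continuous_chart: "continuous_on (U n) (\<phi> n)" "continuous_on (dom n) (chart_inv n)"
  using chart(3) by (auto simp: homeomorphism_def)

lemma borel_chart_image: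
  assumes "K \<in> sets borel" "K \<subseteq> U n"
  shows "\<phi> n ` K \<in> sets borel"
proof -
  have "chart_inv n \<in> borel_measurable (restrict_space borel (dom n))"
    by (rule borel_measurable_continuous_on_restrict[OF continuous_chart(2)])
  then have "chart_inv n -` K \<inter> space (restrict_space borel (dom n)) \<in> sets (restrict_space borel (dom n))"
    using assms(1) by (rule measurable_sets)
  moreover have "chart_inv n -` K \<inter> space (restrict_space borel (dom n)) = \<phi> n ` K"
    using assms(2) by (auto simp: space_restrict_space intro: rev_image_eqI)
  ultimately show ?thesis
    using chart(2)[of n] by (simp add: sets_restrict_space_iff borel_open)
qed

lemma compact_chart_image: "compact K \<Longrightarrow> K \<subseteq> U n \<Longrightarrow> compact (\<phi> n ` K)"
  by (rule compact_continuous_image[OF continuous_on_subset[OF continuous_chart(1)]])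

lemma compact_chart_inv: "compact C \<Longrightarrow> C \<subseteq> dom n \<Longrightarrow> compact (chart_inv n ` C)"
  by (rule compact_continuous_image[OF continuous_on_subset[OF continuous_chart(2)]])

lemma jac_pullback: "(\<Sum>j\<in>UNIV. pd i (tmap m n) x $ j *\<^sub>R \<theta> $ j) = (\<Sum>j\<in>UNIV. jac m n x $ i $ j *\<^sub>R \<theta> $ j)"
  by (simp add: jac_def)

lemma trans_has_derivative:
  assumes "x \<in> overlap m n"
  shows "(tmap m n has_derivative frechet_derivative (tmap m n) (at x)) (at x)"
  by (rule differentiable_imp_has_derivative[OF smooth_on_differentiable[OF open_overlap smooth_trans assms]])

lemma det_trans_derivative: "det (matrix (frechet_derivative (tmap m n) (at x))) = det (jac m n x)"
proof -
  have "jac m n x = transpose (matrix (frechet_derivative (tmap m n) (at x)))"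
    by (simp add: jac_def matrix_def transpose_def pd_def)
  then show ?thesis by (simp add: det_transpose)
qed

subsection \<open>Integrals of four-forms\<close>

text \<open>A four-form changes by the signed determinant; multiplied by the orientation sign of the
  frame it changes by the modulus, as the change of variables formula asks.\<close>

definition is_density :: "(nat \<Rightarrow> real^4 \<Rightarrow> 'v::real_vector) \<Rightarrow> bool" where
  "is_density f \<longleftrightarrow> (\<forall>m n. \<forall>x\<in>overlap m n. f m x = \<bar>det (jac m n x)\<bar> *\<^sub>R f n (tmap m n x))"

lemma densityD: "is_density f \<Longrightarrow> x \<in> overlap m n \<Longrightarrow> f m x = \<bar>det (jac m n x)\<bar> *\<^sub>R f n (tmap m n x)"
  unfolding is_density_def by blast

end

text \<open>The change of variables formula speaks of absolute integrability for the completed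
  measure, the integral over the manifold of \<open>lborel\<close>; for Borel functions the two
  agree.\<close>

lemma integrable_lborel_iff_absolutely_integrable:
  fixes f :: "real^4 \<Rightarrow> 'b::euclidean_space"
  assumes "(\<lambda>x. indicator S x *\<^sub>R f x) \<in> borel_measurable borel"
  shows "integrable lborel (\<lambda>x. indicator S x *\<^sub>R f x) \<longleftrightarrow> f absolutely_integrable_on S"
    and "integrable lborel (\<lambda>x. indicator S x *\<^sub>R f x) \<Longrightarrow> (\<integral>x. indicator S x *\<^sub>R f x \<partial>lborel) = integral S f"
proof -
  have m: "(\<lambda>x. indicator S x *\<^sub>R f x) \<in> borel_measurable lborel" using assms by simp
  show iff: "integrable lborel (\<lambda>x. indicator S x *\<^sub>R f x) \<longleftrightarrow> f absolutely_integrable_on S"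
    unfolding set_integrable_def by (rule integrable_completion[OF m, symmetric])
  assume "integrable lborel (\<lambda>x. indicator S x *\<^sub>R f x)"
  then have "f absolutely_integrable_on S" using iff by simp
  then have "integral S f = (LINT x:S|lebesgue. f x)"
    by (simp add: set_lebesgue_integral_eq_integral)
  then show "(\<integral>x. indicator S x *\<^sub>R f x \<partial>lborel) = integral S f"
    unfolding set_lebesgue_integral_def by (simp add: integral_completion[OF m])
qed

definition to_vec2 :: "complex \<Rightarrow> real^2" where "to_vec2 z = (\<chi> i. if i = 1 then Re z else Im z)"
definition of_vec2 :: "real^2 \<Rightarrow> complex" where "of_vec2 v = Complex (v $ 1) (v $ 2)"

lemma vec2_simps: "of_vec2 (to_vec2 z) = z" "to_vec2 (r *\<^sub>R z) = r *\<^sub>R to_vec2 z"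
  by (simp_all add: of_vec2_def to_vec2_def vec_eq_iff forall_2)

lemma bounded_linear_vec2: "bounded_linear to_vec2" "bounded_linear of_vec2"
  by (auto intro!: linear_conv_bounded_linear[THEN iffD1] linearI
      simp: of_vec2_def to_vec2_def vec_eq_iff forall_2 complex_eq_iff)

text \<open>The formula for functions into \<open>real^2\<close>, conjugated with the identification
  of complex numbers with pairs of reals.\<close>

lemma complex_change_of_variables:
  fixes f :: "real^4 \<Rightarrow> complex"
  assumes S: "S \<in> sets lebesgue" and d: "\<And>x. x \<in> S \<Longrightarrow> (g has_derivative g' x) (at x within S)" and inj: "inj_on g S"
    and f: "f absolutely_integrable_on (g ` S)"
  shows "(\<lambda>x. \<bar>det (matrix (g' x))\<bar> *\<^sub>R f (g x)) absolutely_integrable_on S"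
    and "integral S (\<lambda>x. \<bar>det (matrix (g' x))\<bar> *\<^sub>R f (g x)) = integral (g ` S) f"
proof -
  have F: "(to_vec2 \<circ> f) absolutely_integrable_on (g ` S)"
    by (rule absolutely_integrable_linear[OF f bounded_linear_vec2(1)])
  have *: "(\<lambda>x. \<bar>det (matrix (g' x))\<bar> *\<^sub>R (to_vec2 \<circ> f) (g x)) absolutely_integrable_on S \<and>
     integral S (\<lambda>x. \<bar>det (matrix (g' x))\<bar> *\<^sub>R (to_vec2 \<circ> f) (g x)) = integral (g ` S) (to_vec2 \<circ> f)"
    using has_absolute_integral_change_of_variables[OF S d inj] F by blast
  have e: "of_vec2 \<circ> (\<lambda>x. \<bar>det (matrix (g' x))\<bar> *\<^sub>R (to_vec2 \<circ> f) (g x)) = (\<lambda>x. \<bar>det (matrix (g' x))\<bar> *\<^sub>R f (g x))"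
    by (simp only: o_def vec2_simps(2)[symmetric] vec2_simps(1))
  show "(\<lambda>x. \<bar>det (matrix (g' x))\<bar> *\<^sub>R f (g x)) absolutely_integrable_on S"
    using absolutely_integrable_linear[OF conjunct1[OF *] bounded_linear_vec2(2)] by (simp only: e)
  have "integral S (of_vec2 \<circ> (\<lambda>x. \<bar>det (matrix (g' x))\<bar> *\<^sub>R (to_vec2 \<circ> f) (g x))) = of_vec2 (integral (g ` S) (to_vec2 \<circ> f))"
    using integral_linear[OF set_lebesgue_integral_eq_integral(1)[OF conjunct1[OF *]] bounded_linear_vec2(2)] by (simp only: conjunct2[OF *])
  also have "integral (g ` S) (to_vec2 \<circ> f) = to_vec2 (integral (g ` S) f)"
    by (rule integral_linear[OF set_lebesgue_integral_eq_integral(1)[OF f] bounded_linear_vec2(1)])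
  finally show "integral S (\<lambda>x. \<bar>det (matrix (g' x))\<bar> *\<^sub>R f (g x)) = integral (g ` S) f"
    unfolding e vec2_simps .
qed

lemma measurable_indicator_continuous:
  fixes f :: "real^4 \<Rightarrow> 'b::euclidean_space"
  assumes "A \<in> sets borel" "A \<subseteq> S" "open S" "continuous_on S f"
  shows "(\<lambda>x. indicator A x *\<^sub>R f x) \<in> borel_measurable borel"
proof -
  have "(\<lambda>x. indicator S x *\<^sub>R f x) \<in> borel_measurable borel"
    by (rule borel_measurable_continuous_on_indicator[OF borel_open[OF assms(3)] assms(4)])
  then have "(\<lambda>x. indicator A x *\<^sub>R (indicator S x *\<^sub>R f x)) \<in> borel_measurable borel"
    using assms(1) by - (rule borel_measurable_scaleR, rule borel_measurable_indicator, auto)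
  moreover have "(\<lambda>x. indicator A x *\<^sub>R (indicator S x *\<^sub>R f x)) = (\<lambda>x. indicator A x *\<^sub>R f x)"
    using assms(2) by (intro ext) (auto split: split_indicator)
  ultimately show ?thesis by simp
qed

text \<open>Only finitely many sheets contribute, so summability is trivial and Fubini reduces the
  integral over the product to a finite sum.\<close>

lemma integral_count_lborel:
  fixes f :: "nat \<times> (real^4) \<Rightarrow> complex"
  assumes int: "\<And>n. integrable lborel (\<lambda>x. f (n, x))" and z: "\<And>n x. n \<ge> N \<Longrightarrow> f (n, x) = 0"
  shows "integrable (count_space UNIV \<Otimes>\<^sub>M lborel) f"
    and "integral\<^sup>L (count_space UNIV \<Otimes>\<^sub>M lborel) f = (\<Sum>n<N. \<integral>x. f (n, x) \<partial>lborel)"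
proof -
  interpret c: sigma_finite_measure "count_space (UNIV :: nat set)"
    by (rule sigma_finite_measure_count_space)
  interpret pair_sigma_finite "count_space (UNIV :: nat set)" "lborel :: (real^4) measure" ..
  have m: "f \<in> borel_measurable (count_space UNIV \<Otimes>\<^sub>M lborel)"
    using int by (intro measurable_pair_measure_countable1) (auto dest: borel_measurable_integrable)
  have "summable (\<lambda>n. norm (\<integral>x. norm (f (n, x)) \<partial>lborel))"
    by (rule summable_finite[of "{..<N}"]) (auto simp: z)
  then have "integrable (count_space UNIV) (\<lambda>n. \<integral>x. norm (f (n, x)) \<partial>lborel)"
    by (simp add: integrable_count_space_nat_iff)
  then show i: "integrable (count_space UNIV \<Otimes>\<^sub>M lborel) f"
    using int by (intro Fubini_integrable m) auto
  have s: "summable (\<lambda>n. norm (\<integral>x. f (n, x) \<partial>lborel))"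
    by (rule summable_finite[of "{..<N}"]) (auto simp: z)
  have "integral\<^sup>L (count_space UNIV \<Otimes>\<^sub>M lborel) f = (\<integral>n. (\<integral>x. f (n, x) \<partial>lborel) \<partial>count_space UNIV)"
    by (rule integral_fst'[OF i, symmetric])
  also have "\<dots> = (\<Sum>n. \<integral>x. f (n, x) \<partial>lborel)"
    using s by (intro integral_count_space_nat) (simp add: integrable_count_space_nat_iff)
  also have "\<dots> = (\<Sum>n<N. \<integral>x. f (n, x) \<partial>lborel)"
    by (rule suminf_finite) (auto simp: z)
  finally show "integral\<^sup>L (count_space UNIV \<Otimes>\<^sub>M lborel) f = (\<Sum>n<N. \<integral>x. f (n, x) \<partial>lborel)" .
qed

context atlas
begin

definition piece :: "nat \<Rightarrow> 'm set" where "piece n = U n - (\<Union>m<n. U m)"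

lemma borel_piece: "piece n \<in> sets borel"
  unfolding piece_def using chart(1) by (auto intro!: sets.Diff borel_open)

lemma piece_cover: "\<exists>n. p \<in> piece n"
proof -
  obtain n where "p \<in> U n" using cover by blast
  then have "p \<in> U (LEAST n. p \<in> U n)" by (rule LeastI)
  moreover have "p \<notin> U m" if "m < (LEAST n. p \<in> U n)" for m using not_less_Least[OF that] .
  ultimately show ?thesis unfolding piece_def by blast
qed

lemma piece_disjoint: "m \<noteq> n \<Longrightarrow> piece m \<inter> piece n = {}"
  unfolding piece_def by (cases m n rule: linorder_cases) auto

lemma piece_subset: "piece n \<subseteq> U n"
  by (auto simp: piece_def)

lemma local_integrand_eq:
  "local_integrand U \<phi> V K L (n, x) = indicator (\<phi> n ` (K \<inter> piece n)) x *\<^sub>R (sgn (V n x [1, 2, 3, 4]) *\<^sub>R L n x [1, 2, 3, 4])"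
  by (simp add: local_integrand_def piece_def indicator_def)

text \<open>Change of variables along the transition map on a set common to both charts; the density
  law supplies the modulus of the Jacobian determinant, continuity on the chart domains the
  measurability.\<close>

lemma change_chart:
  fixes f :: "nat \<Rightarrow> real^4 \<Rightarrow> complex"
  assumes f: "is_density f" "\<And>n. continuous_on (dom n) (f n)"
    and K: "K \<in> sets borel" "K \<subseteq> U m \<inter> U n"
    and int: "integrable lborel (\<lambda>x. indicator (\<phi> n ` K) x *\<^sub>R f n x)"
  shows "integrable lborel (\<lambda>x. indicator (\<phi> m ` K) x *\<^sub>R f m x)"
    and "(\<integral>x. indicator (\<phi> m ` K) x *\<^sub>R f m x \<partial>lborel) = (\<integral>x. indicator (\<phi> n ` K) x *\<^sub>R f n x \<partial>lborel)"
proof -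
  have Km: "\<phi> m ` K \<in> sets borel" "\<phi> m ` K \<subseteq> dom m" "\<phi> m ` K \<subseteq> overlap m n"
    and Kn: "\<phi> n ` K \<in> sets borel" "\<phi> n ` K \<subseteq> dom n"
    using K borel_chart_image[of K] by auto
  have img: "tmap m n ` \<phi> m ` K = \<phi> n ` K" using K(2) by (intro trans_image) auto
  note mm = measurable_indicator_continuous[OF Km(1,2) chart(2) f(2)]
  note mn = measurable_indicator_continuous[OF Kn(1,2) chart(2) f(2)]
  have abs: "f n absolutely_integrable_on (tmap m n ` \<phi> m ` K)"
    using int integrable_lborel_iff_absolutely_integrable(1)[OF mn] unfolding img by simp
  have S: "\<phi> m ` K \<in> sets lebesgue" using Km(1) by simp
  have d: "(tmap m n has_derivative frechet_derivative (tmap m n) (at x)) (at x within \<phi> m ` K)" if "x \<in> \<phi> m ` K" for x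
    using trans_has_derivative Km(3) that by (blast intro: has_derivative_at_withinI)
  note cv = complex_change_of_variables[OF S d inj_on_subset[OF inj_trans Km(3)] abs]
  have eq: "\<bar>det (matrix (frechet_derivative (tmap m n) (at x)))\<bar> *\<^sub>R f n (tmap m n x) = f m x" if "x \<in> \<phi> m ` K" for x
    using densityD[OF f(1), of x m n] Km(3) that by (auto simp: det_trans_derivative)
  have "f m absolutely_integrable_on (\<phi> m ` K)"
    using cv(1) by (subst set_integrable_cong[OF refl refl eq[symmetric]])
  then show i: "integrable lborel (\<lambda>x. indicator (\<phi> m ` K) x *\<^sub>R f m x)"
    using integrable_lborel_iff_absolutely_integrable(1)[OF mm] by simp
  show "(\<integral>x. indicator (\<phi> m ` K) x *\<^sub>R f m x \<partial>lborel) = (\<integral>x. indicator (\<phi> n ` K) x *\<^sub>R f n x \<partial>lborel)"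
    unfolding integrable_lborel_iff_absolutely_integrable(2)[OF mm i] integrable_lborel_iff_absolutely_integrable(2)[OF mn int]
    using cv(2) by (simp only: img Henstock_Kurzweil_Integration.integral_cong[OF eq])
qed

text \<open>Only the pieces up to the \<open>n\<close>-th meet \<open>U n\<close>.\<close>

lemma integral_in_chart:
  fixes f :: "nat \<Rightarrow> real^4 \<Rightarrow> complex"
  assumes f: "is_density f" "\<And>n. continuous_on (dom n) (f n)"
    and fL: "\<And>n x. x \<in> dom n \<Longrightarrow> f n x = sgn (V n x [1, 2, 3, 4]) *\<^sub>R L n x [1, 2, 3, 4]"
    and K: "K \<in> sets borel" "K \<subseteq> U n" and int: "integrable lborel (\<lambda>x. indicator (\<phi> n ` K) x *\<^sub>R f n x)"
  shows "form_integrable U \<phi> V K L"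
    and "form_integral U \<phi> V K L = (\<integral>x. indicator (\<phi> n ` K) x *\<^sub>R f n x \<partial>lborel)"
proof -
  define Km where "Km m = K \<inter> piece m" for m
  have Km: "Km m \<in> sets borel" "Km m \<subseteq> U m \<inter> U n" for m
    using K borel_piece[of m] piece_subset[of m] by (auto simp: Km_def)
  have li: "local_integrand U \<phi> V K L (m, x) = indicator (\<phi> m ` Km m) x *\<^sub>R f m x" for m x
    using Km(2)[of m] fL[of x m] unfolding local_integrand_eq Km_def by (auto simp: indicator_def)
  have in_n: "integrable lborel (\<lambda>x. indicator (\<phi> n ` Km m) x *\<^sub>R f n x)" for m
  proof -
    have "integrable lborel (\<lambda>x. indicator (\<phi> n ` Km m) x *\<^sub>R (indicator (\<phi> n ` K) x *\<^sub>R f n x))"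
      using int borel_chart_image[OF Km(1)] Km(2) by - (rule integrable_mult_indicator, auto)
    moreover have "(\<lambda>x. indicator (\<phi> n ` Km m) x *\<^sub>R (indicator (\<phi> n ` K) x *\<^sub>R f n x)) = (\<lambda>x. indicator (\<phi> n ` Km m) x *\<^sub>R f n x)"
      by (intro ext) (auto simp: Km_def split: split_indicator)
    ultimately show ?thesis by simp
  qed
  note cc = change_chart[OF f Km in_n]
  have z: "local_integrand U \<phi> V K L (m, x) = 0" if "m \<ge> Suc n" for m x
  proof -
    have "Km m = {}" using that K(2) by (auto simp: Km_def piece_def)
    then show ?thesis by (simp add: li)
  qed
  have i: "integrable lborel (\<lambda>x. local_integrand U \<phi> V K L (m, x))" for m
    unfolding li by (rule cc(1))
  show "form_integrable U \<phi> V K L"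
    unfolding form_integrable_def by (rule integral_count_lborel(1)[OF i z])
  have "form_integral U \<phi> V K L = (\<Sum>m<Suc n. \<integral>x. indicator (\<phi> m ` Km m) x *\<^sub>R f m x \<partial>lborel)"
    by (simp only: form_integral_def integral_count_lborel(2)[OF i z] li)
  \<comment> \<open>By definition each piece is integrated in its own chart; here all of them are
    moved to chart \<open>n\<close>.\<close>
  also have "\<dots> = (\<Sum>m<Suc n. \<integral>x. indicator (\<phi> n ` Km m) x *\<^sub>R f n x \<partial>lborel)"
    by (simp only: cc(2))
  also have "\<dots> = (\<integral>x. (\<Sum>m<Suc n. indicator (\<phi> n ` Km m) x *\<^sub>R f n x) \<partial>lborel)"
    by (rule Bochner_Integration.integral_sum[symmetric]) (rule in_n)
  also have "(\<lambda>x. \<Sum>m<Suc n. indicator (\<phi> n ` Km m) x *\<^sub>R f n x) = (\<lambda>x. indicator (\<phi> n ` K) x *\<^sub>R f n x)"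
  proof
    fix x
    \<comment> \<open>The pieces partition \<open>K\<close>, and injectivity of the chart keeps
      their images disjoint.\<close>
    have "(\<Sum>m<Suc n. indicator (\<phi> n ` Km m) x) = (indicator (\<phi> n ` K) x :: real)"
    proof (cases "x \<in> \<phi> n ` K")
      case True
      then obtain p where p: "p \<in> K" "x = \<phi> n p" by auto
      obtain k where k: "p \<in> piece k" using piece_cover by blast
      have iff: "x \<in> \<phi> n ` Km m \<longleftrightarrow> p \<in> Km m" for m
      proof
        assume "x \<in> \<phi> n ` Km m"
        then obtain q where q: "q \<in> Km m" "\<phi> n p = \<phi> n q" using p by auto
        have "p = q" by (rule inj_onD[OF inj_chart q(2)]) (use q p K(2) Km(2)[of m] in auto)
        then show "p \<in> Km m" using q by simp
      qed (use p in auto)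
      have "p \<in> Km m \<longleftrightarrow> m = k" for m
        using p k piece_disjoint[of m k] by (auto simp: Km_def)
      moreover have "k < Suc n" using k p K(2) by (auto simp: piece_def not_less_eq Suc_le_eq)
      ultimately show ?thesis using True by (simp add: indicator_def iff if_distrib cong: if_cong)
    next
      case False
      then have "x \<notin> \<phi> n ` Km m" for m by (auto simp: Km_def)
      then show ?thesis using False by simp
    qed
    then show "(\<Sum>m<Suc n. indicator (\<phi> n ` Km m) x *\<^sub>R f n x) = indicator (\<phi> n ` K) x *\<^sub>R f n x"
      by (simp only: scaleR_sum_left[symmetric])
  qed
  finally show "form_integral U \<phi> V K L = (\<integral>x. indicator (\<phi> n ` K) x *\<^sub>R f n x \<partial>lborel)" .
qed

lemma integrable_compact_subset:
  fixes f :: "nat \<Rightarrow> real^4 \<Rightarrow> complex"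
  assumes f: "continuous_on (dom n) (f n)" and K: "K \<in> sets borel" "K \<subseteq> C" "compact C" "C \<subseteq> U n"
  shows "integrable lborel (\<lambda>x. indicator (\<phi> n ` K) x *\<^sub>R f n x)"
proof -
  have c: "compact (\<phi> n ` C)" using K by (intro compact_chart_image)
  have "integrable lborel (\<lambda>x. indicator (\<phi> n ` C) x *\<^sub>R f n x)"
    using borel_integrable_compact[OF c continuous_on_subset[OF f]] K(4) by (auto simp: indicator_def if_distrib cong: if_cong)
  then have "integrable lborel (\<lambda>x. indicator (\<phi> n ` K) x *\<^sub>R (indicator (\<phi> n ` C) x *\<^sub>R f n x))"
    using borel_chart_image[of K n] K by - (rule integrable_mult_indicator, auto)
  moreover have "(\<lambda>x. indicator (\<phi> n ` K) x *\<^sub>R (indicator (\<phi> n ` C) x *\<^sub>R f n x)) = (\<lambda>x. indicator (\<phi> n ` K) x *\<^sub>R f n x)"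
    using K(2) by (intro ext) (auto split: split_indicator)
  ultimately show ?thesis by simp
qed

lemma chart_cball:
  assumes "p \<in> U n"
  obtains r where "r > 0" "cball (\<phi> n p) r \<subseteq> dom n"
  using chart(2)[of n] assms open_contains_cball by blast

text \<open>Cover \<open>K\<close> by finitely many compact coordinate balls and remove them one by
  one: the part inside a ball is integrated in one chart, where continuity on a compact set
  suffices.\<close>

lemma form_integrable_compact:
  fixes f :: "nat \<Rightarrow> real^4 \<Rightarrow> complex"
  assumes f: "is_density f" "\<And>n. continuous_on (dom n) (f n)"
    and fL: "\<And>n x. x \<in> dom n \<Longrightarrow> f n x = sgn (V n x [1, 2, 3, 4]) *\<^sub>R L n x [1, 2, 3, 4]"
    and K: "compact K"
  shows "form_integrable U \<phi> V K L"
proof -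
  have "\<exists>W C n. open W \<and> p \<in> W \<and> W \<subseteq> C \<and> compact C \<and> C \<subseteq> U n" for p
  proof -
    obtain n where n: "p \<in> U n" using cover by blast
    obtain r where r: "r > 0" "cball (\<phi> n p) r \<subseteq> dom n" using chart_cball[OF n] .
    define C where "C = chart_inv n ` cball (\<phi> n p) r"
    define W where "W = U n \<inter> \<phi> n -` ball (\<phi> n p) r"
    have "open W" unfolding W_def
      using continuous_open_preimage[OF continuous_chart(1) chart(1) open_ball] by (simp add: Int_commute)
    moreover have "W \<subseteq> C"
    proof
      fix q assume "q \<in> W"
      then have "q = chart_inv n (\<phi> n q)" "\<phi> n q \<in> cball (\<phi> n p) r" by (auto simp: W_def)
      then show "q \<in> C" unfolding C_def by blast
    qed
    moreover have "compact C" "C \<subseteq> U n" using compact_chart_inv[OF compact_cball r(2)] r(2) chart_inv_in(1) by (auto simp: C_def)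
    moreover have "p \<in> W" using n r(1) by (simp add: W_def)
    ultimately show ?thesis by blast
  qed
  then obtain W C n where WC: "\<And>p. open (W p)" "\<And>p. p \<in> W p" "\<And>p. W p \<subseteq> C p" "\<And>p. compact (C p)" "\<And>p. C p \<subseteq> U (n p)"
    by metis
  obtain P where P: "P \<subseteq> K" "finite P" "K \<subseteq> (\<Union>p\<in>P. W p)"
    using compactE_image[OF K, of K W] WC(1,2) by (metis UN_I subsetI)
  \<comment> \<open>Stated for Borel sets, because what remains after removing a ball need not be
    compact.\<close>
  have "form_integrable U \<phi> V K' L" if "finite P" "K' \<in> sets borel" "K' \<subseteq> (\<Union>p\<in>P. C p)" for P K'
    using that
  proof (induction P arbitrary: K' rule: finite_induct)
    case empty
    then show ?case by (simp add: form_integrable_def local_integrand_def split_def)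
  next
    case (insert p P)
    have Cp: "C p \<in> sets borel" using WC(4) by (simp add: borel_compact)
    have 1: "form_integrable U \<phi> V (K' \<inter> C p) L"
      using insert.prems Cp WC(4) WC(5)[of p]
      by (intro integral_in_chart(1)[where f=f and V=V and L=L and n="n p", OF f fL] integrable_compact_subset[where C="C p" and f=f, OF f(2)]) auto
    have 2: "form_integrable U \<phi> V (K' - C p) L"
      using insert.prems Cp by (intro insert.IH) auto
    have "local_integrand U \<phi> V K' L (m, x) = local_integrand U \<phi> V (K' \<inter> C p) L (m, x) + local_integrand U \<phi> V (K' - C p) L (m, x)" for m x
    proof -
      have "\<phi> m ` (K' \<inter> piece m) = \<phi> m ` (K' \<inter> C p \<inter> piece m) \<union> \<phi> m ` ((K' - C p) \<inter> piece m)" by blast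
      moreover have "\<phi> m ` (K' \<inter> C p \<inter> piece m) \<inter> \<phi> m ` ((K' - C p) \<inter> piece m) = {}"
        using inj_chart[of m] piece_subset[of m] by (auto simp: inj_on_def)
      ultimately show ?thesis
        unfolding local_integrand_eq scaleR_add_left[symmetric] by (auto simp: indicator_def)
    qed
    then have "local_integrand U \<phi> V K' L = (\<lambda>z. local_integrand U \<phi> V (K' \<inter> C p) L z + local_integrand U \<phi> V (K' - C p) L z)"
      by auto
    then show ?case
      using 1 2 unfolding form_integrable_def by simp
  qed
  then show ?thesis using P WC(3) K by (meson P(2) UN_mono borel_compact order_refl order_trans)
qed

end

section \<open>The \<open>U(2)\<close> curvature, and the Lagrangian as a full contraction\<close>

lemma so4_sum:
  assumes "\<And>k. k \<in> I \<Longrightarrow> so4 (X k)"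
  shows "so4 (\<Sum>k\<in>I. c k *\<^sub>R X k)"
proof (rule so4I)
  fix a b
  have "(\<Sum>k\<in>I. c k * X k $ a $ b) = (\<Sum>k\<in>I. - (c k * X k $ b $ a))"
    by (intro sum.cong refl) (subst so4D[OF assms], simp_all)
  then show "(\<Sum>k\<in>I. c k *\<^sub>R X k) $ a $ b = - (\<Sum>k\<in>I. c k *\<^sub>R X k) $ b $ a"
    by (simp add: sum_negf)
qed

lemma bounded_linear_mat: "bounded_linear (mat :: complex \<Rightarrow> complex^2^2)"
  by (intro linear_conv_bounded_linear[THEN iffD1] linearI) (simp_all add: mat_def vec_eq_iff)

lemma bounded_linear_trace: "bounded_linear (trace :: complex^2^2 \<Rightarrow> complex)"
  by (intro linear_conv_bounded_linear[THEN iffD1] linearI) (simp_all add: trace_def sum_2 algebra_simps)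

lemmas mat_linear = linear_sum[OF bounded_linear.linear[OF bounded_linear_mat]] linear_scale[OF bounded_linear.linear[OF bounded_linear_mat]]
lemmas uncplx_linear = linear_sum[OF bounded_linear.linear[OF bounded_linear_uncplx]] linear_scale[OF bounded_linear.linear[OF bounded_linear_uncplx]]
lemmas asd_matrix_sum = linear_sum[OF bounded_linear.linear[OF bounded_linear_asd_matrix]]

lemmas trace_simps = bounded_linear.linear[OF bounded_linear_trace, THEN linear_add]
  bounded_linear.linear[OF bounded_linear_trace, THEN linear_diff]
  bounded_linear.linear[OF bounded_linear_trace, THEN linear_scale]
  bounded_linear.linear[OF bounded_linear_trace, THEN linear_sum]
  bounded_linear.linear[OF bounded_linear_trace, THEN linear_neg]

lemma mat_commute: "mat z ** X = X ** mat z" for X :: "complex^2^2"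
  by (simp add: mat_def matrix_matrix_mult_def vec_eq_iff forall_2 sum_2 mult.commute)

lemma trace_mat [simp]: "trace (mat z :: complex^2^2) = 2 * z"
  by (simp add: trace_def mat_def sum_2)

text \<open>Multiples of the identity commute with everything, so the abelian part contributes only
  its exterior derivative.\<close>

lemma curvature_u2_conn_form:
  assumes "A differentiable (at x)" "a differentiable (at x)"
  shows "curvature (u2_conn_form A a) x [i, j] = curvature A x [i, j] + mat (ext_d (form1 a) x [i, j])"
proof -
  have d: "(\<lambda>y. A y $ j) differentiable (at x)" "(\<lambda>y. a y $ j) differentiable (at x)" for j
    using assms differentiable_bounded_linear[OF bounded_linear_vec_nth] by blast+
  have p: "pd i (\<lambda>y. A y $ j + mat (a y $ j)) x = pd i (\<lambda>y. A y $ j) x + mat (pd i (\<lambda>y. a y $ j) x)" for i j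
    by (simp add: pd_add d differentiable_bounded_linear[OF bounded_linear_mat] pd_bounded_linear[OF bounded_linear_mat])
  have m: "mat (u - v) = mat u - (mat v :: complex^2^2)" for u v
    by (rule linear_diff[OF bounded_linear.linear[OF bounded_linear_mat]])
  have mm: "(X + mat u) ** (Y + mat v) - (Y + mat v) ** (X + mat u) = X ** Y - Y ** X" for X Y :: "complex^2^2" and u v
    by (simp add: matrix_mult_simps mat_commute[of u Y] mat_commute[of v X] mat_commute[of u "mat v"])
  show ?thesis
    by (simp add: curvature_pair ext_d_form1_pair u2_conn_form_def p m mm)
qed

text \<open>A commutator is tracefree and the trace commutes with derivatives. This lets traces
  separate the \<open>su(2)\<close> and \<open>U(1)\<close> parts of a curvature.\<close>

lemma trace_curvature:
  fixes A :: "real^4 \<Rightarrow> (complex^2^2)^4"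
  assumes "open S" "x \<in> S" "smooth_on S A" "\<And>y i. y \<in> S \<Longrightarrow> trace (A y $ i) = 0"
  shows "trace (curvature A x [i, j]) = 0"
proof -
  have d: "(\<lambda>y. A y $ j) differentiable (at x)" for j
    using smooth_on_differentiable[OF assms(1) smooth_on_nth[OF assms(1,3)] assms(2)] .
  have "trace (pd i (\<lambda>y. A y $ j) x) = pd i (\<lambda>y. trace (A y $ j)) x" for i j
    by (rule pd_bounded_linear[OF bounded_linear_trace d, symmetric])
  also have "\<dots> i j = pd i (\<lambda>y. 0) x" for i j
    by (rule pd_cong[OF assms(1,2)]) (rule assms(4))
  finally have "trace (pd i (\<lambda>y. A y $ j) x) = 0" for i j by simp
  then show ?thesis
    by (simp add: curvature_pair trace_simps trace_mul_sym[of "A x $ i"])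
qed

text \<open>Components of \<open>C \<and> B + B \<and> C\<close>, the polarisation of the quadratic
  term of the curvature.\<close>

definition comm_form :: "(complex^2^2)^4 \<Rightarrow> (complex^2^2)^4 \<Rightarrow> 4 \<Rightarrow> 4 \<Rightarrow> complex^2^2" where
  "comm_form C B j k = C $ j ** B $ k - C $ k ** B $ j + (B $ j ** C $ k - B $ k ** C $ j)"

lemma comm_form_expand:
  "comm_form (\<chi> j. \<Sum>J\<in>UNIV. P $ j $ J *\<^sub>R C $ J) (\<chi> j. \<Sum>J\<in>UNIV. P $ j $ J *\<^sub>R B $ J) j k =
    (\<Sum>J\<in>UNIV. \<Sum>K\<in>UNIV. (P $ j $ J * P $ k $ K) *\<^sub>R comm_form C B J K)" for P :: "real^4^4"
proof -
  have prod: "(\<Sum>J\<in>UNIV. P $ j $ J *\<^sub>R X $ J) ** (\<Sum>J\<in>UNIV. P $ k $ J *\<^sub>R Y $ J)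
      = (\<Sum>J\<in>UNIV. \<Sum>K\<in>UNIV. (P $ j $ J * P $ k $ K) *\<^sub>R (X $ J ** Y $ K))" for j k and X Y :: "(complex^2^2)^4"
    unfolding bounded_bilinear.sum_left[OF bounded_bilinear_matrix_mult]
    unfolding matrix_sum_simps matrix_mult_simps by (simp add: mult.commute)
  have swap: "(\<Sum>J\<in>UNIV. \<Sum>K\<in>UNIV. (P $ k $ J * P $ j $ K) *\<^sub>R X J K) = (\<Sum>J\<in>UNIV. \<Sum>K\<in>UNIV. (P $ j $ J * P $ k $ K) *\<^sub>R X K J)"
    for X :: "4 \<Rightarrow> 4 \<Rightarrow> complex^2^2"
    by (subst sum.swap) (simp add: mult.commute)
  show ?thesis
    unfolding comm_form_def vec_lambda_beta prod swap[of "\<lambda>J K. C $ J ** B $ K"] swap[of "\<lambda>J K. B $ J ** C $ K"]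
    by (simp add: scaleR_add_right scaleR_diff_right sum.distrib sum_subtractf)
qed

lemma comm_form_conj:
  assumes g: "unitary2 g" and C: "\<And>j. C $ j = g ** C' $ j ** hconj g" and B: "\<And>j. B $ j = g ** B' $ j ** hconj g"
  shows "comm_form C B j k = g ** comm_form C' B' j k ** hconj g"
proof -
  have cancel: "hconj g ** (g ** X) = X" for X
    by (simp add: matrix_mul_assoc matrix_left_unitary[OF g])
  show ?thesis
    unfolding comm_form_def C B by (simp add: matrix_mult_simps cancel flip: matrix_mul_assoc)
qed

lemma smooth_on_top4: "open S \<Longrightarrow> (\<And>i j k l. smooth_on S (\<lambda>x. f x i j k l)) \<Longrightarrow> smooth_on S (\<lambda>x. top4 (f x))"
  unfolding top4_def by (intro smooth_on_sum smooth_on_scaleR smooth_on_const) auto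

lemma smooth_on_sandwich:
  assumes "open S" "smooth_on S \<psi>" "\<And>j k. smooth_on S (\<lambda>x. F x j k)"
  shows "smooth_on S (\<lambda>x. sandwich (\<psi> x) (F x))"
  unfolding sandwich_def
  by (intro smooth_on_scaleR smooth_on_const smooth_on_top4 smooth_on_bilinear[OF bounded_bilinear_herm]
      smooth_on_matrix_vector smooth_on_nth assms)

lemma smooth_on_curvature:
  fixes A :: "real^4 \<Rightarrow> ('a::{real_normed_field,euclidean_space}^'n^'n)^4"
  assumes "open S" "smooth_on S A"
  shows "smooth_on S (\<lambda>x. curvature A x [j, k])"
  unfolding curvature_pair
  by (intro smooth_on_add smooth_on_diff smooth_on_pd smooth_on_matrix_mult smooth_on_nth assms)

lemma smooth_on_comm_form:
  assumes "open S" "smooth_on S C" "smooth_on S B"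
  shows "smooth_on S (\<lambda>x. comm_form (C x) (B x) j k)"
  unfolding comm_form_def
  by (intro smooth_on_add smooth_on_diff smooth_on_matrix_mult smooth_on_nth assms)

text \<open>In this form each term changes under chart and gauge by the same determinant. The
  products \<open>herm\<close> are not antisymmetrised and so absorb a factor 2 for each
  \<open>psi_psi\<close>, whence the coefficients \<open>mu / 2\<close> and
  \<open>nu\<close>.\<close>

lemma lagrangian_top_eq:
  "lagrangian lam mu nu \<Psi> A a x [1, 2, 3, 4] = lam *\<^sub>R sandwich (\<Psi> x) (\<lambda>j k. curvature A x [j, k])
    + (mu / 2) *\<^sub>R top4 (\<lambda>i j k l. ext_d (form1 a) x [i, j] * herm (\<Psi> x $ k) (\<Psi> x $ l))
    + nu *\<^sub>R top4 (\<lambda>i j k l. herm (\<Psi> x $ i) (\<Psi> x $ j) * herm (\<Psi> x $ k) (\<Psi> x $ l))"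
proof -
  have a: "ext_d (form1 a) x [2, 1] = - ext_d (form1 a) x [1, 2]" "ext_d (form1 a) x [3, 1] = - ext_d (form1 a) x [1, 3]"
    "ext_d (form1 a) x [4, 1] = - ext_d (form1 a) x [1, 4]" "ext_d (form1 a) x [3, 2] = - ext_d (form1 a) x [2, 3]"
    "ext_d (form1 a) x [4, 2] = - ext_d (form1 a) x [2, 4]" "ext_d (form1 a) x [4, 3] = - ext_d (form1 a) x [3, 4]"
    by (simp_all add: ext_d_form1_pair)
  have 1: "wedge (*) (ext_d (form1 a)) (psi_psi \<Psi>) x [1, 2, 3, 4] =
     (1 / 2) *\<^sub>R top4 (\<lambda>i j k l. ext_d (form1 a) x [i, j] * herm (\<Psi> x $ k) (\<Psi> x $ l))"
    by (subst wedge22[OF _ _ homog_ext_d_form1 homog_psi_psi], simp, simp)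
      (simp only: psi_psi_pair top4_eq a, simp add: scaleR_conv_of_real field_simps)
  have 2: "wedge (*) (psi_psi \<Psi>) (psi_psi \<Psi>) x [1, 2, 3, 4] =
     top4 (\<lambda>i j k l. herm (\<Psi> x $ i) (\<Psi> x $ j) * herm (\<Psi> x $ k) (\<Psi> x $ l))"
    by (subst wedge22[OF _ _ homog_psi_psi homog_psi_psi], simp, simp)
      (simp only: psi_psi_pair top4_eq, simp add: algebra_simps)
  show ?thesis
    unfolding lagrangian_def by (simp add: 1 2 psi_F_psi_eq) (simp add: scaleR_conv_of_real)
qed

lemma top4_pair_transform:
  fixes P :: "real^4^4" and \<alpha> \<beta> :: "4 \<Rightarrow> 4 \<Rightarrow> complex"
  assumes "\<And>i j. \<alpha> i j = (\<Sum>I\<in>UNIV. \<Sum>J\<in>UNIV. (P $ i $ I * P $ j $ J) *\<^sub>R \<alpha>' I J)"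
    and "\<And>i j. \<beta> i j = (\<Sum>I\<in>UNIV. \<Sum>J\<in>UNIV. (P $ i $ I * P $ j $ J) *\<^sub>R \<beta>' I J)"
  shows "top4 (\<lambda>i j k l. \<alpha> i j * \<beta> k l) = det P *\<^sub>R top4 (\<lambda>i j k l. \<alpha>' i j * \<beta>' k l)"
proof (rule top4_transform)
  fix i j k l
  show "\<alpha> i j * \<beta> k l = (\<Sum>I\<in>UNIV. \<Sum>J\<in>UNIV. \<Sum>K\<in>UNIV. \<Sum>L\<in>UNIV. (P $ i $ I * P $ j $ J * P $ k $ K * P $ l $ L) *\<^sub>R (\<alpha>' I J * \<beta>' K L))"
    unfolding assms sum_distrib_right unfolding sum_distrib_left by (simp add: mult_ac)
qed

subsection \<open>Behaviour of the fields under changes of chart and gauge\<close>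

locale u2_geometry = atlas U \<phi> for U :: "nat \<Rightarrow> 'm::{t2_space, second_countable_topology} set" and \<phi> :: "nat \<Rightarrow> 'm \<Rightarrow> real^4" +
  fixes h :: "nat \<Rightarrow> nat \<Rightarrow> real^4 \<Rightarrow> complex^2^2" and \<Psi> :: "nat \<Rightarrow> frame"
  assumes u2_bundle: "u2_bundle U \<phi> h" and u2_frame: "u2_frame U \<phi> h \<Psi>"
begin

lemma smooth_h: "smooth_on (overlap m n) (h m n)"
  and unitary_h: "x \<in> overlap m n \<Longrightarrow> unitary2 (h m n x)"
  using u2_bundle unfolding u2_bundle_def by blast+

lemma smooth_frame: "smooth_on (dom n) (\<Psi> n)"
  and det_frame: "x \<in> dom n \<Longrightarrow> det (coframe (\<Psi> n) x) \<noteq> 0"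
  and frame_pullback: "x \<in> overlap m n \<Longrightarrow> \<Psi> m x $ i = h m n x *v pullback1 (tmap m n) (\<Psi> n) x $ i"
  using u2_frame det_coframe unfolding u2_frame_def by blast+

lemma frame_trans: "x \<in> overlap m n \<Longrightarrow> \<Psi> m x $ i = h m n x *v (\<Sum>j\<in>UNIV. jac m n x $ i $ j *\<^sub>R \<Psi> n (tmap m n x) $ j)"
  by (simp add: frame_pullback pullback1_nth jac_pullback)

lemma coframe_pullback:
  assumes "x \<in> overlap m n"
  shows "coframe (\<Psi> m) x $ i = realify (h m n x) *v pullback1 (tmap m n) (coframe (\<Psi> n)) x $ i"
proof -
  have "coframe (\<Psi> m) x $ i = realify (h m n x) *v uncplx (pullback1 (tmap m n) (\<Psi> n) x $ i)"
    by (simp add: coframe_def frame_pullback[OF assms] realify_mult_vec)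
  also have "uncplx (pullback1 (tmap m n) (\<Psi> n) x $ i) = pullback1 (tmap m n) (coframe (\<Psi> n)) x $ i"
    by (simp add: pullback1_nth coframe_def uncplx_linear del: uncplx_nth)
  finally show ?thesis .
qed

text \<open>The gauge factor has real determinant 1, so only the Jacobian remains.\<close>

lemma det_coframe_trans:
  assumes "x \<in> overlap m n"
  shows "det (coframe (\<Psi> m) x) = det (jac m n x) * det (coframe (\<Psi> n) (tmap m n x))"
proof -
  have "coframe (\<Psi> m) x = jac m n x ** coframe (\<Psi> n) (tmap m n x) ** transpose (realify (h m n x))"
    by (simp add: vec_eq_iff coframe_pullback[OF assms] pullback1_nth jac_pullback matrix_vector_mult_def
        matrix_matrix_mult_def transpose_def mult.commute)
  then show ?thesis
    using det_realify_unitary[OF unitary_h[OF assms]] by (simp add: det_mul det_transpose)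
qed

text \<open>\<open>det jac\<close> times its own sign is its modulus, and by
  \<open>det_coframe_trans\<close> the orientation signs in the two charts differ by exactly this
  sign.\<close>

lemma density_oriented:
  fixes L :: "nat \<Rightarrow> real^4 \<Rightarrow> 'v::real_vector"
  assumes "\<And>m n x. x \<in> overlap m n \<Longrightarrow> L m x = det (jac m n x) *\<^sub>R L n (tmap m n x)"
  shows "is_density (\<lambda>n x. sgn (coframe_vol (coframe (\<Psi> n)) x [1, 2, 3, 4]) *\<^sub>R L n x)"
  unfolding is_density_def
proof (intro allI ballI)
  fix m n x assume x: "x \<in> overlap m n"
  have "sgn (det (jac m n x)) * det (jac m n x) = \<bar>det (jac m n x)\<bar>"
    by (simp add: abs_sgn mult.commute)
  then show "sgn (coframe_vol (coframe (\<Psi> m)) x [1, 2, 3, 4]) *\<^sub>R L m x =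
      \<bar>det (jac m n x)\<bar> *\<^sub>R sgn (coframe_vol (coframe (\<Psi> n)) (tmap m n x) [1, 2, 3, 4]) *\<^sub>R L n (tmap m n x)"
    unfolding coframe_vol_eq det_coframe_trans[OF x] assms[OF x] by (simp add: sgn_mult mult_ac)
qed

text \<open>Differentiate the unitarity relation of \<open>h\<close>. The result places
  \<open>dh h\<^sup>\<dagger>\<close> in \<open>u(2)\<close>, where
  \<open>asd_matrix_realify\<close> applies.\<close>

lemma pd_unitary_antihermitian:
  assumes "x \<in> overlap m n"
  shows "hconj (pd i (h m n) x ** hconj (h m n x)) = - (pd i (h m n) x ** hconj (h m n x))"
proof -
  have d: "h m n differentiable (at x)"
    by (rule smooth_on_differentiable[OF open_overlap smooth_h assms])
  have "pd i (\<lambda>y. hconj (h m n y)) x = - (hconj (h m n x) ** pd i (h m n) x ** hconj (h m n x))"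
    by (rule pd_matrix_inverse[OF open_overlap assms smooth_h smooth_on_linear[OF bounded_linear_hconj open_overlap smooth_h]])
      (rule matrix_left_unitary[OF unitary_h])
  then have "hconj (pd i (h m n) x) = - (hconj (h m n x) ** pd i (h m n) x ** hconj (h m n x))"
    by (simp add: pd_bounded_linear[OF bounded_linear_hconj d])
  then have "h m n x ** hconj (pd i (h m n) x) = - ((h m n x ** hconj (h m n x)) ** (pd i (h m n) x ** hconj (h m n x)))"
    by (simp add: matrix_mult_simps matrix_mul_assoc)
  then show ?thesis
    using unitary_h[OF assms] by (simp add: unitary2_def hconj_simps)
qed

lemma asd_conn_eq: "x \<in> dom n \<Longrightarrow> asd_conn (\<Psi> n) x $ i = asd_matrix (lc_conn (coframe (\<Psi> n)) x $ i)"
  by (rule asd_conn_nth[OF det_frame])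

lemma smooth_asd_conn: "smooth_on (dom n) (asd_conn (\<Psi> n))"
proof (subst smooth_on_vec_iff[OF chart(2)], rule allI)
  fix i
  have lc: "smooth_on (dom n) (lc_conn (coframe (\<Psi> n)))"
    by (rule smooth_on_lc_conn[OF chart(2) smooth_on_coframe[OF chart(2) smooth_frame] det_frame])
  show "smooth_on (dom n) (\<lambda>x. asd_conn (\<Psi> n) x $ i)"
    by (rule smooth_on_cong[OF chart(2) smooth_on_linear[OF bounded_linear_asd_matrix chart(2) smooth_on_nth[OF chart(2) lc]]])
      (simp add: asd_conn_eq)
qed

text \<open>Anti-self-dual projection of \<open>lc_conn_gauge\<close> for the real form of
  \<open>h\<close>. Only the tracefree part of \<open>dh h\<^sup>\<dagger>\<close> survives, its
  trace part being self-dual.\<close>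

lemma asd_conn_pullback:
  assumes x: "x \<in> overlap m n"
  shows "asd_conn (\<Psi> m) x $ i = h m n x ** pullback1 (tmap m n) (asd_conn (\<Psi> n)) x $ i ** hconj (h m n x)
     - (pd i (h m n) x ** hconj (h m n x) - mat (trace (pd i (h m n) x ** hconj (h m n x)) / 2))"
proof -
  let ?Q = "\<lambda>y. realify (h m n y)" and ?W = "lc_conn (coframe (\<Psi> n))"
  have dm: "x \<in> dom m" and dn: "tmap m n x \<in> dom n" using x by auto
  have Q: "smooth_on (overlap m n) ?Q" by (rule smooth_on_linear[OF bounded_linear_realify open_overlap smooth_h])
  have orth: "transpose (?Q y) ** ?Q y = mat 1" if "y \<in> overlap m n" for y
    using matrix_left_unitary[OF unitary_h[OF that]] by (simp flip: realify_hconj realify_mult)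
  have "lc_conn (coframe (\<Psi> m)) x $ i = ?Q x ** pullback1 (tmap m n) ?W x $ i ** transpose (?Q x) - pd i ?Q x ** transpose (?Q x)"
    by (rule lc_conn_gauge[OF open_overlap x chart(2) smooth_trans trans_dom smooth_on_coframe[OF chart(2) smooth_frame]
          det_frame[OF dn] Q orth coframe_pullback det_frame[OF dm]])
  also have "pd i ?Q x = realify (pd i (h m n) x)"
    by (rule pd_bounded_linear[OF bounded_linear_realify smooth_on_differentiable[OF open_overlap smooth_h x]])
  finally have lc: "lc_conn (coframe (\<Psi> m)) x $ i = ?Q x ** pullback1 (tmap m n) ?W x $ i ** transpose (?Q x)
     - realify (pd i (h m n) x ** hconj (h m n x))"
    by (simp add: realify_mult realify_hconj)
  have so: "so4 (pullback1 (tmap m n) ?W x $ i)"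
    unfolding pullback1_nth by (rule so4_sum) (rule lc_conn_spec(1)[where e="coframe (\<Psi> n)", OF det_frame[OF dn]])
  have "asd_matrix (pullback1 (tmap m n) ?W x $ i) = pullback1 (tmap m n) (asd_conn (\<Psi> n)) x $ i"
    by (simp add: pullback1_nth asd_conn_eq[OF dn] asd_matrix_linear(3) asd_matrix_sum)
  then show ?thesis
    unfolding asd_conn_eq[OF dm] lc asd_matrix_linear(2) asd_matrix_conj[OF so unitary_h[OF x]]
      asd_matrix_realify[OF pd_unitary_antihermitian[OF x]] by simp
qed

lemma connD:
  assumes "u2_connection U \<phi> h A a"
  shows "smooth_on (dom n) (A n)" "smooth_on (dom n) (a n)" "x \<in> dom n \<Longrightarrow> su2 (A n x $ i)" "x \<in> dom n \<Longrightarrow> Re (a n x $ i) = 0"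
    and "x \<in> overlap m n \<Longrightarrow> u2_conn_form (A m) (a m) x $ i =
          h m n x ** (pullback1 (tmap m n) (u2_conn_form (A n) (a n)) x $ i) ** hconj (h m n x)
          - pd i (h m n) x ** hconj (h m n x)"
  using assms unfolding u2_connection_def by blast+

lemma pullback1_u2_conn_form:
  "pullback1 \<tau> (u2_conn_form A a) x $ i = pullback1 \<tau> A x $ i + mat (pullback1 \<tau> a x $ i)"
proof -
  have "mat (\<Sum>j\<in>UNIV. c j *\<^sub>R z j) = (\<Sum>j\<in>UNIV. c j *\<^sub>R (mat (z j) :: complex^2^2))" for c :: "4 \<Rightarrow> real" and z
    by (simp add: mat_linear)
  then show ?thesis by (simp add: pullback1_nth u2_conn_form_def scaleR_add_right sum.distrib)
qed

lemma unitary_conj_add_mat: "unitary2 g \<Longrightarrow> g ** (X + mat z) ** hconj g = g ** X ** hconj g + mat z"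
proof -
  assume g: "unitary2 g"
  have "g ** mat z ** hconj g = mat z ** (g ** hconj g)"
    by (simp only: mat_commute[of z g, symmetric] matrix_mul_assoc)
  then show ?thesis using g by (simp add: matrix_mult_simps unitary2_def)
qed

lemma trace_unitary_conj: "unitary2 g \<Longrightarrow> trace (g ** X ** hconj g) = trace X"
  using trace_mul_sym[of "g ** X" "hconj g"] by (simp add: matrix_mul_assoc matrix_left_unitary)

text \<open>Take the trace of the law for the whole connection: the \<open>su(2)\<close> parts drop
  out, and the identity has trace 2.\<close>

lemma trace_conn_pullback:
  assumes "u2_connection U \<phi> h A a" "x \<in> overlap m n"
  shows "a m x $ i = pullback1 (tmap m n) (a n) x $ i - trace (pd i (h m n) x ** hconj (h m n x)) / 2"
proof -
  have dm: "x \<in> dom m" and dn: "tmap m n x \<in> dom n" using assms(2) by auto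
  have tr: "trace (A m x $ i) = 0" "trace (pullback1 (tmap m n) (A n) x $ i) = 0"
    using connD(3)[OF assms(1) dm] connD(3)[OF assms(1) dn] by (simp_all add: su2_def pullback1_nth trace_simps)
  have "trace (A m x $ i + mat (a m x $ i)) = trace (h m n x ** (pullback1 (tmap m n) (u2_conn_form (A n) (a n)) x $ i) ** hconj (h m n x)
          - pd i (h m n) x ** hconj (h m n x))"
    using connD(5)[OF assms] by (simp add: u2_conn_form_def)
  then show ?thesis
    unfolding pullback1_u2_conn_form trace_simps trace_unitary_conj[OF unitary_h[OF assms(2)]] tr by (simp add: field_simps)
qed

text \<open>The trace part missing from \<open>asd_conn_pullback\<close> is exactly the
  inhomogeneous term of \<open>a\<close>, whose law is extracted from the given connection.\<close>

lemma asd_connection: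
  assumes "u2_connection U \<phi> h A a"
  shows "u2_connection U \<phi> h (\<lambda>n. asd_conn (\<Psi> n)) a"
  unfolding u2_connection_def
proof (intro conjI allI ballI)
  fix n show "smooth_on (dom n) (asd_conn (\<Psi> n))" by (rule smooth_asd_conn)
  show "smooth_on (dom n) (a n)" by (rule connD(2)[OF assms])
  fix x i assume "x \<in> dom n"
  then show "su2 (asd_conn (\<Psi> n) x $ i)" "Re (a n x $ i) = 0"
    using connD(4)[OF assms] by (auto simp: asd_conn_eq su2_asd_matrix)
next
  fix m n x i assume x: "x \<in> overlap m n"
  show "u2_conn_form (asd_conn (\<Psi> m)) (a m) x $ i =
     h m n x ** pullback1 (tmap m n) (u2_conn_form (asd_conn (\<Psi> n)) (a n)) x $ i ** hconj (h m n x)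
       - pd i (h m n) x ** hconj (h m n x)"
  proof -
    have "mat (u - v) = mat u - (mat v :: complex^2^2)" for u v
      by (rule linear_diff[OF bounded_linear.linear[OF bounded_linear_mat]])
    then show ?thesis
      unfolding pullback1_u2_conn_form unitary_conj_add_mat[OF unitary_h[OF x]]
      by (simp add: u2_conn_form_def asd_conn_pullback[OF x] trace_conn_pullback[OF assms x])
  qed
qed

text \<open>The curvature of \<open>u2_conn_form A a\<close> transforms as a whole. Since the
  curvature of \<open>A\<close> is tracefree, the trace isolates \<open>da\<close>, and the rest
  follows by subtraction.\<close>

lemma curvature_trans:
  assumes A: "u2_connection U \<phi> h A a" and x: "x \<in> overlap m n"
  shows "ext_d (form1 (a m)) x [i, j] = (\<Sum>k\<in>UNIV. \<Sum>l\<in>UNIV. (jac m n x $ i $ k * jac m n x $ j $ l) *\<^sub>R ext_d (form1 (a n)) (tmap m n x) [k, l])"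
    and "curvature (A m) x [i, j] = h m n x ** (\<Sum>k\<in>UNIV. \<Sum>l\<in>UNIV. (jac m n x $ i $ k * jac m n x $ j $ l) *\<^sub>R curvature (A n) (tmap m n x) [k, l]) ** hconj (h m n x)"
proof -
  let ?W = "\<lambda>n. u2_conn_form (A n) (a n)" and ?\<tau> = "tmap m n"
  have dm: "x \<in> dom m" and dn: "?\<tau> x \<in> dom n" using x by auto
  have smW: "smooth_on (dom n) (?W n)" for n
    unfolding smooth_on_vec_iff[OF chart(2)] u2_conn_form_def
    using connD(1,2)[OF A] by (auto intro!: smooth_on_add smooth_on_nth smooth_on_linear[OF bounded_linear_mat] chart(2))
  have d: "A n differentiable (at y)" "a n differentiable (at y)" if "y \<in> dom n" for n y
    using smooth_on_differentiable[OF chart(2) connD(1)[OF A] that] smooth_on_differentiable[OF chart(2) connD(2)[OF A] that] .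
  define D where "D i j = (\<Sum>k\<in>UNIV. \<Sum>l\<in>UNIV. (jac m n x $ i $ k * jac m n x $ j $ l) *\<^sub>R ext_d (form1 (a n)) (?\<tau> x) [k, l])" for i j
  define F where "F i j = (\<Sum>k\<in>UNIV. \<Sum>l\<in>UNIV. (jac m n x $ i $ k * jac m n x $ j $ l) *\<^sub>R curvature (A n) (?\<tau> x) [k, l])" for i j
  have "curvature (?W m) x [i, j] = h m n x ** curvature (pullback1 ?\<tau> (?W n)) x [i, j] ** hconj (h m n x)"
    by (rule curvature_gauge[OF open_overlap x smooth_h smooth_on_linear[OF bounded_linear_hconj open_overlap smooth_h]
          smooth_on_pullback1[OF open_overlap chart(2) smooth_trans trans_dom smW] matrix_left_unitary[OF unitary_h] connD(5)[OF A]])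
  also have "curvature (pullback1 ?\<tau> (?W n)) x [i, j] = F i j + mat (D i j)"
  proof -
    have "mat (\<Sum>k\<in>UNIV. \<Sum>l\<in>UNIV. c k l *\<^sub>R z k l) = (\<Sum>k\<in>UNIV. \<Sum>l\<in>UNIV. c k l *\<^sub>R (mat (z k l) :: complex^2^2))" for c :: "4 \<Rightarrow> 4 \<Rightarrow> real" and z
      by (simp add: mat_linear)
    then show ?thesis
      by (simp add: curvature_pullback1[OF open_overlap x chart(2) smooth_trans trans_dom smW] curvature_u2_conn_form[OF d[OF dn]] F_def D_def jac_def scaleR_add_right sum.distrib)
  qed
  finally have e: "curvature (A m) x [i, j] + mat (ext_d (form1 (a m)) x [i, j]) = h m n x ** F i j ** hconj (h m n x) + mat (D i j)"
    by (simp add: curvature_u2_conn_form[OF d[OF dm]] unitary_conj_add_mat[OF unitary_h[OF x]])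
  have tr: "trace (curvature (A n) y [i, j]) = 0" if "y \<in> dom n" for n y i j
    by (rule trace_curvature[OF chart(2) that connD(1)[OF A]]) (use connD(3)[OF A] in \<open>auto simp: su2_def\<close>)
  have "trace (curvature (A m) x [i, j] + mat (ext_d (form1 (a m)) x [i, j])) = trace (h m n x ** F i j ** hconj (h m n x) + mat (D i j))"
    using e by simp
  then have "ext_d (form1 (a m)) x [i, j] = D i j"
    unfolding trace_simps trace_unitary_conj[OF unitary_h[OF x]] F_def tr[OF dm] tr[OF dn] by simp
  then show "ext_d (form1 (a m)) x [i, j] = (\<Sum>k\<in>UNIV. \<Sum>l\<in>UNIV. (jac m n x $ i $ k * jac m n x $ j $ l) *\<^sub>R ext_d (form1 (a n)) (?\<tau> x) [k, l])"
    and "curvature (A m) x [i, j] = h m n x ** (\<Sum>k\<in>UNIV. \<Sum>l\<in>UNIV. (jac m n x $ i $ k * jac m n x $ j $ l) *\<^sub>R curvature (A n) (?\<tau> x) [k, l]) ** hconj (h m n x)"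
    using e by (simp_all add: D_def F_def)
qed

lemma herm_trans:
  assumes x: "x \<in> overlap m n"
  shows "herm (\<Psi> m x $ i) (\<Psi> m x $ j) = (\<Sum>k\<in>UNIV. \<Sum>l\<in>UNIV. (jac m n x $ i $ k * jac m n x $ j $ l) *\<^sub>R herm (\<Psi> n (tmap m n x) $ k) (\<Psi> n (tmap m n x) $ l))"
  unfolding frame_trans[OF x] herm_unitary[OF unitary_h[OF x]]
  unfolding bounded_bilinear.sum_left[OF bounded_bilinear_herm]
  unfolding herm_simps by (simp add: scaleR_sum_right mult_ac)

lemma lagrangian_trans:
  assumes A: "u2_connection U \<phi> h A a" and x: "x \<in> overlap m n"
  shows "lagrangian lam mu nu (\<Psi> m) (A m) (a m) x [1, 2, 3, 4] =
    det (jac m n x) *\<^sub>R lagrangian lam mu nu (\<Psi> n) (A n) (a n) (tmap m n x) [1, 2, 3, 4]"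
  unfolding lagrangian_top_eq
    sandwich_transform[OF unitary_h[OF x] frame_trans[OF x] curvature_trans(2)[OF A x]]
    top4_pair_transform[OF curvature_trans(1)[OF A x] herm_trans[OF x]]
    top4_pair_transform[OF herm_trans[OF x] herm_trans[OF x]]
  by (simp add: scaleR_add_right mult.commute)

lemma smooth_lagrangian:
  assumes A: "u2_connection U \<phi> h A a"
  shows "smooth_on (dom n) (\<lambda>x. lagrangian lam mu nu (\<Psi> n) (A n) (a n) x [1, 2, 3, 4])"
  unfolding lagrangian_top_eq
  by (intro smooth_on_add smooth_on_scaleR smooth_on_const smooth_on_sandwich smooth_on_top4 smooth_on_mult
      smooth_on_curvature smooth_on_ext_d_form1 smooth_on_bilinear[OF bounded_bilinear_herm] smooth_on_nth
      chart(2) smooth_frame connD(1,2)[OF A])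

text \<open>Variations without the condition on the support. Differences of connections are of the
  same type, so one notion covers both slots of the pairing.\<close>

definition adjoint_form :: "(nat \<Rightarrow> real^4 \<Rightarrow> (complex^2^2)^4) \<Rightarrow> bool" where
  "adjoint_form B \<longleftrightarrow> (\<forall>n. smooth_on (dom n) (B n) \<and> (\<forall>x\<in>dom n. \<forall>i. su2 (B n x $ i))) \<and>
     (\<forall>m n. \<forall>x\<in>overlap m n. \<forall>i. B m x $ i = h m n x ** (pullback1 (tmap m n) (B n) x $ i) ** hconj (h m n x))"

lemma su2_variation_iff: "su2_variation U \<phi> h K B \<longleftrightarrow> adjoint_form B \<and> (\<forall>n. \<forall>p\<in>U n - K. B n (\<phi> n p) = 0)"
  unfolding su2_variation_def adjoint_form_def by blast

lemma adjointD:
  assumes "adjoint_form B"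
  shows "smooth_on (dom n) (B n)" "x \<in> dom n \<Longrightarrow> su2 (B n x $ i)"
    and "x \<in> overlap m n \<Longrightarrow> B m x $ i = h m n x ** (\<Sum>j\<in>UNIV. jac m n x $ i $ j *\<^sub>R B n (tmap m n x) $ j) ** hconj (h m n x)"
  using assms unfolding adjoint_form_def pullback1_nth jac_pullback by blast+

text \<open>The inhomogeneous terms and the common \<open>a\<close> cancel in the
  difference.\<close>

lemma adjoint_form_difference:
  assumes A: "u2_connection U \<phi> h A a" and A': "u2_connection U \<phi> h A' a"
  shows "adjoint_form (\<lambda>n x. A n x - A' n x)"
  unfolding adjoint_form_def
proof (intro conjI allI ballI)
  fix n show "smooth_on (dom n) (\<lambda>x. A n x - A' n x)"
    by (intro smooth_on_diff chart(2) connD(1)[OF A] connD(1)[OF A'])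
  fix x i assume "x \<in> dom n"
  then show "su2 ((A n x - A' n x) $ i)"
    using connD(3)[OF A] connD(3)[OF A'] by (simp add: su2_nth)
next
  fix m n x i assume x: "x \<in> overlap m n"
  have p: "pullback1 (tmap m n) (\<lambda>x. A n x - A' n x) x $ i = pullback1 (tmap m n) (A n) x $ i - pullback1 (tmap m n) (A' n) x $ i"
    by (simp add: pullback1_nth scaleR_diff_right sum_subtractf)
  have "A m x $ i - A' m x $ i = u2_conn_form (A m) (a m) x $ i - u2_conn_form (A' m) (a m) x $ i"
    by (simp add: u2_conn_form_def)
  also have "\<dots> = h m n x ** (pullback1 (tmap m n) (A n) x $ i) ** hconj (h m n x) - h m n x ** (pullback1 (tmap m n) (A' n) x $ i) ** hconj (h m n x)"
    unfolding connD(5)[OF A x] connD(5)[OF A' x] pullback1_u2_conn_form unitary_conj_add_mat[OF unitary_h[OF x]] by simp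
  finally show "(A m x - A' m x) $ i = h m n x ** pullback1 (tmap m n) (\<lambda>x. A n x - A' n x) x $ i ** hconj (h m n x)"
    unfolding p by (simp add: matrix_mult_simps)
qed

lemma connection_add_variation:
  assumes A: "u2_connection U \<phi> h A a" and B: "adjoint_form B"
  shows "u2_connection U \<phi> h (\<lambda>n x. A n x + t *\<^sub>R B n x) a"
  unfolding u2_connection_def
proof (intro conjI allI ballI)
  fix n show "smooth_on (dom n) (\<lambda>x. A n x + t *\<^sub>R B n x)"
    by (intro smooth_on_add smooth_on_scaleR smooth_on_const chart(2) connD(1)[OF A] adjointD(1)[OF B])
  show "smooth_on (dom n) (a n)" by (rule connD(2)[OF A])
  fix x i assume x: "x \<in> dom n"
  show "su2 ((A n x + t *\<^sub>R B n x) $ i)"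
    using connD(3)[OF A x] adjointD(2)[OF B x] by (simp add: su2_nth)
  show "Re (a n x $ i) = 0" by (rule connD(4)[OF A x])
next
  fix m n x i assume x: "x \<in> overlap m n"
  have p: "pullback1 (tmap m n) (u2_conn_form (\<lambda>x. A n x + t *\<^sub>R B n x) (a n)) x $ i =
     pullback1 (tmap m n) (u2_conn_form (A n) (a n)) x $ i + t *\<^sub>R (\<Sum>j\<in>UNIV. jac m n x $ i $ j *\<^sub>R B n (tmap m n x) $ j)"
    unfolding pullback1_nth jac_pullback by (simp add: u2_conn_form_def scaleR_add_right sum.distrib scaleR_sum_right mult.commute)
  have "u2_conn_form (\<lambda>x. A m x + t *\<^sub>R B m x) (a m) x $ i = u2_conn_form (A m) (a m) x $ i + t *\<^sub>R B m x $ i"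
    by (simp add: u2_conn_form_def)
  then show "u2_conn_form (\<lambda>x. A m x + t *\<^sub>R B m x) (a m) x $ i =
     h m n x ** pullback1 (tmap m n) (u2_conn_form (\<lambda>x. A n x + t *\<^sub>R B n x) (a n)) x $ i ** hconj (h m n x)
       - pd i (h m n) x ** hconj (h m n x)"
    unfolding p connD(5)[OF A x] adjointD(3)[OF B x] by (simp add: matrix_mult_simps)
qed

lemma comm_form_trans:
  assumes C: "adjoint_form C" and B: "adjoint_form B" and x: "x \<in> overlap m n"
  shows "sandwich (\<Psi> m x) (comm_form (C m x) (B m x)) =
    det (jac m n x) *\<^sub>R sandwich (\<Psi> n (tmap m n x)) (comm_form (C n (tmap m n x)) (B n (tmap m n x)))"
proof (rule sandwich_transform[OF unitary_h[OF x] frame_trans[OF x]])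
  fix j k
  let ?g = "h m n x" and ?y = "tmap m n x" and ?P = "jac m n x"
  have "comm_form (C m x) (B m x) j k = ?g ** comm_form (\<chi> j. \<Sum>J\<in>UNIV. ?P $ j $ J *\<^sub>R C n ?y $ J) (\<chi> j. \<Sum>J\<in>UNIV. ?P $ j $ J *\<^sub>R B n ?y $ J) j k ** hconj ?g"
    by (rule comm_form_conj[OF unitary_h[OF x]]) (simp_all add: adjointD(3)[OF C x] adjointD(3)[OF B x])
  then show "comm_form (C m x) (B m x) j k = ?g ** (\<Sum>J\<in>UNIV. \<Sum>K\<in>UNIV. (?P $ j $ J * ?P $ k $ K) *\<^sub>R comm_form (C n ?y) (B n ?y) J K) ** hconj ?g"
    unfolding comm_form_expand .
qed

lemma smooth_comm_form:
  assumes "adjoint_form C" "adjoint_form B"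
  shows "smooth_on (dom n) (\<lambda>x. sandwich (\<Psi> n x) (comm_form (C n x) (B n x)))"
  by (intro smooth_on_sandwich smooth_on_comm_form chart(2) smooth_frame adjointD(1)[OF assms(1)] adjointD(1)[OF assms(2)])

lemma continuous_orientation:
  "continuous_on (dom n) (\<lambda>x. sgn (coframe_vol (coframe (\<Psi> n)) x [1, 2, 3, 4]))"
proof -
  have "smooth_on (dom n) (\<lambda>x. det (coframe (\<Psi> n) x))"
    by (intro smooth_on_det smooth_on_nth chart(2) smooth_on_coframe smooth_frame)
  then show ?thesis
    unfolding coframe_vol_eq
    by (intro continuous_on_sgn smooth_on_continuous[OF chart(2)]) (auto simp: det_frame)
qed

end

subsection \<open>The variation of the Lagrangian\<close>

lemma comm_form_linear:
  "comm_form (C - C') B j k = comm_form C B j k - comm_form C' B j k"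
  "comm_form C (B + B') j k = comm_form C B j k + comm_form C B' j k"
  "comm_form C (t *\<^sub>R B) j k = t *\<^sub>R comm_form C B j k"
  "comm_form 0 B j k = 0"
  by (simp_all add: comm_form_def matrix_mult_simps algebra_simps scaleR_diff_right scaleR_add_right)

lemma ext_d_form1_linear:
  assumes "A differentiable (at x)" "B differentiable (at x)"
  shows "ext_d (form1 (\<lambda>x. A x + t *\<^sub>R B x)) x [j, k] = ext_d (form1 A) x [j, k] + t *\<^sub>R ext_d (form1 B) x [j, k]"
proof -
  have d: "(\<lambda>y. A y $ j) differentiable (at x)" "(\<lambda>y. B y $ j) differentiable (at x)" for j
    using assms differentiable_bounded_linear[OF bounded_linear_vec_nth] by blast+
  have "pd i (\<lambda>y. A y $ j + t *\<^sub>R B y $ j) x = pd i (\<lambda>y. A y $ j) x + t *\<^sub>R pd i (\<lambda>y. B y $ j) x" for i j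
    by (simp add: pd_add d differentiable_bounded_linear[OF bounded_linear_scaleR_right] pd_bounded_linear[OF bounded_linear_scaleR_right])
  then show ?thesis by (simp add: ext_d_form1_pair scaleR_diff_right)
qed

text \<open>The curvature is quadratic in the connection, so along a line of connections it is
  exactly a polynomial of degree 2 in \<open>t\<close>.\<close>

lemma curvature_add:
  fixes A B :: "real^4 \<Rightarrow> (complex^2^2)^4"
  assumes "A differentiable (at x)" "B differentiable (at x)"
  shows "curvature (\<lambda>x. A x + t *\<^sub>R B x) x [j, k] = curvature A x [j, k]
     + t *\<^sub>R (ext_d (form1 B) x [j, k] + comm_form (A x) (B x) j k)
     + (t * t) *\<^sub>R (B x $ j ** B x $ k - B x $ k ** B x $ j)"
  unfolding curvature_def ext_d_form1_linear[OF assms]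
  by (simp add: ext_d_form1_linear[OF assms] wedge11[OF _ _ homog_form1 homog_form1] comm_form_def matrix_mult_simps
      scaleR_add_right scaleR_diff_right algebra_simps)

lemma top4_anti:
  "top4 (\<lambda>i j k l. T j i k l) = - top4 T" "top4 (\<lambda>i j k l. T i k j l) = - top4 T"
  "top4 (\<lambda>i j k l. T i l k j) = - top4 T" "top4 (\<lambda>i j k l. T l j k i) = - top4 T"
  unfolding top4_eq by (simp_all add: algebra_simps)

definition bilin :: "real^4^4 \<Rightarrow> real^4 \<Rightarrow> real^4 \<Rightarrow> real" where
  "bilin M u v = (\<Sum>K\<in>UNIV. \<Sum>L\<in>UNIV. M $ K $ L * (u $ K * v $ L))"

lemma bilin_inner: "bilin M u v = u \<bullet> (M *v v)"
  by (simp add: bilin_def inner_vec_def matrix_vector_mult_def sum_distrib_left mult_ac)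

lemma bilin_left: "bilin M (X *v u) v = bilin (transpose X ** M) u v"
  using dot_lmul_matrix[of u "transpose X" "M *v v"]
  by (simp only: bilin_inner vector_transpose_matrix matrix_vector_mul_assoc)

lemma bilin_right: "bilin M u (X *v v) = bilin (M ** X) u v"
  by (simp add: bilin_inner matrix_vector_mul_assoc)

lemma bilin_linear: "bilin (M + N) u v = bilin M u v + bilin N u v" "bilin (M - N) u v = bilin M u v - bilin N u v"
  "bilin (- M) u v = - bilin M u v"
  by (simp_all add: bilin_def algebra_simps sum.distrib sum_subtractf sum_negf)

lemma bilin_transpose: "bilin M u v = bilin (transpose M) v u"
  unfolding bilin_def by (subst sum.swap) (simp add: transpose_def mult_ac)

lemma herm_bilin: "herm u (m *v v) = Complex (bilin (realify m) (uncplx u) (uncplx v)) (bilin (realify (mat (- \<i>) ** m)) (uncplx u) (uncplx v))"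
  unfolding herm_coframe bilin_def ..

text \<open>A self-dual \<open>X\<close> commutes with \<open>B\<close>, which settles the real part; the imaginary part involves
  matrices that are symmetric, hence killed by the antisymmetry in \<open>i\<close> and \<open>l\<close>.\<close>

lemma top4_self_dual_zero:
  assumes X: "\<And>j. so4 (X j)" "\<And>j. hodge (X j) = X j" and B: "\<And>k. su2 (B k)"
  shows "top4 (\<lambda>i j k l. herm (cplx (X j *v e i)) (B k *v cplx (e l)) + herm (cplx (e i)) (B k *v cplx (X j *v e l))) = 0"
proof -
  have trX: "transpose (X j) = - X j" for j using X(1) by (simp add: so4_def)
  \<comment> \<open>\<open>- \<i>\<close> times an anti-Hermitian matrix is Hermitian, hence its
    real form is symmetric.\<close>
  define N where "N k = realify (mat (- \<i>) ** B k)" for k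
  have N: "transpose (N k) = N k" for k
    using B[of k] by (simp add: N_def vec_eq_iff forall_4 transpose_def realify_nth su2_nth matrix_matrix_mult_def mat_def sum_2)
  have comm: "realify (B k) ** X j = X j ** realify (B k)" for j k
    by (rule sd_asd_commute[OF asd_realify[OF B] X])
  define M where "M j k = N k ** X j - X j ** N k" for j k
  have M: "transpose (M j k) = M j k" for j k
  proof -
    have "transpose (A - A') = transpose A - transpose A'" for A A' :: "real^4^4"
      by (simp add: transpose_def vec_eq_iff)
    then show ?thesis by (simp add: M_def matrix_transpose_mul N trX matrix_mult_simps)
  qed
  have "herm (cplx (X j *v e i)) (B k *v cplx (e l)) + herm (cplx (e i)) (B k *v cplx (X j *v e l)) = \<i> * of_real (bilin (M j k) (e i) (e l))" for i j k l
    unfolding herm_bilin uncplx_cplx N_def[symmetric] bilin_left bilin_right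
    by (simp add: complex_eq_iff trX comm matrix_mult_simps bilin_linear M_def)
  moreover have "top4 (\<lambda>i j k l. \<i> * complex_of_real (bilin (M j k) (e i) (e l))) = 0"
  proof -
    let ?T = "\<lambda>i j k l. \<i> * complex_of_real (bilin (M j k) (e i) (e l))"
    have "bilin (M j k) (e l) (e i) = bilin (M j k) (e i) (e l)" for i j k l
      using bilin_transpose[of "M j k" "e l" "e i"] by (simp add: M)
    then have "top4 ?T = top4 (\<lambda>i j k l. ?T l j k i)" by simp
    then have "top4 ?T = - top4 ?T" using top4_anti(4)[of ?T] by simp
    then show ?thesis by simp
  qed
  ultimately show ?thesis by simp
qed

text \<open>Minus the three-form \<open>\<Psi>\<^sup>\<dagger> \<and> B \<and> \<Psi>\<close> as a
  vector density, so that its exterior derivative becomes a divergence. Index \<open>j\<close> sits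
  in the slot of \<open>eps\<close> where \<open>sandwich\<close> has the first index of the
  two-form.\<close>

definition flux :: "frame \<Rightarrow> (real^4 \<Rightarrow> (complex^2^2)^4) \<Rightarrow> 4 \<Rightarrow> real^4 \<Rightarrow> complex" where
  "flux \<Psi> B j y = (\<Sum>i\<in>UNIV. \<Sum>k\<in>UNIV. \<Sum>l\<in>UNIV. eps i j k l *\<^sub>R herm (\<Psi> y $ i) (B y $ k *v \<Psi> y $ l))"

lemma smooth_flux:
  assumes "open S" "smooth_on S \<Psi>" "smooth_on S B"
  shows "smooth_on S (flux \<Psi> B j)"
  unfolding flux_def[abs_def]
  by (intro smooth_on_sum smooth_on_scaleR smooth_on_const smooth_on_bilinear[OF bounded_bilinear_herm] smooth_on_matrix_vector smooth_on_nth assms)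

lemma divergence_flux:
  assumes S: "open S" "x \<in> S" and \<Psi>: "smooth_on S \<Psi>" and B: "smooth_on S B"
  shows "(\<Sum>j\<in>UNIV. pd j (flux \<Psi> B j) x) = top4 (\<lambda>i j k l. herm (pd j (\<lambda>y. \<Psi> y $ i) x) (B x $ k *v \<Psi> x $ l)
     + herm (\<Psi> x $ i) (pd j (\<lambda>y. B y $ k) x *v \<Psi> x $ l) + herm (\<Psi> x $ i) (B x $ k *v pd j (\<lambda>y. \<Psi> y $ l) x))"
proof -
  have d: "(\<lambda>y. \<Psi> y $ i) differentiable (at x)" "(\<lambda>y. B y $ i) differentiable (at x)" for i
    by (rule smooth_on_differentiable[OF S(1) smooth_on_nth[OF S(1) \<Psi>] S(2)],
        rule smooth_on_differentiable[OF S(1) smooth_on_nth[OF S(1) B] S(2)])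
  have d2: "(\<lambda>y. B y $ k *v \<Psi> y $ l) differentiable (at x)" for k l
    by (rule differentiable_bilinear[OF bounded_bilinear_matrix_vector d(2) d(1)])
  have d3: "(\<lambda>y. herm (\<Psi> y $ i) (B y $ k *v \<Psi> y $ l)) differentiable (at x)" for i k l
    by (rule differentiable_bilinear[OF bounded_bilinear_herm d(1) d2])
  have p: "pd j (\<lambda>y. herm (\<Psi> y $ i) (B y $ k *v \<Psi> y $ l)) x = herm (pd j (\<lambda>y. \<Psi> y $ i) x) (B x $ k *v \<Psi> x $ l)
     + herm (\<Psi> x $ i) (pd j (\<lambda>y. B y $ k) x *v \<Psi> x $ l) + herm (\<Psi> x $ i) (B x $ k *v pd j (\<lambda>y. \<Psi> y $ l) x)" for i j k l
    by (simp add: pd_bilinear[OF bounded_bilinear_herm d(1) d2] pd_matrix_vector d herm_simps)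
  have "pd j (flux \<Psi> B j) x = (\<Sum>i\<in>UNIV. \<Sum>k\<in>UNIV. \<Sum>l\<in>UNIV. eps i j k l *\<^sub>R pd j (\<lambda>y. herm (\<Psi> y $ i) (B y $ k *v \<Psi> y $ l)) x)" for j
    unfolding flux_def[abs_def]
    by (simp add: pd_sum differentiable_sum d3 differentiable_bounded_linear[OF bounded_linear_scaleR_right] pd_bounded_linear[OF bounded_linear_scaleR_right])
  then show ?thesis
    unfolding top4_def by (subst sum.swap) (simp only: p)
qed

text \<open>Complete the derivatives of the frame in the divergence to covariant ones for
  \<open>asd_conn\<close>; as that connection is anti-Hermitian, the corrections are the terms of
  \<open>comm_form\<close>. What remains is the covariant derivative of the frame, which the
  contraction reduces to the self-dual part and \<open>top4_self_dual_zero\<close> removes.\<close>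

lemma sandwich_exact:
  assumes S: "open S" "x \<in> S" and \<Psi>: "smooth_on S \<Psi>" and det: "det (coframe \<Psi> x) \<noteq> 0"
    and B: "smooth_on S B" "\<And>i. su2 (B x $ i)"
  shows "sandwich (\<Psi> x) (\<lambda>j k. ext_d (form1 B) x [j, k] + comm_form (asd_conn \<Psi> x) (B x) j k) = (\<Sum>j\<in>UNIV. pd j (flux \<Psi> B j) x)"
proof -
  define w where "w = asd_conn \<Psi> x"
  define W where "W = lc_conn (coframe \<Psi>) x"
  define X where "X j = W $ j - realify (w $ j)" for j
  define \<psi> where "\<psi> = \<Psi> x"
  define e where "e = coframe \<Psi> x"
  define dB where "dB j k = pd j (\<lambda>y. B y $ k) x" for j k
  define d\<psi> where "d\<psi> j i = pd j (\<lambda>y. \<Psi> y $ i) x" for j i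
  define b where "b = B x"
  have wW: "w $ j = asd_matrix (W $ j)" for j unfolding w_def W_def by (rule asd_conn_nth[OF det])
  have soW: "so4 (W $ j)" for j unfolding W_def by (rule lc_conn_spec(1)[where e="coframe \<Psi>", OF det])
  have X: "so4 (X j)" "hodge (X j) = X j" for j
  proof -
    show so: "so4 (X j)" using soW[of j] asd_realify(1)[OF su2_asd_matrix[of "W $ j"]] by (simp add: X_def wW so4_nth)
    show "hodge (X j) = X j"
      unfolding sd_iff[OF so] by (simp add: X_def wW realify_nth asd_matrix_nth field_simps)
  qed
  have e: "e $ i = uncplx (\<psi> $ i)" for i by (simp add: e_def \<psi>_def coframe_def)
  have w_herm: "herm u (w $ j *v v) = - herm (w $ j *v u) v" for j u v
    using su2_asd_matrix[of "W $ j"] by (simp add: herm_hconj[of u] wW su2_def matrix_vector_simps herm_simps)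
  have d\<Psi>: "(\<lambda>y. \<Psi> y $ i) differentiable (at x)" for i
    by (rule smooth_on_differentiable[OF S(1) smooth_on_nth[OF S(1) \<Psi>] S(2)])
  \<comment> \<open>Structure equation in complex form: the anti-self-dual part of \<open>W\<close>
    acts as \<open>w\<close> and stays on the left, the self-dual part \<open>X\<close> goes to the
    right.\<close>
  have tors: "(d\<psi> j i + w $ j *v \<psi> $ i) - (d\<psi> i j + w $ i *v \<psi> $ j) = - cplx (X j *v e $ i) + cplx (X i *v e $ j)" for i j
  proof -
    have "uncplx (d\<psi> j i) - uncplx (d\<psi> i j) = ext_d (form1 (coframe \<Psi>)) x [j, i]"
      unfolding ext_d_form1_pair d\<psi>_def
      by (simp add: coframe_def pd_bounded_linear[OF bounded_linear_uncplx d\<Psi>] del: uncplx_nth)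
    also have "\<dots> = - (W $ j *v e $ i - W $ i *v e $ j)"
      unfolding W_def e_def by (rule lc_conn_spec(2)[where e="coframe \<Psi>", OF det])
    finally have "uncplx (d\<psi> j i) - uncplx (d\<psi> i j) + (realify (w $ j) *v e $ i - realify (w $ i) *v e $ j) = - (X j *v e $ i) + X i *v e $ j"
      by (simp add: X_def matrix_vector_simps)
    then have "uncplx ((d\<psi> j i + w $ j *v \<psi> $ i) - (d\<psi> i j + w $ i *v \<psi> $ j)) = - (X j *v e $ i) + X i *v e $ j"
      unfolding e realify_mult_vec by (simp add: vec_eq_iff forall_4)
    then have "cplx (uncplx ((d\<psi> j i + w $ j *v \<psi> $ i) - (d\<psi> i j + w $ i *v \<psi> $ j))) = cplx (- (X j *v e $ i) + X i *v e $ j)"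
      by simp
    then show ?thesis by (simp add: vec_eq_iff forall_2 complex_eq_iff)
  qed
  \<comment> \<open>Only the part antisymmetric under an index swap survives the contraction, and
    that part is known from \<open>tors\<close>.\<close>
  have half: "top4 T = (1/2) *\<^sub>R top4 (\<lambda>i j k l. T i j k l - T' i j k l)" if "top4 T' = - top4 T" for T T' :: "4 \<Rightarrow> 4 \<Rightarrow> 4 \<Rightarrow> 4 \<Rightarrow> complex"
    using that by (simp add: top4_linear scaleR_conv_of_real)
  have t1: "top4 (\<lambda>i j k l. herm (d\<psi> j i + w $ j *v \<psi> $ i) (b $ k *v \<psi> $ l)) = - top4 (\<lambda>i j k l. herm (cplx (X j *v e $ i)) (b $ k *v \<psi> $ l))"
  proof -
    let ?T = "\<lambda>i j k l. herm (d\<psi> j i + w $ j *v \<psi> $ i) (b $ k *v \<psi> $ l)"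
    let ?Z = "\<lambda>i j k l. herm (cplx (X j *v e $ i)) (b $ k *v \<psi> $ l)"
    have "top4 ?T = (1/2) *\<^sub>R top4 (\<lambda>i j k l. ?T i j k l - ?T j i k l)"
      by (rule half) (rule top4_anti(1))
    also have "(\<lambda>i j k l. ?T i j k l - ?T j i k l) = (\<lambda>i j k l. ?Z j i k l - ?Z i j k l)"
      unfolding bounded_bilinear.diff_left[OF bounded_bilinear_herm, symmetric] tors by (simp add: add.commute)
    also have "top4 \<dots> = - 2 *\<^sub>R top4 ?Z"
      unfolding top4_linear(2) using top4_anti(1)[of ?Z] by (simp add: scaleR_conv_of_real)
    finally show ?thesis by simp
  qed
  have t2: "top4 (\<lambda>i j k l. herm (\<psi> $ i) (b $ k *v (d\<psi> j l + w $ j *v \<psi> $ l))) = - top4 (\<lambda>i j k l. herm (\<psi> $ i) (b $ k *v cplx (X j *v e $ l)))"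
  proof -
    let ?T = "\<lambda>i j k l. herm (\<psi> $ i) (b $ k *v (d\<psi> j l + w $ j *v \<psi> $ l))"
    let ?Z = "\<lambda>i j k l. herm (\<psi> $ i) (b $ k *v cplx (X j *v e $ l))"
    have "top4 ?T = (1/2) *\<^sub>R top4 (\<lambda>i j k l. ?T i j k l - ?T i l k j)"
      by (rule half) (rule top4_anti(3))
    also have "(\<lambda>i j k l. ?T i j k l - ?T i l k j) = (\<lambda>i j k l. ?Z i l k j - ?Z i j k l)"
      unfolding bounded_bilinear.diff_right[OF bounded_bilinear_herm, symmetric] bounded_bilinear.diff_right[OF bounded_bilinear_matrix_vector, symmetric] tors
      by (simp add: add.commute)
    also have "top4 \<dots> = - 2 *\<^sub>R top4 ?Z"
      unfolding top4_linear(2) using top4_anti(3)[of ?Z] by (simp add: scaleR_conv_of_real)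
    finally show ?thesis by simp
  qed
  have "top4 (\<lambda>i j k l. herm (cplx (X j *v e $ i)) (b $ k *v cplx (e $ l)) + herm (cplx (e $ i)) (b $ k *v cplx (X j *v e $ l))) = 0"
    using B(2) by (intro top4_self_dual_zero X) (simp add: b_def)
  then have t3: "top4 (\<lambda>i j k l. herm (d\<psi> j i + w $ j *v \<psi> $ i) (b $ k *v \<psi> $ l)) + top4 (\<lambda>i j k l. herm (\<psi> $ i) (b $ k *v (d\<psi> j l + w $ j *v \<psi> $ l))) = 0"
    unfolding t1 t2 top4_linear(1) by (simp add: e add_eq_0_iff)
  have ext: "ext_d (form1 B) x [j, k] = dB j k - dB k j" for j k
    by (simp add: ext_d_form1_pair dB_def)
  define T1 T2 T3 where "T1 = (\<lambda>i j k l. herm (\<psi> $ i) (dB j k *v \<psi> $ l))"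
    and "T2 = (\<lambda>i j k l. herm (\<psi> $ i) ((w $ j ** b $ k) *v \<psi> $ l))"
    and "T3 = (\<lambda>i j k l. herm (\<psi> $ i) ((b $ k ** w $ j) *v \<psi> $ l))"
  have "herm (\<psi> $ i) ((ext_d (form1 B) x [j, k] + comm_form w b j k) *v \<psi> $ l)
     = (T1 i j k l - T1 i k j l) + (T2 i j k l - T2 i k j l) + (T3 i k j l - T3 i j k l)" for i j k l
    by (simp add: ext comm_form_def T1_def T2_def T3_def matrix_vector_simps herm_simps)
  then have s1: "sandwich \<psi> (\<lambda>j k. ext_d (form1 B) x [j, k] + comm_form w b j k) = top4 T1 + top4 T2 - top4 T3"
    unfolding sandwich_def by (simp add: top4_linear top4_anti(2)[of T1] top4_anti(2)[of T2] top4_anti(2)[of T3] scaleR_conv_of_real)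
  have s2: "(\<Sum>j\<in>UNIV. pd j (flux \<Psi> B j) x) = top4 (\<lambda>i j k l. herm (d\<psi> j i) (b $ k *v \<psi> $ l)) + top4 T1 + top4 (\<lambda>i j k l. herm (\<psi> $ i) (b $ k *v d\<psi> j l))"
    unfolding divergence_flux[OF S \<Psi> B(1)] by (simp add: top4_linear T1_def dB_def d\<psi>_def b_def \<psi>_def)
  \<comment> \<open>By \<open>t3\<close> the covariant derivatives of the frame contribute nothing,
    so ordinary derivatives may be traded for connection terms.\<close>
  have s3: "top4 (\<lambda>i j k l. herm (d\<psi> j i) (b $ k *v \<psi> $ l)) + top4 (\<lambda>i j k l. herm (\<psi> $ i) (b $ k *v d\<psi> j l)) = top4 T2 - top4 T3"
  proof -
    have "herm (w $ j *v \<psi> $ i) (b $ k *v \<psi> $ l) = - T2 i j k l" for i j k l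
      using w_herm[of "\<psi> $ i" j "b $ k *v \<psi> $ l"] by (simp add: T2_def matrix_vector_mul_assoc)
    moreover have "herm (\<psi> $ i) (b $ k *v (w $ j *v \<psi> $ l)) = T3 i j k l" for i j k l
      by (simp add: T3_def matrix_vector_mul_assoc)
    ultimately show ?thesis
      using t3 by (simp add: herm_simps matrix_vector_simps top4_linear) 
         (simp add: top4_linear(3)[of "-1", simplified] algebra_simps)
  qed
  have "top4 T1 + top4 T2 - top4 T3 = top4 T1 + (top4 T2 - top4 T3)" by simp
  also have "\<dots> = (\<Sum>j\<in>UNIV. pd j (flux \<Psi> B j) x)"
    unfolding s3[symmetric] s2 by simp
  finally show ?thesis
    using s1 by (simp only: w_def b_def \<psi>_def)
qed

subsection \<open>Nondegeneracy of the algebraic part\<close>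

text \<open>Expressing \<open>C\<close> in the orthonormal coframe makes the frame the constant
  \<open>\<psi>0\<close>, at the cost of the nonzero factor \<open>det ?e\<close>. What remains is a
  constant linear system of twelve equations for the twelve real components of
  \<open>C'\<close>.\<close>

lemma comm_form_nondegenerate:
  assumes det: "det (coframe \<Psi> x) \<noteq> 0" and C: "\<And>i. su2 (C $ i)"
    and zero: "\<And>B. (\<And>i. su2 (B $ i)) \<Longrightarrow> sandwich (\<Psi> x) (comm_form C B) = 0"
  shows "C = 0"
proof -
  let ?e = "coframe \<Psi> x"
  define \<psi>0 :: "(complex^2)^4" where "\<psi>0 = (\<chi> I. cplx (axis I 1))"
  define C' where "C' = (\<chi> K. \<Sum>i\<in>UNIV. matrix_inv ?e $ K $ i *\<^sub>R C $ i)"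
  have C_eq: "C = (\<chi> i. \<Sum>K\<in>UNIV. ?e $ i $ K *\<^sub>R C' $ K)"
  proof -
    have "(\<Sum>K\<in>UNIV. ?e $ i $ K *\<^sub>R C' $ K) = (\<Sum>j\<in>UNIV. (\<Sum>K\<in>UNIV. ?e $ i $ K * matrix_inv ?e $ K $ j) *\<^sub>R C $ j)" for i
      unfolding C'_def vec_lambda_beta scaleR_sum_right scaleR_sum_left scaleR_scaleR by (rule sum.swap)
    then show ?thesis by (simp add: matrix_inv_row[OF det] vec_eq_iff of_bool_def if_distrib[of "\<lambda>c. c *\<^sub>R _"] cong: if_cong)
  qed
  have su2_sum: "su2 (\<Sum>i\<in>UNIV. c i *\<^sub>R M i)" if "\<And>i. su2 (M i)" for c and M :: "4 \<Rightarrow> complex^2^2"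
    using that by (simp add: su2_nth sum_negf[symmetric])
  have su2_C': "su2 (C' $ K)" for K
    using su2_sum[of "\<lambda>i. C $ i"] C by (simp add: C'_def)
  have frame: "\<Psi> x $ i = mat 1 *v (\<Sum>I\<in>UNIV. ?e $ i $ I *\<^sub>R \<psi>0 $ I)" for i
    by (simp add: \<psi>0_def coframe_def vec_eq_iff forall_2 sum_4 complex_eq_iff axis_def)
  have zero': "sandwich \<psi>0 (comm_form C' B) = 0" if B: "\<And>i. su2 (B $ i)" for B
  proof -
    let ?B = "\<chi> i. \<Sum>K\<in>UNIV. ?e $ i $ K *\<^sub>R B $ K"
    have "sandwich (\<Psi> x) (comm_form C ?B) = det ?e *\<^sub>R sandwich \<psi>0 (comm_form C' B)"
      by (rule sandwich_transform[of "mat 1"]) (simp_all add: frame comm_form_expand C_eq unitary2_def hconj_simps)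
    moreover have "sandwich (\<Psi> x) (comm_form C ?B) = 0"
      by (rule zero) (use su2_sum[of "\<lambda>i. B $ i"] B in simp)
    ultimately show ?thesis using det by simp
  qed
  have ent: "(C' $ K) $ 2 $ 1 = - cnj ((C' $ K) $ 1 $ 2)" "(C' $ K) $ 2 $ 2 = - (C' $ K) $ 1 $ 1" "Re ((C' $ K) $ 1 $ 1) = 0" for K
    using su2_C'[of K] by (auto simp: su2_nth complex_eq_iff)
  define a where "a K = Im ((C' $ K) $ 1 $ 1)" for K
  define b where "b K = Re ((C' $ K) $ 1 $ 2)" for K
  define c where "c K = Im ((C' $ K) $ 1 $ 2)" for K
  have C'K: "C' $ K = (\<chi> i j. if i = 1 then if j = 1 then Complex 0 (a K) else Complex (b K) (c K)
     else if j = 1 then Complex (- b K) (c K) else Complex 0 (- a K))" for K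
    using ent[of K] by (simp add: a_def b_def c_def vec_eq_iff forall_2 complex_eq_iff)
  \<comment> \<open>Test variations with a single occupied slot \<open>K\<close>: four slots times
    three directions of \<open>su(2)\<close> give the twelve equations.\<close>
  define B :: "4 \<Rightarrow> real \<Rightarrow> real \<Rightarrow> real \<Rightarrow> (complex^2^2)^4" where
    "B K p q r = (\<chi> J. if J = K then \<chi> i j. if i = 1 then if j = 1 then Complex 0 p else Complex q r
     else if j = 1 then Complex (- q) r else Complex 0 (- p) else 0)" for K p q r
  have su2B: "su2 (B K p q r $ i)" for K p q r i
    by (simp add: B_def su2_nth)
  have eq: "Re (sandwich \<psi>0 (comm_form C' (B K p q r))) = 0" for K p q r
    using zero'[OF su2B] by simp
  have re: "Re (sandwich \<psi>0 F) = (1/2) * top4 (\<lambda>i j k l. realify (F j k) $ i $ l)" for F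
  proof -
    have "Re (herm (\<psi>0 $ i) (F j k *v \<psi>0 $ l)) = realify (F j k) $ i $ l" for i j k l
      by (simp add: herm_bilin \<psi>0_def bilin_inner inner_axis matrix_vector_mult_basis column_def inner_commute[of "axis _ _"])
    then show ?thesis
      by (simp add: sandwich_def top4_bounded_linear[OF bounded_linear_Re])
  qed
  have eqs: "top4 (\<lambda>i j k l. realify (comm_form C' (B K p q r) j k) $ i $ l) = 0" for K p q r
    using eq[of K p q r] by (simp add: re)
  note comp = top4_eq comm_form_def B_def C'K realify_nth matrix_matrix_mult_def sum_2
  have k1: "c 3 + b 4 = 0" "a 4 = c 2" "b 2 + a 3 = 0"
    using eqs[of 1 1 0 0] eqs[of 1 0 1 0] eqs[of 1 0 0 1] by (simp_all add: comp)
  have k2: "b 3 = c 4" "c 1 = a 3" "a 4 = b 1"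
    using eqs[of 2 1 0 0] eqs[of 2 0 1 0] eqs[of 2 0 0 1] by (simp_all add: comp)
  have k3: "c 1 = b 2" "a 2 + c 4 = 0" "a 1 + b 4 = 0"
    using eqs[of 3 1 0 0] eqs[of 3 0 1 0] eqs[of 3 0 0 1] by (simp_all add: comp)
  have k4: "b 1 + c 2 = 0" "a 1 + c 3 = 0" "b 3 = a 2"
    using eqs[of 4 1 0 0] eqs[of 4 0 1 0] eqs[of 4 0 0 1] by (simp_all add: comp)
  \<comment> \<open>The system falls into four blocks of three, such as \<open>c 1 = a 3\<close>,
    \<open>c 1 = b 2\<close>, \<open>b 2 + a 3 = 0\<close>, each with only the zero
    solution.\<close>
  have 1: "a K = 0 \<and> b K = 0 \<and> c K = 0" for K
    using exhaust_4[of K] k1 k2 k3 k4 by (elim disjE) auto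
  then have "C' $ K = 0" for K by (simp add: C'K vec_eq_iff forall_2 complex_eq_iff)
  then show "C = 0" by (subst C_eq) (simp add: vec_eq_iff)
qed

subsection \<open>Smooth bump functions\<close>

text \<open>The powers of \<open>t\<close> in the denominator make the family closed under
  differentiation up to linear combinations; \<open>bexp 0\<close> is the usual flat
  function.\<close>

definition bexp :: "nat \<Rightarrow> real \<Rightarrow> real" where
  "bexp m t = (if t > 0 then exp (- 1 / t) / t ^ m else 0)"

text \<open>The exponential series at \<open>1 / t\<close> dominates its term of order
  \<open>m + 1\<close>. The linear bound makes \<open>bexp m\<close> tend to 0 at 0.\<close>

lemma bexp_bound: "\<bar>bexp m t\<bar> \<le> fact (Suc m) * \<bar>t\<bar>"
proof (cases "t > 0")
  case True
  have "(1 / t) ^ Suc m / fact (Suc m) \<le> exp (1 / t)"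
  proof -
    have "(\<Sum>n\<in>{Suc m}. (1 / t) ^ n /\<^sub>R fact n) \<le> (\<Sum>n. (1 / t) ^ n /\<^sub>R fact n)"
      using True by (intro sum_le_suminf summable_exp_generic) auto
    then show ?thesis by (simp add: exp_def divide_inverse mult.commute)
  qed
  then have "(1 / t) ^ Suc m \<le> fact (Suc m) * exp (1 / t)"
    by (subst (asm) pos_divide_le_eq) (simp_all only: fact_gt_zero mult.commute)
  then have "(1 / t) ^ Suc m / exp (1 / t) \<le> fact (Suc m)"
    by (subst pos_divide_le_eq) simp_all
  then have "(1 / t) ^ Suc m / exp (1 / t) * t \<le> fact (Suc m) * t"
    using True by (intro mult_right_mono) auto
  moreover have "(1 / t) ^ Suc m / exp (1 / t) * t = bexp m t"
    using True by (simp add: bexp_def exp_minus field_simps)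
  moreover have "bexp m t \<ge> 0" by (simp add: bexp_def)
  ultimately show ?thesis using True by simp
next
  case False
  then have "\<bar>bexp m t\<bar> = 0" by (simp add: bexp_def)
  then show ?thesis by (simp only: mult_nonneg_nonneg[OF fact_ge_zero abs_ge_zero])
qed

text \<open>At 0 the difference quotient of \<open>bexp m\<close> is \<open>bexp (m + 1)\<close>,
  which tends to 0; for positive \<open>t\<close> the quotient rule applies.\<close>

lemma bexp_deriv: "(bexp m has_real_derivative bexp (m + 2) t - real m * bexp (m + 1) t) (at t)"
proof (cases t "0 :: real" rule: linorder_cases)
  case less
  have "(bexp m has_real_derivative 0) (at t) \<longleftrightarrow> ((\<lambda>_. 0) has_real_derivative 0) (at t)"
    by (rule DERIV_cong_ev) (use less eventually_nhds_in_open[of "{..<0}" t] in \<open>auto simp: bexp_def elim!: eventually_mono\<close>)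
  then show ?thesis using less by (simp add: bexp_def)
next
  case equal
  have "bexp (Suc m) \<midarrow>0\<rightarrow> 0"
    by (rule Lim_null_comparison[where g="\<lambda>t. fact (Suc (Suc m)) * \<bar>t\<bar>"])
      (auto intro!: tendsto_eq_intros always_eventually bexp_bound simp del: fact_Suc)
  moreover have "(\<lambda>t. (bexp m (0 + t) - bexp m 0) / t) \<midarrow>0\<rightarrow> 0 \<longleftrightarrow> bexp (Suc m) \<midarrow>0\<rightarrow> 0"
    by (rule filterlim_cong) (auto simp: eventually_at_filter bexp_def)
  ultimately show ?thesis using equal by (simp add: DERIV_def bexp_def)
next
  case greater
  have "((\<lambda>t. exp (- 1 / t) / t ^ m) has_real_derivative bexp (m + 2) t - real m * bexp (m + 1) t) (at t)"
  proof -
    have E: "((\<lambda>t. exp (- 1 / t)) has_real_derivative exp (- 1 / t) * (1 / (t * t))) (at t)"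
      using greater by (auto intro!: derivative_eq_intros simp: field_simps)
    have "((\<lambda>t. t ^ m) has_real_derivative real m * t ^ m / t) (at t)"
    proof -
      have "real m * t ^ (m - Suc 0) = real m * t ^ m / t"
        using greater by (cases m) simp_all
      then show ?thesis using DERIV_pow[of m t UNIV] by (simp only:)
    qed
    from DERIV_divide[OF E this] have "((\<lambda>t. exp (- 1 / t) / t ^ m) has_real_derivative
        (exp (- 1 / t) * (1 / (t * t)) * t ^ m - exp (- 1 / t) * (real m * t ^ m / t)) / (t ^ m * t ^ m)) (at t)"
      using greater by simp
    also have "(exp (- 1 / t) * (1 / (t * t)) * t ^ m - exp (- 1 / t) * (real m * t ^ m / t)) / (t ^ m * t ^ m) = bexp (m + 2) t - real m * bexp (m + 1) t"
      using greater by (simp add: bexp_def field_simps)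
    finally show ?thesis .
  qed
  moreover have "((\<lambda>t. exp (- 1 / t) / t ^ m) has_real_derivative D) (at t) \<longleftrightarrow> (bexp m has_real_derivative D) (at t)" for D
    by (rule DERIV_cong_ev) (use greater eventually_nhds_in_open[of "{0<..}" t] in \<open>auto simp: bexp_def elim!: eventually_mono\<close>)
  ultimately show ?thesis by simp
qed

text \<open>Induction for all \<open>m\<close> at once, since differentiating raises the
  index.\<close>

lemma ckn_bexp:
  assumes "open S"
  shows "ckn n S f \<Longrightarrow> ckn n S (\<lambda>x. bexp m (f x))"
proof (induction n arbitrary: m)
  case 0
  have "bexp m differentiable (at (f x))" for x
    using bexp_deriv by (meson differentiableI has_field_derivative_def)
  then show ?case using 0 by (auto intro!: differentiable_compose_at[of f _ "bexp m"])
next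
  case (Suc n)
  have *: "ckn n S (\<lambda>x. (bexp (m + 2) (f x) + (- real m) * bexp (m + 1) (f x)) * pd i f x)" for i
    using Suc.prems ckn_SucD[OF Suc.prems]
    by (intro ckn_bilinear[OF bounded_bilinear_mult assms] ckn_add[OF assms] ckn_const Suc.IH) auto
  have d: "((\<lambda>x. bexp m (f x)) has_derivative (\<lambda>v. (bexp (m + 2) (f x) - real m * bexp (m + 1) (f x)) * frechet_derivative f (at x) v)) (at x)"
    if "x \<in> S" for x
    by (rule has_derivative_compose[where f=f])
      (use Suc.prems that bexp_deriv[of m "f x"] in \<open>auto intro: differentiable_imp_has_derivative simp: has_field_derivative_def\<close>)
  have "ckn n S (pd i (\<lambda>x. bexp m (f x)))" for i
    by (rule ckn_cong[OF assms _ *]) (use pd_eq[OF d] in \<open>auto simp: pd_def\<close>)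
  then show ?case using d differentiableI by (simp, blast)
qed

lemma smooth_on_bexp: "open S \<Longrightarrow> smooth_on S f \<Longrightarrow> smooth_on S (\<lambda>x. bexp m (f x))"
  by (simp add: smooth_on_iff_ckn ckn_bexp)

text \<open>Quotient \<open>f / (f + g)\<close> with \<open>f\<close> positive inside radius
  \<open>r\<close> and \<open>g\<close> positive outside radius \<open>r / 2\<close>; the two
  regions cover the space, so the denominator never vanishes.\<close>

definition bump :: "real \<Rightarrow> real^4 \<Rightarrow> real" where
  "bump r y = bexp 0 (r\<^sup>2 - y \<bullet> y) * inverse (bexp 0 (r\<^sup>2 - y \<bullet> y) + bexp 0 (y \<bullet> y - r\<^sup>2 / 4))"

lemma bexp_nonneg: "bexp m t \<ge> 0" and bexp_pos_iff: "bexp m t > 0 \<longleftrightarrow> t > 0"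
  by (simp_all add: bexp_def)

lemma bump_denominator:
  assumes "r > 0" shows "bexp 0 (r\<^sup>2 - y \<bullet> y) + bexp 0 (y \<bullet> y - r\<^sup>2 / 4) > 0"
proof -
  have "r\<^sup>2 > 0" using assms by simp
  then have "r\<^sup>2 - y \<bullet> y > 0 \<or> y \<bullet> y - r\<^sup>2 / 4 > 0" by linarith
  then show ?thesis using bexp_nonneg bexp_pos_iff by (metis add_nonneg_pos add_pos_nonneg)
qed

lemma smooth_bump: "r > 0 \<Longrightarrow> smooth_on S (\<lambda>y. bump r (y - c))"
proof (rule smooth_on_subset[of UNIV])
  assume r: "r > 0"
  have s: "smooth_on UNIV (\<lambda>y. (y - c) \<bullet> (y - c))"
    by (intro smooth_on_bilinear[OF bounded_bilinear_inner] smooth_on_diff smooth_on_id smooth_on_const) auto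
  show "smooth_on UNIV (\<lambda>y. bump r (y - c))"
    unfolding bump_def
    by (intro smooth_on_mult smooth_on_inverse smooth_on_add smooth_on_bexp smooth_on_diff smooth_on_const s)
      (use bump_denominator[OF r] in \<open>auto simp: less_le\<close>)
qed simp

lemma bump_simps:
  assumes "r > 0"
  shows "norm y \<ge> r \<Longrightarrow> bump r y = 0" "norm y \<le> r / 2 \<Longrightarrow> bump r y = 1" "bump r y \<ge> 0" "norm y < r \<Longrightarrow> bump r y > 0"
proof -
  have n: "y \<bullet> y = (norm y)\<^sup>2" by (simp add: power2_norm_eq_inner)
  show "bump r y = 0" if "norm y \<ge> r"
  proof -
    have "r\<^sup>2 \<le> (norm y)\<^sup>2" using that assms by (intro power_mono) auto
    then show ?thesis by (simp add: bump_def n bexp_def)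
  qed
  show "bump r y = 1" if "norm y \<le> r / 2"
  proof -
    have "(norm y)\<^sup>2 \<le> (r / 2)\<^sup>2" using that by (intro power_mono) auto
    then have "bexp 0 (y \<bullet> y - r\<^sup>2 / 4) = 0" by (simp add: n bexp_def power_divide)
    then show ?thesis using bump_denominator[OF assms, of y] by (simp add: bump_def)
  qed
  show "bump r y \<ge> 0" using bump_denominator[OF assms, of y] bexp_nonneg by (simp add: bump_def)
  show "bump r y > 0" if "norm y < r"
  proof -
    have "(norm y)\<^sup>2 < r\<^sup>2" using that by (intro power_strict_mono) auto
    then have "bexp 0 (r\<^sup>2 - y \<bullet> y) > 0" by (simp add: n bexp_def)
    then show ?thesis using bump_denominator[OF assms, of y] by (simp add: bump_def)
  qed
qed

lemma smooth_on_glue: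
  assumes "open S" "open S1" "open S2" "S \<subseteq> S1 \<union> S2" "smooth_on S1 f" "smooth_on S2 g"
    and "\<And>x. x \<in> S1 \<Longrightarrow> F x = f x" "\<And>x. x \<in> S2 \<Longrightarrow> F x = g x"
  shows "smooth_on S F"
proof (rule smooth_on_local[OF assms(1)])
  fix x assume "x \<in> S"
  then consider "x \<in> S1" | "x \<in> S2" using assms(4) by blast
  then show "\<exists>T. open T \<and> x \<in> T \<and> smooth_on T F"
    using smooth_on_cong[OF assms(2,5), of F] smooth_on_cong[OF assms(3,6), of F] assms(2,3,7,8) by (cases, auto)
qed

subsection \<open>Integrals of derivatives with compact support\<close>

lemma pd_zero_outside:
  assumes "closed C" "\<And>x. x \<notin> C \<Longrightarrow> G x = 0" "x \<notin> C"
  shows "pd j G x = 0"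
  using pd_cong[of "- C" x G "\<lambda>_. 0" j] assms by (simp add: open_Compl)

lemma integrable_compact_support:
  fixes f :: "real^4 \<Rightarrow> 'b::euclidean_space"
  assumes "compact C" "continuous_on UNIV f" "\<And>x. x \<notin> C \<Longrightarrow> f x = 0"
  shows "integrable lborel f"
proof -
  have "integrable lborel (\<lambda>x. if x \<in> C then f x else 0)"
    using borel_integrable_compact[OF assms(1) continuous_on_subset[OF assms(2)]] by (simp add: indicator_scaleR_eq_if)
  moreover have "(\<lambda>x. if x \<in> C then f x else 0) = f" using assms(3) by auto
  ultimately show ?thesis by simp
qed

text \<open>The difference quotients in direction \<open>j\<close> have integral \<open>0\<close> because Lebesgue measure is
  translation invariant.\<close>

lemma integral_pd_real:
  fixes G :: "real^4 \<Rightarrow> real"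
  assumes G: "smooth_on UNIV G" and C: "compact C" "\<And>x. x \<notin> C \<Longrightarrow> G x = 0"
  shows "(\<integral>x. pd j G x \<partial>lborel) = 0"
proof -
  have dG: "G differentiable (at x)" for x by (rule smooth_on_differentiable[OF open_UNIV G]) simp
  have cG: "continuous_on UNIV G" by (rule smooth_on_continuous[OF open_UNIV G])
  have cpd: "continuous_on UNIV (pd j G)" by (rule smooth_on_continuous[OF open_UNIV smooth_on_pd[OF open_UNIV G]])
  have zpd: "pd j G x = 0" if "x \<notin> C" for x by (rule pd_zero_outside[OF compact_imp_closed[OF C(1)] C(2) that])
  have "bounded (pd j G ` C)"
    by (rule compact_imp_bounded[OF compact_continuous_image[OF continuous_on_subset[OF cpd] C(1)]]) simp
  then obtain M0 where M0: "\<And>x. x \<in> C \<Longrightarrow> \<bar>pd j G x\<bar> \<le> M0" unfolding bounded_iff by auto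
  define M where "M = max M0 0"
  have Mpos: "M \<ge> 0" by (simp add: M_def)
  have M: "\<bar>pd j G x\<bar> \<le> M" for x
  proof (cases "x \<in> C")
    case True
    then show ?thesis using M0[of x] unfolding M_def by linarith
  next
    case False
    then show ?thesis using zpd[of x] Mpos by simp
  qed
  obtain R where R: "\<And>x. x \<in> C \<Longrightarrow> norm x \<le> R"
    using compact_imp_bounded[OF C(1)] unfolding bounded_iff by auto
  define e :: "real^4" where "e = axis j 1"
  define s where "s n = 1 / real (Suc n)" for n
  have s: "s n > 0" "s n \<le> 1" for n by (simp_all add: s_def)
  define q where "q n x = (G (x + s n *\<^sub>R e) - G x) / s n" for n x
  have iG: "integrable lborel G" by (rule integrable_compact_support[OF C(1) cG C(2)])
  have trans: "integrable lborel (\<lambda>x. G (x + v))" "(\<integral>x. G (x + v) \<partial>lborel) = (\<integral>x. G x \<partial>lborel)" for v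
  proof -
    have l: "distr lborel borel ((+) v) = lborel" by (rule lborel_distr_plus)
    have "integrable (distr lborel borel ((+) v)) G" using iG l by simp
    then show "integrable lborel (\<lambda>x. G (x + v))"
      by (subst (asm) integrable_distr_eq) (auto simp: add.commute borel_measurable_continuous_onI[OF cG])
    have "(\<integral>x. G x \<partial>lborel) = (\<integral>x. G x \<partial>distr lborel borel ((+) v))" using l by simp
    also have "\<dots> = (\<integral>x. G (v + x) \<partial>lborel)"
      by (rule integral_distr) (auto simp: borel_measurable_continuous_onI[OF cG])
    finally show "(\<integral>x. G (x + v) \<partial>lborel) = (\<integral>x. G x \<partial>lborel)" by (simp add: add.commute)
  qed
  have q0: "(\<integral>x. q n x \<partial>lborel) = 0" for n
    unfolding q_def using trans iG by simp
  have mq: "q n \<in> borel_measurable lborel" for n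
    unfolding q_def using trans(1) iG by (intro borel_measurable_divide borel_measurable_diff borel_measurable_const borel_measurable_integrable) auto
  have qlim: "(\<lambda>n. q n x) \<longlonglongrightarrow> pd j G x" for x
  proof -
    have "((\<lambda>u. G (x + u *\<^sub>R e)) has_real_derivative pd j G (x + 0 *\<^sub>R e)) (at 0)"
      unfolding e_def by (rule pd_line[OF dG])
    then have "(\<lambda>u. (G (x + u *\<^sub>R e) - G x) / u) \<midarrow>0\<rightarrow> pd j G x"
      by (simp add: DERIV_def)
    moreover have "filterlim s (at 0) sequentially"
    proof -
      have "s = (\<lambda>n. inverse (real (Suc n)))" by (auto simp: s_def inverse_eq_divide)
      then show ?thesis
        using LIMSEQ_inverse_real_of_nat s(1) by (auto simp: filterlim_at)
    qed
    ultimately show ?thesis unfolding q_def by (rule filterlim_compose)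
  qed
  \<comment> \<open>Domination: the mean value theorem bounds the quotients by \<open>M\<close>, and
    since the steps are at most 1 they all vanish outside the ball of radius
    \<open>R + 1\<close>.\<close>
  have qbound: "norm (q n x) \<le> M * indicator (cball 0 (R + 1)) x" for n x
  proof (cases "x \<in> cball 0 (R + 1)")
    case True
    have "\<exists>z>0. z < s n \<and> G (x + s n *\<^sub>R e) - G (x + 0 *\<^sub>R e) = (s n - 0) * pd j G (x + z *\<^sub>R e)"
      unfolding e_def by (rule MVT2[OF s(1)]) (rule pd_line[OF dG])
    then obtain z where "G (x + s n *\<^sub>R e) - G x = s n * pd j G (x + z *\<^sub>R e)" by auto
    then have "q n x = pd j G (x + z *\<^sub>R e)" using s(1)[of n] by (simp add: q_def)
    then show ?thesis using True M by simp
  next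
    case False
    have "norm (s n *\<^sub>R e) \<le> 1" using s[of n] by (simp add: e_def)
    then have "norm x - 1 \<le> norm (x + s n *\<^sub>R e)"
      using norm_diff_ineq[of x "s n *\<^sub>R e"] by linarith
    then have "x \<notin> C" "x + s n *\<^sub>R e \<notin> C" using False R[of x] R[of "x + s n *\<^sub>R e"] by auto
    then show ?thesis using False by (simp add: q_def C(2))
  qed
  have "integrable lborel (\<lambda>x. M * indicator (cball 0 (R + 1)) x :: real)"
    by (intro integrable_mult_right integrable_real_indicator)
      (simp_all only: sets_lborel borel_closed closed_cball emeasure_bounded_finite bounded_cball)
  then have "(\<lambda>n. \<integral>x. q n x \<partial>lborel) \<longlonglongrightarrow> (\<integral>x. pd j G x \<partial>lborel)"
    using borel_measurable_continuous_onI[OF cpd] mq qlim qbound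
    by (intro integral_dominated_convergence[where w="\<lambda>x. M * indicator (cball 0 (R + 1)) x"]) auto
  then show ?thesis unfolding q0 using LIMSEQ_unique tendsto_const by blast
qed

lemma integral_pd:
  fixes G :: "real^4 \<Rightarrow> complex"
  assumes G: "smooth_on UNIV G" and C: "compact C" "\<And>x. x \<notin> C \<Longrightarrow> G x = 0"
  shows "integrable lborel (pd j G)" "(\<integral>x. pd j G x \<partial>lborel) = 0"
proof -
  have dG: "G differentiable (at x)" for x by (rule smooth_on_differentiable[OF open_UNIV G]) simp
  show i: "integrable lborel (pd j G)"
    by (rule integrable_compact_support[OF C(1) smooth_on_continuous[OF open_UNIV smooth_on_pd[OF open_UNIV G]]])
      (rule pd_zero_outside[OF compact_imp_closed[OF C(1)] C(2)])
  have "(\<integral>x. pd j (\<lambda>x. Re (G x)) x \<partial>lborel) = 0" "(\<integral>x. pd j (\<lambda>x. Im (G x)) x \<partial>lborel) = 0"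
    using C by (auto intro!: integral_pd_real[OF smooth_on_linear[OF _ open_UNIV G]] bounded_linear_Re bounded_linear_Im)
  then have "(\<integral>x. Re (pd j G x) \<partial>lborel) = 0" "(\<integral>x. Im (pd j G x) \<partial>lborel) = 0"
    by (simp_all add: pd_bounded_linear[OF bounded_linear_Re dG] pd_bounded_linear[OF bounded_linear_Im dG])
  then show "(\<integral>x. pd j G x \<partial>lborel) = 0"
    using i by (simp add: complex_eq_iff)
qed

subsection \<open>Integrals of volume forms over the manifold\<close>

context u2_geometry
begin

abbreviation vol :: "nat \<Rightarrow> real form" where "vol \<equiv> \<lambda>n. coframe_vol (coframe (\<Psi> n))"
abbreviation orient :: "nat \<Rightarrow> real^4 \<Rightarrow> real" where "orient n x \<equiv> sgn (vol n x [1, 2, 3, 4])"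

text \<open>Smooth four-forms, each represented by its component \<open>[1, 2, 3, 4]\<close>
  alone.\<close>

definition volume_form :: "(nat \<Rightarrow> real^4 \<Rightarrow> complex) \<Rightarrow> bool" where
  "volume_form f \<longleftrightarrow> (\<forall>n. smooth_on (dom n) (f n)) \<and>
     (\<forall>m n. \<forall>x\<in>overlap m n. f m x = det (jac m n x) *\<^sub>R f n (tmap m n x))"

lemma volume_formI:
  assumes "\<And>n. smooth_on (dom n) (f n)" "\<And>m n x. x \<in> overlap m n \<Longrightarrow> f m x = det (jac m n x) *\<^sub>R f n (tmap m n x)"
  shows "volume_form f"
  using assms unfolding volume_form_def by blast

lemma volume_formD:
  assumes "volume_form f"
  shows "smooth_on (dom n) (f n)" "x \<in> overlap m n \<Longrightarrow> f m x = det (jac m n x) *\<^sub>R f n (tmap m n x)"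
  using assms unfolding volume_form_def by blast+

lemma volume_form_cong:
  assumes "volume_form f" "\<And>n x. x \<in> dom n \<Longrightarrow> f n x = g n x"
  shows "volume_form g"
proof (rule volume_formI)
  show "smooth_on (dom n) (g n)" for n
    by (rule smooth_on_cong[OF chart(2) volume_formD(1)[OF assms(1)] assms(2)])
  fix m n x assume x: "x \<in> overlap m n"
  then have "x \<in> dom m" "tmap m n x \<in> dom n" by auto
  then show "g m x = det (jac m n x) *\<^sub>R g n (tmap m n x)"
    using volume_formD(2)[OF assms(1) x] assms(2) by simp
qed

lemma volume_form_add: "volume_form f \<Longrightarrow> volume_form g \<Longrightarrow> volume_form (\<lambda>n x. f n x + g n x)"
  by (intro volume_formI smooth_on_add chart(2)) (simp_all add: volume_formD scaleR_add_right)

lemma volume_form_scale: "volume_form f \<Longrightarrow> volume_form (\<lambda>n x. c *\<^sub>R f n x)"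
  by (intro volume_formI smooth_on_scaleR smooth_on_const chart(2)) (simp_all add: volume_formD mult.commute)

text \<open>The constant extension to all lists is harmless, as integration reads only the component
  \<open>[1, 2, 3, 4]\<close>.\<close>

definition form_of :: "(nat \<Rightarrow> real^4 \<Rightarrow> complex) \<Rightarrow> nat \<Rightarrow> complex form" where
  "form_of f n x xs = f n x"

definition tint :: "'m set \<Rightarrow> (nat \<Rightarrow> real^4 \<Rightarrow> complex) \<Rightarrow> complex" where
  "tint K f = form_integral U \<phi> vol K (form_of f)"

lemma volume_form_is_density: "volume_form f \<Longrightarrow> is_density (\<lambda>n x. orient n x *\<^sub>R f n x)"
  by (rule density_oriented) (rule volume_formD(2))

lemma volume_form_continuous: "volume_form f \<Longrightarrow> continuous_on (dom n) (\<lambda>x. orient n x *\<^sub>R f n x)"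
  by (intro continuous_on_scaleR continuous_orientation smooth_on_continuous[OF chart(2)] volume_formD(1))

lemma volume_form_integrable:
  assumes "volume_form f" "compact K"
  shows "form_integrable U \<phi> vol K (form_of f)"
  by (rule form_integrable_compact[where f="\<lambda>n x. orient n x *\<^sub>R f n x", OF volume_form_is_density[OF assms(1)] volume_form_continuous[OF assms(1)] _ assms(2)])
    (simp add: form_of_def)

lemma form_integral_eq_tint:
  assumes "\<And>n x. x \<in> dom n \<Longrightarrow> L n x [1, 2, 3, 4] = f n x"
  shows "form_integral U \<phi> vol K L = tint K f"
proof -
  have "local_integrand U \<phi> vol K L (n, x) = local_integrand U \<phi> vol K (form_of f) (n, x)" for n x
  proof (cases "x \<in> dom n")
    case True
    then show ?thesis using assms by (simp add: local_integrand_eq form_of_def)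
  next
    case False
    then have "x \<notin> \<phi> n ` (K \<inter> piece n)" using piece_subset by blast
    then show ?thesis by (simp add: local_integrand_eq)
  qed
  then have "local_integrand U \<phi> vol K L = local_integrand U \<phi> vol K (form_of f)" by auto
  then show ?thesis by (simp add: tint_def form_integral_def)
qed

lemma tint_add:
  assumes "volume_form f" "volume_form g" "compact K"
  shows "tint K (\<lambda>n x. f n x + g n x) = tint K f + tint K g"
proof -
  have "local_integrand U \<phi> vol K (form_of (\<lambda>n x. f n x + g n x)) = (\<lambda>z. local_integrand U \<phi> vol K (form_of f) z + local_integrand U \<phi> vol K (form_of g) z)"
    by (auto simp: local_integrand_eq form_of_def scaleR_add_right)
  then show ?thesis
    using volume_form_integrable[OF assms(1,3)] volume_form_integrable[OF assms(2,3)]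
    by (simp add: tint_def form_integral_def form_integrable_def)
qed

lemma tint_scale: "tint K (\<lambda>n x. c *\<^sub>R f n x) = c *\<^sub>R tint K f"
proof -
  have "local_integrand U \<phi> vol K (form_of (\<lambda>n x. c *\<^sub>R f n x)) = (\<lambda>z. c *\<^sub>R local_integrand U \<phi> vol K (form_of f) z)"
    by (auto simp: local_integrand_eq form_of_def)
  then show ?thesis by (simp add: tint_def form_integral_def)
qed

lemma tint_cong: "(\<And>n x. x \<in> dom n \<Longrightarrow> f n x = g n x) \<Longrightarrow> tint K f = tint K g"
  using form_integral_eq_tint[of "form_of f" g K] by (simp add: tint_def form_of_def)

lemma tint_in_chart:
  assumes "volume_form f" "compact K" "K \<subseteq> U n"
  shows "tint K f = (\<integral>x. indicator (\<phi> n ` K) x *\<^sub>R (orient n x *\<^sub>R f n x) \<partial>lborel)"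
proof -
  have K: "K \<in> sets borel" using assms(2) by (rule borel_compact)
  show ?thesis
    unfolding tint_def
    by (rule integral_in_chart(2)[where f="\<lambda>n x. orient n x *\<^sub>R f n x", OF volume_form_is_density[OF assms(1)] volume_form_continuous[OF assms(1)] _ K assms(3)
          integrable_compact_subset[where f="\<lambda>n x. orient n x *\<^sub>R f n x", OF volume_form_continuous[OF assms(1)] K order_refl assms(2,3)]])
      (simp add: form_of_def)
qed

lemma tint_support:
  assumes "K \<subseteq> K0" "\<And>n x. x \<in> dom n \<Longrightarrow> chart_inv n x \<notin> K \<Longrightarrow> f n x = 0"
  shows "tint K0 f = tint K f"
proof -
  have "local_integrand U \<phi> vol K0 (form_of f) (n, x) = local_integrand U \<phi> vol K (form_of f) (n, x)" for n x
  proof (cases "x \<in> dom n")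
    case True
    have iff: "x \<in> \<phi> n ` (K' \<inter> piece n) \<longleftrightarrow> chart_inv n x \<in> K' \<inter> piece n" for K'
    proof
      assume "x \<in> \<phi> n ` (K' \<inter> piece n)"
      then show "chart_inv n x \<in> K' \<inter> piece n" using piece_subset[of n] by (auto simp: subset_iff)
    next
      assume "chart_inv n x \<in> K' \<inter> piece n"
      then show "x \<in> \<phi> n ` (K' \<inter> piece n)" using chart_inv_in(2)[OF True] by (metis imageI)
    qed
    show ?thesis
      using assms(1) assms(2)[OF True] unfolding local_integrand_eq form_of_def by (auto simp: indicator_def iff)
  next
    case False
    then have "x \<notin> \<phi> n ` (K \<inter> piece n)" "x \<notin> \<phi> n ` (K0 \<inter> piece n)" using piece_subset by blast+
    then show ?thesis by (simp add: local_integrand_eq)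
  qed
  then have "local_integrand U \<phi> vol K0 (form_of f) = local_integrand U \<phi> vol K (form_of f)" by auto
  then show ?thesis by (simp add: tint_def form_integral_def)
qed

lemma tint_empty: "tint {} f = 0"
proof -
  have "local_integrand U \<phi> vol {} (form_of f) = (\<lambda>_. 0)" by (auto simp: local_integrand_eq)
  then show ?thesis by (simp add: tint_def form_integral_def)
qed

subsection \<open>The first variation\<close>

text \<open>Coefficient of \<open>t\<close> in the expansion of
  \<open>\<Psi>\<^sup>\<dagger> \<and> F \<and> \<Psi>\<close> along \<open>A + t B\<close>: the
  covariant exterior derivative of \<open>B\<close> between two frames.\<close>

definition var_form :: "(nat \<Rightarrow> real^4 \<Rightarrow> (complex^2^2)^4) \<Rightarrow> (nat \<Rightarrow> real^4 \<Rightarrow> (complex^2^2)^4) \<Rightarrow> nat \<Rightarrow> real^4 \<Rightarrow> complex" where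
  "var_form A B n x = sandwich (\<Psi> n x) (\<lambda>j k. ext_d (form1 (B n)) x [j, k] + comm_form (A n x) (B n x) j k)"

definition quad_form :: "(nat \<Rightarrow> real^4 \<Rightarrow> (complex^2^2)^4) \<Rightarrow> nat \<Rightarrow> real^4 \<Rightarrow> complex" where
  "quad_form B n x = sandwich (\<Psi> n x) (\<lambda>j k. B n x $ j ** B n x $ k - B n x $ k ** B n x $ j)"

lemma lagrangian_add:
  assumes A: "u2_connection U \<phi> h A a" and B: "adjoint_form B" and x: "x \<in> dom n"
  shows "lagrangian lam mu nu (\<Psi> n) (\<lambda>x. A n x + t *\<^sub>R B n x) (a n) x [1, 2, 3, 4] =
    lagrangian lam mu nu (\<Psi> n) (A n) (a n) x [1, 2, 3, 4] + t *\<^sub>R (lam *\<^sub>R var_form A B n x) + (t * t) *\<^sub>R (lam *\<^sub>R quad_form B n x)"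
proof -
  have d: "A n differentiable (at x)" "B n differentiable (at x)"
    using smooth_on_differentiable[OF chart(2) connD(1)[OF A] x] smooth_on_differentiable[OF chart(2) adjointD(1)[OF B] x] .
  show ?thesis
    unfolding lagrangian_top_eq var_form_def quad_form_def curvature_add[OF d] sandwich_linear
    by (simp add: scaleR_add_right algebra_simps)
qed

lemma volume_form_lagrangian:
  "u2_connection U \<phi> h A a \<Longrightarrow> volume_form (\<lambda>n x. lagrangian lam mu nu (\<Psi> n) (A n) (a n) x [1, 2, 3, 4])"
  by (intro volume_formI smooth_lagrangian lagrangian_trans)

text \<open>Neither \<open>ext_d\<close> of \<open>B\<close> nor \<open>comm_form\<close> of
  \<open>A\<close> and \<open>B\<close> is covariant alone, so covariance is inherited from the
  Lagrangian: the coefficients of a quadratic polynomial are combinations of its values at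
  \<open>1\<close>, \<open>-1\<close> and \<open>0\<close>.\<close>

lemma volume_form_var:
  assumes A: "u2_connection U \<phi> h A a" and B: "adjoint_form B"
  shows "volume_form (var_form A B)" "volume_form (quad_form B)"
proof -
  \<comment> \<open>The parameters \<open>1\<close>, \<open>0\<close>, \<open>0\<close> isolate the
    curvature term of the Lagrangian.\<close>
  define L where "L t n x = lagrangian 1 0 0 (\<Psi> n) (\<lambda>x. A n x + t *\<^sub>R B n x) (a n) x [1, 2, 3, 4]" for t n x
  have L: "volume_form (L t)" for t
    unfolding L_def[abs_def] by (rule volume_form_lagrangian[OF connection_add_variation[OF A B]])
  have e: "L t n x = L 0 n x + t *\<^sub>R var_form A B n x + (t * t) *\<^sub>R quad_form B n x" if "x \<in> dom n" for t n x
    using lagrangian_add[OF A B that, of 1 0 0 t] by (simp add: L_def)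
  show "volume_form (var_form A B)"
    by (rule volume_form_cong[OF volume_form_scale[OF volume_form_add[OF L[of 1] volume_form_scale[OF L[of "-1"], of "-1"]], of "1/2"]])
      (simp add: e[of _ _ 1] e[of _ _ "-1"] scaleR_conv_of_real)
  show "volume_form (quad_form B)"
    by (rule volume_form_cong[OF volume_form_add[OF volume_form_scale[OF volume_form_add[OF L[of 1] L[of "-1"]], of "1/2"] volume_form_scale[OF L[of 0], of "-1"]]])
      (simp add: e[of _ _ 1] e[of _ _ "-1"] scaleR_conv_of_real field_simps)
qed

lemma frame_action_eq_tint:
  "frame_action U \<phi> lam mu nu K \<Psi> A a = tint K (\<lambda>n x. lagrangian lam mu nu (\<Psi> n) (A n) (a n) x [1, 2, 3, 4])"
  unfolding frame_action_def by (rule form_integral_eq_tint) simp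

text \<open>The action is a quadratic polynomial in \<open>t\<close>, so no interchange of limit and
  integral is involved.\<close>

lemma frame_action_derivative:
  assumes A: "u2_connection U \<phi> h A a" and B: "adjoint_form B" and K: "compact K"
  shows "((\<lambda>t::real. frame_action U \<phi> lam mu nu K \<Psi> (\<lambda>n x. A n x + t *\<^sub>R B n x) a)
      has_vector_derivative lam *\<^sub>R tint K (var_form A B)) (at 0)"
proof -
  let ?f = "\<lambda>n x. lagrangian lam mu nu (\<Psi> n) (A n) (a n) x [1, 2, 3, 4]"
  note v = volume_form_var[OF A B]
  have "frame_action U \<phi> lam mu nu K \<Psi> (\<lambda>n x. A n x + t *\<^sub>R B n x) a =
     tint K ?f + t *\<^sub>R (lam *\<^sub>R tint K (var_form A B)) + (t * t) *\<^sub>R (lam *\<^sub>R tint K (quad_form B))" for t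
  proof -
    have "frame_action U \<phi> lam mu nu K \<Psi> (\<lambda>n x. A n x + t *\<^sub>R B n x) a =
       tint K (\<lambda>n x. ?f n x + t *\<^sub>R (lam *\<^sub>R var_form A B n x) + (t * t) *\<^sub>R (lam *\<^sub>R quad_form B n x))"
      unfolding frame_action_eq_tint by (rule tint_cong) (rule lagrangian_add[OF A B])
    then show ?thesis
      using v K by (simp add: tint_add tint_scale volume_form_add volume_form_scale volume_form_lagrangian[OF A])
  qed
  then show ?thesis
    by (auto intro!: derivative_eq_intros)
qed

text \<open>Compact sets are closed in a Hausdorff space, so \<open>B\<close> vanishes on a
  neighbourhood of \<open>x\<close>, and its derivatives at \<open>x\<close> vanish too.\<close>

lemma var_form_zero:
  assumes K: "compact K" and B: "\<And>n p. p \<in> U n - K \<Longrightarrow> B n (\<phi> n p) = 0" and x: "x \<in> dom n" "chart_inv n x \<notin> K"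
  shows "var_form A B n x = 0"
proof -
  have o: "open (\<phi> n ` (U n - K))"
    using chart(1)[of n] compact_imp_closed[OF K] by (intro open_chart_image) auto
  have xo: "x \<in> \<phi> n ` (U n - K)" using x by force
  have z: "B n y = 0" if "y \<in> \<phi> n ` (U n - K)" for y using B that by auto
  have "pd j (\<lambda>y. B n y $ k) x = 0" for j k
    using pd_cong[OF o xo, of "\<lambda>y. B n y $ k" "\<lambda>_. 0" j] z by simp
  then have "ext_d (form1 (B n)) x [j, k] = 0" for j k by (simp add: ext_d_form1_pair)
  then show ?thesis
    using z[OF xo] by (simp add: var_form_def sandwich_def comm_form_def top4_def herm_simps)
qed

text \<open>The orientation sign is locally constant, hence passes through derivatives.\<close>

lemma smooth_oriented:
  assumes "smooth_on (dom n) f"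
  shows "smooth_on (dom n) (\<lambda>x. orient n x *\<^sub>R f x)"
    and "x \<in> dom n \<Longrightarrow> pd j (\<lambda>x. orient n x *\<^sub>R f x) x = orient n x *\<^sub>R pd j f x"
proof -
  have loc: "\<exists>T. open T \<and> x \<in> T \<and> T \<subseteq> dom n \<and> (\<forall>y\<in>T. orient n y = orient n x)" if x: "x \<in> dom n" for x
  proof -
    have c: "continuous_on (dom n) (orient n)" by (rule continuous_orientation)
    \<comment> \<open>Radius 1 suffices, since two values among 1 and -1 at distance less than 1
      coincide.\<close>
    define T where "T = dom n \<inter> orient n -` ball (orient n x) 1"
    have "open T" unfolding T_def by (rule continuous_open_preimage[OF c chart(2) open_ball])
    moreover have "orient n y = orient n x" if "y \<in> T" for y
    proof -
      have "orient n y \<noteq> 0" "orient n x \<noteq> 0" using that x det_frame by (auto simp: T_def coframe_vol_eq sgn_zero_iff)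
      moreover have "\<bar>orient n x - orient n y\<bar> < 1" using that by (simp add: T_def dist_real_def)
      ultimately show ?thesis by (auto simp: sgn_real_def split: if_splits)
    qed
    moreover have "x \<in> T" "T \<subseteq> dom n" using x by (simp_all add: T_def)
    ultimately show ?thesis by blast
  qed
  show "smooth_on (dom n) (\<lambda>x. orient n x *\<^sub>R f x)"
  proof (rule smooth_on_local[OF chart(2)])
    fix x assume "x \<in> dom n"
    from loc[OF this] obtain T where T: "open T" "x \<in> T" "T \<subseteq> dom n" "\<forall>y\<in>T. orient n y = orient n x" by (elim exE conjE)
    have "smooth_on T (\<lambda>y. orient n x *\<^sub>R f y)"
      by (intro smooth_on_scaleR smooth_on_const T(1) smooth_on_subset[OF assms T(3)])
    then have "smooth_on T (\<lambda>x. orient n x *\<^sub>R f x)"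
      by (rule smooth_on_cong[OF T(1)]) (simp only: T(4)[rule_format])
    then show "\<exists>T. open T \<and> x \<in> T \<and> smooth_on T (\<lambda>x. orient n x *\<^sub>R f x)" using T(1,2) by (intro exI[of _ T] conjI)
  qed
  assume x: "x \<in> dom n"
  from loc[OF this] obtain T where T: "open T" "x \<in> T" "\<forall>y\<in>T. orient n y = orient n x" by (elim exE conjE)
  have "pd j (\<lambda>x. orient n x *\<^sub>R f x) x = pd j (\<lambda>y. orient n x *\<^sub>R f y) x"
    by (rule pd_cong[OF T(1,2)]) (simp only: T(3)[rule_format])
  then show "pd j (\<lambda>x. orient n x *\<^sub>R f x) x = orient n x *\<^sub>R pd j f x"
    by (simp add: pd_bounded_linear[OF bounded_linear_scaleR_right smooth_on_differentiable[OF chart(2) assms x]])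
qed

text \<open>Divergence theorem in one chart: the oriented flux vanishes off the compact support,
  extends by zero to a smooth function on \<open>real^4\<close>, and its partial derivatives
  integrate to zero.\<close>

lemma var_asd_local:
  assumes conn: "u2_connection U \<phi> h A a" and B: "adjoint_form B" "\<And>m p. p \<in> U m - K \<Longrightarrow> B m (\<phi> m p) = 0" and K: "compact K" "K \<subseteq> U n"
  shows "tint K (var_form (\<lambda>n. asd_conn (\<Psi> n)) B) = 0"
proof -
  note v = volume_form_var(1)[OF asd_connection[OF conn] B(1)]
  let ?C = "\<phi> n ` K"
  have C: "compact ?C" "closed ?C" "?C \<subseteq> dom n"
    using compact_chart_image[OF K] K(2) compact_imp_closed by auto
  have fl: "smooth_on (dom n) (flux (\<Psi> n) (B n) j)" for j
    by (rule smooth_flux[OF chart(2) smooth_frame adjointD(1)[OF B(1)]])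
  define G where "G j x = (if x \<in> dom n then orient n x *\<^sub>R flux (\<Psi> n) (B n) j x else 0)" for j x
  have G0: "G j x = 0" if "x \<notin> ?C" for j x
  proof (cases "x \<in> dom n")
    case True
    then obtain p where "p \<in> U n - K" "x = \<phi> n p" using \<open>x \<notin> ?C\<close> by auto
    then have "B n x = 0" using B(2) by simp
    then show ?thesis by (simp add: G_def flux_def herm_simps)
  qed (simp add: G_def)
  have smG: "smooth_on UNIV (G j)" for j
    by (rule smooth_on_glue[OF open_UNIV chart(2)[of n] open_Compl[OF C(2)] _ smooth_oriented(1)[OF fl] smooth_on_const[of _ 0]])
      (use C(3) G0 in \<open>auto simp: G_def\<close>)
  have pdG: "pd j (G j) x = orient n x *\<^sub>R pd j (flux (\<Psi> n) (B n) j) x" if "x \<in> dom n" for j x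
    using pd_cong[OF chart(2) that, of "G j" "\<lambda>x. orient n x *\<^sub>R flux (\<Psi> n) (B n) j x" j] smooth_oriented(2)[OF fl that]
    by (simp add: G_def)
  have "indicator ?C x *\<^sub>R (orient n x *\<^sub>R var_form (\<lambda>n. asd_conn (\<Psi> n)) B n x) = (\<Sum>j\<in>UNIV. pd j (G j) x)" for x
  proof (cases "x \<in> ?C")
    case True
    then have x: "x \<in> dom n" using C(3) by blast
    have "var_form (\<lambda>n. asd_conn (\<Psi> n)) B n x = (\<Sum>j\<in>UNIV. pd j (flux (\<Psi> n) (B n) j) x)"
      unfolding var_form_def
      by (rule sandwich_exact[OF chart(2) x smooth_frame det_frame[OF x] adjointD(1)[OF B(1)] adjointD(2)[OF B(1) x]])
    then show ?thesis using True by (simp add: pdG[OF x] scaleR_sum_right)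
  next
    case False
    then show ?thesis using pd_zero_outside[OF C(2) G0 False] by simp
  qed
  then have "tint K (var_form (\<lambda>n. asd_conn (\<Psi> n)) B) = (\<integral>x. (\<Sum>j\<in>UNIV. pd j (G j) x) \<partial>lborel)"
    unfolding tint_in_chart[OF v K] by simp
  also have "\<dots> = (\<Sum>j\<in>UNIV. \<integral>x. pd j (G j) x \<partial>lborel)"
    by (rule Bochner_Integration.integral_sum) (rule integral_pd(1)[OF smG C(1) G0])
  also have "\<dots> = 0"
    by (rule sum.neutral) (use integral_pd(2)[OF smG C(1) G0] in blast)
  finally show ?thesis .
qed

section \<open>Cutting variations off in coordinate balls\<close>

definition chart_bump :: "nat \<Rightarrow> real^4 \<Rightarrow> real \<Rightarrow> 'm \<Rightarrow> real" where
  "chart_bump n c r q = (if q \<in> U n then bump r (\<phi> n q - c) else 0)"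

definition smooth_fun :: "('m \<Rightarrow> real) \<Rightarrow> bool" where
  "smooth_fun F \<longleftrightarrow> (\<forall>m. smooth_on (dom m) (\<lambda>x. F (chart_inv m x)))"

lemma chart_bump_outside:
  assumes "r > 0" "q \<notin> chart_inv n ` cball c r"
  shows "chart_bump n c r q = 0"
proof (cases "q \<in> U n")
  case True
  then have "\<phi> n q \<notin> cball c r" using assms(2) by (metis chart_inv_left imageI)
  then have "norm (\<phi> n q - c) \<ge> r" by (simp add: dist_norm norm_minus_commute)
  then show ?thesis using bump_simps(1)[OF assms(1)] by (simp add: chart_bump_def)
qed (simp add: chart_bump_def)

lemma compact_chart_cball:
  assumes "cball c r \<subseteq> dom n"
  shows "compact (chart_inv n ` cball c r)" "chart_inv n ` cball c r \<subseteq> U n"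
  using compact_chart_inv[OF compact_cball assms] assms chart_inv_in(1) by blast+

text \<open>Smoothness is local: on the overlap the formula \<open>f\<close> applies, and off
  \<open>C\<close>, which is closed, the function is zero near each point.\<close>

lemma chart_glue:
  fixes g :: "real^4 \<Rightarrow> 'v::real_normed_vector"
  assumes "compact C" "C \<subseteq> U n" "smooth_on (overlap m n) f" "\<And>x. x \<in> overlap m n \<Longrightarrow> g x = f x"
    and "\<And>p. p \<in> U m \<Longrightarrow> p \<notin> C \<Longrightarrow> g (\<phi> m p) = 0"
  shows "smooth_on (dom m) g"
proof (rule smooth_on_glue[OF chart(2) open_overlap[of m n]])
  show "open (\<phi> m ` (U m - C))"
    using chart(1)[of m] compact_imp_closed[OF assms(1)] by (intro open_chart_image) auto
  show "dom m \<subseteq> overlap m n \<union> \<phi> m ` (U m - C)" using assms(2) by auto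
  show "smooth_on (\<phi> m ` (U m - C)) (\<lambda>_. 0 :: 'v)" by simp
qed (use assms in auto)

lemma smooth_chart_bump:
  assumes r: "r > 0" "cball c r \<subseteq> dom n"
  shows "smooth_fun (chart_bump n c r)"
  unfolding smooth_fun_def
proof
  fix m
  have "smooth_on (overlap m n) (\<lambda>x. bump r (tmap m n x - c))"
    by (rule smooth_on_compose[OF open_overlap smooth_trans open_UNIV smooth_bump[OF r(1)]]) simp
  then show "smooth_on (dom m) (\<lambda>x. chart_bump n c r (chart_inv m x))"
    by (rule chart_glue[OF compact_chart_cball[OF r(2)]]) (use r chart_bump_outside in \<open>auto simp: chart_bump_def\<close>)
qed

lemma adjoint_scale:
  assumes B: "adjoint_form B" and F: "smooth_fun F"
  shows "adjoint_form (\<lambda>n x. F (chart_inv n x) *\<^sub>R B n x)"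
  unfolding adjoint_form_def
proof (intro conjI allI ballI)
  fix n
  show "smooth_on (dom n) (\<lambda>x. F (chart_inv n x) *\<^sub>R B n x)"
    using F by (intro smooth_on_scaleR chart(2) adjointD(1)[OF B]) (simp add: smooth_fun_def)
  fix x i assume "x \<in> dom n"
  then show "su2 ((F (chart_inv n x) *\<^sub>R B n x) $ i)"
    using adjointD(2)[OF B] by (simp add: su2_nth)
next
  fix m n x i assume x: "x \<in> overlap m n"
  then have "chart_inv n (tmap m n x) = chart_inv m x" by auto
  then show "(F (chart_inv m x) *\<^sub>R B m x) $ i = h m n x ** pullback1 (tmap m n) (\<lambda>x. F (chart_inv n x) *\<^sub>R B n x) x $ i ** hconj (h m n x)"
    unfolding pullback1_nth jac_pullback
    by (simp add: adjointD(3)[OF B x] matrix_mult_simps scaleR_sum_right matrix_sum_simps mult.commute)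
qed

lemma smooth_fun_complement: "smooth_fun F \<Longrightarrow> smooth_fun (\<lambda>q. 1 - F q)"
  unfolding smooth_fun_def by (intro allI smooth_on_diff smooth_on_const chart(2)) auto

lemma var_form_add:
  assumes "adjoint_form B" "adjoint_form B'" "x \<in> dom n"
  shows "var_form A (\<lambda>n x. B n x + B' n x) n x = var_form A B n x + var_form A B' n x"
proof -
  have d: "B n differentiable (at x)" "B' n differentiable (at x)"
    using smooth_on_differentiable[OF chart(2) adjointD(1)[OF assms(1)] assms(3)]
      smooth_on_differentiable[OF chart(2) adjointD(1)[OF assms(2)] assms(3)] .
  have "ext_d (form1 (\<lambda>x. B n x + B' n x)) x [j, k] = ext_d (form1 (B n)) x [j, k] + ext_d (form1 (B' n)) x [j, k]" for j k
    using ext_d_form1_linear[OF d, of 1 j k] by simp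
  then show ?thesis
    unfolding var_form_def by (simp add: comm_form_linear sandwich_linear(1)[symmetric] add_ac)
qed

text \<open>Induction over a finite cover by coordinate balls: the part \<open>F B\<close> of the variation lives in
  one ball, and \<open>(1 - F) B\<close> vanishes where \<open>F = 1\<close>.\<close>

lemma var_asd_cover:
  assumes conn: "u2_connection U \<phi> h A a" and K0: "compact K0"
  shows "adjoint_form B \<Longrightarrow> (\<And>m p. p \<in> U m - K \<Longrightarrow> B m (\<phi> m p) = 0) \<Longrightarrow> compact K \<Longrightarrow> K \<subseteq> K0 \<Longrightarrow>
    (\<And>n c r. (n, c, r) \<in> set bs \<Longrightarrow> r > 0 \<and> cball c r \<subseteq> dom n) \<Longrightarrow>
    K \<subseteq> (\<Union>(n, c, r)\<in>set bs. chart_inv n ` cball c (r / 2)) \<Longrightarrow>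
    tint K0 (var_form (\<lambda>n. asd_conn (\<Psi> n)) B) = 0"
proof (induction bs arbitrary: B K)
  case Nil
  then have K: "K = {}" by simp
  have "tint K0 (var_form (\<lambda>n. asd_conn (\<Psi> n)) B) = tint K (var_form (\<lambda>n. asd_conn (\<Psi> n)) B)"
    by (rule tint_support[OF Nil(4)]) (rule var_form_zero[where B=B and K=K, OF Nil(3,2)])
  then show ?case by (simp add: K tint_empty)
next
  case (Cons b bs)
  obtain n c r where b: "b = (n, c, r)" by (cases b)
  have r: "r > 0" "cball c r \<subseteq> dom n" using Cons.prems(5)[of n c r] b by auto
  define F where "F = chart_bump n c r"
  have F: "smooth_fun F" unfolding F_def by (rule smooth_chart_bump[OF r])
  define B1 where "B1 m x = F (chart_inv m x) *\<^sub>R B m x" for m x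
  define B2 where "B2 m x = (1 - F (chart_inv m x)) *\<^sub>R B m x" for m x
  have B1: "adjoint_form B1" unfolding B1_def[abs_def] by (rule adjoint_scale[OF Cons.prems(1) F])
  have B2: "adjoint_form B2" unfolding B2_def[abs_def] by (rule adjoint_scale[OF Cons.prems(1) smooth_fun_complement[OF F]])
  let ?w = "\<lambda>n. asd_conn (\<Psi> n)"
  note asd = asd_connection[OF conn]
  define K1 where "K1 = K \<inter> chart_inv n ` cball c r"
  have K1: "compact K1" "K1 \<subseteq> U n" "K1 \<subseteq> K0"
    using compact_Int[OF Cons.prems(3) compact_chart_cball(1)[OF r(2)]] compact_chart_cball(2)[OF r(2)] Cons.prems(4) by (auto simp: K1_def)
  have z1: "B1 m (\<phi> m p) = 0" if "p \<in> U m - K1" for m p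
    using that Cons.prems(2)[of p m] chart_bump_outside[OF r(1), of p n c] by (auto simp: B1_def F_def K1_def)
  have "tint K0 (var_form ?w B1) = tint K1 (var_form ?w B1)"
    by (rule tint_support[OF K1(3)]) (rule var_form_zero[where B=B1 and K=K1, OF K1(1) z1])
  also have "\<dots> = 0" by (rule var_asd_local[OF conn B1 z1 K1(1,2)])
  finally have 1: "tint K0 (var_form ?w B1) = 0" .
  \<comment> \<open>\<open>(1 - F) B\<close> vanishes on the half ball just treated, so its support
    lies in the half balls that are left.\<close>
  define K2 where "K2 = K \<inter> (\<Union>(n, c, r)\<in>set bs. chart_inv n ` cball c (r / 2))"
  have half: "compact (chart_inv n ` cball c (r / 2))" if "(n, c, r) \<in> set bs" for n c r
  proof -
    have "r > 0" "cball c r \<subseteq> dom n" using Cons.prems(5)[of n c r] that by auto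
    then have "cball c (r / 2) \<subseteq> dom n" by (intro order_trans[OF subset_cball[of "r / 2" r c]]) auto
    then show ?thesis by (rule compact_chart_cball(1))
  qed
  have "compact (\<Union>(n, c, r)\<in>set bs. chart_inv n ` cball c (r / 2))"
    by (intro compact_UN) (auto intro: half)
  then have K2: "compact K2" "K2 \<subseteq> K0" using Cons.prems(3,4) by (auto simp: K2_def)
  have z2: "B2 m (\<phi> m p) = 0" if p: "p \<in> U m - K2" for m p
  proof (cases "p \<in> K")
    case True
    define Y where "Y = (\<Union>(n, c, r)\<in>set bs. chart_inv n ` cball c (r / 2))"
    have "K \<subseteq> chart_inv n ` cball c (r / 2) \<union> Y"
      using Cons.prems(6) by (simp add: b Y_def)
    moreover have "p \<notin> Y" using p True by (simp add: K2_def Y_def)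
    ultimately have "p \<in> chart_inv n ` cball c (r / 2)" using True by blast
    then obtain y where y: "y \<in> cball c (r / 2)" "p = chart_inv n y" by auto
    then have "y \<in> dom n" using r by (auto simp: subset_iff)
    then have "p \<in> U n" "\<phi> n p = y" using y(2) chart_inv_in[of y n] by auto
    then have "F p = 1" using bump_simps(2)[OF r(1), of "y - c"] y(1) by (simp add: F_def chart_bump_def dist_norm norm_minus_commute)
    then show ?thesis using p by (simp add: B2_def)
  next
    case False
    then show ?thesis using Cons.prems(2)[of p m] p by (simp add: B2_def)
  qed
  have 2: "tint K0 (var_form ?w B2) = 0"
    by (rule Cons.IH[OF B2 z2 K2]) (use Cons.prems(5) in \<open>auto simp: K2_def\<close>)
  have "tint K0 (var_form ?w B) = tint K0 (\<lambda>n x. var_form ?w B1 n x + var_form ?w B2 n x)"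
  proof (rule tint_cong)
    fix n x assume x: "x \<in> dom n"
    have "(\<lambda>n x. B1 n x + B2 n x) = B" by (auto simp: B1_def B2_def scaleR_left_diff_distrib)
    then show "var_form ?w B n x = var_form ?w B1 n x + var_form ?w B2 n x"
      using var_form_add[OF B1 B2 x, of ?w] by simp
  qed
  then show ?case
    using tint_add[OF volume_form_var(1)[OF asd B1] volume_form_var(1)[OF asd B2] K0] 1 2 by simp
qed

text \<open>Compactness provides finitely many coordinate balls whose halves cover \<open>K\<close>;
  the halves are where the bump functions equal 1.\<close>

lemma var_asd_zero:
  assumes conn: "u2_connection U \<phi> h A a" and B: "adjoint_form B" "\<And>m p. p \<in> U m - K \<Longrightarrow> B m (\<phi> m p) = 0" and K: "compact K"
  shows "tint K (var_form (\<lambda>n. asd_conn (\<Psi> n)) B) = 0"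
proof -
  have "\<exists>W n c r. open W \<and> p \<in> W \<and> W \<subseteq> chart_inv n ` cball c (r / 2) \<and> r > 0 \<and> cball c r \<subseteq> dom n" for p
  proof -
    obtain n where n: "p \<in> U n" using cover by blast
    obtain r where r: "r > 0" "cball (\<phi> n p) r \<subseteq> dom n" using chart_cball[OF n] .
    define W where "W = U n \<inter> \<phi> n -` ball (\<phi> n p) (r / 2)"
    have "open W" unfolding W_def by (rule continuous_open_preimage[OF continuous_chart(1) chart(1) open_ball])
    moreover have "W \<subseteq> chart_inv n ` cball (\<phi> n p) (r / 2)"
    proof
      fix q assume "q \<in> W"
      then have "q = chart_inv n (\<phi> n q)" "\<phi> n q \<in> cball (\<phi> n p) (r / 2)" by (auto simp: W_def)
      then show "q \<in> chart_inv n ` cball (\<phi> n p) (r / 2)" by (rule image_eqI)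
    qed
    moreover have "p \<in> W" using n r(1) by (simp add: W_def)
    ultimately show ?thesis using r by blast
  qed
  then obtain W n c r where W: "\<And>p. open (W p)" "\<And>p. p \<in> W p" "\<And>p. W p \<subseteq> chart_inv (n p) ` cball (c p) (r p / 2)"
      and r: "\<And>p. r p > 0" "\<And>p. cball (c p) (r p) \<subseteq> dom (n p)" by metis
  obtain P where P: "P \<subseteq> K" "finite P" "K \<subseteq> (\<Union>p\<in>P. W p)"
    by (rule compactE_image[OF K, of K W]) (use W in auto)
  obtain ps where ps: "set ps = P" using finite_list[OF P(2)] by blast
  show ?thesis
  proof (rule var_asd_cover[OF conn K B K order_refl, of "map (\<lambda>p. (n p, c p, r p)) ps"])
    show "0 < r' \<and> cball c' r' \<subseteq> dom n'" if "(n', c', r') \<in> set (map (\<lambda>p. (n p, c p, r p)) ps)" for n' c' r'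
      using that r by auto
    show "K \<subseteq> (\<Union>(n, c, r)\<in>set (map (\<lambda>p. (n p, c p, r p)) ps). chart_inv n ` cball c (r / 2))"
      using P(3) W(3) ps by fastforce
  qed
qed

text \<open>The algebraic integrand: in contrast to \<open>var_form\<close>, no derivative of
  \<open>A\<close> or \<open>B\<close> occurs.\<close>

definition el_form :: "(nat \<Rightarrow> real^4 \<Rightarrow> (complex^2^2)^4) \<Rightarrow> (nat \<Rightarrow> real^4 \<Rightarrow> (complex^2^2)^4) \<Rightarrow> nat \<Rightarrow> real^4 \<Rightarrow> complex" where
  "el_form A B n x = sandwich (\<Psi> n x) (comm_form (A n x - asd_conn (\<Psi> n) x) (B n x))"

lemma volume_form_el:
  assumes A: "u2_connection U \<phi> h A a" and B: "adjoint_form B"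
  shows "volume_form (el_form A B)"
proof -
  note C = adjoint_form_difference[OF A asd_connection[OF A]]
  show ?thesis
    unfolding el_form_def by (intro volume_formI smooth_comm_form[OF C B] comm_form_trans[OF C B])
qed

text \<open>\<open>var_form\<close> is affine in the connection; splitting off its value at
  \<open>asd_conn\<close>, whose integral vanishes, leaves the algebraic pairing with the
  difference.\<close>

lemma tint_var_eq_el:
  assumes A: "u2_connection U \<phi> h A a" and B: "adjoint_form B" "\<And>m p. p \<in> U m - K \<Longrightarrow> B m (\<phi> m p) = 0" and K: "compact K"
  shows "tint K (var_form A B) = tint K (el_form A B)"
proof -
  let ?w = "\<lambda>n. asd_conn (\<Psi> n)"
  have "var_form A B n x = var_form ?w B n x + el_form A B n x" for n x
    unfolding var_form_def el_form_def sandwich_linear(1)[symmetric] comm_form_linear(1) by simp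
  then have "tint K (var_form A B) = tint K (\<lambda>n x. var_form ?w B n x + el_form A B n x)"
    by (intro tint_cong)
  also have "\<dots> = tint K (var_form ?w B) + tint K (el_form A B)"
    by (rule tint_add[OF volume_form_var(1)[OF asd_connection[OF A] B(1)] volume_form_el[OF A B(1)] K])
  finally show ?thesis using var_asd_zero[OF A B K] by simp
qed

end

subsection \<open>Localised variations\<close>

lemma sandwich_comm_linear:
  "sandwich \<psi> (comm_form C (B + B')) = sandwich \<psi> (comm_form C B) + sandwich \<psi> (comm_form C B')"
  "sandwich \<psi> (comm_form C (t *\<^sub>R B)) = t *\<^sub>R sandwich \<psi> (comm_form C B)"
proof -
  have "comm_form C (B + B') = (\<lambda>j k. comm_form C B j k + comm_form C B' j k)" "comm_form C (t *\<^sub>R B) = (\<lambda>j k. t *\<^sub>R comm_form C B j k)"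
    by (intro ext comm_form_linear)+
  then show "sandwich \<psi> (comm_form C (B + B')) = sandwich \<psi> (comm_form C B) + sandwich \<psi> (comm_form C B')"
    "sandwich \<psi> (comm_form C (t *\<^sub>R B)) = t *\<^sub>R sandwich \<psi> (comm_form C B)"
    by (simp_all only: sandwich_linear)
qed

context u2_geometry
begin

text \<open>The cocycle condition for three equal indices makes \<open>h\<close> idempotent, and a
  unitary matrix can be cancelled.\<close>

lemma h_diag: "x \<in> dom n \<Longrightarrow> h n n x = mat 1"
proof -
  assume x: "x \<in> dom n"
  have "x \<in> \<phi> n ` (U n \<inter> U n \<inter> U n)" using x by simp
  then have "h n n x = h n n x ** h n n (trans_map U \<phi> n n x)"
    using u2_bundle unfolding u2_bundle_def by blast
  moreover have "trans_map U \<phi> n n x = x" using x by auto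
  ultimately have "h n n x = h n n x ** h n n x" by simp
  then have "hconj (h n n x) ** h n n x = hconj (h n n x) ** h n n x ** h n n x"
    by (metis matrix_mul_assoc)
  then show ?thesis
    using matrix_left_unitary[OF unitary_h[of x n n]] x by simp
qed

lemma h_cocycle:
  "x \<in> \<phi> k ` (U k \<inter> U m \<inter> U n) \<Longrightarrow> h k n x = h k m x ** h m n (tmap k m x)"
  using u2_bundle unfolding u2_bundle_def by blast

lemma jac_diag: "x \<in> dom n \<Longrightarrow> jac n n x = mat 1"
proof -
  assume x: "x \<in> dom n"
  have "pd i (tmap n n) x = pd i (\<lambda>y. y) x" for i
    by (rule pd_cong[OF chart(2) x]) auto
  then show ?thesis
    by (simp add: jac_def mat_def vec_eq_iff pd_eq[OF has_derivative_ident] axis_def eq_commute)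
qed

lemma jac_cocycle:
  assumes x: "x \<in> \<phi> k ` (U k \<inter> U m \<inter> U n)"
  shows "jac k n x = jac k m x ** jac m n (tmap k m x)"
proof -
  have o: "open (\<phi> k ` (U k \<inter> U m \<inter> U n))" using chart(1) by (intro open_chart_image) auto
  have xk: "x \<in> overlap k m" and xm: "tmap k m x \<in> overlap m n" using x by auto
  have d: "tmap k m differentiable (at x)" "tmap m n differentiable (at (tmap k m x))"
    by (rule smooth_on_differentiable[OF open_overlap smooth_trans xk], rule smooth_on_differentiable[OF open_overlap smooth_trans xm])
  have "pd i (tmap k n) x = (\<Sum>j\<in>UNIV. pd i (tmap k m) x $ j *\<^sub>R pd j (tmap m n) (tmap k m x))" for i
    unfolding pd_compose[OF d, symmetric] by (rule pd_cong[OF o x]) auto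
  then show ?thesis
    by (simp add: jac_def matrix_matrix_mult_def vec_eq_iff)
qed

text \<open>The constant \<open>B0\<close> in chart and gauge \<open>n\<close>, cut off by
  \<open>F\<close> and carried to every other chart by the transition law.\<close>

definition local_variation :: "nat \<Rightarrow> ('m \<Rightarrow> real) \<Rightarrow> (complex^2^2)^4 \<Rightarrow> nat \<Rightarrow> real^4 \<Rightarrow> (complex^2^2)^4" where
  "local_variation n F B0 m x = (if chart_inv m x \<in> U n then
     F (chart_inv m x) *\<^sub>R (\<chi> i. h m n x ** (\<Sum>j\<in>UNIV. jac m n x $ i $ j *\<^sub>R B0 $ j) ** hconj (h m n x)) else 0)"

lemma local_variation_diag:
  assumes "x \<in> dom n" shows "local_variation n F B0 n x = F (chart_inv n x) *\<^sub>R B0"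
proof -
  have "(\<Sum>j\<in>UNIV. mat 1 $ i $ j *\<^sub>R B0 $ j) = B0 $ i" for i :: 4
    using exhaust_4[of i] by (auto simp: sum_4 mat_def)
  then show ?thesis
    using assms by (simp add: local_variation_def h_diag jac_diag hconj_simps vec_eq_iff chart_inv_in)
qed

lemma su2_sum: "(\<And>i. i \<in> I \<Longrightarrow> su2 (M i)) \<Longrightarrow> su2 (\<Sum>i\<in>I. c i *\<^sub>R M i)"
  by (simp add: su2_nth sum_negf[symmetric])

text \<open>Compatibility between two further charts is the cocycle condition of \<open>h\<close>
  together with the chain rule for the Jacobians; the cut-off ensures smoothness at the edge of
  \<open>U n\<close>.\<close>

lemma adjoint_local_variation:
  assumes r: "r > 0" "cball c r \<subseteq> dom n" and B0: "\<And>i. su2 (B0 $ i)"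
  shows "adjoint_form (local_variation n (chart_bump n c r) B0)"
  unfolding adjoint_form_def
proof (intro conjI allI ballI)
  fix m
  let ?F = "chart_bump n c r"
  have jac: "smooth_on (overlap m n) (\<lambda>x. jac m n x $ i $ j)" for i j
    using smooth_on_nth[OF open_overlap smooth_on_pd[OF open_overlap smooth_trans], of m n i j] by (simp add: jac_def)
  have "smooth_on (overlap m n) (\<lambda>x. ?F (chart_inv m x))"
    using smooth_chart_bump[OF r] smooth_on_subset[of "dom m"] unfolding smooth_fun_def by (metis Int_lower1 image_mono)
  then have "smooth_on (overlap m n) (\<lambda>x. ?F (chart_inv m x) *\<^sub>R (h m n x ** (\<Sum>j\<in>UNIV. jac m n x $ i $ j *\<^sub>R B0 $ j) ** hconj (h m n x)))" for i
    by (intro smooth_on_scaleR smooth_on_matrix_mult smooth_on_sum smooth_on_const open_overlap smooth_h jac smooth_on_linear[OF bounded_linear_hconj])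
  then have sm: "smooth_on (overlap m n) (\<lambda>x. ?F (chart_inv m x) *\<^sub>R (\<chi> i. h m n x ** (\<Sum>j\<in>UNIV. jac m n x $ i $ j *\<^sub>R B0 $ j) ** hconj (h m n x)))"
    by (subst smooth_on_vec_iff[OF open_overlap]) simp
  show "smooth_on (dom m) (local_variation n ?F B0 m)"
    by (rule chart_glue[OF compact_chart_cball[OF r(2)] sm])
      (use chart_bump_outside[OF r(1)] in \<open>auto simp: local_variation_def\<close>)
  fix x i assume x: "x \<in> dom m"
  show "su2 (local_variation n ?F B0 m x $ i)"
  proof (cases "chart_inv m x \<in> U n")
    case True
    then have "x \<in> overlap m n" using x by auto
    then have "su2 (h m n x ** (\<Sum>j\<in>UNIV. jac m n x $ i $ j *\<^sub>R B0 $ j) ** hconj (h m n x))"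
      by (intro su2_conj su2_sum B0 unitary_h)
    then show ?thesis using True by (simp add: local_variation_def su2_nth)
  qed (simp add: local_variation_def su2_nth)
next
  fix m k x i assume x: "x \<in> overlap m k"
  let ?F = "chart_bump n c r" and ?y = "tmap m k x"
  have inv: "chart_inv k ?y = chart_inv m x" using x by auto
  show "local_variation n ?F B0 m x $ i = h m k x ** pullback1 (tmap m k) (local_variation n ?F B0 k) x $ i ** hconj (h m k x)"
  proof (cases "chart_inv m x \<in> U n")
    case True
    then have t: "x \<in> \<phi> m ` (U m \<inter> U k \<inter> U n)" using x by auto
    define Z where "Z l = (\<Sum>j\<in>UNIV. jac k n ?y $ l $ j *\<^sub>R B0 $ j)" for l
    have "(\<Sum>j\<in>UNIV. jac m n x $ i $ j *\<^sub>R B0 $ j) = (\<Sum>l\<in>UNIV. jac m k x $ i $ l *\<^sub>R Z l)"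
      unfolding jac_cocycle[OF t] Z_def matrix_matrix_mult_def
      by (simp add: scaleR_sum_left scaleR_sum_right) (rule sum.swap)
    then have "local_variation n ?F B0 m x $ i = ?F (chart_inv m x) *\<^sub>R
        (h m k x ** h k n ?y ** (\<Sum>l\<in>UNIV. jac m k x $ i $ l *\<^sub>R Z l) ** (hconj (h k n ?y) ** hconj (h m k x)))"
      using True by (simp add: local_variation_def h_cocycle[OF t] hconj_simps)
    also have "\<dots> = h m k x ** (\<Sum>l\<in>UNIV. jac m k x $ i $ l *\<^sub>R (?F (chart_inv m x) *\<^sub>R (h k n ?y ** Z l ** hconj (h k n ?y)))) ** hconj (h m k x)"
      unfolding matrix_sum_simps by (simp add: matrix_mult_simps matrix_mul_assoc scaleR_sum_right mult.commute)
    also have "\<dots> = h m k x ** pullback1 (tmap m k) (local_variation n ?F B0 k) x $ i ** hconj (h m k x)"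
      unfolding pullback1_nth jac_pullback using True by (simp add: local_variation_def inv Z_def)
    finally show ?thesis .
  next
    case False
    then show ?thesis by (simp add: local_variation_def pullback1_nth inv)
  qed
qed

text \<open>Nondegeneracy supplies a direction \<open>B0\<close> paired nontrivially with the
  deviation from \<open>asd_conn\<close> at \<open>x0\<close>. Cut off close to \<open>x0\<close>,
  the pairing cannot change its phase enough to integrate to zero.\<close>

lemma tint_el_nonzero:
  assumes A: "u2_connection U \<phi> h A a" and x0: "x0 \<in> dom n" "A n x0 \<noteq> asd_conn (\<Psi> n) x0"
  shows "\<exists>K B. compact K \<and> adjoint_form B \<and> (\<forall>m. \<forall>p\<in>U m - K. B m (\<phi> m p) = 0) \<and> tint K (el_form A B) \<noteq> 0"
proof -
  define C where "C n x = A n x - asd_conn (\<Psi> n) x" for n x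
  have C: "adjoint_form C" unfolding C_def[abs_def] by (rule adjoint_form_difference[OF A asd_connection[OF A]])
  have "C n x0 \<noteq> 0" using x0 by (simp add: C_def)
  then obtain B0 where B0: "\<And>i. su2 (B0 $ i)" "sandwich (\<Psi> n x0) (comm_form (C n x0) B0) \<noteq> 0"
    using comm_form_nondegenerate[OF det_frame[OF x0(1)], of "C n x0"] adjointD(2)[OF C x0(1)] by blast
  define g where "g x = orient n x *\<^sub>R sandwich (\<Psi> n x) (comm_form (C n x) B0)" for x
  have "continuous_on (dom n) g"
    unfolding g_def
    by (intro continuous_on_scaleR continuous_orientation smooth_on_continuous[OF chart(2)] smooth_on_sandwich smooth_on_comm_form
        chart(2) smooth_frame adjointD(1)[OF C] smooth_on_const)
  \<comment> \<open>Multiplying by the conjugate of \<open>g x0\<close> turns the complex pairing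
    into a real function that is positive near \<open>x0\<close>.\<close>
  define k where "k x = Re (cnj (g x0) * g x)" for x
  have k: "continuous_on (dom n) k"
    unfolding k_def by (intro continuous_intros \<open>continuous_on (dom n) g\<close>)
  have "g x0 \<noteq> 0"
    using B0(2) det_frame[OF x0(1)] by (simp add: g_def coframe_vol_eq sgn_zero_iff)
  then have k0: "k x0 > 0"
    by (simp add: k_def complex_neq_0 power2_eq_square[symmetric])
  have "open {x \<in> dom n. k x > 0}"
    using continuous_open_preimage[OF k chart(2) open_greaterThan[of 0]] by (simp add: vimage_def Int_def conj_commute)
  then obtain r where r: "r > 0" "cball x0 r \<subseteq> {x \<in> dom n. k x > 0}"
    using x0(1) k0 unfolding open_contains_cball by blast
  then have r2: "cball x0 r \<subseteq> dom n" and kpos: "\<And>x. x \<in> cball x0 r \<Longrightarrow> k x > 0" by auto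
  define F where "F = chart_bump n x0 r"
  define B where "B = local_variation n F B0"
  define K where "K = chart_inv n ` cball x0 r"
  have B: "adjoint_form B" unfolding B_def F_def by (rule adjoint_local_variation[OF r(1) r2 B0(1)])
  have K: "compact K" "K \<subseteq> U n" using compact_chart_cball[OF r2] by (auto simp: K_def)
  have z: "B m (\<phi> m p) = 0" if "p \<in> U m - K" for m p
    using that chart_bump_outside[OF r(1)] by (simp add: B_def F_def K_def local_variation_def)
  have img: "\<phi> n ` K = cball x0 r"
  proof -
    have "\<phi> n ` K = (\<lambda>x. x) ` cball x0 r"
      unfolding K_def image_image by (rule image_cong[OF refl]) (use r2 chart_inv_in(2) in blast)
    then show ?thesis by simp
  qed
  have f: "orient n x *\<^sub>R el_form A B n x = bump r (x - x0) *\<^sub>R g x" if "x \<in> cball x0 r" for x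
  proof -
    have x: "x \<in> dom n" using that r2 by blast
    have "B n x = bump r (x - x0) *\<^sub>R B0"
      using x chart_inv_in[of x n] by (simp add: B_def F_def local_variation_diag chart_bump_def)
    then have "el_form A B n x = bump r (x - x0) *\<^sub>R sandwich (\<Psi> n x) (comm_form (C n x) B0)"
      by (simp add: el_form_def C_def sandwich_comm_linear(2))
    then show ?thesis by (simp add: g_def mult.commute)
  qed
  define I where "I x = indicator (cball x0 r) x *\<^sub>R (orient n x *\<^sub>R el_form A B n x)" for x
  have tint: "tint K (el_form A B) = (\<integral>x. I x \<partial>lborel)"
    unfolding tint_in_chart[OF volume_form_el[OF A B] K] img I_def ..
  have intI: "integrable lborel I"
    using integrable_compact_subset[where f="\<lambda>n x. orient n x *\<^sub>R el_form A B n x", OF volume_form_continuous[OF volume_form_el[OF A B]] borel_compact[OF K(1)] order_refl K]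
    unfolding img I_def .
  have "tint K (el_form A B) \<noteq> 0"
  proof
    assume "tint K (el_form A B) = 0"
    then have "Re (cnj (g x0) * (\<integral>x. I x \<partial>lborel)) = 0" by (simp add: tint)
    then have "(\<integral>x. Re (cnj (g x0) * I x) \<partial>lborel) = 0"
      using intI by (simp add: integral_Re)
    moreover have J: "Re (cnj (g x0) * I x) = indicator (cball x0 r) x * bump r (x - x0) * k x" for x
      using f[of x] by (cases "x \<in> cball x0 r") (simp_all add: I_def k_def scaleR_conv_of_real algebra_simps)
    moreover have nn: "Re (cnj (g x0) * I x) \<ge> 0" for x
      unfolding J using bump_simps(3)[OF r(1), of "x - x0"] kpos[of x] by (cases "x \<in> cball x0 r") auto
    moreover have "integrable lborel (\<lambda>x. Re (cnj (g x0) * I x))"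
      using intI by (intro integrable_Re integrable_mult_right) auto
    ultimately have "AE x in lborel. Re (cnj (g x0) * I x) = 0"
      using integral_nonneg_eq_0_iff_AE[of lborel "\<lambda>x. Re (cnj (g x0) * I x)"] by simp
    \<comment> \<open>The integrand is positive on the open ball, which would thus be a null
      set.\<close>
    then have "AE x in lborel. x \<notin> ball x0 r"
    proof (rule AE_mp, intro AE_I2 impI notI)
      fix x assume "Re (cnj (g x0) * I x) = 0" "x \<in> ball x0 r"
      moreover have "bump r (x - x0) > 0" "k x > 0"
        using \<open>x \<in> ball x0 r\<close> bump_simps(4)[OF r(1), of "x - x0"] kpos[of x] by (auto simp: dist_norm norm_minus_commute)
      moreover have "x \<in> cball x0 r" using \<open>x \<in> ball x0 r\<close> by simp
      ultimately show False using J[of x] by (simp only: indicator_simps) auto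
    qed
    then have "emeasure lborel (ball x0 r) = 0"
      by (subst (asm) AE_iff_measurable[of "ball x0 r"]) auto
    then show False using r(1) using unit_ball_vol_pos[of 4] by (simp add: emeasure_ball)
  qed
  then show ?thesis using K(1) B z by blast
qed

end

subsection \<open>The Euler--Lagrange expression\<close>

text \<open>Expanding a matrix in matrix units takes complex coefficients, and the pairing is
  complex linear in \<open>B\<close> although the variations only form a real vector space.\<close>

definition scale_matrix :: "complex \<Rightarrow> (complex^2^2)^4 \<Rightarrow> (complex^2^2)^4" where
  "scale_matrix z B = (\<chi> i. mat z ** B $ i)"

lemma sandwich_comm_scale: "sandwich \<psi> (comm_form C (scale_matrix z B)) = z * sandwich \<psi> (comm_form C B)"
proof -
  have c: "X ** (mat z ** Y) = mat z ** (X ** Y)" "(mat z ** Y) ** X = mat z ** (Y ** X)" for X Y :: "complex^2^2"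
    using mat_commute[of z X] by (metis matrix_mul_assoc)+
  have "comm_form C (scale_matrix z B) j k = mat z ** comm_form C B j k" for j k
    by (simp add: comm_form_def scale_matrix_def c matrix_mult_simps)
  moreover have "herm u ((mat z ** M) *v v) = z * herm u (M *v v)" for u v and M :: "complex^2^2"
    by (simp add: herm_eq matrix_vector_mult_def matrix_matrix_mult_def mat_def sum_2 algebra_simps)
  ultimately show ?thesis
    unfolding sandwich_def by (simp add: top4_bounded_linear[OF bounded_linear_mult_right, symmetric])
qed

lemma sandwich_comm_sum: "finite I \<Longrightarrow> sandwich \<psi> (comm_form C (\<Sum>q\<in>I. f q)) = (\<Sum>q\<in>I. sandwich \<psi> (comm_form C (f q)))"
proof (induction I rule: finite_induct)
  case empty
  have "comm_form C 0 j k = 0" for j k by (simp add: comm_form_def)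
  then show ?case by (simp add: sandwich_def top4_def herm_simps)
next
  case (insert q I)
  then show ?case by (simp add: sandwich_comm_linear(1))
qed

definition matrix_unit :: "2 \<Rightarrow> 2 \<Rightarrow> complex^2^2" where
  "matrix_unit b c = (\<chi> i j. of_bool (i = b \<and> j = c))"

text \<open>Dual to the trace pairing: the trace of \<open>matrix_unit b c ** X\<close> is the entry
  \<open>X $ c $ b\<close>, hence the transposed index order.\<close>

definition el_component :: "(complex^2)^4 \<Rightarrow> (complex^2^2)^4 \<Rightarrow> 4 \<Rightarrow> complex^2^2" where
  "el_component \<psi> C i = (\<chi> c b. sandwich \<psi> (comm_form C (axis i (matrix_unit b c))))"

text \<open>Expand every matrix of \<open>B\<close> in matrix units and use complex linearity of the
  pairing.\<close>

lemma trace_el_component: "(\<Sum>i\<in>UNIV. trace (B $ i ** el_component \<psi> C i)) = sandwich \<psi> (comm_form C B)"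
proof -
  have B: "B = (\<Sum>i\<in>UNIV. \<Sum>b\<in>UNIV. \<Sum>c\<in>UNIV. scale_matrix (B $ i $ b $ c) (axis i (matrix_unit b c)))"
  proof -
    have e: "scale_matrix z (axis i (matrix_unit b c)) $ k $ r $ s = (if k = i \<and> r = b \<and> s = c then z else 0)" for z i k b c r s
      using exhaust_2[of r] exhaust_2[of b] 
      by (auto simp: scale_matrix_def axis_def matrix_unit_def matrix_matrix_mult_def mat_def sum_2)
    have "B $ k $ r $ s = (\<Sum>i\<in>UNIV. \<Sum>b\<in>UNIV. \<Sum>c\<in>UNIV. if k = i \<and> r = b \<and> s = c then B $ i $ b $ c else 0)" for k r s
      using exhaust_4[of k] exhaust_2[of r] exhaust_2[of s] by (auto simp: sum_4 sum_2)
    then have "B $ k $ r $ s = (\<Sum>i\<in>UNIV. \<Sum>b\<in>UNIV. \<Sum>c\<in>UNIV. scale_matrix (B $ i $ b $ c) (axis i (matrix_unit b c))) $ k $ r $ s" for k r s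
      unfolding sum_component e .
    then show ?thesis unfolding vec_eq_iff by blast
  qed
  have "sandwich \<psi> (comm_form C B) = (\<Sum>i\<in>UNIV. \<Sum>b\<in>UNIV. \<Sum>c\<in>UNIV. B $ i $ b $ c * sandwich \<psi> (comm_form C (axis i (matrix_unit b c))))"
    by (subst B) (simp add: sandwich_comm_sum sandwich_comm_scale)
  also have "\<dots> = (\<Sum>i\<in>UNIV. trace (B $ i ** el_component \<psi> C i))"
    by (simp add: trace_def matrix_matrix_mult_def el_component_def)
  finally show ?thesis ..
qed

text \<open>The four components assembled into a three-form by the alternating symbol; with
  \<open>i\<close> in front, wedging a one-form from the left reproduces the sum over
  \<open>i\<close> without signs.\<close>

definition el_three_form :: "real \<Rightarrow> (complex^2)^4 \<Rightarrow> (complex^2^2)^4 \<Rightarrow> 4 list \<Rightarrow> complex^2^2" where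
  "el_three_form lam \<psi> C xs = (if length xs = 3 then
     lam *\<^sub>R (\<Sum>i\<in>UNIV. eps i (xs ! 0) (xs ! 1) (xs ! 2) *\<^sub>R el_component \<psi> C i) else 0)"

lemma integrable_complex_mult_iff:
  fixes c :: complex
  assumes "c \<noteq> 0"
  shows "integrable M (\<lambda>x. c * f x) \<longleftrightarrow> integrable M f"
  using integrable_mult_right[of c M f] integrable_mult_right[of "1 / c" M "\<lambda>x. c * f x"] assms by auto

lemma el_three_form_zero: "el_three_form lam \<psi> 0 xs = 0"
proof -
  have "el_component \<psi> 0 i = 0" for i
    by (simp add: el_component_def comm_form_linear(4) sandwich_def top4_def herm_simps vec_eq_iff)
  then show ?thesis by (simp add: el_three_form_def)
qed

lemma wedge_el_three_form:
  assumes "T x = el_three_form lam \<psi> C" "\<And>y xs. length xs \<noteq> 3 \<Longrightarrow> T y xs = 0"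
  shows "wedge (\<lambda>X Y. trace (X ** Y)) (form1 B) T x [1, 2, 3, 4] = lam *\<^sub>R sandwich \<psi> (comm_form C (B x))"
proof -
  have h: "homog 3 T" using assms(2) by (simp add: homog_def)
  \<comment> \<open>These signs cancel against the alternating signs in the wedge of a one-form with
    a three-form.\<close>
  have e: "T x [2, 3, 4] = lam *\<^sub>R el_component \<psi> C 1" "T x [1, 3, 4] = - (lam *\<^sub>R el_component \<psi> C 2)"
    "T x [1, 2, 4] = lam *\<^sub>R el_component \<psi> C 3" "T x [1, 2, 3] = - (lam *\<^sub>R el_component \<psi> C 4)"
    unfolding assms(1) el_three_form_def sum_4 by (simp_all add: eps_eq)
  have "wedge (\<lambda>X Y. trace (X ** Y)) (form1 B) T x [1, 2, 3, 4] = lam *\<^sub>R (\<Sum>i\<in>UNIV. trace (B x $ i ** el_component \<psi> C i))"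
    by (subst wedge13[OF _ _ homog_form1 h]) (simp_all add: e trace_simps matrix_mult_simps sum_4 scaleR_add_right trace_def[of 0])
  then show ?thesis by (simp add: trace_el_component)
qed

text \<open>That the equation is algebraic is expressed by the type of \<open>E\<close>: it receives
  the value of the connection at a point, not the connection as a function. Actions are compared
  over every Borel region, which has content also when the integral over the whole manifold
  diverges.\<close>

theorem proposition2:
  fixes U :: "nat \<Rightarrow> 'm::{t2_space, second_countable_topology} set"
    and \<phi> :: "nat \<Rightarrow> 'm \<Rightarrow> real^4"
    and h :: "nat \<Rightarrow> nat \<Rightarrow> real^4 \<Rightarrow> complex^2^2"
    and \<Psi> :: "nat \<Rightarrow> frame"
    and A :: "nat \<Rightarrow> real^4 \<Rightarrow> (complex^2^2)^4"
    and a :: "nat \<Rightarrow> real^4 \<Rightarrow> complex^4"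
    and lam mu nu :: real
  assumes "smooth_atlas U \<phi>"
    and "u2_bundle U \<phi> h"
    and "u2_frame U \<phi> h \<Psi>"
    and "u2_connection U \<phi> h A a"
    and "lam \<noteq> 0"
    and "3 * lam - mu + 4 * nu = 0"
  shows
    "(\<exists>E :: nat \<Rightarrow> real^4 \<Rightarrow> (complex^2^2)^4 \<Rightarrow> 4 list \<Rightarrow> complex^2^2.
       \<forall>A'. u2_connection U \<phi> h A' a \<longrightarrow>
         (\<forall>K B. compact K \<and> su2_variation U \<phi> h K B \<longrightarrow>
            ((\<lambda>t::real. frame_action U \<phi> lam mu nu K \<Psi> (\<lambda>n x. A' n x + t *\<^sub>R B n x) a)
               has_vector_derivative
             form_integral U \<phi> (\<lambda>n. coframe_vol (coframe (\<Psi> n))) K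
               (\<lambda>n. wedge (\<lambda>X Y. trace (X ** Y)) (form1 (B n)) (\<lambda>x. E n x (A' n x)))) (at 0)) \<and>
         (stationary_in_A U \<phi> h lam mu nu \<Psi> A' a \<longleftrightarrow>
            (\<forall>n. \<forall>x\<in>\<phi> n ` U n. \<forall>xs. E n x (A' n x) xs = 0)))
     \<and> u2_connection U \<phi> h (\<lambda>n. asd_conn (\<Psi> n)) a
     \<and> (\<forall>A'. u2_connection U \<phi> h A' a \<longrightarrow>
         (stationary_in_A U \<phi> h lam mu nu \<Psi> A' a \<longleftrightarrow>
            (\<forall>n. \<forall>x\<in>\<phi> n ` U n. A' n x = asd_conn (\<Psi> n) x)))
     \<and> (\<forall>K\<in>sets borel.
         frame_action U \<phi> lam mu nu K \<Psi> (\<lambda>n. asd_conn (\<Psi> n)) a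
           = metric_action U \<phi> lam mu K (\<lambda>n. metric_of (\<Psi> n)) (\<lambda>n. omega_of (\<Psi> n)) a
         \<and> (form_integrable U \<phi> (\<lambda>n. coframe_vol (coframe (\<Psi> n))) K
              (\<lambda>n. lagrangian lam mu nu (\<Psi> n) (asd_conn (\<Psi> n)) (a n))
            \<longleftrightarrow>
            form_integrable U \<phi> (\<lambda>n. metric_vol (metric_of (\<Psi> n)) (omega_of (\<Psi> n))) K
              (\<lambda>n. metric_lagrangian (mu / lam) (metric_of (\<Psi> n)) (omega_of (\<Psi> n)) (a n))))
     \<and> (\<forall>n. \<forall>x\<in>\<phi> n ` U n.
         form2_matrix (omega_of (\<Psi> n)) x ** matrix_inv (metric_of (\<Psi> n) x)
           ** form2_matrix (omega_of (\<Psi> n)) x = - metric_of (\<Psi> n) x)"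
proof -
  interpret u2_geometry U \<phi> h \<Psi>
    by unfold_locales (use assms in auto)
  \<comment> \<open>The connection enters only through its deviation from \<open>asd_conn\<close> at
    the point.\<close>
  define E where "E n x Av = el_three_form lam (\<Psi> n x) (Av - asd_conn (\<Psi> n) x)" for n x Av
  have deriv: "((\<lambda>t::real. frame_action U \<phi> lam mu nu K \<Psi> (\<lambda>n x. A' n x + t *\<^sub>R B n x) a)
      has_vector_derivative form_integral U \<phi> vol K (\<lambda>n. wedge (\<lambda>X Y. trace (X ** Y)) (form1 (B n)) (\<lambda>x. E n x (A' n x)))) (at 0)"
    and deriv_el: "((\<lambda>t::real. frame_action U \<phi> lam mu nu K \<Psi> (\<lambda>n x. A' n x + t *\<^sub>R B n x) a)
      has_vector_derivative lam *\<^sub>R tint K (el_form A' B)) (at 0)"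
    if A': "u2_connection U \<phi> h A' a" and K: "compact K" and B: "su2_variation U \<phi> h K B" for A' K B
  proof -
    have B': "adjoint_form B" "\<And>m p. p \<in> U m - K \<Longrightarrow> B m (\<phi> m p) = 0"
      using B by (auto simp: su2_variation_iff)
    show el: "((\<lambda>t::real. frame_action U \<phi> lam mu nu K \<Psi> (\<lambda>n x. A' n x + t *\<^sub>R B n x) a)
      has_vector_derivative lam *\<^sub>R tint K (el_form A' B)) (at 0)"
      using frame_action_derivative[OF A' B'(1) K, of lam mu nu] by (simp only: tint_var_eq_el[OF A' B' K])
    have "form_integral U \<phi> vol K (\<lambda>n. wedge (\<lambda>X Y. trace (X ** Y)) (form1 (B n)) (\<lambda>x. E n x (A' n x))) = tint K (\<lambda>n x. lam *\<^sub>R el_form A' B n x)"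
    proof (rule form_integral_eq_tint)
      fix n x
      show "wedge (\<lambda>X Y. trace (X ** Y)) (form1 (B n)) (\<lambda>x. E n x (A' n x)) x [1, 2, 3, 4] = lam *\<^sub>R el_form A' B n x"
        unfolding el_form_def by (rule wedge_el_three_form) (simp_all add: E_def el_three_form_def)
    qed
    then show "((\<lambda>t::real. frame_action U \<phi> lam mu nu K \<Psi> (\<lambda>n x. A' n x + t *\<^sub>R B n x) a)
      has_vector_derivative form_integral U \<phi> vol K (\<lambda>n. wedge (\<lambda>X Y. trace (X ** Y)) (form1 (B n)) (\<lambda>x. E n x (A' n x)))) (at 0)"
      using el by (simp add: tint_scale)
  qed
  have stationary_imp: "A' n x = asd_conn (\<Psi> n) x"
    if A': "u2_connection U \<phi> h A' a" and st: "stationary_in_A U \<phi> h lam mu nu \<Psi> A' a" and x: "x \<in> dom n" for A' n x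
  proof (rule ccontr)
    assume "A' n x \<noteq> asd_conn (\<Psi> n) x"
    from tint_el_nonzero[OF A' x this] obtain K B where KB: "compact K" "adjoint_form B"
      "\<forall>m. \<forall>p\<in>U m - K. B m (\<phi> m p) = 0" "tint K (el_form A' B) \<noteq> 0" by blast
    have B: "su2_variation U \<phi> h K B" using KB by (simp add: su2_variation_iff)
    have "((\<lambda>t::real. frame_action U \<phi> lam mu nu K \<Psi> (\<lambda>n x. A' n x + t *\<^sub>R B n x) a) has_vector_derivative 0) (at 0)"
      using st KB(1) B unfolding stationary_in_A_def by blast
    \<comment> \<open>Derivatives are unique, so stationarity contradicts the nonzero pairing; the
      division by \<open>lam\<close> happens here.\<close>
    from vector_derivative_unique_at[OF this deriv_el[OF A' KB(1) B]] show False
      using KB(4) \<open>lam \<noteq> 0\<close> by simp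
  qed
  have E_zero_imp: "stationary_in_A U \<phi> h lam mu nu \<Psi> A' a"
    if A': "u2_connection U \<phi> h A' a" and E: "\<forall>n. \<forall>x\<in>dom n. \<forall>xs. E n x (A' n x) xs = 0" for A'
    unfolding stationary_in_A_def
  proof (intro allI impI, elim conjE)
    fix K B assume K: "compact K" and B: "su2_variation U \<phi> h K B"
    have "form_integral U \<phi> vol K (\<lambda>n. wedge (\<lambda>X Y. trace (X ** Y)) (form1 (B n)) (\<lambda>x. E n x (A' n x))) = tint K (\<lambda>n x. 0)"
    proof (rule form_integral_eq_tint)
      fix n x assume "x \<in> dom n"
      then have "E n x (A' n x) xs = 0" for xs using E by blast
      moreover have "trace ((X :: complex^2^2) ** 0) = 0" for X by (simp add: trace_def)
      ultimately show "wedge (\<lambda>X Y. trace (X ** Y)) (form1 (B n)) (\<lambda>x. E n x (A' n x)) x [1, 2, 3, 4] = 0"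
        by (simp only: wedge_def) simp
    qed
    moreover have "tint K (\<lambda>n x. 0) = 0" using tint_scale[of K 0 "\<lambda>n x. 0"] by simp
    ultimately show "((\<lambda>t::real. frame_action U \<phi> lam mu nu K \<Psi> (\<lambda>n x. A' n x + t *\<^sub>R B n x) a) has_vector_derivative 0) (at 0)"
      using deriv[OF A' K B] by simp
  qed
  have asd_E: "E n x (asd_conn (\<Psi> n) x) xs = 0" for n x xs
    by (simp add: E_def el_three_form_zero)
  \<comment> \<open>A circle of implications: stationary gives equality with
    \<open>asd_conn\<close>, this makes \<open>E\<close> vanish, and vanishing of \<open>E\<close>
    gives stationary.\<close>
  have 1: "stationary_in_A U \<phi> h lam mu nu \<Psi> A' a \<longleftrightarrow> (\<forall>n. \<forall>x\<in>dom n. \<forall>xs. E n x (A' n x) xs = 0)"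
    and 2: "stationary_in_A U \<phi> h lam mu nu \<Psi> A' a \<longleftrightarrow> (\<forall>n. \<forall>x\<in>dom n. A' n x = asd_conn (\<Psi> n) x)"
    if A': "u2_connection U \<phi> h A' a" for A'
    using stationary_imp[OF A'] E_zero_imp[OF A'] asd_E by metis+
  \<comment> \<open>Proved for the integrands, so that values and integrability transfer together;
    where the integrands are not integrable, both integrals take the default value 0.\<close>
  have pointwise: "local_integrand U \<phi> vol K (\<lambda>n. lagrangian lam mu nu (\<Psi> n) (asd_conn (\<Psi> n)) (a n)) z =
     - of_real lam * local_integrand U \<phi> (\<lambda>n. metric_vol (metric_of (\<Psi> n)) (omega_of (\<Psi> n))) K
       (\<lambda>n. metric_lagrangian (mu / lam) (metric_of (\<Psi> n)) (omega_of (\<Psi> n)) (a n)) z" for K z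
  proof -
    obtain n x where z: "z = (n, x)" by fastforce
    show ?thesis
    proof (cases "x \<in> dom n")
      case True
      show ?thesis
        unfolding z local_integrand_eq metric_vol_eq coframe_vol_eq
        by (simp add: lagrangian_asd_conn[OF chart(2) True smooth_frame det_frame assms(5,6)])
    next
      case False
      then have "x \<notin> \<phi> n ` (K \<inter> piece n)" using piece_subset by blast
      then show ?thesis by (simp add: z local_integrand_eq)
    qed
  qed
  have action: "frame_action U \<phi> lam mu nu K \<Psi> (\<lambda>n. asd_conn (\<Psi> n)) a
           = metric_action U \<phi> lam mu K (\<lambda>n. metric_of (\<Psi> n)) (\<lambda>n. omega_of (\<Psi> n)) a" for K
    unfolding frame_action_def metric_action_def form_integral_def pointwise by simp
  have integrable: "form_integrable U \<phi> vol K (\<lambda>n. lagrangian lam mu nu (\<Psi> n) (asd_conn (\<Psi> n)) (a n))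
            \<longleftrightarrow> form_integrable U \<phi> (\<lambda>n. metric_vol (metric_of (\<Psi> n)) (omega_of (\<Psi> n))) K
              (\<lambda>n. metric_lagrangian (mu / lam) (metric_of (\<Psi> n)) (omega_of (\<Psi> n)) (a n))" for K
    unfolding form_integrable_def pointwise using \<open>lam \<noteq> 0\<close>
    by (subst integrable_complex_mult_iff) simp_all
  show ?thesis
  proof (intro conjI)
    show "\<exists>E :: nat \<Rightarrow> real^4 \<Rightarrow> (complex^2^2)^4 \<Rightarrow> 4 list \<Rightarrow> complex^2^2.
       \<forall>A'. u2_connection U \<phi> h A' a \<longrightarrow>
         (\<forall>K B. compact K \<and> su2_variation U \<phi> h K B \<longrightarrow>
            ((\<lambda>t::real. frame_action U \<phi> lam mu nu K \<Psi> (\<lambda>n x. A' n x + t *\<^sub>R B n x) a)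
               has_vector_derivative
             form_integral U \<phi> vol K
               (\<lambda>n. wedge (\<lambda>X Y. trace (X ** Y)) (form1 (B n)) (\<lambda>x. E n x (A' n x)))) (at 0)) \<and>
         (stationary_in_A U \<phi> h lam mu nu \<Psi> A' a \<longleftrightarrow>
            (\<forall>n. \<forall>x\<in>\<phi> n ` U n. \<forall>xs. E n x (A' n x) xs = 0))"
    proof (intro exI[of _ E] allI impI conjI, elim conjE)
      fix A' K B assume "u2_connection U \<phi> h A' a" "compact K" "su2_variation U \<phi> h K B"
      then show "((\<lambda>t::real. frame_action U \<phi> lam mu nu K \<Psi> (\<lambda>n x. A' n x + t *\<^sub>R B n x) a)
               has_vector_derivative
             form_integral U \<phi> vol K
               (\<lambda>n. wedge (\<lambda>X Y. trace (X ** Y)) (form1 (B n)) (\<lambda>x. E n x (A' n x)))) (at 0)"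
        by (rule deriv)
    qed (rule 1)
    show "u2_connection U \<phi> h (\<lambda>n. asd_conn (\<Psi> n)) a"
      by (rule asd_connection[OF assms(4)])
  qed (intro allI impI ballI conjI 2 action integrable compatible det_frame; assumption)+
qed

end
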